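(* Let $V$ be a quasi-vertex operator algebra and $\Gamma\subset\mathrm{PSL}_2(\mathbb R)$ a Fuchsian group of the first kind. (1) The map $$\iota:Q(\Gamma)\otimes V^{(2)}\longrightarrow Q(V,\Gamma),\qquad f(\tau)\otimes v\mapsto f(\tau)v,$$ is a (canonical) isomorphism of graded $Q(\Gamma)$-modules. (2) If $\Gamma$ has at least one cusp, then $Q(V,\Gamma)$ is a doubled quasi-vertex operator algebra.
   Context: QVOA: a quasi-vertex operator algebra is a $\mathbb Z$-graded vertex algebra $V=\bigoplus_n V_n$ (vertex operators $Y$, vacuum $\mathbf 1$) with $\dim V_n<\infty$ and $V_n=0$ for $n\ll0$, together with a representation $\rho$ of $\mathfrak{sl}_2$ by operators $L(-1),L(0),L(1)$ satisfying $[L(m),L(n)]=(m-n)L(m+n)$, where $L(-1)$ is the canonical derivation, $L(0)$ acts on $V_n$ as multiplication by $n$ and $[L(1),Y(u,z)]=Y((L(1)+2zL(0)+z^2L(-1))u,z)$. $F_NV=\bigoplus_{n\le N}V_n$. $V^{(2)}$ is $V$ with doubled grading: $V^{(2)}_{2n}=V_n$, $V^{(2)}_{m}=0$ for $m$ odd. A doubled QVOA is a graded space obtained from a QVOA by doubling its grading in this way. Elements of $\Gamma$ are lifted to $\mathrm{SL}_2(\mathbb R)$ (full preimage). For $\gamma=\begin{pmatrix}a&b\\c&d\end{pmatrix}$: $j(\gamma,\tau)=c\tau+d$, $X(\gamma,\tau)=c/j(\gamma,\tau)$, $f|_k\gamma(\tau)=j(\gamma,\tau)^{-k}f(\gamma\tau)$,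 $K(\gamma,\tau)=e^{-c\,j(\gamma,\tau)L(1)}j(\gamma,\tau)^{-2L(0)}\in\mathrm{End}(V)$, and $f\Vert_k\gamma(\tau)=j(\gamma,\tau)^{-k}K(\gamma,\tau)^{-1}f(\gamma\tau)$ for $V$-valued $f$. $Q_k(\Gamma)$: holomorphic $f:\mathbb H\to\mathbb C$ for which there are $s\ge0$ and holomorphic $Q_0(f),\dots,Q_s(f)$ with $f|_k\gamma(\tau)=\sum_{m=0}^sX(\gamma,\tau)^mQ_m(f)(\tau)$ for all $\gamma\in\Gamma$, holomorphic at the cusps: for every $\sigma\in\mathrm{SL}_2(\mathbb R)$ with $\sigma\infty$ a cusp and every $m$, $Q_m(f)|_{k-2m}\sigma$ is bounded as $\mathrm{Im}\,\tau\to\infty$, uniformly for $\mathrm{Re}\,\tau$ in compact sets. $Q(\Gamma)=\bigoplus_{k\ge0}Q_k(\Gamma)$. $Q_k(V,\Gamma)$: holomorphic $f:\mathbb H\to F_NV$ (some $N$) for which there are $s\ge0$ and holomorphic $Q_m(f):\mathbb H\to F_NV$ with $f\Vert_k\gamma(\tau)=\sum_{m=0}^sX(\gamma,\tau)^mQ_m(f)(\tau)$ for all $\gamma\in\Gamma$, with the analogous condition at cusps ($Q_m(f)\Vert_{k-2m}\sigma$ bounded as $\mathrm{Im}\,\tau\to\infty$). $Q(V,\Gamma)=\bigoplus_{k\ge0}Q_k(V,\Gamma)$, a $Q(\Gamma)$-module by pointwise multiplication.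
   Formalization: Q(V,Γ) is taken as the direct sum of Q_k(V,Γ) over all integers k rather than k≥0, since for v in V_n with n<0 the constant function v has weight 2n<0, so ι would not land in the stated target; if V_n=0 for n<0 the two agree. *)

theory Defs
  imports
    "HOL-Analysis.Analysis"
    "HOL-Library.Function_Algebras"
    "HOL-Library.Poly_Mapping"
    "HOL-Algebra.AbelCoset"
    "HOL-Algebra.Module"
begin

section \<open>Graded vector spaces\<close>

text \<open>A \<open>\<int>\<close>-graded vector space is given by the family of its homogeneous pieces inside an ambient
  abelian group; its underlying space is the internal sum of the pieces.
  \<^const>\<open>Sum_any\<close> is the sum of a finitely supported family.\<close>

definition finsupp_family :: "(int \<Rightarrow> 'a::ab_group_add set) \<Rightarrow> (int \<Rightarrow> 'a) \<Rightarrow> bool" where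
  "finsupp_family G x \<longleftrightarrow> (\<forall>k. x k \<in> G k) \<and> finite {k. x k \<noteq> 0}"

definition total_space :: "(int \<Rightarrow> 'a::ab_group_add set) \<Rightarrow> 'a set" where
  "total_space G = {Sum_any x |x. finsupp_family G x}"

definition component :: "(int \<Rightarrow> 'a::ab_group_add set) \<Rightarrow> 'a \<Rightarrow> int \<Rightarrow> 'a" where
  "component G v = (THE x. finsupp_family G x \<and> v = Sum_any x)"

definition filtration :: "(int \<Rightarrow> 'a::ab_group_add set) \<Rightarrow> int \<Rightarrow> 'a set" where
  "filtration G N = total_space (\<lambda>n. if n \<le> N then G n else {0})"

definition doubled :: "(int \<Rightarrow> 'a::ab_group_add set) \<Rightarrow> int \<Rightarrow> 'a set" where
  "doubled G k = (if even k then G (k div 2) else {0})"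

locale graded_vector_space = vector_space smul
  for smul :: "complex \<Rightarrow> 'v::ab_group_add \<Rightarrow> 'v" +
  fixes V :: "int \<Rightarrow> 'v set"
  assumes subspace_piece: "subspace (V n)"
    and direct: "finsupp_family V x \<Longrightarrow> Sum_any x = 0 \<Longrightarrow> x = (\<lambda>_. 0)"


section \<open>Quasi-vertex operator algebras\<close>

text \<open>\<open>Y u n v\<close> is the mode \<open>u\<^sub>(\<^sub>n\<^sub>)v\<close>, where \<open>Y(u,z) = \<Sum>\<^sub>n u\<^sub>(\<^sub>n\<^sub>) z\<^sup>-\<^sup>n\<^sup>-\<^sup>1\<close>. The Jacobi identity is
  stated in the form of the Borcherds identity; by \<open>truncation\<close> all sums in it are finite.\<close>

locale graded_vertex_algebra = graded_vector_space smul V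
  for smul :: "complex \<Rightarrow> 'v::ab_group_add \<Rightarrow> 'v" and V :: "int \<Rightarrow> 'v set" +
  fixes Y :: "'v \<Rightarrow> int \<Rightarrow> 'v \<Rightarrow> 'v" and vac :: 'v
  assumes vac_degree: "vac \<in> V 0"
    and mode_degree: "u \<in> V a \<Longrightarrow> v \<in> V b \<Longrightarrow> Y u n v \<in> V (a + b - n - 1)"
    and mode_add_left: "u \<in> total_space V \<Longrightarrow> u' \<in> total_space V \<Longrightarrow> v \<in> total_space V \<Longrightarrow>
          Y (u + u') n v = Y u n v + Y u' n v"
    and mode_scale_left: "u \<in> total_space V \<Longrightarrow> v \<in> total_space V \<Longrightarrow>
          Y (smul c u) n v = smul c (Y u n v)"
    and mode_add_right: "u \<in> total_space V \<Longrightarrow> v \<in> total_space V \<Longrightarrow> v' \<in> total_space V \<Longrightarrow>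
          Y u n (v + v') = Y u n v + Y u n v'"
    and mode_scale_right: "u \<in> total_space V \<Longrightarrow> v \<in> total_space V \<Longrightarrow>
          Y u n (smul c v) = smul c (Y u n v)"
    and truncation: "u \<in> total_space V \<Longrightarrow> v \<in> total_space V \<Longrightarrow> \<exists>N. \<forall>n\<ge>N. Y u n v = 0"
    and vacuum: "v \<in> total_space V \<Longrightarrow> Y vac n v = (if n = -1 then v else 0)"
    and creation: "u \<in> total_space V \<Longrightarrow> Y u (-1) vac = u"
      "u \<in> total_space V \<Longrightarrow> n \<ge> 0 \<Longrightarrow> Y u n vac = 0"
    and borcherds: "u \<in> total_space V \<Longrightarrow> v \<in> total_space V \<Longrightarrow> w \<in> total_space V \<Longrightarrow>
          Sum_any (\<lambda>i::nat. smul (of_int m gchoose i)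
              (Y (Y u (l + int i) v) (m + n - int i) w)) =
          Sum_any (\<lambda>i::nat. smul ((-1) ^ i * (of_int l gchoose i))
              (Y u (m + l - int i) (Y v (n + int i) w)
               - smul ((-1) powi l) (Y v (n + l - int i) (Y u (m + int i) w))))"

text \<open>Only \<open>L (-1)\<close>, \<open>L 0\<close>, \<open>L 1\<close> matter: for \<open>m, n \<in> {-1, 0, 1}\<close> with \<open>\<bar>m + n\<bar> > 1\<close> the
  coefficient \<open>m - n\<close> vanishes. The canonical derivation is \<open>u \<mapsto> u\<^sub>(\<^sub>-\<^sub>2\<^sub>)\<one>\<close>, and \<open>covariance\<close> is the
  coefficient of \<open>z\<^sup>-\<^sup>n\<^sup>-\<^sup>1\<close> in \<open>[L(1), Y(u,z)] = Y((L(1) + 2z L(0) + z\<^sup>2 L(-1))u, z)\<close>.\<close>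

locale quasi_voa = graded_vertex_algebra smul V Y vac
  for smul :: "complex \<Rightarrow> 'v::ab_group_add \<Rightarrow> 'v" and V :: "int \<Rightarrow> 'v set"
    and Y :: "'v \<Rightarrow> int \<Rightarrow> 'v \<Rightarrow> 'v" and vac :: 'v +
  fixes L :: "int \<Rightarrow> 'v \<Rightarrow> 'v"
  assumes finite_dimensional: "\<exists>B. finite B \<and> V n = span B"
    and bounded_below: "\<exists>N. \<forall>n<N. V n = {0}"
    and L_closed: "m \<in> {-1, 0, 1} \<Longrightarrow> v \<in> total_space V \<Longrightarrow> L m v \<in> total_space V"
    and L_add: "m \<in> {-1, 0, 1} \<Longrightarrow> v \<in> total_space V \<Longrightarrow> w \<in> total_space V \<Longrightarrow>
          L m (v + w) = L m v + L m w"
    and L_scale: "m \<in> {-1, 0, 1} \<Longrightarrow> v \<in> total_space V \<Longrightarrow> L m (smul c v) = smul c (L m v)"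
    and sl2: "m \<in> {-1, 0, 1} \<Longrightarrow> n \<in> {-1, 0, 1} \<Longrightarrow> v \<in> total_space V \<Longrightarrow>
          L m (L n v) - L n (L m v) = smul (of_int (m - n)) (L (m + n) v)"
    and derivation: "u \<in> total_space V \<Longrightarrow> L (-1) u = Y u (-2) vac"
    and L0_degree: "v \<in> V n \<Longrightarrow> L 0 v = smul (of_int n) v"
    and covariance: "u \<in> total_space V \<Longrightarrow> v \<in> total_space V \<Longrightarrow>
          L 1 (Y u n v) - Y u n (L 1 v) =
            Y (L 1 u) n v + smul 2 (Y (L 0 u) (n + 1) v) + Y (L (-1) u) (n + 2) v"

definition doubled_quasi_voa ::
  "(complex \<Rightarrow> 'v::ab_group_add \<Rightarrow> 'v) \<Rightarrow> (int \<Rightarrow> 'v set) \<Rightarrow> ('v \<Rightarrow> int \<Rightarrow> 'v \<Rightarrow> 'v) \<Rightarrow> 'v \<Rightarrow>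
    (int \<Rightarrow> 'v \<Rightarrow> 'v) \<Rightarrow> bool" where
  "doubled_quasi_voa smul W Y vac L \<longleftrightarrow> (\<exists>V. quasi_voa smul V Y vac L \<and> W = doubled V)"


section \<open>Fuchsian groups of the first kind\<close>

definition uhp :: "complex set" where
  "uhp = {z. 0 < Im z}"

definition SL2R :: "(real^2^2) set" where
  "SL2R = {g. det g = 1}"

definition jfac :: "real^2^2 \<Rightarrow> complex \<Rightarrow> complex" where
  "jfac g z = of_real (g$2$1) * z + of_real (g$2$2)"

definition Xfac :: "real^2^2 \<Rightarrow> complex \<Rightarrow> complex" where
  "Xfac g z = of_real (g$2$1) / jfac g z"

definition mobius :: "real^2^2 \<Rightarrow> complex \<Rightarrow> complex" where
  "mobius g z = (of_real (g$1$1) * z + of_real (g$1$2)) / jfac g z"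

text \<open>Action on the boundary \<open>\<real> \<union> {\<infinity>}\<close>, with \<open>None\<close> for \<open>\<infinity>\<close>.\<close>

definition bdry_mobius :: "real^2^2 \<Rightarrow> real option \<Rightarrow> real option" where
  "bdry_mobius g s =
    (case s of
       None \<Rightarrow> if g$2$1 = 0 then None else Some (g$1$1 / g$2$1)
     | Some x \<Rightarrow> if g$2$1 * x + g$2$2 = 0 then None
                 else Some ((g$1$1 * x + g$1$2) / (g$2$1 * x + g$2$2)))"

definition parabolic :: "real^2^2 \<Rightarrow> bool" where
  "parabolic g \<longleftrightarrow> g \<in> SL2R \<and> (trace g)\<^sup>2 = 4 \<and> g \<noteq> mat 1 \<and> g \<noteq> - mat 1"

definition cusps :: "(real^2^2) set \<Rightarrow> real option set" where
  "cusps \<Gamma> = {s. \<exists>g\<in>\<Gamma>. parabolic g \<and> bdry_mobius g s = s}"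

text \<open>The extended upper half plane \<open>\<H>\<^sup>* = \<H> \<union> {cusps}\<close> with its usual topology: the sets
  \<open>\<sigma>{z. Im z > Y} \<union> {s}\<close> with \<open>\<sigma>\<infinity> = s\<close> form a neighbourhood base of the cusp \<open>s\<close>.\<close>

definition ext_uhp :: "(real^2^2) set \<Rightarrow> (complex + real option) set" where
  "ext_uhp \<Gamma> = Inl ` uhp \<union> Inr ` cusps \<Gamma>"

definition ext_open :: "(real^2^2) set \<Rightarrow> (complex + real option) set \<Rightarrow> bool" where
  "ext_open \<Gamma> U \<longleftrightarrow> U \<subseteq> ext_uhp \<Gamma> \<and> open (Inl -` U) \<and>
    (\<forall>s. Inr s \<in> U \<longrightarrow>
      (\<forall>\<sigma>\<in>SL2R. bdry_mobius \<sigma> None = s \<longrightarrow> (\<exists>Y>0. \<forall>z. Y < Im z \<longrightarrow> Inl (mobius \<sigma> z) \<in> U)))"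

definition ext_topology :: "(real^2^2) set \<Rightarrow> (complex + real option) topology" where
  "ext_topology \<Gamma> = topology (ext_open \<Gamma>)"

definition orbit :: "(real^2^2) set \<Rightarrow> complex + real option \<Rightarrow> (complex + real option) set" where
  "orbit \<Gamma> p = (\<lambda>g. map_sum (mobius g) (bdry_mobius g) p) ` \<Gamma>"

definition quotient_open :: "(real^2^2) set \<Rightarrow> (complex + real option) set set \<Rightarrow> bool" where
  "quotient_open \<Gamma> W \<longleftrightarrow> W \<subseteq> orbit \<Gamma> ` ext_uhp \<Gamma> \<and>
    openin (ext_topology \<Gamma>) {p \<in> ext_uhp \<Gamma>. orbit \<Gamma> p \<in> W}"

definition quotient_topology :: "(real^2^2) set \<Rightarrow> (complex + real option) set topology" where
  "quotient_topology \<Gamma> = topology (quotient_open \<Gamma>)"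

text \<open>A subgroup of \<open>PSL\<^sub>2(\<real>)\<close> is represented by its full preimage in \<open>SL\<^sub>2(\<real>)\<close>, i.e. by a subgroup
  containing \<open>-1\<close>. The first kind condition is Shimura's: \<open>\<Gamma>\<setminus>\<H>\<^sup>*\<close> is compact.\<close>

definition fuchsian_first_kind :: "(real^2^2) set \<Rightarrow> bool" where
  "fuchsian_first_kind \<Gamma> \<longleftrightarrow>
    \<Gamma> \<subseteq> SL2R \<and> mat 1 \<in> \<Gamma> \<and> - mat 1 \<in> \<Gamma> \<and>
    (\<forall>g\<in>\<Gamma>. \<forall>h\<in>\<Gamma>. g ** h \<in> \<Gamma>) \<and> (\<forall>g\<in>\<Gamma>. matrix_inv g \<in> \<Gamma>) \<and>
    discrete \<Gamma> \<and> compact_space (quotient_topology \<Gamma>)"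

lemma jfac_nonzero:
  assumes "g \<in> SL2R" "z \<in> uhp"
  shows "jfac g z \<noteq> 0"
proof
  assume *: "jfac g z = 0"
  have "Im (jfac g z) = g$2$1 * Im z" by (simp add: jfac_def)
  with * assms(2) have c: "g$2$1 = 0" by (auto simp: uhp_def)
  with * have "g$2$2 = 0" by (simp add: jfac_def)
  with c assms(1) show False by (simp add: SL2R_def det_2)
qed

lemma mobius_uhp:
  assumes "g \<in> SL2R" "z \<in> uhp"
  shows "mobius g z \<in> uhp"
proof -
  let ?n = "of_real (g$1$1) * z + of_real (g$1$2)"
  have "Im (mobius g z) = Im (?n * cnj (jfac g z)) / (cmod (jfac g z))\<^sup>2"
    unfolding mobius_def by (simp add: complex_div_cnj[of ?n] flip: of_real_power)
  also have "Im (?n * cnj (jfac g z)) = det g * Im z"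
    by (simp add: jfac_def det_2 algebra_simps)
  finally have "Im (mobius g z) = Im z / (cmod (jfac g z))\<^sup>2"
    using assms(1) by (simp add: SL2R_def)
  with jfac_nonzero[OF assms] assms(2) show ?thesis by (simp add: uhp_def)
qed

lemma istopology_ext_open: "istopology (ext_open \<Gamma>)"
  unfolding istopology_def
proof (intro conjI allI impI)
  fix S T assume S: "ext_open \<Gamma> S" and T: "ext_open \<Gamma> T"
  show "ext_open \<Gamma> (S \<inter> T)"
    unfolding ext_open_def
  proof (intro conjI allI impI ballI)
    show "S \<inter> T \<subseteq> ext_uhp \<Gamma>" using S by (auto simp: ext_open_def)
    show "open (Inl -` (S \<inter> T))" using S T by (simp add: ext_open_def open_Int)
  next
    fix s \<sigma> assume s: "Inr s \<in> S \<inter> T" and \<sigma>: "\<sigma> \<in> SL2R" "bdry_mobius \<sigma> None = s"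
    obtain A where "A > 0" "\<forall>z. A < Im z \<longrightarrow> Inl (mobius \<sigma> z) \<in> S"
      using S s \<sigma> unfolding ext_open_def by blast
    moreover obtain B where "B > 0" "\<forall>z. B < Im z \<longrightarrow> Inl (mobius \<sigma> z) \<in> T"
      using T s \<sigma> unfolding ext_open_def by blast
    ultimately show "\<exists>Y>0. \<forall>z. Y < Im z \<longrightarrow> Inl (mobius \<sigma> z) \<in> S \<inter> T"
      by (intro exI[of _ "max A B"]) auto
  qed
next
  fix K assume K: "\<forall>U\<in>K. ext_open \<Gamma> U"
  show "ext_open \<Gamma> (\<Union>K)"
    unfolding ext_open_def
  proof (intro conjI allI impI ballI)
    show "\<Union>K \<subseteq> ext_uhp \<Gamma>" using K by (auto simp: ext_open_def)
    show "open (Inl -` \<Union>K)"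
      using K unfolding vimage_Union by (intro open_UN) (auto simp: ext_open_def)
  next
    fix s \<sigma> assume s: "Inr s \<in> \<Union>K" and \<sigma>: "\<sigma> \<in> SL2R" "bdry_mobius \<sigma> None = s"
    then obtain U where U: "U \<in> K" "Inr s \<in> U" by blast
    with K \<sigma> obtain Y where "Y > 0" "\<forall>z. Y < Im z \<longrightarrow> Inl (mobius \<sigma> z) \<in> U"
      unfolding ext_open_def by blast
    with U show "\<exists>Y>0. \<forall>z. Y < Im z \<longrightarrow> Inl (mobius \<sigma> z) \<in> \<Union>K" by blast
  qed
qed

lemma openin_ext_topology: "openin (ext_topology \<Gamma>) = ext_open \<Gamma>"
  by (simp add: ext_topology_def istopology_ext_open)

lemma topspace_ext_topology: "topspace (ext_topology \<Gamma>) = ext_uhp \<Gamma>"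
proof
  show "topspace (ext_topology \<Gamma>) \<subseteq> ext_uhp \<Gamma>"
    by (auto simp: topspace_def openin_ext_topology ext_open_def)
  have "Inl -` ext_uhp \<Gamma> = uhp" by (auto simp: ext_uhp_def)
  moreover have "open uhp" by (simp add: uhp_def open_halfspace_Im_gt)
  moreover have "Inl (mobius \<sigma> z) \<in> ext_uhp \<Gamma>" if "\<sigma> \<in> SL2R" "Im z > 1" for \<sigma> z
    using mobius_uhp[OF that(1), of z] that(2) by (auto simp: ext_uhp_def uhp_def)
  ultimately have "ext_open \<Gamma> (ext_uhp \<Gamma>)"
    unfolding ext_open_def by (auto intro!: exI[of _ "1::real"])
  then show "ext_uhp \<Gamma> \<subseteq> topspace (ext_topology \<Gamma>)"
    by (simp add: openin_ext_topology openin_subset)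
qed

lemma istopology_quotient_open: "istopology (quotient_open \<Gamma>)"
  unfolding istopology_def
proof (intro conjI allI impI)
  fix S T assume "quotient_open \<Gamma> S" "quotient_open \<Gamma> T"
  moreover have "{p \<in> ext_uhp \<Gamma>. orbit \<Gamma> p \<in> S \<inter> T} =
      {p \<in> ext_uhp \<Gamma>. orbit \<Gamma> p \<in> S} \<inter> {p \<in> ext_uhp \<Gamma>. orbit \<Gamma> p \<in> T}" by blast
  ultimately show "quotient_open \<Gamma> (S \<inter> T)"
    unfolding quotient_open_def by (simp add: openin_Int le_infI1)
next
  fix K assume K: "\<forall>W\<in>K. quotient_open \<Gamma> W"
  have "{p \<in> ext_uhp \<Gamma>. orbit \<Gamma> p \<in> \<Union>K} = (\<Union>W\<in>K. {p \<in> ext_uhp \<Gamma>. orbit \<Gamma> p \<in> W})" by blast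
  then show "quotient_open \<Gamma> (\<Union>K)"
    using K unfolding quotient_open_def by (auto intro: openin_Union)
qed

lemma openin_quotient_topology: "openin (quotient_topology \<Gamma>) = quotient_open \<Gamma>"
  by (simp add: quotient_topology_def istopology_quotient_open)

lemma topspace_quotient_topology: "topspace (quotient_topology \<Gamma>) = orbit \<Gamma> ` ext_uhp \<Gamma>"
proof
  show "topspace (quotient_topology \<Gamma>) \<subseteq> orbit \<Gamma> ` ext_uhp \<Gamma>"
    by (auto simp: topspace_def openin_quotient_topology quotient_open_def)
  have "{p \<in> ext_uhp \<Gamma>. orbit \<Gamma> p \<in> orbit \<Gamma> ` ext_uhp \<Gamma>} = topspace (ext_topology \<Gamma>)"
    by (auto simp: topspace_ext_topology)
  then have "quotient_open \<Gamma> (orbit \<Gamma> ` ext_uhp \<Gamma>)"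
    by (simp add: quotient_open_def)
  then show "orbit \<Gamma> ` ext_uhp \<Gamma> \<subseteq> topspace (quotient_topology \<Gamma>)"
    by (simp add: openin_quotient_topology openin_subset)
qed


section \<open>Scalar quasimodular forms\<close>

text \<open>A function on \<open>\<H>\<close> is represented by its extension by \<open>0\<close> to \<open>\<complex>\<close>, so that equality of
  functions on \<open>\<H>\<close> is equality in HOL.\<close>

definition holo_uhp :: "(complex \<Rightarrow> complex) \<Rightarrow> bool" where
  "holo_uhp f \<longleftrightarrow> f holomorphic_on uhp \<and> (\<forall>\<tau>. \<tau> \<notin> uhp \<longrightarrow> f \<tau> = 0)"

definition slash :: "int \<Rightarrow> (complex \<Rightarrow> complex) \<Rightarrow> real^2^2 \<Rightarrow> complex \<Rightarrow> complex" where
  "slash k f g \<tau> = jfac g \<tau> powi (- k) * f (mobius g \<tau>)"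

definition bounded_at_i_inf :: "(complex \<Rightarrow> complex) \<Rightarrow> bool" where
  "bounded_at_i_inf f \<longleftrightarrow>
    (\<forall>C::real set. compact C \<longrightarrow>
      (\<exists>Y>0. \<exists>M. \<forall>\<tau>. Re \<tau> \<in> C \<longrightarrow> Y < Im \<tau> \<longrightarrow> cmod (f \<tau>) \<le> M))"

text \<open>\<open>qm_coeffs \<Gamma> k f Q\<close>: the family \<open>Q\<^sub>0(f), \<dots>, Q\<^sub>s(f)\<close>, continued by zero, witnesses that \<open>f\<close> is
  quasimodular of weight \<open>k\<close>.\<close>

definition qm_coeffs ::
  "(real^2^2) set \<Rightarrow> int \<Rightarrow> (complex \<Rightarrow> complex) \<Rightarrow> (nat \<Rightarrow> complex \<Rightarrow> complex) \<Rightarrow> bool" where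
  "qm_coeffs \<Gamma> k f Q \<longleftrightarrow>
    (\<forall>m. holo_uhp (Q m)) \<and>
    (\<exists>s. (\<forall>m>s. Q m = 0) \<and>
      (\<forall>g\<in>\<Gamma>. \<forall>\<tau>\<in>uhp. slash k f g \<tau> = (\<Sum>m\<le>s. Xfac g \<tau> ^ m * Q m \<tau>))) \<and>
    (\<forall>\<sigma>\<in>SL2R. bdry_mobius \<sigma> None \<in> cusps \<Gamma> \<longrightarrow>
      (\<forall>m. bounded_at_i_inf (slash (k - 2 * int m) (Q m) \<sigma>)))"

definition QM :: "(real^2^2) set \<Rightarrow> int \<Rightarrow> (complex \<Rightarrow> complex) set" where
  "QM \<Gamma> k = {f. holo_uhp f \<and> (\<exists>Q. qm_coeffs \<Gamma> k f Q)}"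

definition QM_graded :: "(real^2^2) set \<Rightarrow> int \<Rightarrow> (complex \<Rightarrow> complex) set" where
  "QM_graded \<Gamma> k = (if 0 \<le> k then QM \<Gamma> k else {0})"

definition QM_ring :: "(real^2^2) set \<Rightarrow> (complex \<Rightarrow> complex) ring" where
  "QM_ring \<Gamma> = \<lparr>carrier = total_space (QM_graded \<Gamma>), mult = (\<lambda>f g \<tau>. f \<tau> * g \<tau>),
     one = (\<lambda>\<tau>. if \<tau> \<in> uhp then 1 else 0), zero = (\<lambda>\<tau>. 0), add = (\<lambda>f g \<tau>. f \<tau> + g \<tau>)\<rparr>"


section \<open>Quasimodular forms with values in a quasi-vertex operator algebra\<close>

definition fun_vec :: "(complex \<Rightarrow> 'v \<Rightarrow> 'v) \<Rightarrow> (complex \<Rightarrow> complex) \<Rightarrow> 'v \<Rightarrow> complex \<Rightarrow> 'v" where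
  "fun_vec smul f v = (\<lambda>\<tau>. smul (f \<tau>) v)"

definition fscale :: "(complex \<Rightarrow> 'v \<Rightarrow> 'v) \<Rightarrow> complex \<Rightarrow> (complex \<Rightarrow> 'v) \<Rightarrow> complex \<Rightarrow> 'v" where
  "fscale smul c F = (\<lambda>\<tau>. smul c (F \<tau>))"

text \<open>Holomorphy and boundedness of functions with values in a finite-dimensional space \<open>W\<close> are
  expressed through coordinates with respect to a finite subset of \<open>W\<close>.\<close>

definition vholo_uhp ::
  "(complex \<Rightarrow> 'v::ab_group_add \<Rightarrow> 'v) \<Rightarrow> 'v set \<Rightarrow> (complex \<Rightarrow> 'v) \<Rightarrow> bool" where
  "vholo_uhp smul W F \<longleftrightarrow>
    (\<exists>B c. finite B \<and> B \<subseteq> W \<and> (\<forall>b\<in>B. holo_uhp (c b)) \<and> F = (\<lambda>\<tau>. \<Sum>b\<in>B. smul (c b \<tau>) b))"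

definition vbounded_at_i_inf ::
  "(complex \<Rightarrow> 'v::ab_group_add \<Rightarrow> 'v) \<Rightarrow> 'v set \<Rightarrow> (complex \<Rightarrow> 'v) \<Rightarrow> bool" where
  "vbounded_at_i_inf smul W F \<longleftrightarrow>
    (\<forall>C::real set. compact C \<longrightarrow>
      (\<exists>Y>0. \<exists>M. \<exists>B. finite B \<and> B \<subseteq> W \<and>
        (\<forall>\<tau>. Re \<tau> \<in> C \<longrightarrow> Y < Im \<tau> \<longrightarrow>
          (\<exists>c. (\<forall>b\<in>B. cmod (c b) \<le> M) \<and> F \<tau> = (\<Sum>b\<in>B. smul (c b) b)))))"

text \<open>\<open>exp_op smul T a\<close> is \<open>e\<^sup>a\<^sup>T\<close> for a locally nilpotent operator \<open>T\<close>, and \<open>deg_op smul V x\<close> is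
  \<open>x\<^sup>-\<^sup>2\<^sup>L\<^sup>(\<^sup>0\<^sup>)\<close>.\<close>

definition exp_op ::
  "(complex \<Rightarrow> 'v::ab_group_add \<Rightarrow> 'v) \<Rightarrow> ('v \<Rightarrow> 'v) \<Rightarrow> complex \<Rightarrow> 'v \<Rightarrow> 'v" where
  "exp_op smul T a v = Sum_any (\<lambda>i::nat. smul (a ^ i / fact i) ((T ^^ i) v))"

definition deg_op ::
  "(complex \<Rightarrow> 'v::ab_group_add \<Rightarrow> 'v) \<Rightarrow> (int \<Rightarrow> 'v set) \<Rightarrow> complex \<Rightarrow> 'v \<Rightarrow> 'v" where
  "deg_op smul V x v = Sum_any (\<lambda>n. smul (x powi (- 2 * n)) (component V v n))"

definition K_op ::
  "(complex \<Rightarrow> 'v::ab_group_add \<Rightarrow> 'v) \<Rightarrow> (int \<Rightarrow> 'v set) \<Rightarrow> (int \<Rightarrow> 'v \<Rightarrow> 'v) \<Rightarrow>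
    real^2^2 \<Rightarrow> complex \<Rightarrow> 'v \<Rightarrow> 'v" where
  "K_op smul V L g \<tau> v =
    exp_op smul (L 1) (- of_real (g$2$1) * jfac g \<tau>) (deg_op smul V (jfac g \<tau>) v)"

definition vslash ::
  "(complex \<Rightarrow> 'v::ab_group_add \<Rightarrow> 'v) \<Rightarrow> (int \<Rightarrow> 'v set) \<Rightarrow> (int \<Rightarrow> 'v \<Rightarrow> 'v) \<Rightarrow>
    int \<Rightarrow> (complex \<Rightarrow> 'v) \<Rightarrow> real^2^2 \<Rightarrow> complex \<Rightarrow> 'v" where
  "vslash smul V L k F g \<tau> =
    smul (jfac g \<tau> powi (- k)) (the_inv_into (total_space V) (K_op smul V L g \<tau>) (F (mobius g \<tau>)))"

definition vqm_coeffs ::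
  "(complex \<Rightarrow> 'v::ab_group_add \<Rightarrow> 'v) \<Rightarrow> (int \<Rightarrow> 'v set) \<Rightarrow> (int \<Rightarrow> 'v \<Rightarrow> 'v) \<Rightarrow>
    (real^2^2) set \<Rightarrow> int \<Rightarrow> int \<Rightarrow> (complex \<Rightarrow> 'v) \<Rightarrow> (nat \<Rightarrow> complex \<Rightarrow> 'v) \<Rightarrow> bool" where
  "vqm_coeffs smul V L \<Gamma> N k F Q \<longleftrightarrow>
    (\<forall>m. vholo_uhp smul (filtration V N) (Q m)) \<and>
    (\<exists>s. (\<forall>m>s. Q m = 0) \<and>
      (\<forall>g\<in>\<Gamma>. \<forall>\<tau>\<in>uhp.
        vslash smul V L k F g \<tau> = (\<Sum>m\<le>s. smul (Xfac g \<tau> ^ m) (Q m \<tau>)))) \<and>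
    (\<forall>\<sigma>\<in>SL2R. bdry_mobius \<sigma> None \<in> cusps \<Gamma> \<longrightarrow>
      (\<forall>m. vbounded_at_i_inf smul (filtration V N) (vslash smul V L (k - 2 * int m) (Q m) \<sigma>)))"

text \<open>The weight \<open>k\<close> ranges over all of \<open>\<int>\<close>: if \<open>v \<in> V\<^sub>n\<close> with \<open>n < 0\<close>, then the constant function \<open>v\<close>
  has weight \<open>2n < 0\<close>.\<close>

definition QMV ::
  "(complex \<Rightarrow> 'v::ab_group_add \<Rightarrow> 'v) \<Rightarrow> (int \<Rightarrow> 'v set) \<Rightarrow> (int \<Rightarrow> 'v \<Rightarrow> 'v) \<Rightarrow>
    (real^2^2) set \<Rightarrow> int \<Rightarrow> (complex \<Rightarrow> 'v) set" where
  "QMV smul V L \<Gamma> k =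
    {F. \<exists>N. vholo_uhp smul (filtration V N) F \<and> (\<exists>Q. vqm_coeffs smul V L \<Gamma> N k F Q)}"

definition QMV_module ::
  "(complex \<Rightarrow> 'v::ab_group_add \<Rightarrow> 'v) \<Rightarrow> (int \<Rightarrow> 'v set) \<Rightarrow> (int \<Rightarrow> 'v \<Rightarrow> 'v) \<Rightarrow>
    (real^2^2) set \<Rightarrow> (complex \<Rightarrow> complex, complex \<Rightarrow> 'v) module" where
  "QMV_module smul V L \<Gamma> = \<lparr>carrier = total_space (QMV smul V L \<Gamma>),
     mult = undefined, one = undefined, zero = (\<lambda>\<tau>. 0), add = (\<lambda>F G \<tau>. F \<tau> + G \<tau>),
     smult = (\<lambda>f F \<tau>. smul (f \<tau>) (F \<tau>))\<rparr>"


section \<open>Graded modules\<close>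

definition grading :: "('a, 'm) ring_scheme \<Rightarrow> (int \<Rightarrow> 'a set) \<Rightarrow> bool" where
  "grading M B \<longleftrightarrow> (\<forall>k. additive_subgroup (B k) M) \<and>
    (\<forall>x\<in>carrier M. \<exists>!c. (\<forall>k. c k \<in> B k) \<and> finite {k. c k \<noteq> \<zero>\<^bsub>M\<^esub>} \<and>
       x = finsum M c {k. c k \<noteq> \<zero>\<^bsub>M\<^esub>})"

definition graded_cring :: "('a, 'm) ring_scheme \<Rightarrow> (int \<Rightarrow> 'a set) \<Rightarrow> bool" where
  "graded_cring R A \<longleftrightarrow> cring R \<and> grading R A \<and> \<one>\<^bsub>R\<^esub> \<in> A 0 \<and>
    (\<forall>i j. \<forall>x\<in>A i. \<forall>y\<in>A j. x \<otimes>\<^bsub>R\<^esub> y \<in> A (i + j))"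

definition graded_module ::
  "('a, 'm) ring_scheme \<Rightarrow> (int \<Rightarrow> 'a set) \<Rightarrow> ('a, 'b, 'n) module_scheme \<Rightarrow> (int \<Rightarrow> 'b set) \<Rightarrow> bool" where
  "graded_module R A M B \<longleftrightarrow> graded_cring R A \<and> Module.module R M \<and> grading M B \<and>
    (\<forall>i j. \<forall>r\<in>A i. \<forall>x\<in>B j. r \<odot>\<^bsub>M\<^esub> x \<in> B (i + j))"

definition graded_module_iso ::
  "('a, 'm) ring_scheme \<Rightarrow> (int \<Rightarrow> 'a set) \<Rightarrow> ('a, 'b, 'n) module_scheme \<Rightarrow> (int \<Rightarrow> 'b set) \<Rightarrow>
    ('a, 'c, 'l) module_scheme \<Rightarrow> (int \<Rightarrow> 'c set) \<Rightarrow> ('b \<Rightarrow> 'c) \<Rightarrow> bool" where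
  "graded_module_iso R A M B N C \<phi> \<longleftrightarrow>
    graded_module R A M B \<and> graded_module R A N C \<and>
    bij_betw \<phi> (carrier M) (carrier N) \<and>
    (\<forall>x\<in>carrier M. \<forall>y\<in>carrier M. \<phi> (x \<oplus>\<^bsub>M\<^esub> y) = \<phi> x \<oplus>\<^bsub>N\<^esub> \<phi> y) \<and>
    (\<forall>r\<in>carrier R. \<forall>x\<in>carrier M. \<phi> (r \<odot>\<^bsub>M\<^esub> x) = r \<odot>\<^bsub>N\<^esub> \<phi> x) \<and>
    (\<forall>k. \<phi> ` B k = C k)"


section \<open>Tensor products over the complex numbers\<close>

text \<open>\<open>A \<otimes>\<^sub>\<complex> B\<close> is the free vector space on \<open>A \<times> B\<close> modulo the bilinearity relations; its elements are
  cosets. Here \<open>A\<close> and \<open>B\<close> are subspaces for the scalar multiplications \<open>sA\<close> and \<open>sB\<close>.\<close>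

definition free_scale :: "complex \<Rightarrow> ('x \<Rightarrow>\<^sub>0 complex) \<Rightarrow> 'x \<Rightarrow>\<^sub>0 complex" where
  "free_scale c p = Poly_Mapping.map ((*) c) p"

abbreviation free_gen :: "'a \<Rightarrow> 'b \<Rightarrow> 'a \<times> 'b \<Rightarrow>\<^sub>0 complex" where
  "free_gen a b \<equiv> Poly_Mapping.single (a, b) 1"

definition tensor_relations ::
  "(complex \<Rightarrow> 'a::ab_group_add \<Rightarrow> 'a) \<Rightarrow> (complex \<Rightarrow> 'b::ab_group_add \<Rightarrow> 'b) \<Rightarrow>
    'a set \<Rightarrow> 'b set \<Rightarrow> ('a \<times> 'b \<Rightarrow>\<^sub>0 complex) set" where
  "tensor_relations sA sB A B = Modules.module.span free_scale
    ({free_gen (a + a') b - free_gen a b - free_gen a' b |a a' b. a \<in> A \<and> a' \<in> A \<and> b \<in> B} \<union>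
     {free_gen a (b + b') - free_gen a b - free_gen a b' |a b b'. a \<in> A \<and> b \<in> B \<and> b' \<in> B} \<union>
     {free_gen (sA c a) b - free_scale c (free_gen a b) |c a b. a \<in> A \<and> b \<in> B} \<union>
     {free_gen a (sB c b) - free_scale c (free_gen a b) |c a b. a \<in> A \<and> b \<in> B})"

definition tensor_class ::
  "(complex \<Rightarrow> 'a::ab_group_add \<Rightarrow> 'a) \<Rightarrow> (complex \<Rightarrow> 'b::ab_group_add \<Rightarrow> 'b) \<Rightarrow>
    'a set \<Rightarrow> 'b set \<Rightarrow> ('a \<times> 'b \<Rightarrow>\<^sub>0 complex) \<Rightarrow> ('a \<times> 'b \<Rightarrow>\<^sub>0 complex) set" where
  "tensor_class sA sB A B p = {q. q - p \<in> tensor_relations sA sB A B}"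

text \<open>\<open>g\<cdot>(f \<otimes> v) = (g f) \<otimes> v\<close> on the free space, for functions \<open>g, f\<close>.\<close>

definition free_action ::
  "(complex \<Rightarrow> complex) \<Rightarrow> ((complex \<Rightarrow> complex) \<times> 'v \<Rightarrow>\<^sub>0 complex) \<Rightarrow>
    ((complex \<Rightarrow> complex) \<times> 'v \<Rightarrow>\<^sub>0 complex)" where
  "free_action g p = (\<Sum>(f, v)\<in>Poly_Mapping.keys p.
     Poly_Mapping.single ((\<lambda>\<tau>. g \<tau> * f \<tau>), v) (Poly_Mapping.lookup p (f, v)))"

abbreviation QM_tensor_class ::
  "(complex \<Rightarrow> 'v::ab_group_add \<Rightarrow> 'v) \<Rightarrow> (int \<Rightarrow> (complex \<Rightarrow> complex) set) \<Rightarrow> (int \<Rightarrow> 'v set) \<Rightarrow>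
    ((complex \<Rightarrow> complex) \<times> 'v \<Rightarrow>\<^sub>0 complex) \<Rightarrow> ((complex \<Rightarrow> complex) \<times> 'v \<Rightarrow>\<^sub>0 complex) set" where
  "QM_tensor_class smul A W \<equiv> tensor_class (fscale (*)) smul (total_space A) (total_space W)"

text \<open>The tensor product of a graded algebra of functions (with pieces \<open>A i\<close>) and a graded vector
  space (with pieces \<open>W j\<close>), as a module over the former; its piece of degree \<open>k\<close> is spanned by the
  \<open>A i \<otimes> W j\<close> with \<open>i + j = k\<close>.\<close>

definition tensor_module ::
  "(complex \<Rightarrow> 'v::ab_group_add \<Rightarrow> 'v) \<Rightarrow> (int \<Rightarrow> (complex \<Rightarrow> complex) set) \<Rightarrow> (int \<Rightarrow> 'v set) \<Rightarrow>
    (complex \<Rightarrow> complex, ((complex \<Rightarrow> complex) \<times> 'v \<Rightarrow>\<^sub>0 complex) set) module" where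
  "tensor_module smul A W =
    \<lparr>carrier = QM_tensor_class smul A W `
       {p. Poly_Mapping.keys p \<subseteq> total_space A \<times> total_space W},
     mult = undefined, one = undefined, zero = QM_tensor_class smul A W 0,
     add = (\<lambda>S T. {p + q |p q. p \<in> S \<and> q \<in> T}),
     smult = (\<lambda>g S. \<Union>p\<in>S. QM_tensor_class smul A W (free_action g p))\<rparr>"

definition tensor_piece ::
  "(complex \<Rightarrow> 'v::ab_group_add \<Rightarrow> 'v) \<Rightarrow> (int \<Rightarrow> (complex \<Rightarrow> complex) set) \<Rightarrow> (int \<Rightarrow> 'v set) \<Rightarrow>
    int \<Rightarrow> ((complex \<Rightarrow> complex) \<times> 'v \<Rightarrow>\<^sub>0 complex) set set" where
  "tensor_piece smul A W k = QM_tensor_class smul A W `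
     {p. Poly_Mapping.keys p \<subseteq> (\<Union>i. A i \<times> W (k - i))}"

end

theory Submission
  imports Defs "HOL-Complex_Analysis.Conformal_Mappings"
begin

text \<open>Write \<open>\<V>\<close> for the underlying space of \<open>V\<close>, \<open>\<A>\<close> for the algebra of scalar quasimodular forms and \<open>\<F>\<close>
for the space of vector-valued ones. Everything rests on one observation: for \<open>v\<close> homogeneous of degree
\<open>n\<close>, the operator \<open>K(\<gamma>,\<tau>)\<^sup>-\<^sup>1\<close> equals \<open>exp(X L(1)) j\<^sup>2\<^sup>L\<^sup>(\<^sup>0\<^sup>)\<close>, so that
\<open>(f v) \<parallel>\<^sub>k \<gamma> = (f |\<^sub>k\<^sub>-\<^sub>2\<^sub>n \<gamma>) exp(X L(1)) v\<close> (\<open>vslash_fun_vec\<close>). Since \<open>L(1)\<close> is locally nilpotent the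
exponential is a polynomial in \<open>X\<close>, and \<open>f v\<close> is quasimodular of weight \<open>k\<close> as soon as \<open>f\<close> has weight
\<open>k - 2n\<close> (\<open>fun_vec_coeffs\<close>). Conversely the factor \<open>exp(X L(1))\<close> can be undone, and every coordinate of a
vector-valued form with respect to a homogeneous basis is a scalar quasimodular form
(\<open>crd_quasimodular\<close>). Hence \<open>\<A> \<otimes> V\<^sup>(\<^sup>2\<^sup>) \<rightarrow> \<F>\<close> is onto, and it is injective because a tensor can be
normalised to have basis vectors on the right (\<open>normal_form\<close>, \<open>ev_kernel\<close>).

That the gradings are direct and that the coefficient functions \<open>Q\<^sub>m(f)\<close> are unique is a statement about
the group: the bottom rows of \<open>\<Gamma>\<close> satisfy no polynomial relation (\<open>automorphy_independent\<close>). This holds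
because a group of the first kind preserves no finite set of lines (\<open>no_finite_line_orbit\<close>), which
is a consequence of the compactness of \<open>\<Gamma>\<setminus>\<H>\<^sup>*\<close>. Compactness also shows that forms of negative weight
vanish (\<open>modform_negative\<close>) and, if there is a cusp, that each weight space is finite-dimensional
(\<open>modform_fin_dim\<close>); for quasimodular forms both follow by looking at the last nonzero \<open>Q\<^sub>m(f)\<close>, which
is modular of weight \<open>k - 2m\<close>.

For the second part, \<open>\<A>\<close> is a commutative algebra with the derivation \<open>d/d\<tau>\<close>, hence a commutative vertex
algebra, and \<open>\<A> \<otimes> V\<close> carries the tensor product structure
\<open>(f u)\<^sub>(\<^sub>n\<^sub>) (g v) = \<Sum>\<^sub>i (f\<^sup>(\<^sup>i\<^sup>) / i!) g u\<^sub>(\<^sub>n\<^sub>+\<^sub>i\<^sub>) v\<close>. The Borcherds identity for it is obtained from the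
one in \<open>V\<close> at the shifted indices \<open>m + r\<close>, \<open>n + q\<close>, multiplied by the \<open>r\<close>-th and \<open>q\<close>-th divided derivatives:
the Leibniz rule and the Vandermonde identity match the two sides (\<open>leibniz_vandermonde\<close>). On scalars
\<open>sl\<^sub>2\<close> acts by \<open>d/d\<tau>\<close>, half the weight and \<open>f \<mapsto> Q\<^sub>1(f)\<close>; the diagonal action on \<open>\<A> \<otimes> V\<close> is the required one,
and its covariance reduces to the commutator of \<open>Q\<^sub>1\<close> with divided derivatives (\<open>qop_hasse\<close>).\<close>

section \<open>The action of SL2(R) on rows and on the upper half plane\<close>

definition linfac :: "real^2 => complex => complex" where
 "linfac v z = of_real (v$1) * z + of_real (v$2)"

definition det_rows :: "real^2 => real^2 => real" where
 "det_rows u w = u$1 * w$2 - u$2 * w$1"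

lemma mat2_eqI:
 assumes "g$1$1 = h$1$1" "g$1$2 = h$1$2" "g$2$1 = h$2$1" "g$2$2 = h$2$2"
 shows "g = (h :: real^2^2)"
 using assms by (simp add: vec_eq_iff forall_2)

lemma mat2_mult_nth:
 "((g::real^2^2) ** h)$i$j = g$i$1 * h$1$j + g$i$2 * h$2$j"
 by (simp add: matrix_matrix_mult_def sum_2)

lemma row2_mult_nth:
 "((v::real^2) v* g)$j = v$1 * g$1$j + v$2 * g$2$j"
 by (simp add: vector_matrix_mult_def sum_2 mult.commute)

lemma mat2_row_mult: "((g::real^2^2) ** h)$i = g$i v* h"
 by (simp add: vec_eq_iff forall_2 mat2_mult_nth row2_mult_nth)

lemma jfac_linfac: "jfac g z = linfac (g$2) z"
 by (simp add: jfac_def linfac_def)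

lemma SL2R_mult: "g : SL2R ==> h : SL2R ==> g ** h : SL2R"
 by (simp add: SL2R_def det_mul)

lemma SL2R_det: "g : SL2R ==> g$1$1 * g$2$2 - g$1$2 * g$2$1 = 1"
 by (simp add: SL2R_def det_2)

lemma SL2R_inv:
 assumes "g : SL2R"
 shows "g ** matrix_inv g = mat 1" "matrix_inv g ** g = mat 1" "matrix_inv g : SL2R"
proof -
 have i: "invertible g" using assms by (simp add: SL2R_def invertible_det_nz)
 show 1: "g ** matrix_inv g = mat 1" "matrix_inv g ** g = mat 1"
  using i someI_ex[of "%A'. g ** A' = mat 1 & A' ** g = mat 1"]
  unfolding invertible_def matrix_inv_def by auto
 have "det g * det (matrix_inv g) = 1" using 1 det_mul by (metis det_I)
 with assms show "matrix_inv g : SL2R" by (simp add: SL2R_def)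
qed

lemma det_rows_mult: "det_rows (u v* g) (w v* g) = det g * det_rows u w"
 by (simp add: det_rows_def row2_mult_nth det_2 algebra_simps)

lemma det_rows_scale: "det_rows (s *s u) (t *s w) = s * t * det_rows u w"
 by (simp add: det_rows_def algebra_simps)

lemma det_rows_self: "det_rows u u = 0" "det_rows u (t *s u) = 0" "det_rows (t *s u) u = 0"
 by (simp_all add: det_rows_def)

lemma det_rows_parallel:
 assumes "det_rows u w = 0" "u ~= 0" shows "EX t. w = t *s u"
proof (cases "u$1 = 0")
 case True
 with assms(2) have "u$2 ~= 0" by (auto simp: vec_eq_iff forall_2)
 with True assms show ?thesis
  by (intro exI[of _ "w$2 / u$2"]) (auto simp: vec_eq_iff forall_2 det_rows_def)
next
 case False
 with assms show ?thesis
  by (intro exI[of _ "w$1 / u$1"]) (auto simp: vec_eq_iff forall_2 det_rows_def field_simps)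
qed

lemma row_mult_nz: "g : SL2R ==> v ~= 0 ==> v v* g ~= 0"
 using SL2R_inv(1)[of g] by (metis vector_matrix_mul_assoc vector_matrix_mul_rid vector_matrix_mult_0)

lemma scale_row_mult: "(t *s v) v* (g::real^2^2) = t *s (v v* g)"
 by (simp add: vec_eq_iff row2_mult_nth algebra_simps)

lemma linfac_nz:
 assumes "v ~= 0" "z : uhp" shows "linfac v z ~= 0"
proof
 assume *: "linfac v z = 0"
 have "Im (linfac v z) = v$1 * Im z" by (simp add: linfac_def)
 with * assms(2) have c: "v$1 = 0" by (auto simp: uhp_def)
 with * have "v$2 = 0" by (simp add: linfac_def)
 with c assms(1) show False by (simp add: vec_eq_iff forall_2)
qed

lemma linfac_scale: "linfac (t *s v) z = of_real t * linfac v z"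
 by (simp add: linfac_def algebra_simps)

lemma linfac_mobius:
 assumes "jfac g z ~= 0" shows "linfac v (mobius g z) = linfac (v v* g) z / jfac g z"
 using assms by (simp add: linfac_def mobius_def row2_mult_nth divide_simps)
  (simp add: jfac_def algebra_simps)

lemma jfac_mult:
 assumes "h : SL2R" "z : uhp"
 shows "jfac (g ** h) z = jfac g (mobius h z) * jfac h z"
 using linfac_mobius[OF jfac_nonzero[OF assms], of "g$2"] jfac_nonzero[OF assms]
 by (simp add: jfac_linfac mat2_row_mult)

lemma mobius_linfac: "mobius g z = linfac (g$1) z / linfac (g$2) z"
 by (simp add: mobius_def jfac_def linfac_def)

lemma mobius_mult:
 assumes "g : SL2R" "h : SL2R" "z : uhp"
 shows "mobius (g ** h) z = mobius g (mobius h z)"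
 using jfac_nonzero[OF assms(2,3)]
 by (simp add: mobius_linfac[of "g ** h"] mobius_linfac[of g] linfac_mobius mat2_row_mult)

lemma mobius_one [simp]: "mobius (mat 1) z = z"
 by (simp add: mobius_def jfac_def mat_def)

lemma jfac_one [simp]: "jfac (mat 1) z = 1"
 by (simp add: jfac_def mat_def)

lemma Xfac_one [simp]: "Xfac (mat 1) z = 0"
 by (simp add: Xfac_def mat_def)

lemma mat_one_SL2R [simp]: "mat 1 : SL2R"
 by (simp add: SL2R_def)

lemma mobius_inv:
 assumes "g : SL2R" "z : uhp"
 shows "mobius g (mobius (matrix_inv g) z) = z" "mobius (matrix_inv g) (mobius g z) = z"
 using mobius_mult[of g "matrix_inv g" z] mobius_mult[of "matrix_inv g" g z] SL2R_inv[OF assms(1)] assms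
 by simp_all

lemma Xfac_mult:
 assumes "g : SL2R" "h : SL2R" "z : uhp"
 shows "Xfac (g ** h) z = Xfac h z + Xfac g (mobius h z) / (jfac h z)\<^sup>2"
proof -
 define a b c d where abcd: "a = complex_of_real (h$1$1)" "b = complex_of_real (h$1$2)"
  "c = complex_of_real (h$2$1)" "d = complex_of_real (h$2$2)"
 define p q where pq: "p = complex_of_real (g$2$1)" "q = complex_of_real (g$2$2)"
 define J where "J = c * z + d"
 define G where "G = jfac g (mobius h z)"
 have det: "a * d - b * c = 1"
  using SL2R_det[OF assms(2)] unfolding abcd
  by (metis of_real_1 of_real_diff of_real_mult)
 have J: "J = jfac h z" "J ~= 0" using jfac_nonzero[OF assms(2,3)] by (simp_all add: J_def jfac_def abcd)
 have G0: "G ~= 0" using jfac_nonzero[OF assms(1) mobius_uhp[OF assms(2,3)]] by (simp add: G_def)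
 have GJ: "G * J = p * (a * z + b) + q * J"
  using J(2) by (simp add: G_def jfac_def[of g] mobius_def pq abcd J(1)[symmetric] field_simps)
 have "Xfac (g ** h) z = (p * a + q * c) / (G * J)"
  using jfac_mult[OF assms(2,3), of g]
  by (simp add: Xfac_def mat2_mult_nth pq abcd G_def J(1))
 moreover have "Xfac h z = c / J" "Xfac g (mobius h z) = p / G"
  by (simp_all add: Xfac_def J(1) abcd pq G_def)
 moreover have "(p * a + q * c) / (G * J) = c / J + p / G / J\<^sup>2"
 proof -
  have "(p * a + q * c) * J - c * (p * (a * z + b) + q * J) = p * (a * d - b * c)"
   by (simp add: J_def algebra_simps)
  hence "(p * a + q * c) * J = c * (G * J) + p"
   unfolding GJ det by (simp add: algebra_simps)
  hence "(p * a + q * c) / (G * J) = (c * (G * J) + p) / (G * J * J)"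
   using J(2) G0 by (simp add: field_simps)
  also have "\<dots> = c / J + p / G / J\<^sup>2"
   using J(2) G0 by (simp add: add_divide_distrib power2_eq_square)
  finally show ?thesis .
 qed
 ultimately show ?thesis by (simp add: J(1))
qed

lemma Im_mobius:
 assumes "g : SL2R" "z : uhp" shows "Im (mobius g z) = Im z / (cmod (jfac g z))\<^sup>2"
proof -
 let ?n = "of_real (g$1$1) * z + of_real (g$1$2)"
 have "Im (mobius g z) = Im (?n * cnj (jfac g z)) / (cmod (jfac g z))\<^sup>2"
  unfolding mobius_def by (simp add: complex_div_cnj[of ?n] flip: of_real_power)
 also have "Im (?n * cnj (jfac g z)) = det g * Im z"
  by (simp add: jfac_def det_2 algebra_simps)
 finally show ?thesis using assms(1) by (simp add: SL2R_def)
qed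

lemma norm_Xfac_le:
 assumes "g : SL2R" "z : uhp" shows "cmod (Xfac g z) <= 1 / Im z"
proof -
 have "\<bar>g$2$1\<bar> * Im z = \<bar>Im (jfac g z)\<bar>" using assms(2) by (simp add: jfac_def abs_mult uhp_def)
 also have "\<dots> <= cmod (jfac g z)" by (rule abs_Im_le_cmod)
 finally show ?thesis using jfac_nonzero[OF assms] assms(2)
  by (simp add: Xfac_def norm_divide field_simps uhp_def)
qed

lemma open_uhp: "open uhp" by (simp add: uhp_def open_halfspace_Im_gt)

lemma holo_jfac: "jfac g holomorphic_on S"
 unfolding jfac_def by (intro holomorphic_intros)

lemma holo_mobius: "g : SL2R ==> mobius g holomorphic_on uhp"
 unfolding mobius_def using holo_jfac jfac_nonzero by (intro holomorphic_intros) auto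

lemma cont_mobius: "g : SL2R ==> continuous_on uhp (mobius g)"
 by (simp add: holo_mobius holomorphic_on_imp_continuous_on)

lemma open_mobius_image:
 assumes "g : SL2R" "open U" "U <= uhp" shows "open (mobius g ` U)"
proof -
 have "mobius g ` U = uhp \<inter> mobius (matrix_inv g) -` U"
 proof (intro equalityI subsetI)
  fix w assume "w : mobius g ` U"
  then obtain z where "z : U" "w = mobius g z" by auto
  with assms show "w : uhp \<inter> mobius (matrix_inv g) -` U"
   using mobius_uhp[of g z] mobius_inv(2)[of g z] by auto
 next
  fix w assume "w : uhp \<inter> mobius (matrix_inv g) -` U"
  with assms show "w : mobius g ` U" using mobius_inv(1)[of g w] by (metis IntD1 IntD2 image_eqI vimageE)
 qed
 moreover have "open (uhp \<inter> mobius (matrix_inv g) -` U)"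
  using continuous_open_preimage[OF cont_mobius[OF SL2R_inv(3)[OF assms(1)]] open_uhp assms(2)] .
 ultimately show ?thesis by simp
qed

subsection \<open>Boundary points as lines of columns\<close>

definition bdry_of :: "real^2 => real option" where
 "bdry_of w = (if w$2 = 0 then None else Some (w$1 / w$2))"

lemma bdry_of_surj: "EX w. w ~= 0 & bdry_of w = s"
proof (cases s)
 case None
 thus ?thesis by (intro exI[of _ "vector [1,0]"]) (simp add: bdry_of_def vec_eq_iff forall_2)
next
 case (Some x)
 thus ?thesis by (intro exI[of _ "vector [x,1]"]) (simp add: bdry_of_def vec_eq_iff forall_2)
qed

lemma col2_mult_nth: "((g::real^2^2) *v w)$i = g$i$1 * w$1 + g$i$2 * w$2"
 by (simp add: matrix_vector_mult_def sum_2)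

lemma bdry_mobius_of:
 assumes "w ~= 0" shows "bdry_mobius g (bdry_of w) = bdry_of (g *v w)"
proof (cases "w$2 = 0")
 case True
 with assms have "w$1 ~= 0" by (auto simp: vec_eq_iff forall_2)
 with True show ?thesis by (simp add: bdry_mobius_def bdry_of_def col2_mult_nth)
next
 case False
 hence "g$2$1 * (w$1/w$2) + g$2$2 = (g$2$1 * w$1 + g$2$2 * w$2) / w$2"
  "g$1$1 * (w$1/w$2) + g$1$2 = (g$1$1 * w$1 + g$1$2 * w$2) / w$2"
  by (simp_all add: field_simps)
 with False show ?thesis by (simp add: bdry_mobius_def bdry_of_def col2_mult_nth)
qed

lemma SL2R_col_nz: "g : SL2R ==> w ~= 0 ==> g *v w ~= 0"
 using SL2R_inv(2)[of g] by (metis matrix_vector_mul_assoc matrix_vector_mul_lid matrix_vector_mult_0_right)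

lemma bdry_mobius_mult:
 assumes "h : SL2R" shows "bdry_mobius (g ** h) s = bdry_mobius g (bdry_mobius h s)"
proof -
 obtain w where "w ~= 0" "s = bdry_of w" using bdry_of_surj by metis
 thus ?thesis using SL2R_col_nz[OF assms, of w]
  by (simp add: bdry_mobius_of matrix_vector_mul_assoc)
qed

lemma bdry_mobius_one [simp]: "bdry_mobius (mat 1) s = s"
 by (cases s) (auto simp: bdry_mobius_def mat_def)

lemma bdry_mobius_None: "bdry_mobius g None = None \<longleftrightarrow> g$2$1 = 0"
 by (simp add: bdry_mobius_def)

lemma stabilizer_triangular:
 assumes "s : SL2R" "h : SL2R" "bdry_mobius h None = bdry_mobius s None"
 shows "(matrix_inv s ** h)$2$1 = 0"
proof -
 have "bdry_mobius (matrix_inv s ** h) None = bdry_mobius (matrix_inv s ** s) None"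
  using assms by (simp only: bdry_mobius_mult)
 thus ?thesis using SL2R_inv[OF assms(1)] by (simp add: bdry_mobius_None)
qed

lemma mobius_triangular:
 assumes "g : SL2R" "g$2$1 = 0"
 shows "g$2$2 ~= 0" "Im (mobius g z) = Im z / (g$2$2)\<^sup>2"
proof -
 have d: "g$1$1 * g$2$2 = 1" using SL2R_det[OF assms(1)] assms(2) by simp
 thus "g$2$2 ~= 0" by auto
 with d have "g$1$1 = 1 / g$2$2" by (simp add: field_simps)
 with assms show "Im (mobius g z) = Im z / (g$2$2)\<^sup>2"
  by (simp add: mobius_def jfac_def power2_eq_square)
qed

lemma exists_scaling: "EX h:SL2R. bdry_mobius h None = s"
proof (cases s)
 case None
 thus ?thesis by (intro bexI[of _ "mat 1"]) auto
next
 case (Some x)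
 let ?g = "vector [vector [x, -1], vector [1, 0]] :: real^2^2"
 have "?g : SL2R" by (simp add: SL2R_def det_2)
 moreover have "bdry_mobius ?g None = s" using Some by (simp add: bdry_mobius_def)
 ultimately show ?thesis by blast
qed

section \<open>Compactness\<close>

text \<open>The group enters through compactness only by way of \<open>finite_subcover\<close> and
\<open>exhaustion\<close>, which speak of open invariant subsets of the upper half plane instead of the
quotient topology.\<close>

locale first_kind =
 fixes \<Gamma> :: "(real^2^2) set"
 assumes fk: "fuchsian_first_kind \<Gamma>"
begin

lemma in_SL2R: "g : \<Gamma> ==> g : SL2R"
 and one_in: "mat 1 : \<Gamma>"
 and minus_one_in: "- mat 1 : \<Gamma>"
 and mult_in: "g : \<Gamma> ==> h : \<Gamma> ==> g ** h : \<Gamma>"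
 and inv_in: "g : \<Gamma> ==> matrix_inv g : \<Gamma>"
 and discrete: "discrete \<Gamma>"
 and compact_quotient: "compact_space (quotient_topology \<Gamma>)"
 using fk by (auto simp: fuchsian_first_kind_def)

definition invariant :: "complex set => bool" where
 "invariant A \<longleftrightarrow> (ALL g:\<Gamma>. ALL z:A. mobius g z : A)"

definition near_cusp :: "complex set => real option => bool" where
 "near_cusp A s \<longleftrightarrow> (ALL h:SL2R. bdry_mobius h None = s --> (EX Y>0. ALL z. Y < Im z --> mobius h z : A))"

text \<open>An open cover of \<open>\<H>\<close> by invariant sets becomes an open cover of
\<open>\<Gamma>\<setminus>\<H>\<^sup>*\<close> once each cusp is added to the members that contain a
horoball at it.\<close>

lemma finite_subcover:
 assumes A: "!!A. A : \<A> ==> open A & A <= uhp & invariant A"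
  and pts: "!!z. z : uhp ==> EX A:\<A>. z : A"
  and cusp: "!!s. s : cusps \<Gamma> ==> EX A:\<A>. near_cusp A s"
 shows "EX \<F><=\<A>. finite \<F> & uhp <= \<Union>\<F>"
proof -
 define U where "U A = Inl ` A \<union> Inr ` {s\<in>cusps \<Gamma>. near_cusp A s}" for A
 have op: "ext_open \<Gamma> (U A)" if "A : \<A>" for A
 proof -
  have "Inl -` U A = A" by (auto simp: U_def)
  hence "open (Inl -` U A)" using A[OF that] by simp
  moreover have "U A <= ext_uhp \<Gamma>" using A[OF that] by (auto simp: U_def ext_uhp_def)
  moreover have "EX Y>0. ALL z. Y < Im z --> Inl (mobius t z) : U A"
   if "Inr s : U A" "t : SL2R" "bdry_mobius t None = s" for s t
  proof -
   have "near_cusp A s" using that(1) by (auto simp: U_def)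
   thus ?thesis using that(2,3) unfolding near_cusp_def U_def by blast
  qed
  ultimately show ?thesis unfolding ext_open_def by blast
 qed
 have sat: "p : U A" if AA: "A : \<A>" and pe: "p : ext_uhp \<Gamma>" and pq: "orbit \<Gamma> p = orbit \<Gamma> q" and qU: "q : U A" for A p q
 proof -
  have self: "r : orbit \<Gamma> r" for r
  proof -
   have "r = map_sum (mobius (mat 1)) (bdry_mobius (mat 1)) r" by (cases r) auto
   thus ?thesis unfolding orbit_def using one_in by (rule image_eqI)
  qed
  obtain g where g: "g : \<Gamma>" "p = map_sum (mobius g) (bdry_mobius g) q"
   using self[of p] pq unfolding orbit_def by auto
  obtain h where h: "h : \<Gamma>" "q = map_sum (mobius h) (bdry_mobius h) p"
   using self[of q] pq unfolding orbit_def by auto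
  show ?thesis
  proof (cases q)
   case (Inl z)
   with g A[OF AA] qU show ?thesis by (auto simp: U_def invariant_def)
  next
   case (Inr s)
   then obtain s' where s': "p = Inr s'" "s = bdry_mobius h s'" using h by (cases p) auto
   have "near_cusp A s'" unfolding near_cusp_def
   proof (intro ballI impI)
    fix t assume t: "t : SL2R" "bdry_mobius t None = s'"
    hence "bdry_mobius (h ** t) None = s" by (simp add: bdry_mobius_mult s')
    moreover have "h ** t : SL2R" using SL2R_mult in_SL2R h t by blast
    ultimately obtain Y where Y: "Y > 0" "ALL z. Y < Im z --> mobius (h ** t) z : A"
     using qU Inr unfolding U_def near_cusp_def by auto
    show "EX Y>0. ALL z. Y < Im z --> mobius t z : A"
    proof (intro exI[of _ Y] conjI allI impI)
     fix z assume z: "Y < Im z"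
     hence zu: "z : uhp" using Y by (simp add: uhp_def)
     have "mobius h (mobius t z) : A"
      using Y(2) z mobius_mult[OF in_SL2R[OF h(1)] t(1) zu] by auto
     hence "mobius (matrix_inv h) (mobius h (mobius t z)) : A"
      using A[OF AA] inv_in[OF h(1)] unfolding invariant_def by blast
     thus "mobius t z : A"
      using mobius_inv(2)[OF in_SL2R[OF h(1)]] mobius_uhp[OF t(1) zu] by simp
    qed (use Y in simp)
   qed
   thus ?thesis using s' pe by (auto simp: U_def ext_uhp_def)
  qed
 qed
 have qo: "openin (quotient_topology \<Gamma>) (orbit \<Gamma> ` U A)" if "A : \<A>" for A
 proof -
  have sub: "U A <= ext_uhp \<Gamma>" using op[OF that] by (simp add: ext_open_def)
  have "{p : ext_uhp \<Gamma>. orbit \<Gamma> p : orbit \<Gamma> ` U A} = U A"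
   using sat[OF that] sub by blast
  thus ?thesis
   unfolding openin_quotient_topology quotient_open_def openin_ext_topology
   using op[OF that] sub by auto
 qed
 have "topspace (quotient_topology \<Gamma>) <= \<Union>((%A. orbit \<Gamma> ` U A) ` \<A>)"
 proof
  fix W assume "W : topspace (quotient_topology \<Gamma>)"
  then obtain p where p: "p : ext_uhp \<Gamma>" "W = orbit \<Gamma> p"
   by (auto simp: topspace_quotient_topology)
  have "EX A:\<A>. p : U A"
  proof (cases p)
   case (Inl z)
   with p(1) have "z : uhp" by (auto simp: ext_uhp_def)
   with pts Inl show ?thesis unfolding U_def by blast
  next
   case (Inr s)
   with p(1) have "s : cusps \<Gamma>" by (auto simp: ext_uhp_def)
   with cusp Inr show ?thesis unfolding U_def by blast
  qed
  with p show "W : \<Union>((%A. orbit \<Gamma> ` U A) ` \<A>)" by auto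
 qed
 moreover have "ALL W:(%A. orbit \<Gamma> ` U A) ` \<A>. openin (quotient_topology \<Gamma>) W"
  using qo by blast
 ultimately obtain \<W> where \<W>: "finite \<W>" "\<W> <= (%A. orbit \<Gamma> ` U A) ` \<A>"
   "topspace (quotient_topology \<Gamma>) <= \<Union>\<W>"
  using compact_quotient[unfolded compact_space_alt, rule_format, of "(%A. orbit \<Gamma> ` U A) ` \<A>"] by blast
 obtain \<F> where F: "\<F> <= \<A>" "finite \<F>" "\<W> = (%A. orbit \<Gamma> ` U A) ` \<F>"
  using finite_subset_image[OF \<W>(1,2)] by blast
 have "uhp <= \<Union>\<F>"
 proof
  fix z assume z: "z : uhp"
  hence e: "Inl z : ext_uhp \<Gamma>" by (simp add: ext_uhp_def)
  hence "orbit \<Gamma> (Inl z) : \<Union>\<W>" using \<W>(3) by (auto simp: topspace_quotient_topology)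
  then obtain A q where "A : \<F>" "q : U A" "orbit \<Gamma> (Inl z) = orbit \<Gamma> q" using F by auto
  hence "Inl z : U A" using sat e F by blast
  thus "z : \<Union>\<F>" using \<open>A : \<F>\<close> by (auto simp: U_def)
 qed
 with F show ?thesis by blast
qed

text \<open>The form in which compactness is used against invariant functions: their sublevel sets are
increasing, so one of them is already the whole half plane.\<close>

lemma exhaustion:
 fixes A :: "nat => complex set"
 assumes A: "!!n. open (A n) & A n <= uhp & invariant (A n)" and mono: "!!n. A n <= A (Suc n)"
  and pts: "!!z. z : uhp ==> EX n. z : A n"
  and cusp: "!!s. s : cusps \<Gamma> ==> EX n. near_cusp (A n) s"
 shows "EX n. A n = uhp"
proof -
 obtain \<F> where F: "\<F> <= range A" "finite \<F>" "uhp <= \<Union>\<F>"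
  using finite_subcover[of "range A"] A pts cusp by auto
 then obtain N where N: "finite N" "\<F> = A ` N" by (meson finite_subset_image)
 have "A n <= A (Max (insert 0 N))" if "n : N" for n
  using lift_Suc_mono_le[of A n "Max (insert 0 N)"] mono that N(1) by simp
 hence "\<Union>\<F> <= A (Max (insert 0 N))" unfolding N(2) by blast
 hence "uhp <= A (Max (insert 0 N))" using F(3) by (rule order_trans[rotated])
 thus ?thesis using A by blast
qed

end

section \<open>A Fuchsian group of the first kind fixes no finite set of lines\<close>

lemma smult_row_cancel: "v ~= 0 ==> a *s v = b *s v ==> a = (b::real)"
 by (auto simp: vec_eq_iff)

lemma trace_2: "trace (g::real^2^2) = g$1$1 + g$2$2"
 by (simp add: trace_def sum_2)

lemma row_cayley_hamilton: "(v v* g) v* g = trace g *s (v v* g) - det (g::real^2^2) *s v"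
 by (simp add: vec_eq_iff forall_2 row2_mult_nth trace_2 det_2 algebra_simps)

lemma mat2_eq_on_basis:
 assumes "det_rows u w ~= 0" "u v* g = u v* h" "w v* g = w v* h"
 shows "g = (h::real^2^2)"
proof -
 have "det_rows u w * (g$1$j - h$1$j) = w$2 * ((u v* g)$j - (u v* h)$j) - u$2 * ((w v* g)$j - (w v* h)$j)"
   "det_rows u w * (g$2$j - h$2$j) = u$1 * ((w v* g)$j - (w v* h)$j) - w$1 * ((u v* g)$j - (u v* h)$j)" for j
  by (simp_all add: det_rows_def row2_mult_nth algebra_simps)
 hence "g$1$j = h$1$j" "g$2$j = h$2$j" for j
  unfolding assms(2,3) using assms(1) by simp_all
 thus ?thesis by (simp add: vec_eq_iff forall_2)
qed

lemma row_mult_minus: "v v* (- g::real^2^2) = - (v v* g)"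
 by (simp add: vec_eq_iff forall_2 row2_mult_nth)

lemma mult_minus_one: "g ** (- mat 1) = - (g::real^2^2)"
 by (rule mat2_eqI) (simp_all add: mat2_mult_nth mat_def)

lemma eigenvalue_eq:
 assumes "g : SL2R" "v ~= 0" "v v* g = t *s v"
 shows "t * t - trace g * t + 1 = 0" "t ~= 0"
proof -
 have "(t * t - trace g * t + 1) *s v = 0"
  using row_cayley_hamilton[of v g] assms
  by (simp add: scale_row_mult SL2R_def vec_eq_iff algebra_simps)
 hence "(t * t - trace g * t + 1) *s v = 0 *s v" by simp
 thus "t * t - trace g * t + 1 = 0" using smult_row_cancel[OF assms(2)] by blast
 thus "t ~= 0" by auto
qed

lemma parabolic_eigenvalue:
 assumes "parabolic g" "v ~= 0" "v v* g = t *s v"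
 shows "t = trace g / 2" "t * t = 1"
proof -
 have "t * t - trace g * t + 1 = 0" "(trace g)\<^sup>2 = 4"
  using eigenvalue_eq assms by (auto simp: parabolic_def)
 hence "(2 * t - trace g)\<^sup>2 = 0" by (simp add: power2_eq_square algebra_simps)
 thus "t = trace g / 2" by simp
 hence "trace g = 2 * t" by simp
 with \<open>t * t - trace g * t + 1 = 0\<close> show "t * t = 1" by simp
qed

lemma scalar_on_basis:
 assumes "g : SL2R" "det_rows u w ~= 0" "u v* g = t *s u" "w v* g = t *s w"
 shows "g = mat 1 \<or> g = - mat 1"
proof -
 have "t * t * det_rows u w = det_rows u w"
  using det_rows_mult[of u g w] assms by (simp add: det_rows_scale SL2R_def)
 hence "t * t = 1" using assms(2) by simp
 hence "t = 1 \<or> t = -1" by (simp add: square_eq_1_iff)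
 thus ?thesis
  using mat2_eq_on_basis[OF assms(2), of g "mat 1"] mat2_eq_on_basis[OF assms(2), of g "- mat 1"] assms(3,4)
  by (auto simp: row_mult_minus)
qed

lemma parabolic_unique_line:
 assumes "parabolic g" "v v* g = s *s v" "w v* g = t *s w"
 shows "det_rows v w = 0"
proof (rule ccontr)
 assume d: "det_rows v w ~= 0"
 hence "v ~= 0" "w ~= 0" by (auto simp: det_rows_def)
 hence "s = t" using parabolic_eigenvalue(1) assms by metis
 thus False using scalar_on_basis[OF _ d] assms by (auto simp: parabolic_def)
qed

lemma linfac_lower: "\<bar>v$1 * x + v$2\<bar> <= cmod (linfac v (Complex x y))"
 using abs_Re_le_cmod[of "linfac v (Complex x y)"] by (simp add: linfac_def)

lemma exists_real_nz:
 assumes "v ~= (0::real^2)" "w ~= (0::real^2)"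
 shows "EX x::real. v$1 * x + v$2 ~= 0 & w$1 * x + (w::real^2)$2 ~= 0"
proof -
 have fin: "finite {x. u$1 * x + u$2 = 0}" if "u ~= (0::real^2)" for u
 proof (cases "u$1 = 0")
  case True
  with that have "u$2 ~= 0" by (auto simp: vec_eq_iff forall_2)
  with True show ?thesis by simp
 next
  case False
  hence "{x. u$1 * x + u$2 = 0} <= {- u$2 / u$1}" by (auto simp: field_simps)
  thus ?thesis by (rule finite_subset) simp
 qed
 have "finite ({x. v$1 * x + v$2 = 0} \<union> {x. w$1 * x + w$2 = 0})" using fin assms by simp
 then obtain x where "x ~: {x. v$1 * x + v$2 = 0} \<union> {x. w$1 * x + w$2 = 0}"
  using ex_new_if_finite[OF infinite_UNIV_char_0] by blast
 thus ?thesis by auto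
qed

lemma cont_linfac: "continuous_on S (linfac v)"
 unfolding linfac_def by (intro continuous_intros)

lemma norm_mat2_le: "norm (x::real^2^2) <= \<bar>x$1$1\<bar> + \<bar>x$1$2\<bar> + \<bar>x$2$1\<bar> + \<bar>x$2$2\<bar>"
proof -
 have "norm x <= (\<Sum>i\<in>UNIV. norm (x$i))" unfolding norm_vec_def by (rule L2_set_le_sum) simp
 also have "\<dots> <= (\<Sum>i\<in>UNIV. \<Sum>j\<in>UNIV. \<bar>x$i$j\<bar>)" by (intro sum_mono norm_le_l1_cart)
 finally show ?thesis by (simp add: sum_2)
qed

lemma open_sublevel_uhp:
 fixes f :: "complex => real"
 assumes "continuous_on uhp f" shows "open {z\<in>uhp. f z < c}" "open {z\<in>uhp. c < f z}"
proof -
 have "{z\<in>uhp. f z < c} = uhp \<inter> f -` {..<c}" "{z\<in>uhp. c < f z} = uhp \<inter> f -` {c<..}" by auto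
 thus "open {z\<in>uhp. f z < c}" "open {z\<in>uhp. c < f z}"
  using continuous_open_preimage[OF assms open_uhp] by simp_all
qed

context first_kind
begin

lemma mobius_in: "g : \<Gamma> ==> z : uhp ==> mobius g z : uhp"
 using mobius_uhp in_SL2R by blast

lemma discrete_at_one: "EX e>0. ALL g:\<Gamma>. (ALL i j. \<bar>g$i$j - mat 1$i$j\<bar> < e) --> g = mat 1"
proof -
 have "mat 1 isolated_in \<Gamma>" using discrete one_in discreteD by blast
 then obtain T where T: "open T" "T \<inter> \<Gamma> = {mat 1}" by (auto simp: isolated_in_def)
 then obtain e where e: "e > 0" "ALL y. dist y (mat 1) < e --> y : T"
  using open_dist[of T] by blast
 show ?thesis
 proof (intro exI[of _ "e/4"] conjI ballI impI)
  fix g assume g: "g : \<Gamma>" "ALL i j. \<bar>g$i$j - mat 1$i$j\<bar> < e/4"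
  hence "\<bar>(g - mat 1)$i$j\<bar> < e/4" for i j by simp
  from this[of 1 1] this[of 1 2] this[of 2 1] this[of 2 2] norm_mat2_le[of "g - mat 1"]
  have "dist g (mat 1) < e" unfolding dist_norm by linarith
  with e T g show "g = mat 1" by blast
 qed (use e in simp)
qed

text \<open>If two lines are preserved, the absolute value of the product of the two linear forms divided by
the height is an invariant function; there are no cusps, since a parabolic element fixes a single line, so
compactness would bound it, but it is unbounded.\<close>

lemma no_two_lines:
 assumes d: "det_rows v1 v2 ~= 0"
  and perm: "!!g. g : \<Gamma> ==> (det_rows v1 (v1 v* g) = 0 & det_rows v2 (v2 v* g) = 0) \<or>
   (det_rows v2 (v1 v* g) = 0 & det_rows v1 (v2 v* g) = 0)"
 shows False
proof -
 have nz: "v1 ~= 0" "v2 ~= 0" using d by (auto simp: det_rows_def)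
 have d': "det_rows v2 v1 = - det_rows v1 v2" by (simp add: det_rows_def)
 have scale: "(EX s t. s * t = 1 & v1 v* g = s *s v1 & v2 v* g = t *s v2) \<or>
   (EX s t. s * t = -1 & v1 v* g = s *s v2 & v2 v* g = t *s v1)" if "g : \<Gamma>" for g
 proof -
  have dd: "det_rows (v1 v* g) (v2 v* g) = det_rows v1 v2"
   using det_rows_mult[of v1 g v2] in_SL2R[OF that] by (simp add: SL2R_def)
  from perm[OF that] show ?thesis
  proof
   assume "det_rows v1 (v1 v* g) = 0 & det_rows v2 (v2 v* g) = 0"
   then obtain s t where st: "v1 v* g = s *s v1" "v2 v* g = t *s v2"
    using det_rows_parallel nz by meson
   with dd d have "s * t = 1" by (simp add: det_rows_scale)
   with st show ?thesis by blast
  next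
   assume "det_rows v2 (v1 v* g) = 0 & det_rows v1 (v2 v* g) = 0"
   then obtain s t where st: "v1 v* g = s *s v2" "v2 v* g = t *s v1"
    using det_rows_parallel nz by meson
   have "(s * t + 1) * det_rows v1 v2 = 0" using dd d' unfolding st by (simp add: det_rows_scale algebra_simps)
   with d have "s * t = -1" by (simp add: add_eq_0_iff2)
   with st show ?thesis by blast
  qed
 qed
 have "~ parabolic g" if "g : \<Gamma>" for g
 proof
  assume p: "parabolic g"
  from scale[OF that] show False
  proof (elim disjE exE conjE)
   fix s t assume "v1 v* g = s *s v1" "v2 v* g = t *s v2"
   thus False using parabolic_unique_line[OF p] d by blast
  next
   fix s t assume st: "s * t = -1" "v1 v* g = s *s v2" "v2 v* g = t *s v1"
   have "(s * t) *s v1 = (trace g * s) *s v2 - v1"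
    using row_cayley_hamilton[of v1 g] in_SL2R[OF that] st(2,3)
    by (simp add: scale_row_mult SL2R_def)
   with st(1) have "(trace g * s) *s v2 = 0" by (simp add: vec_eq_iff forall_2)
   with nz have "trace g * s = 0" by (auto simp: vec_eq_iff forall_2)
   with st(1) have "trace g = 0" by auto
   with p show False by (simp add: parabolic_def)
  qed
 qed
 hence nocusp: "cusps \<Gamma> = {}" by (auto simp: cusps_def)
 define q where "q z = cmod (linfac v1 z) * cmod (linfac v2 z) / Im z" for z
 have inv: "q (mobius g z) = q z" if g: "g : \<Gamma>" "z : uhp" for g z
 proof -
  have j: "jfac g z ~= 0" using jfac_nonzero in_SL2R g by blast
  have "q (mobius g z) = cmod (linfac (v1 v* g) z) * cmod (linfac (v2 v* g) z) / Im z"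
   using j by (simp add: q_def linfac_mobius Im_mobius[OF in_SL2R[OF g(1)] g(2)] norm_divide
     power2_eq_square)
  also have "\<dots> = q z" using scale[OF g(1)]
  proof (elim disjE exE conjE)
   fix s t :: real assume "s * t = 1" "v1 v* g = s *s v1" "v2 v* g = t *s v2"
   moreover hence "\<bar>s\<bar> * \<bar>t\<bar> = 1" by (metis abs_mult abs_one)
   ultimately show ?thesis by (simp add: linfac_scale norm_mult q_def)
  next
   fix s t :: real assume "s * t = -1" "v1 v* g = s *s v2" "v2 v* g = t *s v1"
   moreover hence "\<bar>s\<bar> * \<bar>t\<bar> = 1" by (metis abs_mult abs_one abs_minus_cancel)
   ultimately show ?thesis by (simp add: linfac_scale norm_mult q_def mult.commute mult.left_commute)
  qed
  finally show ?thesis .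
 qed
 have cont: "continuous_on uhp q" unfolding q_def
  by (intro continuous_intros cont_linfac) (auto simp: uhp_def)
 have "EX n::nat. {z\<in>uhp. q z < real n} = uhp"
 proof (rule exhaustion)
  fix n show "open {z\<in>uhp. q z < real n} & {z\<in>uhp. q z < real n} <= uhp & invariant {z\<in>uhp. q z < real n}"
   using open_sublevel_uhp[OF cont] inv mobius_in by (auto simp: invariant_def)
  show "{z\<in>uhp. q z < real n} <= {z\<in>uhp. q z < real (Suc n)}" by auto
 next
  fix z assume "z : uhp" thus "EX n. z : {z\<in>uhp. q z < real n}" using reals_Archimedean2 by auto
 qed (use nocusp in simp)
 then obtain n where n: "!!z. z : uhp ==> q z < real n" by blast
 obtain x where x: "v1$1 * x + v1$2 ~= 0" "v2$1 * x + v2$2 ~= 0" using exists_real_nz nz by blast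
 define D where "D = \<bar>v1$1 * x + v1$2\<bar> * \<bar>v2$1 * x + v2$2\<bar>"
 define y where "y = D / (real n + 1)"
 have D: "D > 0" "y > 0" using x by (simp_all add: D_def y_def)
 have "real n + 1 = D / y" using D by (simp add: y_def)
 also have "\<dots> <= q (Complex x y)"
  unfolding q_def D_def using D by (auto intro!: divide_right_mono mult_mono linfac_lower)
 also have "\<dots> < real n" using n D by (simp add: uhp_def)
 finally show False by simp
qed

text \<open>A fixed line corresponds to a boundary point. If all eigenvalues are
\<open>\<plusminus>1\<close>, the height measured from that point is invariant and tends to infinity only at
the cusp itself, so by compactness it would be bounded away from zero. Otherwise there is an element with
eigenvalue of modulus different from one: conjugating a parabolic element by its powers contradicts
discreteness, and without parabolic elements all commutators are trivial, so that a second line is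
fixed.\<close>

lemma no_invariant_line:
 assumes nz: "v ~= 0" and line: "!!g. g : \<Gamma> ==> det_rows v (v v* g) = 0"
 shows False
proof -
 have "EX t. ALL g:\<Gamma>. v v* g = t g *s v"
  using det_rows_parallel[OF line nz] by metis
 then obtain t where t: "!!g. g : \<Gamma> ==> v v* g = t g *s v" by blast
 have t0: "t g ~= 0" if "g : \<Gamma>" for g using eigenvalue_eq(2) nz t in_SL2R that by blast
 have tmul: "t (g ** h) = t g * t h" if "g : \<Gamma>" "h : \<Gamma>" for g h
 proof -
  have "t (g ** h) *s v = (t g * t h) *s v"
   unfolding t[OF mult_in[OF that], symmetric] vector_matrix_mul_assoc[symmetric] t[OF that(1)]
    scale_row_mult t[OF that(2)] by simp
  thus ?thesis using smult_row_cancel[OF nz] by blast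
 qed
 have t1: "t (mat 1) = 1"
 proof -
  have "t (mat 1) *s v = 1 *s v" using t[OF one_in] by simp
  thus ?thesis by (rule smult_row_cancel[OF nz])
 qed
 have tinv: "t (matrix_inv g) = 1 / t g" if "g : \<Gamma>" for g
  using tmul[OF that inv_in[OF that]] SL2R_inv(1)[OF in_SL2R[OF that]] t1 t0[OF that]
  by (simp add: field_simps)
 show False
 proof (cases "ALL g:\<Gamma>. (t g)\<^sup>2 = 1")
  case True
  define H where "H z = Im z / (cmod (linfac v z))\<^sup>2" for z
  have inv: "H (mobius g z) = H z" if g: "g : \<Gamma>" "z : uhp" for g z
  proof -
   have j: "jfac g z ~= 0" using jfac_nonzero in_SL2R g by blast
   have "H (mobius g z) = Im z / (cmod (linfac (v v* g) z))\<^sup>2"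
    using j by (simp add: H_def linfac_mobius Im_mobius[OF in_SL2R[OF g(1)] g(2)] norm_divide
      power_divide)
   thus ?thesis using t[OF g(1)] True g(1)
    by (simp add: linfac_scale norm_mult H_def power_mult_distrib)
  qed
  have cont: "continuous_on uhp H" unfolding H_def
   by (intro continuous_intros cont_linfac) (use linfac_nz nz in auto)
  have "EX n::nat. {z\<in>uhp. 1 / real (Suc n) < H z} = uhp"
  proof (rule exhaustion)
   fix n show "open {z\<in>uhp. 1 / real (Suc n) < H z} & {z\<in>uhp. 1 / real (Suc n) < H z} <= uhp & invariant {z\<in>uhp. 1 / real (Suc n) < H z}"
    using open_sublevel_uhp[OF cont] inv mobius_in by (auto simp: invariant_def)
   have "1 / real (Suc (Suc n)) <= 1 / real (Suc n)" by (simp add: frac_le)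
   thus "{z\<in>uhp. 1 / real (Suc n) < H z} <= {z\<in>uhp. 1 / real (Suc (Suc n)) < H z}" by auto
  next
   fix z assume z: "z : uhp"
   hence "H z > 0" using linfac_nz[OF nz z] by (simp add: H_def uhp_def)
   thus "EX n. z : {z\<in>uhp. 1 / real (Suc n) < H z}" using z nat_approx_posE by (metis (no_types, lifting) mem_Collect_eq)
  next
   fix s assume "s : cusps \<Gamma>"
   then obtain g where g: "g : \<Gamma>" "parabolic g" "bdry_mobius g s = s" by (auto simp: cusps_def)
   have "near_cusp {z\<in>uhp. 1 / real (Suc 0) < H z} s" unfolding near_cusp_def
   proof (intro ballI impI)
    fix q assume q: "q : SL2R" "bdry_mobius q None = s"
    define u where "u = axis 2 1 v* matrix_inv q"
    have e2: "w = (w$2) *s axis 2 1" if "w$1 = 0" for w :: "real^2"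
     using that by (simp add: vec_eq_iff forall_2 axis_def)
    have "(matrix_inv q ** (g ** q))$2$1 = 0"
     using stabilizer_triangular[OF q(1) SL2R_mult[OF in_SL2R[OF g(1)] q(1)]] g q
     by (simp add: bdry_mobius_mult)
    moreover have "axis 2 1 v* k = k$2" for k :: "real^2^2"
     by (simp add: vec_eq_iff row2_mult_nth axis_def)
    ultimately have "EX r. axis 2 1 v* (matrix_inv q ** (g ** q)) = r *s axis 2 1"
     using e2 by metis
    then obtain r where r: "axis 2 1 v* (matrix_inv q ** (g ** q)) = r *s axis 2 1" by blast
    have "u v* g = (axis 2 1 v* (matrix_inv q ** (g ** q))) v* matrix_inv q"
     by (simp add: u_def vector_matrix_mul_assoc matrix_mul_assoc[symmetric] SL2R_inv[OF q(1)])
    also have "\<dots> = r *s u" unfolding r u_def by (simp add: scale_row_mult)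
    finally have "det_rows v u = 0" using parabolic_unique_line[OF g(2) t[OF g(1)]] by blast
    then obtain b where b: "u = b *s v" using det_rows_parallel nz by blast
    have "u v* q = axis 2 1" by (simp add: u_def vector_matrix_mul_assoc SL2R_inv[OF q(1)])
    with b have bv: "b *s (v v* q) = axis 2 1" by (simp add: scale_row_mult)
    hence b0: "b ~= 0" "(v v* q)$1 = 0" by (auto simp: vec_eq_iff forall_2 axis_def)
    define c where "c = (v v* q)$2"
    have c: "c ~= 0" using bv by (auto simp: vec_eq_iff forall_2 axis_def c_def)
    show "EX Y>0. ALL z. Y < Im z --> mobius q z : {z\<in>uhp. 1 / real (Suc 0) < H z}"
    proof (intro exI[of _ "c\<^sup>2"] conjI allI impI)
     show "0 < c\<^sup>2" using c by simp
     fix z assume z: "c\<^sup>2 < Im z"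
     hence zu: "z : uhp" using c by (simp add: uhp_def) (meson less_trans zero_less_power2)
     have "H (mobius q z) = Im z / (cmod (linfac (v v* q) z))\<^sup>2"
      using jfac_nonzero[OF q(1) zu]
      by (simp add: H_def linfac_mobius Im_mobius[OF q(1) zu] norm_divide power_divide)
     also have "\<dots> = Im z / c\<^sup>2" using b0 by (simp add: linfac_def c_def)
     also have "\<dots> > 1" using z c by (simp add: less_divide_eq)
     finally have "H (mobius q z) > 1" .
     thus "mobius q z : {z\<in>uhp. 1 / real (Suc 0) < H z}" using mobius_uhp[OF q(1) zu] by simp
    qed
   qed
   thus "EX n. near_cusp {z\<in>uhp. 1 / real (Suc n) < H z} s" by blast
  qed
  then obtain n where n: "!!z. z : uhp ==> 1 / real (Suc n) < H z" by blast
  obtain x where x: "v$1 * x + v$2 ~= 0" using exists_real_nz nz by blast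
  define D where "D = (v$1 * x + v$2)\<^sup>2"
  define y where "y = D / real (Suc n)"
  have D: "D > 0" "y > 0" using x by (simp_all add: D_def y_def)
  have "D <= (cmod (linfac v (Complex x y)))\<^sup>2"
   unfolding D_def using linfac_lower[of v x y] by (metis abs_ge_zero power2_abs power_mono)
  hence "H (Complex x y) <= y / D" unfolding H_def using D by (simp add: frac_le)
  also have "\<dots> = 1 / real (Suc n)" using D by (simp add: y_def)
  finally show False using n[of "Complex x y"] D by (simp add: uhp_def)
 next
  case False
  then obtain h0 where h0: "h0 : \<Gamma>" "(t h0)\<^sup>2 ~= 1" by blast
  have "EX h:\<Gamma>. 1 < (t h)\<^sup>2"
  proof (cases "1 < (t h0)\<^sup>2")
   case True with h0 show ?thesis by blast
  next
   case False
   with h0 t0[OF h0(1)] have "1 < (t (matrix_inv h0))\<^sup>2"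
    by (simp add: tinv power_divide)
   thus ?thesis using inv_in[OF h0(1)] by blast
  qed
  then obtain h where h: "h : \<Gamma>" "1 < (t h)\<^sup>2" by blast
  define T where "T = t h"
  have T: "T ~= 0" "1 < T\<^sup>2" "v v* h = T *s v" "v v* matrix_inv h = (1/T) *s v"
   using t0 h t tinv inv_in by (simp_all add: T_def)
  define x where "x = (vector [v$2, - v$1] :: real^2)"
  have xv: "det_rows x v = (v$1)\<^sup>2 + (v$2)\<^sup>2" by (simp add: x_def det_rows_def power2_eq_square)
  have xv0: "det_rows x v > 0"
   using nz unfolding xv by (auto simp: vec_eq_iff forall_2 sum_power2_gt_zero_iff)
  have dec: "EX r. x v* g = (1 / t g) *s x + r *s v" if "g : \<Gamma>" for g
  proof -
   have "det_rows (x v* g) (v v* g) = det_rows x v"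
    using det_rows_mult[of x g v] in_SL2R[OF that] by (simp add: SL2R_def)
   hence "t g * det_rows (x v* g) v = det_rows x v"
    unfolding t[OF that] by (simp add: det_rows_def algebra_simps)
   hence "det_rows (x v* g) v = 1 / t g * det_rows x v" using t0[OF that] by (simp add: field_simps)
   moreover have "det_rows v (x v* g - (1 / t g) *s x) = - det_rows (x v* g) v + 1 / t g * det_rows x v"
    by (simp add: det_rows_def algebra_simps)
   ultimately have "det_rows v (x v* g - (1 / t g) *s x) = 0" by simp
   from det_rows_parallel[OF this nz] show ?thesis by (metis add.commute diff_add_cancel)
  qed
  obtain \<beta> where \<beta>: "x v* h = (1/T) *s x + \<beta> *s v" using dec[OF h(1)] by (auto simp: T_def)
  show False
  proof (cases "EX u:\<Gamma>. parabolic u")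
   case True
   then obtain u0 where u0: "u0 : \<Gamma>" "parabolic u0" by blast
   have "t u0 * t u0 = 1" using parabolic_eigenvalue(2)[OF u0(2) nz t[OF u0(1)]] .
   hence "t u0 = 1 \<or> t u0 = -1" by (simp add: square_eq_1_iff)
   moreover have "- u0 : \<Gamma>" using mult_in[OF u0(1) minus_one_in]
    by (simp add: mult_minus_one)
   moreover have "u0 ~= mat 1" "- u0 ~= mat 1" using u0(2) minus_equation_iff[of u0 "mat 1"]
    by (auto simp: parabolic_def)
   ultimately have "EX u:\<Gamma>. v v* u = v & u ~= mat 1"
    using u0(1) t[OF u0(1)] row_mult_minus[of v u0] by (metis add.inverse_inverse vector_smult_lid vector_smult_lneg)
   then obtain u where u: "u : \<Gamma>" "v v* u = v" "u ~= mat 1" by blast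
   have "t u *s v = 1 *s v" using t[OF u(1)] u(2) by simp
   hence tu: "t u = 1" by (rule smult_row_cancel[OF nz])
   obtain \<alpha> where \<alpha>: "x v* u = x + \<alpha> *s v" using dec[OF u(1)] tu by auto
   have "\<alpha> ~= 0"
    using \<alpha> u mat2_eq_on_basis[of x v u "mat 1"] xv0 by auto
   define P where "P r \<longleftrightarrow> (EX k:\<Gamma>. v v* k = v & x v* k = x + r *s v)" for r
   have P0: "P \<alpha>" using \<alpha> u by (auto simp: P_def)
   have Pc: "P (r / T\<^sup>2)" if "P r" for r
   proof -
    obtain k where k: "k : \<Gamma>" "v v* k = v" "x v* k = x + r *s v" using \<open>P r\<close> by (auto simp: P_def)
    define k' where "k' = h ** (k ** matrix_inv h)"
    have "k' : \<Gamma>" using h k mult_in inv_in by (simp add: k'_def)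
    moreover have "v v* k' = v"
     using T k by (simp add: k'_def vector_matrix_mul_assoc[symmetric] scale_row_mult)
    moreover have "x v* k' = x + (r / T\<^sup>2) *s v"
    proof -
     have "x v* h v* k = x v* h + (r / T) *s v"
      unfolding \<beta> using k by (simp add: vector_matrix_left_distrib scale_row_mult)
     moreover have "x v* k' = (x v* h v* k) v* matrix_inv h"
      by (simp add: k'_def vector_matrix_mul_assoc matrix_mul_assoc)
     moreover have "(x v* h) v* matrix_inv h = x"
      by (simp add: vector_matrix_mul_assoc SL2R_inv in_SL2R h)
     ultimately show ?thesis using T
      by (simp add: vector_matrix_left_distrib scale_row_mult power2_eq_square)
    qed
    ultimately show ?thesis by (auto simp: P_def)
   qed
   have Pn: "P (\<alpha> / (T\<^sup>2) ^ n)" for n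
   proof (induction n)
    case (Suc n)
    have "\<alpha> / (T\<^sup>2) ^ Suc n = \<alpha> / (T\<^sup>2) ^ n / T\<^sup>2" by (simp add: mult.commute)
    thus ?case using Pc[OF Suc.IH] by (simp add: mult.commute)
   qed (use P0 in simp)
   obtain e where e: "e > 0" "ALL g:\<Gamma>. (ALL i j. \<bar>g$i$j - mat 1$i$j\<bar> < e) --> g = mat 1"
    using discrete_at_one by blast
   obtain n where n: "\<bar>\<alpha>\<bar> / e < (T\<^sup>2) ^ n" using real_arch_pow[OF T(2)] by blast
   define r where "r = \<alpha> / (T\<^sup>2) ^ n"
   have r: "\<bar>r\<bar> < e" "r ~= 0" using n e(1) T \<open>\<alpha> ~= 0\<close> by (simp_all add: r_def field_simps abs_mult)
   obtain k where k: "k : \<Gamma>" "v v* k = v" "x v* k = x + r *s v" using Pn[of n] by (auto simp: P_def r_def)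
   define E where "E = k - mat 1"
   have E: "w v* E = w v* k - w" for w
   proof -
    have "w v* E = w v* k - w v* mat 1"
     by (simp add: vec_eq_iff row2_mult_nth E_def algebra_simps)
    thus ?thesis by simp
   qed
   have "det_rows x v * E$1$j = v$2 * (x v* E)$j - x$2 * (v v* E)$j"
    "det_rows x v * E$2$j = x$1 * (v v* E)$j - v$1 * (x v* E)$j" for j
    by (simp_all add: det_rows_def row2_mult_nth algebra_simps)
   hence Ev: "det_rows x v * E$1$j = v$2 * (r * v$j)" "det_rows x v * E$2$j = - v$1 * (r * v$j)" for j
    unfolding E k(2,3) by simp_all
   have "\<bar>det_rows x v * E$i$j\<bar> <= \<bar>r\<bar> * det_rows x v" for i j
   proof -
    have a: "\<bar>a * b\<bar> <= a\<^sup>2 + b\<^sup>2" for a b :: real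
    proof -
     have "2 * \<bar>a\<bar> * \<bar>b\<bar> <= \<bar>a\<bar>\<^sup>2 + \<bar>b\<bar>\<^sup>2" by (rule sum_squares_bound)
     moreover have "0 <= \<bar>a\<bar> * \<bar>b\<bar>" by simp
     ultimately show ?thesis unfolding abs_mult power2_abs by linarith
    qed
    have "\<bar>v$1 * v$j\<bar> <= det_rows x v" "\<bar>v$2 * v$j\<bar> <= det_rows x v"
     using a[of "v$1" "v$2"] exhaust_2[of j] unfolding xv
     by (auto simp: power2_eq_square mult.commute)
    hence "\<bar>r\<bar> * \<bar>v$1 * v$j\<bar> <= \<bar>r\<bar> * det_rows x v" "\<bar>r\<bar> * \<bar>v$2 * v$j\<bar> <= \<bar>r\<bar> * det_rows x v"
     by (auto intro: mult_left_mono)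
    moreover have "\<bar>det_rows x v * E$1$j\<bar> = \<bar>r\<bar> * \<bar>v$2 * v$j\<bar>"
     "\<bar>det_rows x v * E$2$j\<bar> = \<bar>r\<bar> * \<bar>v$1 * v$j\<bar>"
     unfolding Ev by (simp_all add: abs_mult mult_ac)
    ultimately show ?thesis using exhaust_2[of i] by metis
   qed
   hence "det_rows x v * \<bar>E$i$j\<bar> <= det_rows x v * \<bar>r\<bar>" for i j
    using xv0 unfolding abs_mult by (simp add: mult.commute)
   hence "\<bar>E$i$j\<bar> <= \<bar>r\<bar>" for i j
    using xv0 by (meson mult_le_cancel_left_pos)
   hence "ALL i j. \<bar>k$i$j - mat 1$i$j\<bar> < e" using r(1) by (simp add: E_def) (meson le_less_trans)
   hence "k = mat 1" using e(2) k(1) by blast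
   hence "r *s v = 0" using k(3) by simp
   with r nz show False by simp
  next
   case False
   have comm: "g ** h = h ** g" if g: "g : \<Gamma>" for g
   proof -
    define k where "k = g ** h ** (matrix_inv g ** matrix_inv h)"
    have k: "k : \<Gamma>" using g h by (simp add: k_def mult_in inv_in)
    have "t k = 1" using g h t0 by (simp add: k_def tmul tinv mult_in inv_in)
    hence "trace k = 2" using eigenvalue_eq(1)[OF in_SL2R[OF k] nz t[OF k]] by simp
    moreover have "k ~= - mat 1" using calculation by (auto simp: trace_2 mat_def)
    ultimately have "k = mat 1" using False k in_SL2R by (auto simp: parabolic_def)
    hence "k ** (h ** g) = h ** g" by simp
    moreover have "k ** (h ** g) = g ** h"
     unfolding k_def using SL2R_inv[OF in_SL2R[OF g]] SL2R_inv[OF in_SL2R[OF h(1)]]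
     by (metis matrix_mul_assoc matrix_mul_rid)
    ultimately show ?thesis by simp
   qed
   define w where "w = x + (\<beta> / (1/T - T)) *s v"
   have TT: "1/T - T ~= 0" using T by (auto simp: field_simps power2_eq_square)
   have "w v* h = (1/T) *s x + \<beta> *s v + (\<beta> / (1/T - T) * T) *s v"
    unfolding w_def by (simp add: vector_matrix_left_distrib scale_row_mult \<beta> T)
   also have "\<dots> = (1/T) *s x + (\<beta> + \<beta> / (1/T - T) * T) *s v"
    by (simp add: vec_eq_iff algebra_simps)
   also have "\<beta> + \<beta> / (1/T - T) * T = 1/T * (\<beta> / (1/T - T))"
   proof -
    define b where "b = \<beta> / (1/T - T)"
    have "(1/T - T) * b = \<beta>" using TT by (simp add: b_def)
    hence "\<beta> = 1/T * b - T * b" by (simp only: left_diff_distrib)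
    thus ?thesis unfolding b_def[symmetric] by (simp add: mult.commute)
   qed
   also have "(1/T) *s x + (1/T * (\<beta> / (1/T - T))) *s v = (1/T) *s w"
    by (simp add: w_def vec_eq_iff algebra_simps)
   finally have wh: "w v* h = (1/T) *s w" .
   have vw: "det_rows v w ~= 0" using xv0 by (simp add: w_def det_rows_def algebra_simps)
   have "det_rows w (w v* g) = 0" if g: "g : \<Gamma>" for g
   proof -
    have "(w v* g) v* h = (1/T) *s (w v* g)"
     using comm[OF g] wh by (metis vector_matrix_mul_assoc scale_row_mult)
    hence "det_rows w (w v* g) = (1/T) * (1/T) * det_rows w (w v* g)"
     using det_rows_mult[of w h "w v* g"] in_SL2R[OF h(1)] wh by (simp add: det_rows_scale SL2R_def)
    hence "(T\<^sup>2 - 1) * det_rows w (w v* g) = 0" using T(1) by (simp add: field_simps power2_eq_square)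
    thus ?thesis using T(2) by simp
   qed
   thus False using no_two_lines[OF vw] line by blast
  qed
 qed
qed

lemma infinite_group_if_parabolic:
 assumes "g : \<Gamma>" "parabolic g" shows "infinite \<Gamma>"
proof -
 define \<epsilon> where "\<epsilon> = trace g / 2"
 have \<epsilon>: "\<epsilon> * \<epsilon> = 1" "trace g = 2 * \<epsilon>" using assms(2) by (auto simp: \<epsilon>_def parabolic_def power2_eq_square)
 have "EX x. x v* g ~= \<epsilon> *s x"
 proof (rule ccontr)
  assume *: "\<nexists>x. x v* g ~= \<epsilon> *s x"
  have "det_rows (vector [1,0]) (vector [0,1]) ~= 0" by (simp add: det_rows_def)
  from scalar_on_basis[OF _ this, of g \<epsilon>] * assms show False by (auto simp: parabolic_def)
 qed
 then obtain x where x: "x v* g ~= \<epsilon> *s x" by blast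
 define v where "v = x v* g - \<epsilon> *s x"
 have v: "v ~= 0" "x v* g = \<epsilon> *s x + v" using x by (auto simp: v_def)
 have vg: "v v* g = \<epsilon> *s v"
  using row_cayley_hamilton[of x g] assms \<epsilon> unfolding v_def
  by (simp add: vector_matrix_mult_diff_distrib scale_row_mult SL2R_def parabolic_def vec_eq_iff forall_2 algebra_simps)
 define k where "k = g ** g"
 have "v v* k = (\<epsilon> * \<epsilon>) *s v" by (simp add: k_def vector_matrix_mul_assoc[symmetric] vg scale_row_mult)
 hence vk: "v v* k = v" using \<epsilon> by simp
 have "x v* k = (\<epsilon> * \<epsilon>) *s x + (2 * \<epsilon>) *s v"
  unfolding k_def vector_matrix_mul_assoc[symmetric] v(2)
  by (simp add: vector_matrix_left_distrib scale_row_mult v(2) vg vec_eq_iff algebra_simps)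
 hence xk: "x v* k = x + (2 * \<epsilon>) *s v" using \<epsilon> by simp
 define p where "p n = ((%m. m ** k) ^^ n) (mat 1)" for n
 have p: "p n : \<Gamma>" "x v* p n = x + (real n * (2 * \<epsilon>)) *s v" for n
 proof (induction n)
  case (Suc n)
  case 1 show ?case using Suc(1) assms(1) by (simp add: p_def k_def mult_in)
  case 2 show ?case using Suc(2) xk vk
   by (simp add: p_def vector_matrix_mul_assoc[symmetric] vector_matrix_left_distrib scale_row_mult)
    (simp add: vec_eq_iff algebra_simps)
 qed (use one_in in \<open>simp_all add: p_def\<close>)
 have "inj p"
 proof (rule injI)
  fix m n assume "p m = p n"
  hence "(real m * (2 * \<epsilon>)) *s v = (real n * (2 * \<epsilon>)) *s v" using p(2)[of m] p(2)[of n] by (metis add_left_cancel)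
  hence "real m * (2 * \<epsilon>) = real n * (2 * \<epsilon>)" by (rule smult_row_cancel[OF v(1)])
  with \<epsilon>(1) show "m = n" by auto
 qed
 thus ?thesis using p(1) by (metis finite_subset image_subsetI infinite_UNIV_nat finite_imageD)
qed

lemma infinite_group: "infinite \<Gamma>"
proof
 assume fin: "finite \<Gamma>"
 hence nocusp: "cusps \<Gamma> = {}" using infinite_group_if_parabolic by (auto simp: cusps_def)
 define A where "A n = {z\<in>uhp. ALL g:\<Gamma>. 1 / real (Suc n) < Im (mobius g z)}" for n
 have "EX n. A n = uhp"
 proof (rule exhaustion)
  fix n
  have "A n = uhp \<inter> (\<Inter>g\<in>\<Gamma>. {z\<in>uhp. 1 / real (Suc n) < Im (mobius g z)})"
   using one_in by (auto simp: A_def)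
  moreover have "open {z\<in>uhp. 1 / real (Suc n) < Im (mobius g z)}" if "g : \<Gamma>" for g
   by (intro open_sublevel_uhp continuous_intros cont_mobius in_SL2R that)
  ultimately have "open (A n)" using fin open_uhp by (auto intro!: open_Int open_INT)
  moreover have "invariant (A n)" unfolding invariant_def A_def
  proof (intro ballI CollectI conjI; elim CollectE conjE)
   fix g z h assume *: "g : \<Gamma>" "h : \<Gamma>" "z : uhp" "ALL g:\<Gamma>. 1 / real (Suc n) < Im (mobius g z)"
   hence "1 / real (Suc n) < Im (mobius (h ** g) z)" using mult_in by blast
   with * show "1 / real (Suc n) < Im (mobius h (mobius g z))" by (simp add: mobius_mult in_SL2R)
  qed (simp add: mobius_in)
  ultimately show "open (A n) & A n <= uhp & invariant (A n)" by (auto simp: A_def)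
  have "1 / real (Suc (Suc n)) <= 1 / real (Suc n)" by (simp add: frac_le)
  thus "A n <= A (Suc n)" unfolding A_def by fastforce
 next
  fix z assume z: "z : uhp"
  define m where "m = Min ((%g. Im (mobius g z)) ` \<Gamma>)"
  have "m : (%g. Im (mobius g z)) ` \<Gamma>" unfolding m_def using fin one_in by (intro Min_in) auto
  hence "m > 0" using mobius_in[OF _ z] by (auto simp: uhp_def)
  then obtain n where n: "1 / real (Suc n) < m" using nat_approx_posE by blast
  have "m <= Im (mobius g z)" if "g : \<Gamma>" for g using fin that by (simp add: m_def)
  with n have "ALL g:\<Gamma>. 1 / real (Suc n) < Im (mobius g z)" by (meson less_le_trans)
  with z show "EX n. z : A n" unfolding A_def by blast
 qed (use nocusp in simp)
 then obtain n where "A n = uhp" by blast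
 moreover have "Complex 0 (1 / real (Suc n)) : uhp" by (simp add: uhp_def)
 ultimately have "1 / real (Suc n) < Im (mobius (mat 1) (Complex 0 (1 / real (Suc n))))"
  using one_in unfolding A_def by blast
 thus False by simp
qed

text \<open>Reduction of a finite orbit of lines to the cases of one and of two lines: an element that fixes
three lines is \<open>\<plusminus>1\<close>, and the group is infinite.\<close>

lemma no_finite_line_orbit:
 assumes nz: "v ~= 0" and fin: "finite B" and lines: "!!g. g : \<Gamma> ==> EX b:B. EX t. v v* g = t *s b"
 shows False
proof -
 obtain g2 where g2: "g2 : \<Gamma>" "det_rows v (v v* g2) ~= 0" using no_invariant_line[OF nz] by blast
 define v2 where "v2 = v v* g2"
 have inv: "det_rows (u v* g) (w v* g) = det_rows u w" if "g : \<Gamma>" for u w g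
  using det_rows_mult[of u g w] in_SL2R[OF that] by (simp add: SL2R_def)
 have trans: "det_rows a c = 0" if "det_rows b a = 0" "det_rows b c = 0" "b ~= 0" for a b c
  using det_rows_parallel[OF that(1,3)] det_rows_parallel[OF that(2,3)] det_rows_scale det_rows_self(1)
  by (metis mult_zero_right)
 have nz2: "v2 ~= 0" using row_mult_nz in_SL2R g2 nz by (simp add: v2_def)
 have d12: "det_rows v v2 ~= 0" using g2 by (simp add: v2_def)
 have "EX g3:\<Gamma>. det_rows v (v v* g3) ~= 0 & det_rows v2 (v v* g3) ~= 0"
 proof (rule ccontr)
  assume "~ ?thesis"
  hence *: "det_rows v (v v* g) = 0 \<or> det_rows v2 (v v* g) = 0" if "g : \<Gamma>" for g using that by blast
  show False
  proof (rule no_two_lines[OF d12])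
   fix g assume g: "g : \<Gamma>"
   have "v2 v* g = v v* (g2 ** g)" by (simp add: v2_def vector_matrix_mul_assoc)
   with *[OF g] *[OF mult_in[OF g2(1) g]] inv[OF g, of v v2] d12 trans nz nz2
   show "det_rows v (v v* g) = 0 & det_rows v2 (v2 v* g) = 0 \<or>
     det_rows v2 (v v* g) = 0 & det_rows v (v2 v* g) = 0" by metis
  qed
 qed
 then obtain g3 where g3: "g3 : \<Gamma>" "det_rows v (v v* g3) ~= 0" "det_rows v2 (v v* g3) ~= 0" by blast
 define v3 where "v3 = v v* g3"
 have d: "det_rows v v3 ~= 0" "det_rows v2 v3 ~= 0" using g3 by (simp_all add: v3_def)
 have "EX b t. ALL g:\<Gamma>. b g : B & v v* g = t g *s b g" using lines by metis
 then obtain b t where bt: "!!g. g : \<Gamma> ==> b g : B" "!!g. g : \<Gamma> ==> v v* g = t g *s b g" by blast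
 define f where "f g = (b g, b (g2 ** g), b (g3 ** g))" for g
 have "f ` \<Gamma> <= B \<times> B \<times> B" using bt(1) mult_in g2 g3 by (auto simp: f_def)
 hence "finite (f ` \<Gamma>)" using fin finite_subset by blast
 then obtain g where g: "g : \<Gamma>" and y: "infinite {h\<in>\<Gamma>. f h = f g}"
  using pigeonhole_infinite[OF infinite_group] by blast
 have "{h\<in>\<Gamma>. f h = f g} <= {g, - g}"
 proof
  fix h assume "h : {h\<in>\<Gamma>. f h = f g}"
  hence h: "h : \<Gamma>" "f h = f g" by auto
  define k where "k = h ** matrix_inv g"
  have k: "k : \<Gamma>" using h g by (simp add: k_def mult_in inv_in)
  have "EX s. (v v* a) v* k = s *s (v v* a)" if "a : \<Gamma>" "b (a ** h) = b (a ** g)" for a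
  proof -
   have i: "(v v* (a ** g)) v* matrix_inv g = v v* a"
    by (simp add: vector_matrix_mul_assoc matrix_mul_assoc[symmetric] SL2R_inv[OF in_SL2R[OF g]])
   have "v v* (a ** g) ~= 0" using row_mult_nz in_SL2R mult_in that g nz by blast
   hence tn: "t (a ** g) ~= 0" using bt(2)[OF mult_in[OF that(1) g]] by auto
   have "v v* (a ** h) = (t (a ** h) / t (a ** g)) *s (v v* (a ** g))"
    using bt(2)[OF mult_in[OF that(1) g]] bt(2)[OF mult_in[OF that(1) h(1)]] that(2) tn by simp
   moreover have "(v v* a) v* k = (v v* (a ** h)) v* matrix_inv g"
    by (simp add: k_def vector_matrix_mul_assoc matrix_mul_assoc)
   ultimately show ?thesis using i by (auto simp: scale_row_mult)
  qed
  from this[of "mat 1"] this[of g2] this[of g3] one_in g2(1) g3(1) h(2)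
  obtain s1 s2 s3 where s: "v v* k = s1 *s v" "v2 v* k = s2 *s v2" "v3 v* k = s3 *s v3"
   by (auto simp: f_def v2_def v3_def)
  have "s1 * s2 = 1" "s1 * s3 = 1" "s2 * s3 = 1"
   using inv[OF k, of v v2] inv[OF k, of v v3] inv[OF k, of v2 v3] s d d12
   by (simp_all add: det_rows_scale)
  hence "s1 = s2" by (metis mult.commute mult.left_commute mult.right_neutral)
  hence "k = mat 1 \<or> k = - mat 1" using scalar_on_basis[OF in_SL2R[OF k] d12] s by blast
  moreover have "k ** g = h" by (simp add: k_def matrix_mul_assoc[symmetric] SL2R_inv in_SL2R g)
  moreover have "- mat 1 ** g = - g" by (rule mat2_eqI) (simp_all add: mat2_mult_nth mat_def)
  ultimately show "h : {g, - g}" by auto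
 qed
 thus False using y finite_subset by blast
qed

text \<open>If the bottom rows were bounded, multiplication by an element with nonzero lower left entry
would bound all entries, and a discrete group with bounded entries is finite.\<close>

lemma rows_unbounded: "EX g:\<Gamma>. R < norm (g$2)"
proof (rule ccontr)
 assume "~ ?thesis"
 hence R: "norm (g$2) <= R" if "g : \<Gamma>" for g using that by force
 have e2: "axis 2 1 v* g = g$2" for g :: "real^2^2"
  by (simp add: vec_eq_iff row2_mult_nth axis_def)
 have e20: "(axis 2 1 :: real^2) ~= 0" by (simp add: vec_eq_iff forall_2 axis_def)
 obtain g0 where g0: "g0 : \<Gamma>" "g0$2$1 ~= 0"
  using no_invariant_line[OF e20] unfolding e2 by (auto simp: det_rows_def axis_def)
 have ent: "\<bar>g$i$j\<bar> <= R + (R + \<bar>g0$2$2\<bar> * R) / \<bar>g0$2$1\<bar>" if "g : \<Gamma>" for g i j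
 proof -
  have a: "\<bar>g$2$j\<bar> <= R" using R[OF that] component_le_norm_cart[of "g$2" j] by simp
  hence R0: "R >= 0" by linarith
  have b: "\<bar>(g0 ** g)$2$j\<bar> <= R"
   using R[OF mult_in[OF g0(1) that]] component_le_norm_cart[of "(g0 ** g)$2" j] by simp
  have "\<bar>g0$2$1\<bar> * \<bar>g$1$j\<bar> = \<bar>(g0 ** g)$2$j - g0$2$2 * g$2$j\<bar>"
   by (simp add: mat2_mult_nth abs_mult)
  also have "\<dots> <= R + \<bar>g0$2$2\<bar> * R"
   using b mult_left_mono[OF a, of "\<bar>g0$2$2\<bar>"] abs_triangle_ineq4[of "(g0 ** g)$2$j" "g0$2$2 * g$2$j"]
   by (simp add: abs_mult)
  finally have "\<bar>g$1$j\<bar> <= (R + \<bar>g0$2$2\<bar> * R) / \<bar>g0$2$1\<bar>" using g0(2) by (simp add: field_simps)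
  moreover have "0 <= (R + \<bar>g0$2$2\<bar> * R) / \<bar>g0$2$1\<bar>" using R0 by simp
  ultimately show ?thesis using a R0 exhaust_2[of i] by auto
 qed
 define C where "C = R + (R + \<bar>g0$2$2\<bar> * R) / \<bar>g0$2$1\<bar>"
 have C: "\<bar>g$i$j\<bar> <= C" if "g : \<Gamma>" for g i j using ent[OF that] by (simp add: C_def)
 have "bounded \<Gamma>" unfolding bounded_iff
 proof (intro exI[of _ "4 * C"] ballI)
  fix g assume "g : \<Gamma>"
  from C[OF this, of 1 1] C[OF this, of 1 2] C[OF this, of 2 1] C[OF this, of 2 2] norm_mat2_le[of g]
  show "norm g <= 4 * C" by linarith
 qed
 hence "compact (closure \<Gamma>)" by simp
 moreover have "infinite (closure \<Gamma>)" "\<Gamma> <= closure \<Gamma>" using infinite_group closure_subset finite_subset by blast+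
 ultimately obtain g' where g': "g' islimpt \<Gamma>"
  using infinite_group compact_eq_Bolzano_Weierstrass[of "closure \<Gamma>"] by blast
 obtain e where e: "e > 0" "ALL g:\<Gamma>. (ALL i j. \<bar>g$i$j - mat 1$i$j\<bar> < e) --> g = mat 1"
  using discrete_at_one by blast
 have C0: "C >= 0" using C[OF one_in] by (meson abs_ge_zero order_trans)
 define \<delta> where "\<delta> = e / (4 * (C + 1))"
 have \<delta>: "\<delta> > 0" using e C0 by (simp add: \<delta>_def)
 have "infinite (\<Gamma> \<inter> ball g' \<delta>)" using g' \<delta> islimpt_eq_infinite_ball by blast
 hence "\<Gamma> \<inter> ball g' \<delta> ~= {}" by (rule infinite_imp_nonempty)
 then obtain g where g: "g : \<Gamma>" "dist g' g < \<delta>" by auto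
 have "infinite (\<Gamma> \<inter> ball g' \<delta> - {g})" using \<open>infinite (\<Gamma> \<inter> ball g' \<delta>)\<close> by simp
 hence "\<Gamma> \<inter> ball g' \<delta> - {g} ~= {}" by (rule infinite_imp_nonempty)
 then obtain h where "h : \<Gamma> \<inter> ball g' \<delta> - {g}" by blast
 hence h: "h : \<Gamma>" "dist g' h < \<delta>" "h ~= g" by simp_all
 have "dist h g < 2 * \<delta>" using g h dist_triangle2[of h g g'] by (simp add: dist_commute)
 have hg: "\<bar>(h - g)$i$j\<bar> < 2 * \<delta>" for i j
  using \<open>dist h g < 2 * \<delta>\<close> component_le_norm_cart[of "(h - g)$i" j] Finite_Cartesian_Product.norm_nth_le[of "h - g" i]
  by (simp add: dist_norm)
 define k where "k = matrix_inv g ** h"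
 have "k - mat 1 = matrix_inv g ** (h - g)"
  using SL2R_inv(2)[OF in_SL2R[OF g(1)]]
  by (simp add: vec_eq_iff forall_2 k_def mat2_mult_nth algebra_simps)
 hence "\<bar>k$i$j - mat 1$i$j\<bar> < e" for i j
 proof -
  assume "k - mat 1 = matrix_inv g ** (h - g)"
  hence "k$i$j - mat 1$i$j = (matrix_inv g ** (h - g))$i$j" by (metis vector_minus_component)
  also have "\<bar>\<dots>\<bar> <= \<bar>matrix_inv g$i$1\<bar> * \<bar>(h - g)$1$j\<bar> + \<bar>matrix_inv g$i$2\<bar> * \<bar>(h - g)$2$j\<bar>"
   using abs_triangle_ineq[of "matrix_inv g$i$1 * (h - g)$1$j" "matrix_inv g$i$2 * (h - g)$2$j"]
   unfolding mat2_mult_nth abs_mult .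
  also have "\<dots> <= C * (2 * \<delta>) + C * (2 * \<delta>)"
   using hg[of 1 j] hg[of 2 j] C[OF inv_in[OF g(1)]] C0 \<delta> by (intro add_mono mult_mono) auto
  also have "\<dots> < e"
  proof -
   have "4 * (C + 1) * \<delta> = e" using C0 by (simp add: \<delta>_def)
   hence "C * (2 * \<delta>) + C * (2 * \<delta>) + 4 * \<delta> = e" by (simp add: algebra_simps)
   with \<delta> show ?thesis by linarith
  qed
  finally show ?thesis .
 qed
 hence "k = mat 1" using e(2) g h by (simp add: k_def mult_in inv_in)
 hence "h = g" unfolding k_def using SL2R_inv(1)[OF in_SL2R[OF g(1)]]
  by (metis matrix_mul_assoc matrix_mul_lid matrix_mul_rid)
 with h show False by simp
qed

end

section \<open>Linear independence of the automorphy factors\<close>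

lemma det_rows_Xratio:
 assumes "linfac w z ~= 0" "of_real (w$1) / linfac w z = x"
 shows "EX t. w = t *s (if x = 0 then axis 2 1 else vector [1, Re (1 / x - z)])"
proof (cases "x = 0")
 case True
 with assms have "w$1 = 0" by simp
 with True show ?thesis by (intro exI[of _ "w$2"]) (simp add: vec_eq_iff forall_2 axis_def)
next
 case False
 with assms have w1: "w$1 ~= 0" by auto
 have "1 / x - z = of_real (w$2 / w$1)"
  unfolding assms(2)[symmetric] using assms(1) w1 by (simp add: linfac_def field_simps)
 hence "Re (1 / x - z) = w$2 / w$1" by simp
 with False w1 show ?thesis by (intro exI[of _ "w$1"]) (simp add: vec_eq_iff forall_2)
qed

context first_kind
begin

text \<open>Along elements whose bottom rows grow, the highest power of \<open>j\<close> dominates and its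
coefficient polynomial vanishes at every limit value of \<open>X\<close>. Right multiplication by the group
moves such a value to infinitely many others.\<close>

lemma automorphy_independent:
 fixes a :: "int => nat => complex"
 assumes z: "z : uhp" and K: "finite K"
  and zero: "!!g. g : \<Gamma> ==> (\<Sum>k\<in>K. jfac g z powi k * (\<Sum>m\<le>s. a k m * Xfac g z ^ m)) = 0"
  and km: "k : K" "m <= s"
 shows "a k m = 0"
proof (rule ccontr)
 assume "a k m ~= 0"
 define K' where "K' = {k\<in>K. EX m<=s. a k m ~= 0}"
 have K': "finite K'" "K' ~= {}" using K km \<open>a k m ~= 0\<close> by (auto simp: K'_def)
 define k0 where "k0 = Max K'"
 have k0: "k0 : K" "EX m<=s. a k0 m ~= 0" using Max_in[OF K'] by (auto simp: k0_def K'_def)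
 have above: "a l m = 0" if "l : K" "l > k0" "m <= s" for l m
  using that Max_ge[OF K'(1), of l] by (force simp: k0_def K'_def)
 define p where "p l x = (\<Sum>m\<le>s. a l m * x ^ m)" for l and x :: complex
 have cp: "continuous_on UNIV (p l)" for l unfolding p_def by (intro continuous_intros)
 define M where "M = (\<Sum>l\<in>K. \<Sum>m\<le>s. cmod (a l m) * (1 / Im z) ^ m)"
 have main: "cmod (p k0 (Xfac g z)) <= M / cmod (jfac g z)" if g: "g : \<Gamma>" "1 <= cmod (jfac g z)" for g
 proof -
  define J where "J = jfac g z"
  have J: "J ~= 0" "1 <= cmod J" using g by (auto simp: J_def)
  have "J powi k0 * p k0 (Xfac g z) + (\<Sum>l\<in>K - {k0}. J powi l * p l (Xfac g z)) = 0"
   using zero[OF g(1)] unfolding sum.remove[OF K k0(1)] by (simp add: p_def J_def)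
  hence "p k0 (Xfac g z) = - (\<Sum>l\<in>K - {k0}. J powi l * p l (Xfac g z)) / J powi k0"
   using J by (simp add: field_simps add_eq_0_iff2)
  also have "\<dots> = - (\<Sum>l\<in>K - {k0}. J powi (l - k0) * p l (Xfac g z))"
   using J by (simp add: sum_divide_distrib power_int_diff)
  finally have "cmod (p k0 (Xfac g z)) <= (\<Sum>l\<in>K - {k0}. cmod (J powi (l - k0) * p l (Xfac g z)))"
   by (simp add: norm_sum)
  also have "\<dots> <= (\<Sum>l\<in>K - {k0}. (\<Sum>m\<le>s. cmod (a l m) * (1 / Im z) ^ m) / cmod J)"
  proof (rule sum_mono)
   fix l assume l: "l : K - {k0}"
   have pb: "cmod (p l (Xfac g z)) <= (\<Sum>m\<le>s. cmod (a l m) * (1 / Im z) ^ m)"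
    unfolding p_def
    by (rule order_trans[OF norm_sum], rule sum_mono)
     (auto simp: norm_mult norm_power intro!: mult_left_mono power_mono norm_Xfac_le in_SL2R g(1) z)
   show "cmod (J powi (l - k0) * p l (Xfac g z)) <= (\<Sum>m\<le>s. cmod (a l m) * (1 / Im z) ^ m) / cmod J"
   proof (cases "l > k0")
    case True
    hence "p l (Xfac g z) = 0" using above l by (simp add: p_def)
    thus ?thesis using z by (auto simp: uhp_def intro!: divide_nonneg_nonneg sum_nonneg)
   next
    case False
    with l have "l - k0 <= -1" by auto
    hence "cmod J powi (l - k0) <= cmod J powi (-1)"
     using J(2) by (intro power_int_increasing) auto
    hence "cmod (J powi (l - k0)) <= 1 / cmod J"
     by (simp add: norm_power_int power_int_minus field_simps)
    hence "cmod (J powi (l - k0)) * cmod (p l (Xfac g z)) <= 1 / cmod J * (\<Sum>m\<le>s. cmod (a l m) * (1 / Im z) ^ m)"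
     using pb by (intro mult_mono) auto
    thus ?thesis by (simp add: norm_mult)
   qed
  qed
  also have "\<dots> <= (\<Sum>l\<in>K. (\<Sum>m\<le>s. cmod (a l m) * (1 / Im z) ^ m) / cmod J)"
   using K z by (intro sum_mono2) (auto simp: uhp_def intro!: divide_nonneg_nonneg sum_nonneg)
  also have "\<dots> = M / cmod J" by (simp add: M_def sum_divide_distrib)
  finally show ?thesis by (simp add: J_def)
 qed
 define x where "x w = of_real (w$1) / linfac w z" for w :: "real^2"
 have Xx: "Xfac g z = x (g$2)" for g by (simp add: Xfac_def x_def jfac_linfac)
 have xs: "x (t *s w) = x w" if "t ~= 0" for t w using that by (simp add: x_def linfac_scale)
 \<comment> \<open>a limit direction of the bottom rows\<close>
 have "ALL n. EX g. g : \<Gamma> & real (Suc n) < norm (g$2)" using rows_unbounded by blast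
 then obtain G where G: "!!n. G n : \<Gamma>" "!!n. real (Suc n) < norm (G n$2)" by metis
 define u where "u n = (1 / norm (G n$2)) *s (G n$2)" for n
 have nn: "norm (G n$2) > 0" for n using G(2)[of n] by linarith
 have "u n : sphere 0 1" for n using nn[of n] by (simp add: u_def scalar_mult_eq_scaleR)
 then obtain v r where v: "v : sphere 0 1" "strict_mono r" "(u \<circ> r) \<longlonglongrightarrow> v"
  using compact_sphere[of "0::real^2" 1] unfolding compact_def by blast
 have v0: "v ~= 0" using v(1) by auto
 have root: "p k0 (x (v v* h)) = 0" if h: "h : \<Gamma>" for h
 proof -
  have vh: "v v* h ~= 0" using row_mult_nz in_SL2R h v0 by blast
  have lim: "(%n. ((u \<circ> r) n v* h)$i) \<longlonglongrightarrow> (v v* h)$i" for i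
   unfolding row2_mult_nth by (intro tendsto_intros v(3))
  have limL: "(%n. linfac ((u \<circ> r) n v* h) z) \<longlonglongrightarrow> linfac (v v* h) z"
   unfolding linfac_def by (intro tendsto_intros lim)
  have "(%n. x ((u \<circ> r) n v* h)) \<longlonglongrightarrow> x (v v* h)"
   unfolding x_def by (intro tendsto_intros lim limL linfac_nz[OF vh z])
  hence limp: "(%n. cmod (p k0 (x ((u \<circ> r) n v* h)))) \<longlonglongrightarrow> cmod (p k0 (x (v v* h)))"
   using continuous_on_tendsto_compose[OF cp[of k0]] by (intro tendsto_norm) auto
  have rowE: "(G (r n) ** h)$2 = norm (G (r n)$2) *s ((u \<circ> r) n v* h)" for n
   using nn[of "r n"] by (simp add: mat2_row_mult u_def scale_row_mult)
  have xE: "Xfac (G (r n) ** h) z = x ((u \<circ> r) n v* h)" for n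
   unfolding Xx rowE using nn[of "r n"] by (intro xs) simp
  have jE: "cmod (jfac (G (r n) ** h) z) = norm (G (r n)$2) * cmod (linfac ((u \<circ> r) n v* h) z)" for n
   unfolding jfac_linfac rowE linfac_scale by (simp add: norm_mult)
  have Gtop: "filterlim (%n. norm (G (r n)$2)) at_top sequentially"
  proof (rule filterlim_at_top_mono[OF filterlim_real_sequentially])
   show "\<forall>\<^sub>F n in sequentially. real n <= norm (G (r n)$2)"
   proof (rule always_eventually, rule allI)
    fix n show "real n <= norm (G (r n)$2)"
     using G(2)[of "r n"] seq_suble[OF v(2), of n] by linarith
   qed
  qed
  have "0 < cmod (linfac (v v* h) z)" using linfac_nz[OF vh z] by simp
  hence jtop: "filterlim (%n. cmod (jfac (G (r n) ** h) z)) at_top sequentially"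
   unfolding jE by (rule filterlim_at_top_mult_tendsto_pos[OF tendsto_norm[OF limL] _ Gtop])
  have "\<forall>\<^sub>F n in sequentially. 1 <= cmod (jfac (G (r n) ** h) z)"
   using jtop unfolding filterlim_at_top by blast
  hence "\<forall>\<^sub>F n in sequentially. cmod (p k0 (x ((u \<circ> r) n v* h))) <= M / cmod (jfac (G (r n) ** h) z)"
   by eventually_elim (metis main mult_in G(1) h xE)
  moreover have "(%n. M / cmod (jfac (G (r n) ** h) z)) \<longlonglongrightarrow> 0"
   by (rule real_tendsto_divide_at_top[OF tendsto_const jtop])
  ultimately have "cmod (p k0 (x (v v* h))) <= 0"
   using tendsto_le[OF sequentially_bot _ limp] by blast
  thus ?thesis by simp
 qed
 define R where "R = {y. p k0 y = 0}"
 have "finite R" unfolding R_def p_def using k0(2) polyfun_finite_roots[of "a k0" s] by simp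
 define B where "B = (%y. if y = 0 then axis 2 1 else vector [1, Re (1 / y - z)] :: real^2) ` R"
 show False
 proof (rule no_finite_line_orbit[OF v0, of B])
  show "finite B" using \<open>finite R\<close> by (simp add: B_def)
  fix g assume g: "g : \<Gamma>"
  have "linfac (v v* g) z ~= 0" using linfac_nz[OF _ z] row_mult_nz in_SL2R g v0 by blast
  from det_rows_Xratio[OF this refl] root[OF g]
  show "EX b:B. EX t. v v* g = t *s b" unfolding B_def R_def x_def[symmetric] by blast
 qed
qed

end

section \<open>Scalar quasimodular forms\<close>

lemma holo_uhp_add: "holo_uhp f ==> holo_uhp g ==> holo_uhp (%z. f z + g z)"
 and holo_uhp_mult: "holo_uhp f ==> holo_uhp g ==> holo_uhp (%z. f z * g z)"
 and holo_uhp_cmult: "holo_uhp f ==> holo_uhp (%z. c * f z)"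
 and holo_uhp_zero: "holo_uhp (%z. 0)"
 by (auto simp: holo_uhp_def intro!: holomorphic_intros)

lemma holo_uhp_sum: "(!!i. i : I ==> holo_uhp (f i)) ==> holo_uhp (%z. \<Sum>i\<in>I. f i z)"
 by (auto simp: holo_uhp_def intro!: holomorphic_intros)

lemma holo_uhp_ext:
 assumes "holo_uhp f" "holo_uhp g" "!!z. z : uhp ==> f z = g z" shows "f = g"
proof
 fix z show "f z = g z" using assms by (cases "z : uhp") (auto simp: holo_uhp_def)
qed

definition uderiv :: "(complex => complex) => complex => complex" where
 "uderiv f z = (if z : uhp then deriv f z else 0)"

lemma holo_uderiv: "holo_uhp f ==> holo_uhp (uderiv f)"
 unfolding holo_uhp_def
 by (auto simp: uderiv_def intro: holomorphic_transform[OF holomorphic_deriv[OF _ open_uhp]])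

lemma uderiv_DERIV: "holo_uhp f ==> z : uhp ==> (f has_field_derivative uderiv f z) (at z)"
 using holomorphic_derivI[OF _ open_uhp] by (auto simp: holo_uhp_def uderiv_def)

lemma bounded_at_i_inf_add:
 assumes "bounded_at_i_inf f" "bounded_at_i_inf g" shows "bounded_at_i_inf (%z. f z + g z)"
 unfolding bounded_at_i_inf_def
proof (intro allI impI)
 fix C :: "real set" assume C: "compact C"
 obtain Y M where 1: "Y > 0" "ALL z. Re z : C --> Y < Im z --> cmod (f z) <= M"
  using assms(1) C unfolding bounded_at_i_inf_def by blast
 obtain Y' M' where 2: "Y' > 0" "ALL z. Re z : C --> Y' < Im z --> cmod (g z) <= M'"
  using assms(2) C unfolding bounded_at_i_inf_def by blast
 show "EX Y>0. EX M. ALL z. Re z : C --> Y < Im z --> cmod (f z + g z) <= M"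
  using 1 2 by (intro exI[of _ "max Y Y'"] conjI exI[of _ "M + M'"] allI impI norm_triangle_mono) auto
qed

lemma bounded_at_i_inf_mult:
 assumes "bounded_at_i_inf f" "bounded_at_i_inf g" shows "bounded_at_i_inf (%z. f z * g z)"
 unfolding bounded_at_i_inf_def
proof (intro allI impI)
 fix C :: "real set" assume C: "compact C"
 obtain Y M where 1: "Y > 0" "ALL z. Re z : C --> Y < Im z --> cmod (f z) <= M"
  using assms(1) C unfolding bounded_at_i_inf_def by blast
 obtain Y' M' where 2: "Y' > 0" "ALL z. Re z : C --> Y' < Im z --> cmod (g z) <= M'"
  using assms(2) C unfolding bounded_at_i_inf_def by blast
 have "cmod (f z * g z) <= max 0 M * max 0 M'" if "Re z : C" "max Y Y' < Im z" for z
  unfolding norm_mult using 1 2 that by (intro mult_mono) (auto simp: le_max_iff_disj)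
 thus "EX Y>0. EX M. ALL z. Re z : C --> Y < Im z --> cmod (f z * g z) <= M"
  using 1 2 by (intro exI[of _ "max Y Y'"] conjI exI[of _ "max 0 M * max 0 M'"]) auto
qed

lemma bounded_at_i_inf_const: "bounded_at_i_inf (%z. c)"
 unfolding bounded_at_i_inf_def by (intro allI impI exI[of _ 1] conjI exI[of _ "cmod c"]) auto

lemma bounded_at_i_inf_cmult: "bounded_at_i_inf f ==> bounded_at_i_inf (%z. c * f z)"
 by (rule bounded_at_i_inf_mult[OF bounded_at_i_inf_const])

lemma bounded_at_i_inf_sum:
 "finite I ==> (!!i. i : I ==> bounded_at_i_inf (f i)) ==> bounded_at_i_inf (%z. \<Sum>i\<in>I. f i z)"
 by (induction I rule: finite_induct) (auto intro: bounded_at_i_inf_const bounded_at_i_inf_add)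

lemma bounded_at_i_inf_cong:
 assumes "bounded_at_i_inf f" "!!z. z : uhp ==> f z = g z" shows "bounded_at_i_inf g"
 unfolding bounded_at_i_inf_def
proof (intro allI impI)
 fix C :: "real set" assume C: "compact C"
 obtain Y M where 1: "Y > 0" "ALL z. Re z : C --> Y < Im z --> cmod (f z) <= M"
  using assms(1) C unfolding bounded_at_i_inf_def by blast
 thus "EX Y>0. EX M. ALL z. Re z : C --> Y < Im z --> cmod (g z) <= M"
  using assms(2) by (intro exI[of _ Y] conjI exI[of _ M] allI impI) (auto simp: uhp_def)
qed

lemma bounded_Xfac:
 assumes "s : SL2R" shows "bounded_at_i_inf (Xfac s)"
 unfolding bounded_at_i_inf_def
proof (intro allI impI exI[of _ 1] conjI)
 fix z assume "1 < Im z"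
 hence "cmod (Xfac s z) <= 1 / Im z" "1 / Im z <= 1"
  using norm_Xfac_le[OF assms, of z] by (simp_all add: uhp_def)
 thus "cmod (Xfac s z) <= 1" by linarith
qed simp

lemma bounded_at_i_inf_power: "bounded_at_i_inf f ==> bounded_at_i_inf (%z. f z ^ n)"
 by (induction n) (auto intro: bounded_at_i_inf_const bounded_at_i_inf_mult)

lemma qm_coeffs_holo: "qm_coeffs \<Gamma> k f Q ==> holo_uhp (Q m)"
 by (simp add: qm_coeffs_def)

lemma qm_coeffs_bounded:
 "qm_coeffs \<Gamma> k f Q ==> s : SL2R ==> bdry_mobius s None : cusps \<Gamma> ==>
  bounded_at_i_inf (slash (k - 2 * int m) (Q m) s)"
 by (simp add: qm_coeffs_def)

lemma qm_coeffs_expansion: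
 assumes "qm_coeffs \<Gamma> k f Q"
 shows "EX s. (ALL m>s. Q m = 0) & (ALL s'>=s. ALL g:\<Gamma>. ALL z:uhp. slash k f g z = (\<Sum>m\<le>s'. Xfac g z ^ m * Q m z))"
proof -
 obtain s where s: "ALL m>s. Q m = 0"
   "ALL g:\<Gamma>. ALL z:uhp. slash k f g z = (\<Sum>m\<le>s. Xfac g z ^ m * Q m z)"
  using assms unfolding qm_coeffs_def by blast
 have eq: "(\<Sum>m\<le>s'. Xfac g z ^ m * Q m z) = (\<Sum>m\<le>s. Xfac g z ^ m * Q m z)" if "s' >= s" for s' g z
 proof (rule sum.mono_neutral_right)
  show "ALL m:{..s'} - {..s}. Xfac g z ^ m * Q m z = 0"
  by (simp add: s(1))
 qed (use that in simp_all)
 have "slash k f g z = (\<Sum>m\<le>s'. Xfac g z ^ m * Q m z)" if "s' >= s" "g : \<Gamma>" "z : uhp" for s' g z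
  unfolding eq[OF that(1)] using s(2) that(2,3) by blast
 with s(1) show ?thesis by blast
qed

lemma qm_coeffsI:
 assumes "!!m. holo_uhp (Q m)" "!!m. m > s ==> Q m = 0"
  "!!g z. g : \<Gamma> ==> z : uhp ==> slash k f g z = (\<Sum>m\<le>s. Xfac g z ^ m * Q m z)"
  "!!h m. h : SL2R ==> bdry_mobius h None : cusps \<Gamma> ==> bounded_at_i_inf (slash (k - 2 * int m) (Q m) h)"
 shows "qm_coeffs \<Gamma> k f Q"
 using assms unfolding qm_coeffs_def by blast

lemma slash_add: "slash k (%z. f z + g z) \<gamma> = (%z. slash k f \<gamma> z + slash k g \<gamma> z)"
 by (simp add: slash_def algebra_simps fun_eq_iff)

lemma slash_cmult: "slash k (%z. c * f z) \<gamma> = (%z. c * slash k f \<gamma> z)"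
 by (simp add: slash_def algebra_simps fun_eq_iff)

lemma slash_sum: "slash k (%z. \<Sum>i\<in>I. f i z) \<gamma> = (%z. \<Sum>i\<in>I. slash k (f i) \<gamma> z)"
 by (simp add: slash_def sum_distrib_left fun_eq_iff)

lemma slash_mult:
 assumes "\<gamma> : SL2R" "z : uhp"
 shows "slash (k + l) (%z. f z * g z) \<gamma> z = slash k f \<gamma> z * slash l g \<gamma> z"
 using jfac_nonzero[OF assms] by (simp add: slash_def power_int_add power_int_diff power_int_minus field_simps)

lemma qm_coeffs_add:
 assumes f: "qm_coeffs \<Gamma> k f Q" and g: "qm_coeffs \<Gamma> k g R"
 shows "qm_coeffs \<Gamma> k (%z. f z + g z) (%m z. Q m z + R m z)"
proof -
 obtain s where s: "ALL m>s. Q m = 0" "ALL s'>=s. ALL g:\<Gamma>. ALL z:uhp. slash k f g z = (\<Sum>m\<le>s'. Xfac g z ^ m * Q m z)"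
  using qm_coeffs_expansion[OF f] by blast
 obtain t where t: "ALL m>t. R m = 0" "ALL s'>=t. ALL h:\<Gamma>. ALL z:uhp. slash k g h z = (\<Sum>m\<le>s'. Xfac h z ^ m * R m z)"
  using qm_coeffs_expansion[OF g] by blast
 show ?thesis
 proof (rule qm_coeffsI[where s = "max s t"])
  fix h z assume "h : \<Gamma>" "z : uhp"
  thus "slash k (%z. f z + g z) h z = (\<Sum>m\<le>max s t. Xfac h z ^ m * (Q m z + R m z))"
   using s(2)[rule_format, of "max s t" h z] t(2)[rule_format, of "max s t" h z]
   by (simp add: slash_add sum.distrib algebra_simps)
 qed (use s(1) t(1) f g in \<open>auto simp: slash_add qm_coeffs_bounded zero_fun_def intro: holo_uhp_add bounded_at_i_inf_add qm_coeffs_holo\<close>)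
qed

lemma qm_coeffs_cmult:
 assumes f: "qm_coeffs \<Gamma> k f Q"
 shows "qm_coeffs \<Gamma> k (%z. c * f z) (%m z. c * Q m z)"
proof -
 obtain s where s: "ALL m>s. Q m = 0" "ALL s'>=s. ALL g:\<Gamma>. ALL z:uhp. slash k f g z = (\<Sum>m\<le>s'. Xfac g z ^ m * Q m z)"
  using qm_coeffs_expansion[OF f] by blast
 show ?thesis
 proof (rule qm_coeffsI[where s = s])
  fix h z assume "h : \<Gamma>" "z : uhp"
  thus "slash k (%z. c * f z) h z = (\<Sum>m\<le>s. Xfac h z ^ m * (c * Q m z))"
   using s(2)[rule_format, of s h z]
   by (simp add: slash_cmult sum_distrib_left mult.left_commute)
 qed (use s(1) f in \<open>auto simp: slash_cmult qm_coeffs_bounded zero_fun_def intro: holo_uhp_cmult bounded_at_i_inf_cmult qm_coeffs_holo\<close>)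
qed

lemma qm_coeffs_zero: "qm_coeffs \<Gamma> k (%z. 0) (%m z. 0)"
proof (rule qm_coeffsI[where s = 0])
 fix h m
 have "slash (k - 2 * int m) (%z. 0) h = (%z. 0)" by (simp add: slash_def fun_eq_iff)
 thus "bounded_at_i_inf (slash (k - 2 * int m) (%z. 0) h)" by (simp add: bounded_at_i_inf_const)
qed (auto simp: slash_def holo_uhp_zero zero_fun_def)

lemma cauchy_product:
 fixes a b :: "nat => complex"
 assumes "!!m. m > s ==> a m = 0" "!!m. m > t ==> b m = 0"
 shows "(\<Sum>m\<le>s. x ^ m * a m) * (\<Sum>m\<le>t. x ^ m * b m) = (\<Sum>m\<le>s+t. x ^ m * (\<Sum>i\<le>m. a i * b (m - i)))"
 using polynomial_product[of s a t b x] assms by (simp add: mult.commute)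

lemma qm_coeffs_mult:
 assumes \<Gamma>: "\<Gamma> <= SL2R" and f: "qm_coeffs \<Gamma> k f Q" and g: "qm_coeffs \<Gamma> l g R"
 shows "qm_coeffs \<Gamma> (k + l) (%z. f z * g z) (%m z. \<Sum>i\<le>m. Q i z * R (m - i) z)"
proof -
 obtain s where s: "ALL m>s. Q m = 0" "ALL s'>=s. ALL g:\<Gamma>. ALL z:uhp. slash k f g z = (\<Sum>m\<le>s'. Xfac g z ^ m * Q m z)"
  using qm_coeffs_expansion[OF f] by blast
 obtain t where t: "ALL m>t. R m = 0" "ALL s'>=t. ALL h:\<Gamma>. ALL z:uhp. slash l g h z = (\<Sum>m\<le>s'. Xfac h z ^ m * R m z)"
  using qm_coeffs_expansion[OF g] by blast
 show ?thesis
 proof (rule qm_coeffsI[where s = "s + t"])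
  fix m assume m: "m > s + t"
  have "Q i z * R (m - i) z = 0" for i z
  proof (cases "i > s")
   case False
   hence "m - i > t" using m by simp
   with t(1) show ?thesis by simp
  qed (use s(1) in simp)
  hence "(\<Sum>i\<le>m. Q i z * R (m - i) z) = 0" for z by (intro sum.neutral) blast
  thus "(%z. \<Sum>i\<le>m. Q i z * R (m - i) z) = 0" by (simp only: fun_eq_iff zero_fun_apply) simp
 next
  fix h z assume h: "h : \<Gamma>" "z : uhp"
  thus "slash (k + l) (%z. f z * g z) h z = (\<Sum>m\<le>s + t. Xfac h z ^ m * (\<Sum>i\<le>m. Q i z * R (m - i) z))"
   using slash_mult[of h z k l f g] \<Gamma> s(2)[rule_format, of s h z] t(2)[rule_format, of t h z]
    cauchy_product[of s "%m. Q m z" t "%m. R m z" "Xfac h z"] s(1) t(1) by auto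
 next
  fix q m assume q: "q : SL2R" "bdry_mobius q None : cusps \<Gamma>"
  have "bounded_at_i_inf (%z. \<Sum>i\<le>m. slash (k - 2 * int i) (Q i) q z * slash (l - 2 * int (m - i)) (R (m - i)) q z)"
   by (intro bounded_at_i_inf_sum bounded_at_i_inf_mult qm_coeffs_bounded[OF f q] qm_coeffs_bounded[OF g q]) auto
  thus "bounded_at_i_inf (slash (k + l - 2 * int m) (%z. \<Sum>i\<le>m. Q i z * R (m - i) z) q)"
  proof (rule bounded_at_i_inf_cong)
   fix z assume z: "z : uhp"
   have "slash (k - 2 * int i) (Q i) q z * slash (l - 2 * int (m - i)) (R (m - i)) q z
     = slash (k + l - 2 * int m) (%z. Q i z * R (m - i) z) q z" if "i <= m" for i
   proof -
    have *: "k + l - 2 * int m = (k - 2 * int i) + (l - 2 * int (m - i))" using that by simp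
    show ?thesis unfolding * by (rule slash_mult[OF q(1) z, symmetric])
   qed
   thus "(\<Sum>i\<le>m. slash (k - 2 * int i) (Q i) q z * slash (l - 2 * int (m - i)) (R (m - i)) q z) =
    slash (k + l - 2 * int m) (%z. \<Sum>i\<le>m. Q i z * R (m - i) z) q z"
    by (simp add: slash_sum)
  qed
 qed (auto intro!: holo_uhp_sum holo_uhp_mult qm_coeffs_holo[OF f] qm_coeffs_holo[OF g])
qed

lemma DERIV_jfac: "(jfac g has_field_derivative of_real (g$2$1)) (at z)"
 unfolding jfac_def by (auto intro!: derivative_eq_intros)

lemma DERIV_Xfac:
 assumes "jfac g z ~= 0" shows "(Xfac g has_field_derivative - (Xfac g z)\<^sup>2) (at z)"
 unfolding Xfac_def using assms
 by (auto intro!: derivative_eq_intros DERIV_jfac simp: power2_eq_square field_simps)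

lemma DERIV_mobius:
 assumes "g : SL2R" "z : uhp" shows "(mobius g has_field_derivative 1 / (jfac g z)\<^sup>2) (at z)"
proof -
 have det: "complex_of_real (g$1$1) * of_real (g$2$2) - of_real (g$1$2) * of_real (g$2$1) = 1"
  using arg_cong[OF SL2R_det[OF assms(1)], of complex_of_real] by simp
 have "(mobius g has_field_derivative
   (of_real (g$1$1) * jfac g z - (of_real (g$1$1) * z + of_real (g$1$2)) * of_real (g$2$1)) / (jfac g z * jfac g z)) (at z)"
  unfolding mobius_def using jfac_nonzero[OF assms]
  by (auto intro!: derivative_eq_intros DERIV_jfac)
 also have "of_real (g$1$1) * jfac g z - (of_real (g$1$1) * z + of_real (g$1$2)) * of_real (g$2$1) = 1"
  using det by (simp add: jfac_def algebra_simps)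
 finally show ?thesis by (simp add: power2_eq_square)
qed

lemma slash_uderiv:
 assumes f: "holo_uhp f" and g: "g : SL2R" and w: "w : uhp"
 shows "(slash k f g has_field_derivative
   slash (k + 2) (uderiv f) g w - of_int k * Xfac g w * slash k f g w) (at w)"
proof -
 have j: "jfac g w ~= 0" using jfac_nonzero[OF g w] .
 have 1: "((%z. f (mobius g z)) has_field_derivative uderiv f (mobius g w) * (1 / (jfac g w)\<^sup>2)) (at w)"
  by (rule DERIV_chain2[OF uderiv_DERIV[OF f mobius_uhp[OF g w]] DERIV_mobius[OF g w]])
 have 2: "((%z. jfac g z powi (- k)) has_field_derivative
   of_int (- k) * jfac g w powi (- k - 1) * of_real (g$2$1)) (at w)"
  using j by (auto intro!: derivative_eq_intros DERIV_jfac)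
 have "(slash k f g has_field_derivative
   of_int (- k) * jfac g w powi (- k - 1) * of_real (g$2$1) * f (mobius g w) +
   uderiv f (mobius g w) * (1 / (jfac g w)\<^sup>2) * jfac g w powi (- k)) (at w)"
  unfolding slash_def by (rule DERIV_mult[OF 2 1])
 also have "of_int (- k) * jfac g w powi (- k - 1) * of_real (g$2$1) * f (mobius g w) +
   uderiv f (mobius g w) * (1 / (jfac g w)\<^sup>2) * jfac g w powi (- k) =
   slash (k + 2) (uderiv f) g w - of_int k * Xfac g w * slash k f g w"
 proof -
  have "jfac g w powi (- (k + 2)) = jfac g w powi (- k) / (jfac g w)\<^sup>2"
   "jfac g w powi (- k - 1) = jfac g w powi (- k) / jfac g w"
   using j power_int_diff[of "jfac g w" "-k" 2] power_int_diff[of "jfac g w" "-k" 1] by simp_all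
  thus ?thesis by (simp add: slash_def Xfac_def mult_ac)
 qed
 finally show ?thesis .
qed

lemma bounded_deriv:
 assumes u: "bounded_at_i_inf u" and D: "!!z. z : uhp ==> (u has_field_derivative u' z) (at z)"
 shows "bounded_at_i_inf u'"
 unfolding bounded_at_i_inf_def
proof (intro allI impI)
 fix C :: "real set" assume "compact C"
 then obtain R where R: "!!x. x : C ==> \<bar>x\<bar> <= R" using compact_imp_bounded[of C] by (auto simp: bounded_iff)
 obtain Y M where YM: "Y > 0" "ALL w. Re w : {-R-1..R+1} --> Y < Im w --> cmod (u w) <= M"
  using u unfolding bounded_at_i_inf_def by (metis compact_Icc)
 show "EX Y>0. EX M. ALL w. Re w : C --> Y < Im w --> cmod (u' w) <= M"
 proof (rule exI[of _ "Y + 1"], rule conjI, goal_cases)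
  case 2
  show ?case
  proof (rule exI[of _ M], intro allI impI)
  fix w assume w: "Re w : C" "Y + 1 < Im w"
  have near: "Y < Im z & Re z : {-R-1..R+1}" if "cmod (w - z) <= 1" for z
   using R[OF w(1)] w(2) that abs_Re_le_cmod[of "w - z"] abs_Im_le_cmod[of "w - z"] by auto
  have sub: "cball w 1 <= uhp" using near YM(1) by (force simp: uhp_def dist_norm)
  have holo: "u holomorphic_on uhp" using D holomorphic_on_open[OF open_uhp] by blast
  have "cmod ((deriv ^^ 1) u w) <= fact 1 * M / 1 ^ 1"
  proof (rule Cauchy_inequality)
   show "u holomorphic_on ball w 1" using holo sub ball_subset_cball holomorphic_on_subset by blast
   show "continuous_on (cball w 1) u" using holo sub holomorphic_on_imp_continuous_on holomorphic_on_subset by blast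
   fix x assume "cmod (w - x) = 1"
   thus "cmod (u x) <= M" using near[of x] YM(2) by simp
  qed simp
  moreover have "w : uhp" using sub by auto
  ultimately show "cmod (u' w) <= M" using DERIV_imp_deriv[OF D] by simp
  qed
 qed (use YM(1) in simp)
qed

lemma bounded_slash_uderiv:
 assumes "holo_uhp f" "s : SL2R" "bounded_at_i_inf (slash k f s)"
 shows "bounded_at_i_inf (slash (k + 2) (uderiv f) s)"
proof -
 have "bounded_at_i_inf (%z. slash (k + 2) (uderiv f) s z - of_int k * Xfac s z * slash k f s z)"
  using slash_uderiv[OF assms(1,2)] by (rule bounded_deriv[OF assms(3)])
 moreover have "bounded_at_i_inf (%z. of_int k * Xfac s z * slash k f s z)"
  by (intro bounded_at_i_inf_mult bounded_at_i_inf_const bounded_Xfac assms)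
 ultimately have "bounded_at_i_inf (%z. (slash (k + 2) (uderiv f) s z - of_int k * Xfac s z * slash k f s z)
   + of_int k * Xfac s z * slash k f s z)" by (rule bounded_at_i_inf_add)
 thus ?thesis by simp
qed

text \<open>Differentiating the expansion uses \<open>X' = -X\<^sup>2\<close> and \<open>j' = X j\<close>,
which shifts the index by one.\<close>

lemma qm_coeffs_uderiv:
 assumes \<Gamma>: "\<Gamma> <= SL2R" and hf: "holo_uhp f" and f: "qm_coeffs \<Gamma> k f Q"
 shows "qm_coeffs \<Gamma> (k + 2) (uderiv f)
  (%m w. uderiv (Q m) w + (if m = 0 then 0 else of_int (k - int m + 1) * Q (m - 1) w))"
proof -
 obtain s where s: "ALL m>s. Q m = 0" "ALL s'>=s. ALL g:\<Gamma>. ALL w:uhp. slash k f g w = (\<Sum>m\<le>s'. Xfac g w ^ m * Q m w)"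
  using qm_coeffs_expansion[OF f] by blast
 have u0: "uderiv 0 = 0" by (simp add: fun_eq_iff uderiv_def zero_fun_def)
 show ?thesis
 proof (rule qm_coeffsI[where s = "Suc s"])
  fix m assume "m > Suc s"
  hence "Q m = 0" "Q (m - 1) = 0" using s(1) by auto
  thus "(%w. uderiv (Q m) w + (if m = 0 then 0 else of_int (k - int m + 1) * Q (m - 1) w)) = 0"
   by (intro ext) (simp add: u0)
 next
  fix m show "holo_uhp (%w. uderiv (Q m) w + (if m = 0 then 0 else of_int (k - int m + 1) * Q (m - 1) w))"
   using qm_coeffs_holo[OF f] by (cases "m = 0") (auto intro!: holo_uhp_add holo_uhp_cmult holo_uderiv)
 next
  fix g w assume g: "g : \<Gamma>" and w: "w : uhp"
  define X where "X = Xfac g w"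
  have gS: "g : SL2R" using g \<Gamma> by blast
  have D1: "((%z. \<Sum>m\<le>s. Xfac g z ^ m * Q m z) has_field_derivative
    (\<Sum>m\<le>s. X ^ m * uderiv (Q m) w - of_nat m * X ^ (m + 1) * Q m w)) (at w)"
  proof (rule DERIV_sum)
   fix m
   have "((%z. Xfac g z ^ m) has_field_derivative of_nat m * (- (X\<^sup>2) * X ^ (m - Suc 0))) (at w)"
    unfolding X_def by (rule DERIV_power[OF DERIV_Xfac[OF jfac_nonzero[OF gS w]]])
   from DERIV_mult[OF this uderiv_DERIV[OF qm_coeffs_holo[OF f] w]]
   have "((%z. Xfac g z ^ m * Q m z) has_field_derivative
     of_nat m * (- (X\<^sup>2) * X ^ (m - Suc 0)) * Q m w + uderiv (Q m) w * X ^ m) (at w)" by (simp add: X_def)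
   also have "of_nat m * (- (X\<^sup>2) * X ^ (m - Suc 0)) = - of_nat m * X ^ (m + 1)"
    by (cases m) (simp_all add: power2_eq_square algebra_simps)
   finally show "((%z. Xfac g z ^ m * Q m z) has_field_derivative
     X ^ m * uderiv (Q m) w - of_nat m * X ^ (m + 1) * Q m w) (at w)" by (simp add: mult.commute)
  qed
  have "(slash k f g has_field_derivative
    (\<Sum>m\<le>s. X ^ m * uderiv (Q m) w - of_nat m * X ^ (m + 1) * Q m w)) (at w)"
   by (rule has_field_derivative_transform_within_open[OF D1 open_uhp w])
    (use s(2)[rule_format, of s g] g in simp)
  from DERIV_unique[OF this slash_uderiv[OF hf gS w]] have E:
   "(\<Sum>m\<le>s. X ^ m * uderiv (Q m) w - of_nat m * X ^ (m + 1) * Q m w) =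
    slash (k + 2) (uderiv f) g w - of_int k * X * (\<Sum>m\<le>s. X ^ m * Q m w)"
   using s(2)[rule_format, of s g w] g w by (simp add: X_def)
  have "slash (k + 2) (uderiv f) g w =
    (\<Sum>m\<le>s. X ^ m * uderiv (Q m) w - of_nat m * X ^ (m + 1) * Q m w) + of_int k * X * (\<Sum>m\<le>s. X ^ m * Q m w)"
   unfolding E by simp
  also have "\<dots> = (\<Sum>m\<le>s. X ^ m * uderiv (Q m) w) + (\<Sum>m\<le>s. X ^ Suc m * (of_int (k - int m) * Q m w))"
   by (simp add: sum_distrib_left sum_subtractf sum.distrib algebra_simps)
  also have "(\<Sum>m\<le>s. X ^ m * uderiv (Q m) w) = (\<Sum>m\<le>Suc s. X ^ m * uderiv (Q m) w)"
   using s(1) u0 by simp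
  also have "(\<Sum>m\<le>s. X ^ Suc m * (of_int (k - int m) * Q m w)) =
    (\<Sum>m\<le>Suc s. X ^ m * (if m = 0 then 0 else of_int (k - int m + 1) * Q (m - 1) w))"
   by (subst sum.atMost_Suc_shift) simp
  finally show "slash (k + 2) (uderiv f) g w = (\<Sum>m\<le>Suc s. Xfac g w ^ m *
    (uderiv (Q m) w + (if m = 0 then 0 else of_int (k - int m + 1) * Q (m - 1) w)))"
   by (simp only: sum.distrib[symmetric] distrib_left X_def)
 next
  fix h m assume h: "h : SL2R" "bdry_mobius h None : cusps \<Gamma>"
  have 1: "bounded_at_i_inf (slash (k + 2 - 2 * int m) (uderiv (Q m)) h)"
   using bounded_slash_uderiv[OF qm_coeffs_holo[OF f] h(1) qm_coeffs_bounded[OF f h]]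
   by (simp add: algebra_simps)
  show "bounded_at_i_inf (slash (k + 2 - 2 * int m)
    (%w. uderiv (Q m) w + (if m = 0 then 0 else of_int (k - int m + 1) * Q (m - 1) w)) h)"
  proof (cases m)
   case (Suc n)
   have "bounded_at_i_inf (slash (k + 2 - 2 * int m) (Q n) h)"
    using qm_coeffs_bounded[OF f h, of n] Suc by (simp add: algebra_simps)
   with 1 Suc show ?thesis by (auto simp: slash_add slash_cmult intro!: bounded_at_i_inf_add bounded_at_i_inf_cmult)
  qed (use 1 in simp)
 qed
qed

context first_kind
begin

lemma \<Gamma>_SL2R: "\<Gamma> <= SL2R" using in_SL2R by blast

text \<open>The case of a single weight.\<close>

lemma X_independent:
 assumes z: "z : uhp" and "!!g. g : \<Gamma> ==> (\<Sum>m\<le>s. a m * Xfac g z ^ m) = 0" and "m <= s"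
 shows "a m = 0"
proof (rule automorphy_independent[OF z, where K = "{0}" and s = s and a = "%_. a" and k = 0 and m = m])
 fix g assume "g : \<Gamma>"
 from assms(2)[OF this]
 show "(\<Sum>k\<in>{0}. jfac g z powi k * (\<Sum>m\<le>s. a m * Xfac g z ^ m)) = 0" by simp
qed (use assms(3) in simp_all)

lemma qm_coeffs_unique:
 assumes f: "qm_coeffs \<Gamma> k f Q" and g: "qm_coeffs \<Gamma> k f R"
 shows "Q = R"
proof
 fix m
 obtain s where s: "ALL m>s. Q m = 0" "ALL s'>=s. ALL g:\<Gamma>. ALL z:uhp. slash k f g z = (\<Sum>m\<le>s'. Xfac g z ^ m * Q m z)"
  using qm_coeffs_expansion[OF f] by blast
 obtain t where t: "ALL m>t. R m = 0" "ALL s'>=t. ALL g:\<Gamma>. ALL z:uhp. slash k f g z = (\<Sum>m\<le>s'. Xfac g z ^ m * R m z)"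
  using qm_coeffs_expansion[OF g] by blast
 show "Q m = R m"
 proof (rule holo_uhp_ext)
  fix z assume z: "z : uhp"
  define u where "u = max m (max s t)"
  have "Q m z - R m z = 0"
  proof (rule X_independent[OF z, where s = u and a = "%m. Q m z - R m z"])
   fix g assume "g : \<Gamma>"
   thus "(\<Sum>m\<le>u. (Q m z - R m z) * Xfac g z ^ m) = 0"
    using s(2)[rule_format, of u g z] t(2)[rule_format, of u g z] z
    by (simp add: u_def algebra_simps sum_subtractf)
  qed (simp add: u_def)
  thus "Q m z = R m z" by simp
 qed (use qm_coeffs_holo f g in blast)+
qed

lemma qm_coeffs_Q0:
 assumes hf: "holo_uhp f" and f: "qm_coeffs \<Gamma> k f Q" shows "Q 0 = f"
proof (rule holo_uhp_ext[OF qm_coeffs_holo[OF f] hf])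
 fix z assume z: "z : uhp"
 obtain s where s: "ALL s'>=s. ALL g:\<Gamma>. ALL z:uhp. slash k f g z = (\<Sum>m\<le>s'. Xfac g z ^ m * Q m z)"
  using qm_coeffs_expansion[OF f] by blast
 have "f z = (\<Sum>m\<le>s. 0 ^ m * Q m z)" using s[rule_format, of s "mat 1" z] one_in z by (simp add: slash_def)
 also have "\<dots> = (\<Sum>m\<in>{0}. 0 ^ m * Q m z)" by (rule sum.mono_neutral_right) auto
 finally show "Q 0 z = f z" by simp
qed

text \<open>The coefficient functions of a quasimodular form are quasimodular themselves: comparing the
expansions of \<open>f|\<gamma>\<delta>\<close> and \<open>(f|\<gamma>)|\<delta>\<close> gives
\<open>Q\<^sub>r(Q\<^sub>i f) = (r + i choose i) Q\<^sub>r\<^sub>+\<^sub>i f\<close>.\<close>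

lemma qm_coeffs_Q:
 assumes f: "qm_coeffs \<Gamma> k f Q"
 shows "qm_coeffs \<Gamma> (k - 2 * int i) (Q i) (%r z. of_nat ((i + r) choose i) * Q (i + r) z)"
proof -
 obtain s where s: "ALL m>s. Q m = 0" "ALL s'>=s. ALL g:\<Gamma>. ALL z:uhp. slash k f g z = (\<Sum>m\<le>s'. Xfac g z ^ m * Q m z)"
  using qm_coeffs_expansion[OF f] by blast
 show ?thesis
 proof (rule qm_coeffsI[where s = s])
  fix d z assume d: "d : \<Gamma>" and z: "z : uhp"
  have dS: "d : SL2R" using d in_SL2R by blast
  define j where "j = jfac d z"
  define X where "X = Xfac d z"
  have j0: "j ~= 0" using jfac_nonzero[OF dS z] by (simp add: j_def)
  have w: "mobius d z : uhp" using mobius_uhp[OF dS z] .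
  define u where "u = i + s"
  have key: "(\<Sum>m\<le>u. of_nat (m choose i) * X ^ (m - i) * Q m z / (j\<^sup>2) ^ i) - j powi (- k) * Q i (mobius d z) = 0"
  proof (rule X_independent[OF w, where s = u and a = "%i. (\<Sum>m\<le>u. of_nat (m choose i) * X ^ (m - i) * Q m z / (j\<^sup>2) ^ i) - j powi (- k) * Q i (mobius d z)"])
   fix g assume g: "g : \<Gamma>"
   have gS: "g : SL2R" using g in_SL2R by blast
   define y where "y = Xfac g (mobius d z)"
   have "slash k f (g ** d) z = j powi (- k) * slash k f g (mobius d z)"
    by (simp add: slash_def jfac_mult[OF dS z] mobius_mult[OF gS dS z] j_def power_int_mult_distrib)
   also have "slash k f g (mobius d z) = (\<Sum>i\<le>u. y ^ i * Q i (mobius d z))"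
    using s(2)[rule_format, of u g "mobius d z"] g w by (simp add: y_def u_def)
   finally have 1: "slash k f (g ** d) z = (\<Sum>i\<le>u. y ^ i * (j powi (- k) * Q i (mobius d z)))"
    by (simp add: sum_distrib_left mult.left_commute)
   have "slash k f (g ** d) z = (\<Sum>m\<le>u. (y / j\<^sup>2 + X) ^ m * Q m z)"
    using s(2)[rule_format, of u "g ** d" z] mult_in[OF g d] z Xfac_mult[OF gS dS z]
    by (simp add: u_def y_def X_def j_def add.commute)
   also have "\<dots> = (\<Sum>m\<le>u. \<Sum>i\<le>u. y ^ i * (of_nat (m choose i) * X ^ (m - i) * Q m z / (j\<^sup>2) ^ i))"
   proof (rule sum.cong[OF refl])
    fix m assume m: "m : {..u}"
    have "(y / j\<^sup>2 + X) ^ m = (\<Sum>i\<le>m. of_nat (m choose i) * (y / j\<^sup>2) ^ i * X ^ (m - i))"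
     by (rule binomial_ring)
    also have "\<dots> = (\<Sum>i\<le>u. of_nat (m choose i) * (y / j\<^sup>2) ^ i * X ^ (m - i))"
     using m by (intro sum.mono_neutral_left) auto
    finally have e: "(y / j\<^sup>2 + X) ^ m = (\<Sum>i\<le>u. of_nat (m choose i) * (y / j\<^sup>2) ^ i * X ^ (m - i))" .
    show "(y / j\<^sup>2 + X) ^ m * Q m z = (\<Sum>i\<le>u. y ^ i * (of_nat (m choose i) * X ^ (m - i) * Q m z / (j\<^sup>2) ^ i))"
     unfolding e sum_distrib_right by (simp only: power_divide times_divide_eq_right times_divide_eq_left mult_ac)
   qed
   also have "\<dots> = (\<Sum>i\<le>u. y ^ i * (\<Sum>m\<le>u. of_nat (m choose i) * X ^ (m - i) * Q m z / (j\<^sup>2) ^ i))"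
    by (subst sum.swap) (simp add: sum_distrib_left)
   finally have 2: "slash k f (g ** d) z = (\<Sum>i\<le>u. y ^ i * (\<Sum>m\<le>u. of_nat (m choose i) * X ^ (m - i) * Q m z / (j\<^sup>2) ^ i))" .
   show "(\<Sum>i\<le>u. ((\<Sum>m\<le>u. of_nat (m choose i) * X ^ (m - i) * Q m z / (j\<^sup>2) ^ i) - j powi (- k) * Q i (mobius d z)) *
     Xfac g (mobius d z) ^ i) = 0"
   proof -
    have "(\<Sum>i\<le>u. (A i - B i) * y ^ i) = 0"
     if "(\<Sum>i\<le>u. y ^ i * A i) = (\<Sum>i\<le>u. y ^ i * B i)" for A B :: "nat => complex"
     using that unfolding left_diff_distrib sum_subtractf by (simp only: mult.commute diff_self)
    from this[OF trans[OF 2[symmetric] 1]] show ?thesis unfolding y_def .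
   qed
  qed (simp add: u_def)
  have "(\<Sum>m\<le>u. of_nat (m choose i) * X ^ (m - i) * Q m z) = (\<Sum>m\<in>{i..i+s}. of_nat (m choose i) * X ^ (m - i) * Q m z)"
   by (intro sum.mono_neutral_right) (auto simp: u_def)
  also have "\<dots> = (\<Sum>r\<le>s. of_nat ((i + r) choose i) * X ^ r * Q (i + r) z)"
   by (rule sum.reindex_bij_witness[of _ "%r. i + r" "%m. m - i"]) auto
  finally have 2: "(\<Sum>m\<le>u. of_nat (m choose i) * X ^ (m - i) * Q m z) = (\<Sum>r\<le>s. of_nat ((i + r) choose i) * X ^ r * Q (i + r) z)" .
  have "slash (k - 2 * int i) (Q i) d z = (j\<^sup>2) ^ i * (j powi (- k) * Q i (mobius d z))"
  proof -
   have "j powi (- (k - 2 * int i)) = j powi (2 * int i + (- k))" by simp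
   also have "\<dots> = (j\<^sup>2) ^ i * j powi (- k)" using j0 unfolding power_int_add[OF disjI1[OF j0]]
    by (simp add: power_int_mult)
   finally show ?thesis by (simp add: slash_def j_def)
  qed
  also have "j powi (- k) * Q i (mobius d z) = (\<Sum>m\<le>u. of_nat (m choose i) * X ^ (m - i) * Q m z) / (j\<^sup>2) ^ i"
   using key by (simp add: sum_divide_distrib)
  finally show "slash (k - 2 * int i) (Q i) d z = (\<Sum>r\<le>s. Xfac d z ^ r * (of_nat ((i + r) choose i) * Q (i + r) z))"
   using j0 2 by (simp add: X_def mult_ac)
 next
  fix h r assume h: "h : SL2R" "bdry_mobius h None : cusps \<Gamma>"
  have *: "k - 2 * int i - 2 * int r = k - 2 * int (i + r)" by simp
  show "bounded_at_i_inf (slash (k - 2 * int i - 2 * int r) (%z. of_nat ((i + r) choose i) * Q (i + r) z) h)"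
   unfolding * slash_cmult by (intro bounded_at_i_inf_cmult qm_coeffs_bounded[OF f h])
 next
  fix r show "holo_uhp (%z. of_nat ((i + r) choose i) * Q (i + r) z)"
   by (intro holo_uhp_cmult qm_coeffs_holo[OF f])
  assume "r > s"
  hence "Q (i + r) = 0" using s(1) by simp
  thus "(%z. of_nat ((i + r) choose i) * Q (i + r) z) = 0" by (intro ext) simp
 qed
qed

lemma QM_sum_zero:
 assumes K: "finite K" and f: "!!k. k : K ==> f k : QM \<Gamma> k" and z: "!!w. (\<Sum>k\<in>K. f k w) = 0"
  and k: "k : K"
 shows "f k = 0"
proof -
 define Q where "Q k = (SOME Q. qm_coeffs \<Gamma> k (f k) Q)" for k
 have Q: "qm_coeffs \<Gamma> k (f k) (Q k)" if "k : K" for k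
  unfolding Q_def using f[OF that] by (intro someI_ex[of "qm_coeffs \<Gamma> k (f k)"]) (simp add: QM_def)
 define P where "P k s \<longleftrightarrow> (ALL s'>=s. ALL g:\<Gamma>. ALL w:uhp. slash k (f k) g w = (\<Sum>m\<le>s'. Xfac g w ^ m * Q k m w))" for k s
 define s where "s k = (SOME s. P k s)" for k
 have s: "P k (s k)" if "k : K" for k
  unfolding s_def using qm_coeffs_expansion[OF Q[OF that]] by (intro someI_ex[of "P k"]) (auto simp: P_def)
 define S where "S = (\<Sum>k\<in>K. s k)"
 have sS: "s k <= S" if "k : K" for k unfolding S_def using K that by (intro member_le_sum) auto
 have hf: "holo_uhp (f k)" using f[OF k] by (simp add: QM_def)
 have "Q k 0 = 0"
 proof (rule holo_uhp_ext[OF qm_coeffs_holo[OF Q[OF k]]])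
  show "holo_uhp 0" by (simp add: zero_fun_def holo_uhp_zero)
  fix w assume w: "w : uhp"
  have "Q k 0 w = 0"
  proof (rule automorphy_independent[OF w K, where s = S and a = "%k m. Q k m w"])
   fix g assume g: "g : \<Gamma>"
   have "jfac g w powi k * (\<Sum>m\<le>S. Q k m w * Xfac g w ^ m) = f k (mobius g w)" if "k : K" for k
   proof -
    have "(\<Sum>m\<le>S. Q k m w * Xfac g w ^ m) = slash k (f k) g w"
     using s[OF that, unfolded P_def, rule_format, of S g w] sS[OF that] g w by (simp add: mult.commute)
    thus ?thesis using jfac_nonzero[OF in_SL2R[OF g] w] by (simp add: slash_def power_int_minus)
   qed
   thus "(\<Sum>k\<in>K. jfac g w powi k * (\<Sum>m\<le>S. Q k m w * Xfac g w ^ m)) = 0" using z by simp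
  qed (use k in auto)
  thus "Q k 0 w = 0 w" by simp
 qed
 thus ?thesis using qm_coeffs_Q0[OF hf Q[OF k]] by simp
qed

text \<open>The matrix \<open>-1\<close> belongs to the group and acts by
\<open>(-1)\<^sup>k\<close>.\<close>

lemma QM_odd: assumes "f : QM \<Gamma> k" "odd k" shows "f = 0"
proof (rule holo_uhp_ext)
 obtain Q where hf: "holo_uhp f" and Q: "qm_coeffs \<Gamma> k f Q" using assms by (auto simp: QM_def)
 obtain s where s: "ALL s'>=s. ALL g:\<Gamma>. ALL z:uhp. slash k f g z = (\<Sum>m\<le>s'. Xfac g z ^ m * Q m z)"
  using qm_coeffs_expansion[OF Q] by blast
 fix z assume z: "z : uhp"
 have "(\<Sum>m\<le>s. Xfac (- mat 1) z ^ m * Q m z) = (\<Sum>m\<le>s. Xfac (mat 1) z ^ m * Q m z)"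
  by (simp add: Xfac_def mat_def)
 hence "slash k f (- mat 1) z = slash k f (mat 1) z"
  using s[rule_format, of s, OF _ one_in z] s[rule_format, of s, OF _ minus_one_in z] by simp
 moreover have "mobius (- mat 1) z = z" "jfac (- mat 1) z = -1" by (simp_all add: mobius_def jfac_def mat_def)
 moreover have "(-1 :: complex) powi (- k) = -1" using assms(2) by (simp add: power_int_minus_left)
 ultimately have "- f z = f z" by (simp add: slash_def)
 hence "f z + f z = 0" using right_minus[of "f z"] by (simp only:)
 hence "2 * f z = 0" by (simp only: mult_2)
 thus "f z = 0 z" by simp
next
 show "holo_uhp f" using assms by (simp add: QM_def)
 show "holo_uhp 0" unfolding zero_fun_def by (rule holo_uhp_zero)
qed

lemma one_QM: "(%z. if z : uhp then 1 else 0) : QM \<Gamma> 0"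
proof -
 let ?o = "%z. if z : uhp then 1 else (0::complex)"
 have "?o holomorphic_on uhp" by (rule holomorphic_transform[OF holomorphic_on_const[of 1]]) simp
 hence h: "holo_uhp ?o" by (simp add: holo_uhp_def)
 have "qm_coeffs \<Gamma> 0 ?o (%m. if m = 0 then ?o else (%z. 0))"
 proof (rule qm_coeffsI[where s = 0])
  fix t m assume t: "t : SL2R"
  show "bounded_at_i_inf (slash (0 - 2 * int m) (if m = 0 then ?o else (%z. 0)) t)"
   by (cases "m = 0"; rule bounded_at_i_inf_cong[OF bounded_at_i_inf_const[of "if m = 0 then 1 else 0"]])
    (auto simp: slash_def mobius_uhp t)
 next
  fix m :: nat show "holo_uhp (if m = 0 then ?o else (%z. 0))" using h holo_uhp_zero by (cases "m = 0") simp_all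
  assume "m > 0" thus "(if m = 0 then ?o else (%z. 0)) = 0" by (simp add: zero_fun_def)
 next
  fix g z assume "g : \<Gamma>" "z : uhp"
  thus "slash 0 ?o g z = (\<Sum>m\<le>0. Xfac g z ^ m * (if m = 0 then ?o else (%z. 0)) z)"
   by (simp add: slash_def mobius_in)
 qed
 with h show ?thesis by (auto simp: QM_def)
qed

end

section \<open>Modular forms: negative weight\<close>

lemma slash_at: "jfac g z ~= 0 ==> f (mobius g z) = jfac g z powi k * slash k f g z"
 by (simp add: slash_def power_int_minus)

lemma norm_diff_cnj: "(cmod (z - cnj w))\<^sup>2 = (cmod (z - w))\<^sup>2 + 4 * Im z * Im w"
 unfolding cmod_power2 by (simp add: algebra_simps power2_eq_square)

lemma power_int_antimono_base:
 assumes "0 < x" "x <= y" "k <= 0" shows "(y::real) powi k <= x powi k"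
using assms(1,2,3) power_int_antimono by force

lemma power_int_strict_antimono_base:
 assumes "0 < x" "x < y" "k < 0" shows "(y::real) powi k < x powi k"
by (simp add: assms(1,2,3) power_int_strict_antimono)

definition modform :: "(real^2^2) set => int => (complex => complex) => bool" where
 "modform \<Gamma> k f \<longleftrightarrow> holo_uhp f & (ALL g:\<Gamma>. ALL z:uhp. slash k f g z = f z) &
  (ALL s:SL2R. bdry_mobius s None : cusps \<Gamma> --> bounded_at_i_inf (slash k f s))"

definition petersson :: "int => (complex => complex) => complex => real" where
 "petersson k f z = (cmod (f z))\<^sup>2 * Im z powi k"

lemma petersson_mobius:
 assumes "g : SL2R" "z : uhp"
 shows "petersson k f (mobius g z) = petersson k (slash k f g) z"
proof -
 define J where "J = cmod (jfac g z)"
 have J: "J > 0" using jfac_nonzero[OF assms] by (simp add: J_def)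
 have "cmod (f (mobius g z)) = J powi k * cmod (slash k f g z)"
  using slash_at[of g z f k] jfac_nonzero[OF assms] by (simp add: J_def norm_mult norm_power_int)
 moreover have "Im (mobius g z) powi k = Im z powi k / (J powi k)\<^sup>2"
  unfolding Im_mobius[OF assms] J_def
  by (simp add: power_int_divide_distrib power_int_power power_int_power' mult.commute)
 ultimately show ?thesis using J by (simp add: petersson_def power_mult_distrib)
qed

lemma cont_petersson: "holo_uhp f ==> continuous_on uhp (petersson k f)"
 unfolding petersson_def holo_uhp_def
 by (intro continuous_intros holomorphic_on_imp_continuous_on) (auto simp: uhp_def)

lemma petersson_nonneg: "z : uhp ==> 0 <= petersson k f z"
 by (simp add: petersson_def uhp_def)

context first_kind
begin

lemma petersson_invariant:
 assumes "modform \<Gamma> k f" "g : \<Gamma>" "z : uhp"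
 shows "petersson k f (mobius g z) = petersson k f z"
 using assms petersson_mobius[OF in_SL2R[OF assms(2)] assms(3), of k f] by (simp add: modform_def petersson_def)

text \<open>If the supremum \<open>S\<close> were not attained, the invariant sets \<open>{\<phi> <
c}\<close> with \<open>c < S\<close> would exhaust the half plane and contain a horoball at every cusp, so
by compactness one of them would be everything. That \<open>S\<close> is finite follows in the same
way.\<close>

lemma max_attained:
 fixes \<phi> :: "complex => real"
 assumes cont: "continuous_on uhp \<phi>" and inv: "!!g z. g : \<Gamma> ==> z : uhp ==> \<phi> (mobius g z) = \<phi> z"
  and cusp: "!!h e. h : SL2R ==> bdry_mobius h None : cusps \<Gamma> ==> 0 < e ==> EX Y>0. ALL z. Y < Im z --> \<phi> (mobius h z) < e"
  and pos: "z1 : uhp" "0 < \<phi> z1"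
 shows "EX z0:uhp. ALL z:uhp. \<phi> z <= \<phi> z0"
proof (rule ccontr)
 assume no: "~ ?thesis"
 have near: "near_cusp {z\<in>uhp. \<phi> z < e} s" if sc: "s : cusps \<Gamma>" and e: "0 < e" for s e
  unfolding near_cusp_def
 proof (intro ballI impI)
  fix h assume h: "h : SL2R" "bdry_mobius h None = s"
  then obtain Y where Y: "Y > 0" "ALL z. Y < Im z --> \<phi> (mobius h z) < e" using cusp[OF h(1) _ e] sc by blast
  have "mobius h z : {z\<in>uhp. \<phi> z < e}" if "Y < Im z" for z
  by (smt (verit, best) Y(1,2) h(1) mem_Collect_eq mobius_uhp that uhp_def)
  with Y(1) show "EX Y>0. ALL z. Y < Im z --> mobius h z : {z\<in>uhp. \<phi> z < e}" by blast
 qed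
 have A: "open {z\<in>uhp. \<phi> z < c} & {z\<in>uhp. \<phi> z < c} <= uhp & invariant {z\<in>uhp. \<phi> z < c}" for c
  using open_sublevel_uhp(1)[OF cont] inv mobius_in by (auto simp: invariant_def)
 have "EX n::nat. {z\<in>uhp. \<phi> z < real (Suc n)} = uhp"
 proof (rule exhaustion[OF A])
  fix n :: nat show "{z\<in>uhp. \<phi> z < real (Suc n)} <= {z\<in>uhp. \<phi> z < real (Suc (Suc n))}" by auto
 next
  fix z assume z: "z : uhp"
  obtain n where "\<phi> z < real n" using reals_Archimedean2 by blast
  hence "\<phi> z < real (Suc n)" by simp
  with z show "EX n. z : {z\<in>uhp. \<phi> z < real (Suc n)}" by blast
 next
  fix s assume "s : cusps \<Gamma>"
  have "near_cusp {z\<in>uhp. \<phi> z < real (Suc 0)} s" by (rule near[OF \<open>s : cusps \<Gamma>\<close>]) simp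
  thus "EX n. near_cusp {z\<in>uhp. \<phi> z < real (Suc n)} s" by (rule exI[of _ 0])
 qed
 then obtain n where n: "!!z. z : uhp ==> \<phi> z < real (Suc n)" by blast
 define S where "S = Sup (\<phi> ` uhp)"
 have bdd: "bdd_above (\<phi> ` uhp)" using n by (intro bdd_aboveI2[of _ _ "real (Suc n)"]) (auto intro: less_imp_le)
 have le: "\<phi> z <= S" if "z : uhp" for z unfolding S_def using bdd that by (rule cSUP_upper[rotated])
 have lt: "\<phi> z < S" if z: "z : uhp" for z
 using le no z by fastforce
 have S: "S > 0" using lt[OF pos(1)] pos(2) by simp
 define c where "c n = S - S / real (n + 2)" for n
 have "EX n. {z\<in>uhp. \<phi> z < c n} = uhp"
 proof (rule exhaustion[OF A])
  fix n
  have "S / real (Suc n + 2) <= S / real (n + 2)" using S by (intro divide_left_mono) auto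
  thus "{z\<in>uhp. \<phi> z < c n} <= {z\<in>uhp. \<phi> z < c (Suc n)}" by (auto simp: c_def)
 next
  fix z assume z: "z : uhp"
  have "0 < (S - \<phi> z) / S" using lt[OF z] S by simp
  then obtain n where "1 / real (Suc n) < (S - \<phi> z) / S" using nat_approx_posE by blast
  moreover have "1 / real (n + 2) <= 1 / real (Suc n)" by (intro divide_left_mono) auto
  ultimately have "1 / real (n + 2) < (S - \<phi> z) / S" by linarith
  hence "S * (1 / real (n + 2)) < S * ((S - \<phi> z) / S)" using S by (intro mult_strict_left_mono) auto
  hence "\<phi> z < c n" using S by (simp add: c_def)
  with z show "EX n. z : {z\<in>uhp. \<phi> z < c n}" by blast
 next
  fix s assume "s : cusps \<Gamma>"
  moreover have "0 < c 0" using S by (simp add: c_def)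
  ultimately show "EX n. near_cusp {z\<in>uhp. \<phi> z < c n} s" using near by blast
 qed
 then obtain n where n: "!!z. z : uhp ==> \<phi> z < c n" by blast
 have "S <= c n" unfolding S_def using n pos(1) by (intro cSUP_least) (auto intro: less_imp_le)
 moreover have "0 < S / real (n + 2)" using S by simp
 ultimately show False by (simp add: c_def)
qed

lemma cusp_translation:
 assumes \<sigma>: "\<sigma> : SL2R" "bdry_mobius \<sigma> None : cusps \<Gamma>"
 shows "EX w>0. EX T:\<Gamma>. T ** \<sigma> = \<sigma> ** vector [vector [1, w], vector [0, 1]]"
proof -
 define U :: "real => real^2^2" where "U w = vector [vector [1, w], vector [0, 1]]" for w
 have U: "U w$1$1 = 1" "U w$1$2 = w" "U w$2$1 = 0" "U w$2$2 = 1" for w by (simp_all add: U_def)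
 have UU: "U v ** U w = U (v + w)" for v w by (rule mat2_eqI) (simp_all add: mat2_mult_nth U)
 have U0: "U 0 = mat 1" by (rule mat2_eqI) (simp_all add: U mat_def)
 obtain g where g: "g : \<Gamma>" "parabolic g" "bdry_mobius g (bdry_mobius \<sigma> None) = bdry_mobius \<sigma> None"
  using \<sigma>(2) by (auto simp: cusps_def)
 define P where "P = matrix_inv \<sigma> ** (g ** \<sigma>)"
 have gS: "g : SL2R" using g in_SL2R by blast
 have PS: "P : SL2R" by (simp add: P_def SL2R_mult SL2R_inv \<sigma> gS)
 have P21: "P$2$1 = 0" unfolding P_def
  by (rule stabilizer_triangular[OF \<sigma>(1) SL2R_mult[OF gS \<sigma>(1)]]) (use g in \<open>simp add: bdry_mobius_mult[OF \<sigma>(1)]\<close>)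
 have \<sigma>P: "\<sigma> ** P = g ** \<sigma>" by (simp add: P_def matrix_mul_assoc SL2R_inv[OF \<sigma>(1)])
 have "trace P = trace (g ** \<sigma> ** matrix_inv \<sigma>)" unfolding P_def by (rule trace_mul_sym)
 also have "\<dots> = trace g" by (simp add: matrix_mul_assoc[symmetric] SL2R_inv[OF \<sigma>(1)])
 finally have tr: "(P$1$1 + P$2$2)\<^sup>2 = 4" using g(2) by (simp add: parabolic_def trace_2)
 have ad: "P$1$1 * P$2$2 = 1" using SL2R_det[OF PS] P21 by simp
 have "(P$1$1 - P$2$2)\<^sup>2 = (P$1$1 + P$2$2)\<^sup>2 - 4 * (P$1$1 * P$2$2)" by (simp add: power2_eq_square algebra_simps)
 hence eq: "P$1$1 = P$2$2" using tr ad by simp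
 define d where "d = P$2$2"
 have d: "d * d = 1" "P$1$1 = d" "P$2$2 = d" using eq ad by (simp_all add: d_def)
 have b: "P$1$2 ~= 0"
 proof
  assume "P$1$2 = 0"
  have "d = 1 \<or> d = -1" using d(1) by (simp add: square_eq_1_iff)
  hence "P = mat 1 \<or> P = - mat 1"
   using \<open>P$1$2 = 0\<close> P21 d by (auto simp: vec_eq_iff forall_2 mat_def)
  moreover have "- mat 1 ** \<sigma> = - \<sigma>" "\<sigma> ** (- mat 1) = - \<sigma>" by (rule mat2_eqI; simp add: mat2_mult_nth mat_def)+
  ultimately have "g ** \<sigma> = mat 1 ** \<sigma> \<or> g ** \<sigma> = - mat 1 ** \<sigma>" using \<sigma>P by auto
  hence "g = mat 1 \<or> g = - mat 1"
   using SL2R_inv(1)[OF \<sigma>(1)] by (metis matrix_mul_assoc matrix_mul_rid)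
  with g(2) show False by (auto simp: parabolic_def)
 qed
 have PP: "P ** P = U (2 * d * P$1$2)"
  by (rule mat2_eqI) (use P21 d in \<open>simp_all add: mat2_mult_nth U\<close>)
 have gg: "(g ** g) ** \<sigma> = \<sigma> ** U (2 * d * P$1$2)"
  unfolding PP[symmetric] by (metis \<sigma>P matrix_mul_assoc)
 show ?thesis
 proof (cases "2 * d * P$1$2 > 0")
  case True
  with gg g(1) mult_in show ?thesis unfolding U_def by blast
 next
  case False
  moreover have "d ~= 0" using d(1) by auto
  ultimately have "- (2 * d * P$1$2) > 0" using b by (simp add: not_less order_le_less)
  moreover have cancel: "matrix_inv G ** (G ** \<sigma>) = \<sigma>" if "G : SL2R" for G
   using SL2R_inv(2)[OF that] by (simp add: matrix_mul_assoc)
  moreover have "matrix_inv (g ** g) ** \<sigma> = \<sigma> ** U (- (2 * d * P$1$2))"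
  proof -
   have "matrix_inv (g ** g) ** \<sigma> = matrix_inv (g ** g) ** (\<sigma> ** (U (2 * d * P$1$2) ** U (- (2 * d * P$1$2))))"
    by (simp add: UU U0)
   also have "\<dots> = matrix_inv (g ** g) ** ((g ** g) ** \<sigma>) ** U (- (2 * d * P$1$2))"
    unfolding gg by (simp only: matrix_mul_assoc)
   also have "\<dots> = \<sigma> ** U (- (2 * d * P$1$2))"
    unfolding cancel[OF SL2R_mult[OF gS gS]] ..
   finally show ?thesis .
  qed
  ultimately show ?thesis using g(1) mult_in inv_in unfolding U_def by blast
 qed
qed

lemma slash_cusp_periodic:
 assumes \<sigma>: "\<sigma> : SL2R" "bdry_mobius \<sigma> None : cusps \<Gamma>"
 shows "EX w>0. ALL k f. modform \<Gamma> k f --> (ALL z:uhp. slash k f \<sigma> (z + of_real w) = slash k f \<sigma> z)"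
proof -
 obtain w T where w: "w > 0" "T : \<Gamma>" "T ** \<sigma> = \<sigma> ** vector [vector [1, w], vector [0, 1]]"
  using cusp_translation[OF \<sigma>] by blast
 define U :: "real^2^2" where "U = vector [vector [1, w], vector [0, 1]]"
 have US: "U : SL2R" by (simp add: U_def SL2R_def det_2)
 have Uz: "mobius U z = z + of_real w" "jfac U z = 1" for z by (simp_all add: mobius_def jfac_def U_def)
 have "slash k f \<sigma> (z + of_real w) = slash k f \<sigma> z" if f: "modform \<Gamma> k f" and z: "z : uhp" for k f z
 proof -
  have \<sigma>z: "mobius \<sigma> z : uhp" using mobius_uhp[OF \<sigma>(1) z] .
  have TS: "T : SL2R" using w in_SL2R by blast
  have "slash k f \<sigma> (z + of_real w) = slash k f (\<sigma> ** U) z"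
   using mobius_mult[OF \<sigma>(1) US z] jfac_mult[OF US z, of \<sigma>] by (simp add: slash_def Uz)
  also have "\<dots> = slash k f (T ** \<sigma>) z" using w(3) by (simp add: U_def)
  also have "\<dots> = jfac \<sigma> z powi (- k) * slash k f T (mobius \<sigma> z)"
   by (simp add: slash_def mobius_mult[OF TS \<sigma>(1) z] jfac_mult[OF \<sigma>(1) z] power_int_mult_distrib)
  also have "slash k f T (mobius \<sigma> z) = f (mobius \<sigma> z)" using f w(2) \<sigma>z by (simp add: modform_def)
  finally show ?thesis by (simp add: slash_def)
 qed
 with w(1) show ?thesis by blast
qed

lemma periodic_shift:
 assumes "!!z. z : uhp ==> u (z + of_real w) = u z" "z : uhp"
 shows "u (z + of_int n * of_real w) = (u z :: complex)"
proof -
 have nat: "u (z + of_nat n * of_real w) = u z" if "z : uhp" for n z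
 proof (induction n)
  case (Suc n)
  have "z + of_nat n * of_real w : uhp" using that by (simp add: uhp_def)
  from assms(1)[OF this] Suc show ?case by (simp add: algebra_simps)
 qed simp
 show ?thesis
 proof (cases "n >= 0")
  case True
  thus ?thesis using nat[OF assms(2), of "nat n"] by simp
 next
  case False
  define z' where "z' = z + of_int n * of_real w"
  have "z' : uhp" using assms(2) by (simp add: z'_def uhp_def)
  from nat[OF this, of "nat (- n)"] False show ?thesis by (simp add: z'_def)
 qed
qed

lemma cusp_bound:
 assumes f: "modform \<Gamma> k f" and s: "s : SL2R" "bdry_mobius s None : cusps \<Gamma>"
 shows "EX Y>0. EX M. ALL z. Y < Im z --> cmod (slash k f s z) <= M"
proof -
 obtain w where w: "w > 0" "!!z. z : uhp ==> slash k f s (z + of_real w) = slash k f s z"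
  using slash_cusp_periodic[OF s] f by blast
 have "bounded_at_i_inf (slash k f s)" using f s by (simp add: modform_def)
 then obtain Y M where YM: "Y > 0" "ALL t. Re t : {0..w} --> Y < Im t --> cmod (slash k f s t) <= M"
  unfolding bounded_at_i_inf_def by (meson compact_Icc)
 have "cmod (slash k f s z) <= M" if z: "Y < Im z" for z
 proof -
  define n where "n = \<lfloor>Re z / w\<rfloor>"
  define z' where "z' = z + of_int (- n) * of_real w"
  have zu: "z : uhp" using z YM(1) by (simp add: uhp_def)
  have "of_int n <= Re z / w" "Re z / w < of_int n + 1" unfolding n_def by linarith+
  hence "of_int n * w <= Re z" "Re z < (of_int n + 1) * w" using w(1) by (simp_all add: field_simps)
  hence "Re z' : {0..w}" "Im z' = Im z" by (simp_all add: z'_def algebra_simps)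
  hence "cmod (slash k f s z') <= M" using YM(2) z by simp
  moreover have "slash k f s z' = slash k f s z" unfolding z'_def by (rule periodic_shift[where u = "slash k f s", OF w(2) zu])
  ultimately show ?thesis by simp
 qed
 with YM(1) show ?thesis by blast
qed

text \<open>Near a maximum of \<open>|f|\<^sup>2 y\<^sup>k\<close> the height can be replaced by the modulus
of the holomorphic function \<open>z - \<zeta>\<close>, where \<open>\<zeta>\<close> is the complex
conjugate of the maximum; the maximum modulus principle applies.\<close>

lemma modform_negative:
 assumes f: "modform \<Gamma> k f" and k: "k < 0" shows "f = 0"
proof (rule ccontr)
 assume "f ~= 0"
 have hf: "holo_uhp f" using f by (simp add: modform_def)
 obtain z1 where z1: "z1 : uhp" "f z1 ~= 0"
  using \<open>f ~= 0\<close> hf by (fastforce simp: holo_uhp_def fun_eq_iff)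
 have "EX z0:uhp. ALL z:uhp. petersson k f z <= petersson k f z0"
 proof (rule max_attained[OF cont_petersson[OF hf] petersson_invariant[OF f] _ z1(1)])
  show "0 < petersson k f z1" using z1 by (simp add: petersson_def uhp_def)
  fix s and e :: real assume s: "s : SL2R" "bdry_mobius s None : cusps \<Gamma>" and e: "0 < e"
  obtain Y M where YM: "Y > 0" "!!z. Y < Im z ==> cmod (slash k f s z) <= M" using cusp_bound[OF f s] by blast
  show "EX Y>0. ALL z. Y < Im z --> petersson k f (mobius s z) < e"
  proof (intro exI[of _ "max Y (max 1 ((M\<^sup>2 + 1) / e))"] conjI allI impI)
   fix z assume z: "max Y (max 1 ((M\<^sup>2 + 1) / e)) < Im z"
   hence zu: "z : uhp" by (simp add: uhp_def)
   have "petersson k f (mobius s z) = (cmod (slash k f s z))\<^sup>2 * Im z powi k"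
    using petersson_mobius[OF s(1) zu] by (simp add: petersson_def)
   also have "\<dots> <= M\<^sup>2 * Im z powi (-1)"
    using YM(2)[of z] z k by (intro mult_mono power_mono power_int_increasing) auto
   also have "\<dots> < e"
   proof -
    have "(M\<^sup>2 + 1) < e * Im z" using z e by (simp add: field_simps)
    hence "M\<^sup>2 < e * Im z" by simp
    thus ?thesis using z by (simp add: power_int_minus field_simps)
   qed
   finally show "petersson k f (mobius s z) < e" .
  qed (use YM in simp)
 qed
 then obtain z0 where z0: "z0 : uhp" "!!z. z : uhp ==> petersson k f z <= petersson k f z0" by blast
 define M where "M = petersson k f z0"
 have "0 < petersson k f z1" using z1 by (simp add: petersson_def uhp_def)
 hence M: "M > 0" using z0(2)[OF z1(1)] by (simp add: M_def)
 have i0: "Im z0 > 0" using z0(1) by (simp add: uhp_def)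
 define G where "G z = f z * (z - cnj z0) powi k" for z
 have nz: "z - cnj z0 ~= 0" if "z : uhp" for z
 by (smt (verit, best) cnj.simps(2) eq_iff_diff_eq_0 mem_Collect_eq that uhp_def z0(1))
 have hG: "G holomorphic_on uhp" unfolding G_def
  using hf nz by (auto simp: holo_uhp_def intro!: holomorphic_intros)
 have G2: "(cmod (G z))\<^sup>2 = (cmod (f z))\<^sup>2 * ((cmod (z - cnj z0))\<^sup>2) powi k" for z
  by (simp add: G_def norm_mult norm_power_int power_mult_distrib power_int_power power_int_power' mult.commute)
 have pet: "(cmod (f z))\<^sup>2 * (4 * Im z * Im z0) powi k = petersson k f z * (4 * Im z0) powi k" for z
  by (simp add: petersson_def power_int_mult_distrib mult_ac)
 have le: "(cmod (f z))\<^sup>2 * (4 * Im z * Im z0) powi k <= (cmod (G z0))\<^sup>2" if "z : uhp" for z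
 proof -
  have "(cmod (G z0))\<^sup>2 = M * (4 * Im z0) powi k"
   unfolding G2 norm_diff_cnj M_def using pet[of z0] by simp
  thus ?thesis unfolding pet M_def using z0(2)[OF that] i0 by (simp add: mult_right_mono)
 qed
 have "G constant_on uhp"
 proof (rule maximum_modulus_principle[OF hG open_uhp _ open_uhp order_refl z0(1)])
  show "connected uhp" unfolding uhp_def by (intro convex_connected convex_halfspace_Im_gt)
  fix z assume z: "z : uhp"
  have "(cmod (G z))\<^sup>2 <= (cmod (f z))\<^sup>2 * (4 * Im z * Im z0) powi k"
   unfolding G2 norm_diff_cnj using z i0 k
   by (intro mult_left_mono power_int_antimono_base) (auto simp: uhp_def)
  with le[OF z] have "(cmod (G z))\<^sup>2 <= (cmod (G z0))\<^sup>2" by linarith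
  thus "cmod (G z) <= cmod (G z0)" by (rule power2_le_imp_le) simp
 qed
 then obtain c where c: "!!z. z : uhp ==> G z = c" by (auto simp: constant_on_def)
 define z where "z = z0 + 1"
 have z: "z : uhp" using z0(1) by (simp add: z_def uhp_def)
 have G0: "G z0 ~= 0" using M nz[OF z0(1)] by (auto simp: G_def M_def petersson_def)
 have "G z = G z0" using c z z0(1) by simp
 with G0 have fz: "f z ~= 0" by (auto simp: G_def)
 have "(cmod (G z))\<^sup>2 < (cmod (f z))\<^sup>2 * (4 * Im z * Im z0) powi k"
  unfolding G2 norm_diff_cnj using z i0 k fz
  by (intro mult_strict_left_mono power_int_strict_antimono_base) (auto simp: uhp_def z_def)
 with le[OF z] \<open>G z = G z0\<close> show False by simp
qed

lemma modform_top:
 assumes Q: "qm_coeffs \<Gamma> k f Q" and top: "!!m. m > s ==> Q m = 0"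
 shows "modform \<Gamma> (k - 2 * int s) (Q s)"
 unfolding modform_def
proof (intro conjI ballI impI)
 show "holo_uhp (Q s)" by (rule qm_coeffs_holo[OF Q])
 obtain t where t: "ALL s'>=t. ALL g:\<Gamma>. ALL z:uhp. slash (k - 2 * int s) (Q s) g z =
   (\<Sum>r\<le>s'. Xfac g z ^ r * (of_nat ((s + r) choose s) * Q (s + r) z))"
  using qm_coeffs_expansion[OF qm_coeffs_Q[OF Q]] by blast
 fix g z assume g: "g : \<Gamma>" "z : uhp"
 have "slash (k - 2 * int s) (Q s) g z = (\<Sum>r\<le>t. Xfac g z ^ r * (of_nat ((s + r) choose s) * Q (s + r) z))"
  using t g by blast
 also have "\<dots> = (\<Sum>r\<in>{0}. Xfac g z ^ r * (of_nat ((s + r) choose s) * Q (s + r) z))"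
 proof (rule sum.mono_neutral_right)
  show "ALL r:{..t} - {0}. Xfac g z ^ r * (of_nat ((s + r) choose s) * Q (s + r) z) = 0"
  by (simp add: top)
 qed auto
 finally show "slash (k - 2 * int s) (Q s) g z = Q s z" by simp
qed (rule qm_coeffs_bounded[OF Q])

lemma qm_coeffs_top:
 assumes Q: "qm_coeffs \<Gamma> k f Q" and m: "k < 2 * int m" shows "Q m = 0"
proof (rule ccontr)
 assume nz: "Q m ~= 0"
 obtain s where s: "ALL m>s. Q m = 0" using qm_coeffs_expansion[OF Q] by blast
 define S where "S = {m. Q m ~= 0}"
 have "S <= {..s}" using s by (auto simp: S_def not_le[symmetric])
 hence fin: "finite S" by (rule finite_subset) simp
 define t where "t = Max S"
 have mS: "m : S" using nz by (simp add: S_def)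
 hence t: "Q t ~= 0" "m <= t" using Max_in[OF fin] Max_ge[OF fin mS] by (auto simp: t_def S_def)
 have "Q j = 0" if "j > t" for j
 using Max_ge S_def fin linorder_not_le t_def that by blast
 from modform_top[OF Q this] have "modform \<Gamma> (k - 2 * int t) (Q t)" .
 from modform_negative[OF this] t m show False by simp
qed

lemma QM_negative: assumes "f : QM \<Gamma> k" "k < 0" shows "f = 0"
using QM_def assms(1,2) qm_coeffs_Q0 qm_coeffs_top by fastforce

end

section \<open>Finite-dimensionality of spaces of modular forms\<close>

subsection \<open>Linear algebra\<close>

definition fin_dim :: "('a::field => 'b::ab_group_add => 'b) => 'b set => bool" where
 "fin_dim sc W \<longleftrightarrow> (EX B. finite B & W = Modules.module.span sc B)"

context vector_space
begin

lemma fin_dim_zero: "fin_dim scale {0}"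
 unfolding fin_dim_def by (intro exI[of _ "{}"]) simp

lemma fin_dim_subspace_of:
 assumes "subspace U" "U <= W" "fin_dim scale W" shows "fin_dim scale U"
proof -
 obtain B where B: "finite B" "W = span B" using assms(3) by (auto simp: fin_dim_def)
 obtain A where A: "A <= U" "independent A" "U <= span A" using maximal_independent_subset by blast
 have "finite A" using independent_span_bound[OF B(1) A(2)] A(1) assms(2) B(2) by auto
 moreover have "U = span A" using A assms(1) span_minimal by blast
 ultimately show ?thesis unfolding fin_dim_def by blast
qed

lemma fin_dim_functional:
 assumes W: "subspace W" and ker: "fin_dim scale {x\<in>W. l x = (0::'a)}"
  and add: "!!x y. x : W ==> y : W ==> l (x + y) = l x + l y"
  and scl: "!!c x. x : W ==> l (scale c x) = c * l x"
 shows "fin_dim scale W"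
proof (cases "EX e:W. l e ~= 0")
 case False
 hence "{x\<in>W. l x = 0} = W" by auto
 with ker show ?thesis by simp
next
 case True
 then obtain e where e: "e : W" "l e ~= 0" by blast
 obtain B where B: "finite B" "{x\<in>W. l x = 0} = span B" using ker by (auto simp: fin_dim_def)
 have "W = span (insert e B)"
 proof
  have "insert e B <= W" using e B span_superset by blast
  thus "span (insert e B) <= W" using W span_minimal by blast
  show "W <= span (insert e B)"
  proof
   fix x assume x: "x : W"
   define c where "c = - (l x / l e)"
   have ce: "scale c e : W" using W e subspace_scale by blast
   have "x + scale c e : W" using W x ce subspace_add by blast
   moreover have "l (x + scale c e) = l x + c * l e" by (simp only: add[OF x ce] scl[OF e(1)])
   hence "l (x + scale c e) = 0" using e(2) by (simp add: c_def)
   ultimately have "x + scale c e : span B" using B(2) \<open>l (x + scale c e) = 0\<close> by blast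
   hence "x + scale c e : span (insert e B)" using span_mono[of B "insert e B"] by blast
   moreover have "scale c e : span (insert e B)" by (simp add: span_base span_scale)
   ultimately have "(x + scale c e) - scale c e : span (insert e B)" by (rule span_diff)
   thus "x : span (insert e B)" by simp
  qed
 qed
 thus ?thesis using B(1) unfolding fin_dim_def by blast
qed

lemma fin_dim_functionals:
 assumes "finite I" and "subspace W"
  and "!!i x y. i : I ==> x : W ==> y : W ==> l i (x + y) = l i x + l i y"
  and "!!i c x. i : I ==> x : W ==> l i (scale c x) = c * l i x"
  and "fin_dim scale {x\<in>W. ALL i:I. l i x = (0::'a)}"
 shows "fin_dim scale W"
 using assms
proof (induction I arbitrary: W rule: finite_induct)
 case (insert i I)
 let ?W = "{x\<in>W. l i x = 0}"
 have l0: "l i 0 = 0" using insert.prems(3)[of i 0 0] insert.prems(1) by (simp add: subspace_0)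
 have sub: "subspace ?W"
  unfolding subspace_def using insert.prems(1,2,3) l0 by (auto simp: subspace_0 subspace_add subspace_scale)
 have "{x\<in>?W. ALL i:I. l i x = 0} = {x\<in>W. ALL i:insert i I. l i x = 0}" by auto
 hence "fin_dim scale ?W"
  using insert.IH[OF sub] insert.prems by auto
 thus ?case using fin_dim_functional[of W "l i"] insert.prems by simp
qed simp

lemma fin_dim_rank:
 assumes W: "subspace W" and W': "fin_dim scale W'" and im: "T ` W <= W'" and ker: "fin_dim scale {x\<in>W. T x = 0}"
  and add: "!!x y. x : W ==> y : W ==> T (x + y) = T x + T y"
  and scl: "!!c x. x : W ==> T (scale c x) = scale c (T x)"
 shows "fin_dim scale W"
proof -
 have T0: "T 0 = 0" using scl[OF subspace_0[OF W], of 0] by simp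
 have "subspace (T ` W)" unfolding subspace_def
 proof (intro conjI ballI allI)
  show "0 : T ` W" using T0 subspace_0[OF W] by (metis image_eqI)
  fix u assume "u : T ` W"
  then obtain x where x: "x : W" "u = T x" by blast
  show "scale c u : T ` W" for c using scl[OF x(1), of c] subspace_scale[OF W x(1)] x(2) by (metis image_eqI)
  fix v assume "v : T ` W"
  then obtain y where y: "y : W" "v = T y" by blast
  show "u + v : T ` W" using add[OF x(1) y(1)] subspace_add[OF W x(1) y(1)] x y by (metis image_eqI)
 qed
 from fin_dim_subspace_of[OF this im W'] obtain B where B: "finite B" "T ` W = span B" by (auto simp: fin_dim_def)
 have "EX x:W. T x = b" if "b : B" for b
 proof -
  have "b : T ` W" unfolding B(2) using that by (rule span_base)
  thus ?thesis by blast
 qed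
 hence "ALL b:B. EX x:W. T x = b" by blast
 then obtain p where p: "!!b. b : B ==> p b : W" "!!b. b : B ==> T (p b) = b" by metis
 obtain K where K: "finite K" "{x\<in>W. T x = 0} = span K" using ker by (auto simp: fin_dim_def)
 have lift: "EX x:span (p ` B). x : W & T x = u" if "u : span B" for u
  using that
 proof (induction rule: span_induct_alt)
  case base
  thus ?case using T0 subspace_0[OF W] span_zero by blast
 next
  case (step c b y)
  then obtain x where x: "x : span (p ` B)" "x : W" "T x = y" by blast
  have pc: "scale c (p b) : W" using W p step subspace_scale by blast
  have "T (scale c (p b) + x) = scale c b + y" using x pc p step by (simp add: add scl)
  moreover have "scale c (p b) + x : W" using W pc x subspace_add by blast
  moreover have "scale c (p b) + x : span (p ` B)" using span_add[OF span_scale[OF span_base[of "p b" "p ` B"]] x(1)] step(1) by blast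
  ultimately show ?case by blast
 qed
 have "W = span (p ` B \<union> K)"
 proof
  have "p ` B \<union> K <= W" using p K(2) span_superset[of K] by blast
  thus "span (p ` B \<union> K) <= W" using W span_minimal by blast
  show "W <= span (p ` B \<union> K)"
  proof
   fix x assume x: "x : W"
   then obtain y where y: "y : span (p ` B)" "y : W" "T y = T x" using lift[of "T x"] B(2) by blast
   have my: "scale (-1) y : W" using W y subspace_scale by blast
   have "T (x + scale (-1) y) = T x + scale (-1) (T y)" by (simp only: add[OF x my] scl[OF y(2)])
   hence Txy: "T (x + scale (-1) y) = 0" by (simp add: y(3))
   moreover have "x + scale (-1) y : W" using W x my subspace_add by blast
   ultimately have "x + scale (-1) y : span K" using K(2) Txy by blast
   hence "x + scale (-1) y : span (p ` B \<union> K)" "y : span (p ` B \<union> K)"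
    using y span_mono[of K "p ` B \<union> K"] span_mono[of "p ` B" "p ` B \<union> K"] by blast+
   hence "(x + scale (-1) y) + y : span (p ` B \<union> K)" by (rule span_add)
   thus "x : span (p ` B \<union> K)" by simp
  qed
 qed
 thus ?thesis using B(1) K(1) unfolding fin_dim_def by (metis finite_Un finite_imageI)
qed

end

lemma vector_space_fscale: "vector_space smul ==> vector_space (fscale smul)"
 unfolding vector_space_def fscale_def by (auto simp: fun_eq_iff)

lemma vector_space_mult: "vector_space ((*) :: complex => complex => complex)"
 by (simp add: vector_space_def algebra_simps)

interpretation cfun: vector_space "fscale ((*) :: complex => complex => complex)"
 by (rule vector_space_fscale[OF vector_space_mult])

subsection \<open>Taylor coefficients and a Schwarz lemma\<close>

definition divided_diff :: "complex => (complex => complex) => complex => complex" where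
 "divided_diff p g z = (if z = p then deriv g p else (g z - g p) / (z - p))"

text \<open>Taylor coefficients as iterated divided differences, for which a zero of order \<open>N\<close>
factors out by mere algebra.\<close>

definition taylor_coeff :: "complex => nat => (complex => complex) => complex" where
 "taylor_coeff p n g = (divided_diff p ^^ n) g p"

lemma holo_divided_diff: "g holomorphic_on S ==> open S ==> divided_diff p g holomorphic_on S"
 unfolding divided_diff_def by (rule pole_lemma_open)

lemma holo_divided_diffs: "g holomorphic_on S ==> open S ==> (divided_diff p ^^ n) g holomorphic_on S"
 by (induction n) (simp_all add: holo_divided_diff)

lemma holo_differentiable: "g holomorphic_on S ==> open S ==> p : S ==> g field_differentiable at p"
 by (rule holomorphic_on_imp_differentiable_at)

lemma divided_diff_add:
 "u field_differentiable at p ==> v field_differentiable at p ==>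
  divided_diff p (%z. u z + v z) = (%z. divided_diff p u z + divided_diff p v z)"
 by (auto simp: divided_diff_def fun_eq_iff add_divide_distrib diff_divide_distrib)

lemma divided_diff_cmult:
 "u field_differentiable at p ==> divided_diff p (%z. c * u z) = (%z. c * divided_diff p u z)"
 by (auto simp: divided_diff_def fun_eq_iff right_diff_distrib)

lemma divided_diff_cong:
 assumes "open S" "p : S" "!!z. z : S ==> u z = v z" "z : S"
 shows "divided_diff p u z = divided_diff p v z"
proof -
 have "deriv u p = deriv v p"
  using assms(1-3) by (intro deriv_cong_ev) (auto simp: eventually_nhds)
 with assms show ?thesis by (simp add: divided_diff_def)
qed

lemma taylor_coeff_add:
 assumes "g holomorphic_on S" "h holomorphic_on S" "open S" "p : S"
 shows "taylor_coeff p n (%z. g z + h z) = taylor_coeff p n g + taylor_coeff p n h"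
proof -
 have "(divided_diff p ^^ n) (%z. g z + h z) = (%z. (divided_diff p ^^ n) g z + (divided_diff p ^^ n) h z)"
 proof (induction n)
  case (Suc n)
  have "(divided_diff p ^^ n) g field_differentiable at p" "(divided_diff p ^^ n) h field_differentiable at p"
   using assms holo_differentiable[OF holo_divided_diffs] by blast+
  thus ?case using Suc by (simp add: divided_diff_add)
 qed simp
 thus ?thesis by (simp add: taylor_coeff_def)
qed

lemma taylor_coeff_cmult:
 assumes "g holomorphic_on S" "open S" "p : S"
 shows "taylor_coeff p n (%z. c * g z) = c * taylor_coeff p n g"
proof -
 have "(divided_diff p ^^ n) (%z. c * g z) = (%z. c * (divided_diff p ^^ n) g z)"
 proof (induction n)
  case (Suc n)
  have "(divided_diff p ^^ n) g field_differentiable at p"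
   using assms holo_differentiable[OF holo_divided_diffs] by blast
  thus ?case using Suc by (simp add: divided_diff_cmult)
 qed simp
 thus ?thesis by (simp add: taylor_coeff_def)
qed

lemma taylor_coeff_cong:
 assumes "open S" "p : S" "!!z. z : S ==> g z = h z"
 shows "taylor_coeff p n g = taylor_coeff p n h"
proof -
 have "ALL z:S. (divided_diff p ^^ n) g z = (divided_diff p ^^ n) h z"
 proof (induction n)
  case (Suc n)
  thus ?case using divided_diff_cong[OF assms(1,2), of "(divided_diff p ^^ n) g" "(divided_diff p ^^ n) h"] by simp
 qed (use assms in simp)
 thus ?thesis using assms(2) by (simp add: taylor_coeff_def)
qed

lemma vanishing_factor:
 assumes "!!n. n < N ==> taylor_coeff p n g = 0"
 shows "g z = (z - p) ^ N * (divided_diff p ^^ N) g z"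
 using assms
proof (induction N)
 case (Suc N)
 have "(divided_diff p ^^ N) g p = 0" using Suc.prems[of N] by (simp add: taylor_coeff_def)
 hence "(divided_diff p ^^ N) g z = (z - p) * (divided_diff p ^^ Suc N) g z" by (simp add: divided_diff_def)
 moreover have "g z = (z - p) ^ N * (divided_diff p ^^ N) g z" using Suc.IH Suc.prems by simp
 ultimately show ?case by simp
qed simp

lemma schwarz_vanishing:
 assumes g: "g holomorphic_on S" "open S" "cball p R <= S" and R: "R > 0"
  and van: "!!n. n < N ==> taylor_coeff p n g = 0"
  and B: "!!z. cmod (z - p) = R ==> cmod (g z) <= B" and w: "cmod (w - p) <= R"
 shows "cmod (g w) <= B * (cmod (w - p) / R) ^ N"
proof -
 define h where "h = (divided_diff p ^^ N) g"
 have hh: "h holomorphic_on S" unfolding h_def using g by (intro holo_divided_diffs)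
 have gh: "g z = (z - p) ^ N * h z" for z unfolding h_def by (rule vanishing_factor[OF van])
 have "cmod (h w) <= B / R ^ N"
 proof (rule maximum_modulus_frontier[of h "cball p R"])
  show "h holomorphic_on interior (cball p R)" using hh g(3) interior_subset by (meson holomorphic_on_subset order_trans)
  show "continuous_on (closure (cball p R)) h"
   using hh g(3) by (simp add: holomorphic_on_imp_continuous_on holomorphic_on_subset)
  fix z assume "z : frontier (cball p R)"
  hence z: "cmod (z - p) = R" using R by (simp add: dist_norm norm_minus_commute)
  hence "cmod (h z) * R ^ N = cmod (g z)" unfolding gh[of z] by (simp add: norm_mult norm_power mult.commute)
  with B[OF z] R show "cmod (h z) <= B / R ^ N" by (simp add: field_simps)
 qed (use w in \<open>auto simp: dist_norm norm_minus_commute\<close>)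
 hence "cmod (w - p) ^ N * cmod (h w) <= cmod (w - p) ^ N * (B / R ^ N)" by (rule mult_left_mono) simp
 thus ?thesis unfolding gh[of w] by (simp add: norm_mult norm_power power_divide mult.commute)
qed

subsection \<open>The expansion at a cusp\<close>

definition qparam :: "real => complex => complex" where
 "qparam w z = exp (2 * of_real pi * \<i> * z / of_real w)"

lemma norm_qparam: "cmod (qparam w z) = exp (- (2 * pi * Im z / w))"
 by (simp add: qparam_def norm_exp_eq_Re)

lemma qparam_surj:
 assumes "w > 0" "q ~= 0" "cmod q < 1" shows "EX z:uhp. q = qparam w z"
proof (intro bexI)
 define z where "z = of_real w * Ln q / (2 * of_real pi * \<i>)"
 show "q = qparam w z" using assms by (simp add: qparam_def z_def)
 have "ln (cmod q) < 0" using assms by simp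
 moreover have "Im z = - (w * ln (cmod q) / (2 * pi))"
  using assms by (simp add: z_def Im_divide Re_Ln power2_eq_square field_simps)
 ultimately show "z : uhp" using assms(1) by (simp add: uhp_def mult_pos_neg divide_neg_pos)
qed

text \<open>A bounded periodic function factors through \<open>q = exp(2\<pi>iz/w)\<close>. Two branches of
the logarithm cover the punctured disc, and the singularity at zero is removable.\<close>

lemma qparam_expansion:
 assumes u: "u holomorphic_on uhp" and w: "w > 0" and per: "!!z. z : uhp ==> u (z + of_real w) = u z"
  and bd: "!!z. Y < Im z ==> cmod (u z) <= M"
 shows "EX g. g holomorphic_on ball 0 1 & (ALL z:uhp. u z = g (qparam w z))"
proof -
 define L where "L a = of_real w * a / (2 * of_real pi * \<i>)" for a :: complex
 have ImL: "Im (L a) = - (w * Re a / (2 * pi))" for a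
  by (simp add: L_def Im_divide power2_eq_square field_simps)
 have Lu: "L a : uhp" if "Re a < 0" for a
  using that w unfolding uhp_def mem_Collect_eq ImL by (simp add: mult_pos_neg divide_neg_pos)
 have shift: "u (z + of_int n * of_real w) = u z" if "z : uhp" for z n
 proof -
  have nat: "u (z + of_nat n * of_real w) = u z" if "z : uhp" for n z
  proof (induction n)
   case (Suc n)
   have "z + of_nat n * of_real w : uhp" using that by (simp add: uhp_def)
   from per[OF this] Suc show ?case by (simp add: algebra_simps)
  qed simp
  show ?thesis
  proof (cases "n >= 0")
   case True
   thus ?thesis using nat[OF that, of "nat n"] by simp
  next
   case False
   define z' where "z' = z + of_int n * of_real w"
   have "z' : uhp" using that by (simp add: z'_def uhp_def)
   from nat[OF this, of "nat (- n)"] False show ?thesis by (simp add: z'_def)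
  qed
 qed
 have same: "u (L a) = u (L b)" if ab: "exp a = exp b" and b: "Re b < 0" for a b
 proof -
  obtain n :: int where "a = b + (of_int (2 * n) * pi) * \<i>" using ab unfolding exp_eq by blast
  hence "L a = L b + of_int n * of_real w" by (simp add: L_def field_simps)
  thus ?thesis using shift[OF Lu[OF b]] by simp
 qed
 define h where "h q = u (L (Ln q))" for q
 have hq: "h q = u (L a)" if "q = exp a" "Re a < 0" for q a
  unfolding h_def by (rule same) (use that in auto)
 have holL: "(%q. u (L (f q))) holomorphic_on A" if "f holomorphic_on A" "!!q. q : A ==> Re (f q) < 0" for f A
 proof -
  have "(u \<circ> (%q. L (f q))) holomorphic_on A"
  proof (rule holomorphic_on_compose_gen[OF _ u])
   show "(%q. L (f q)) holomorphic_on A" unfolding L_def by (intro holomorphic_intros that) simp_all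
   show "(%q. L (f q)) ` A <= uhp" using Lu that by auto
  qed
  thus ?thesis by (simp add: o_def)
 qed
 have "h holomorphic_on ((ball 0 1 - {0}) - \<real>\<^sub>\<le>\<^sub>0)" unfolding h_def
  by (rule holL) (auto intro!: holomorphic_intros simp: Re_Ln)
 moreover have "h holomorphic_on ((ball 0 1 - {0}) - \<real>\<^sub>\<ge>\<^sub>0)"
 proof (rule holomorphic_transform)
  show "(%q. u (L (Ln (- q) + of_real pi * \<i>))) holomorphic_on ((ball 0 1 - {0}) - \<real>\<^sub>\<ge>\<^sub>0)"
   by (rule holL) (auto intro!: holomorphic_intros simp: Re_Ln complex_nonpos_Reals_iff complex_nonneg_Reals_iff)
  fix q :: complex assume q: "q : (ball 0 1 - {0}) - \<real>\<^sub>\<ge>\<^sub>0"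
  show "u (L (Ln (- q) + of_real pi * \<i>)) = h q"
   using q by (intro hq[symmetric]) (auto simp: exp_add Re_Ln)
 qed
 ultimately have "h holomorphic_on (((ball 0 1 - {0}) - \<real>\<^sub>\<le>\<^sub>0) \<union> ((ball 0 1 - {0}) - \<real>\<^sub>\<ge>\<^sub>0))"
  by (intro holomorphic_on_Un) (auto intro!: open_Diff)
 moreover have "((ball 0 1 - {0}) - \<real>\<^sub>\<le>\<^sub>0) \<union> ((ball 0 1 - {0}) - \<real>\<^sub>\<ge>\<^sub>0) = ball 0 1 - {0::complex}"
  by (auto simp: complex_nonpos_Reals_iff complex_nonneg_Reals_iff complex_eq_iff)
 ultimately have hol: "h holomorphic_on (ball 0 1 - {0})" by simp
 define Y' where "Y' = max Y 1"
 have "\<forall>\<^sub>F q in at 0. cmod (h q) <= M"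
  unfolding eventually_at
 proof (intro exI[of _ "exp (- (2 * pi * Y' / w))"] conjI ballI impI)
  fix q :: complex assume q: "q ~= 0 & dist q 0 < exp (- (2 * pi * Y' / w))"
  have "ln (cmod q) < - (2 * pi * Y' / w)"
   using q by (metis dist_0_norm dist_commute exp_less_cancel_iff exp_ln zero_less_norm_iff)
  hence "w * (2 * pi * Y' / w) < w * (- ln (cmod q))" using w by (intro mult_strict_left_mono) auto
  hence "Y' < Im (L (Ln q))" using w q by (simp add: ImL Re_Ln field_simps)
  thus "cmod (h q) <= M" unfolding h_def using bd by (simp add: Y'_def)
 qed simp
 then obtain g where g: "g holomorphic_on ball 0 1" "!!q. q : ball 0 1 - {0} ==> g q = h q"
  using holomorphic_on_extend_bounded[OF hol] by auto
 have "u z = g (qparam w z)" if z: "z : uhp" for z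
 proof -
  have "0 < Im z" using z by (simp add: uhp_def)
  define a where "a = 2 * of_real pi * \<i> * z / of_real w"
  have Ra: "Re a < 0" using \<open>0 < Im z\<close> w by (simp add: a_def)
  have "L a = z" using w by (simp add: L_def a_def)
  moreover have "cmod (qparam w z) < 1" unfolding norm_qparam using \<open>0 < Im z\<close> w by simp
  moreover have "qparam w z = exp a" by (simp add: qparam_def a_def)
  ultimately show ?thesis using g(2)[of "qparam w z"] hq[of "qparam w z" a] Ra by simp
 qed
 with g(1) show ?thesis by blast
qed

lemma qparam_unique:
 assumes g: "g holomorphic_on ball 0 1" and h: "h holomorphic_on ball 0 1" and w: "w > 0"
  and eq: "!!z. z : uhp ==> g (qparam w z) = h (qparam w z)" and q: "q : ball 0 1"
 shows "g q = h q"
proof (cases "q = 0")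
 case False
 with q obtain z where "z : uhp" "q = qparam w z" using qparam_surj[OF w] by auto
 with eq show ?thesis by simp
next
 case True
 have ne: "\<forall>\<^sub>F x in at 0. h x = g x"
  unfolding eventually_at
 proof (intro exI[of _ 1] conjI ballI impI)
  fix x :: complex assume "x ~= 0 & dist x 0 < 1"
  then obtain z where "z : uhp" "x = qparam w z" using qparam_surj[OF w, of x] by auto
  with eq show "h x = g x" by simp
 qed simp
 have "isCont g 0" "isCont h 0"
  using holo_differentiable[OF g, of 0] holo_differentiable[OF h, of 0]
  by (simp_all add: field_differentiable_imp_continuous_at)
 hence "(g \<longlongrightarrow> g 0) (at 0)" "(h \<longlongrightarrow> h 0) (at 0)" by (simp_all add: isCont_def)
 moreover from this(2) ne have "(g \<longlongrightarrow> h 0) (at 0)" by (rule Lim_transform_eventually)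
 ultimately show ?thesis using True tendsto_unique[of "at (0::complex)" g] by simp
qed

context first_kind
begin

lemma modform_subspace: "cfun.subspace {f. modform \<Gamma> k f}"
 unfolding cfun.subspace_def
proof (intro conjI ballI allI)
 have "slash k 0 g = (%z. 0)" for g by (simp add: slash_def fun_eq_iff)
 thus "0 : {f. modform \<Gamma> k f}"
  using holo_uhp_zero bounded_at_i_inf_const[of 0] by (simp add: modform_def zero_fun_def[symmetric])
 fix f assume f: "f : {f. modform \<Gamma> k f}"
 have fs: "fscale (*) c f = (%z. c * f z)" for c by (simp add: fscale_def)
 show "fscale (*) c f : {f. modform \<Gamma> k f}" for c
  using f unfolding fs by (simp add: modform_def slash_cmult holo_uhp_cmult bounded_at_i_inf_cmult)
 fix h assume h: "h : {f. modform \<Gamma> k f}"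
 have "f + h = (%z. f z + h z)" by (simp add: fun_eq_iff)
 thus "f + h : {f. modform \<Gamma> k f}"
  using f h by (simp add: modform_def slash_add holo_uhp_add bounded_at_i_inf_add)
qed

definition translates :: "complex set => complex set" where
 "translates U = (\<Union>g\<in>\<Gamma>. mobius g ` U)"

lemma translates:
 assumes "open U" "U <= uhp"
 shows "open (translates U)" "translates U <= uhp" "invariant (translates U)" "U <= translates U"
proof -
 show "open (translates U)" unfolding translates_def using open_mobius_image[OF in_SL2R assms] by auto
 show "translates U <= uhp" using mobius_in assms(2) by (auto simp: translates_def)
 show "invariant (translates U)" unfolding invariant_def
 proof (intro ballI)
  fix g z assume g: "g : \<Gamma>" "z : translates U"
  then obtain h w where h: "h : \<Gamma>" "w : U" "z = mobius h w" by (auto simp: translates_def)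
  hence "mobius g z = mobius (g ** h) w" using mobius_mult in_SL2R g assms(2) by (simp add: subset_iff)
  thus "mobius g z : translates U" using mult_in[OF g(1) h(1)] h(2) by (auto simp: translates_def)
 qed
 show "U <= translates U"
 proof
  fix z assume "z : U"
  hence "mobius (mat 1) z : translates U" using one_in by (auto simp: translates_def simp del: mobius_one)
  thus "z : translates U" by simp
 qed
qed

text \<open>A single cusp already suffices to reach every point, because horoballs of all sizes occur among
the images of \<open>{z. 2 < Im z}\<close>; compactness then selects finitely many of them.\<close>

lemma horoball_cover:
 assumes "cusps \<Gamma> ~= {}"
 shows "EX \<Sigma>. finite \<Sigma> & \<Sigma> <= {\<sigma>\<in>SL2R. bdry_mobius \<sigma> None : cusps \<Gamma>} &
  (ALL z:uhp. EX \<sigma>:\<Sigma>. z : translates (mobius \<sigma> ` {z. 2 < Im z}))"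
proof -
 define C where "C \<sigma> = translates (mobius \<sigma> ` {z. 2 < Im z})" for \<sigma>
 define S where "S = {\<sigma>\<in>SL2R. bdry_mobius \<sigma> None : cusps \<Gamma>}"
 have H: "open {z. 2 < Im z}" "{z. 2 < Im z} <= uhp" by (auto simp: uhp_def open_halfspace_Im_gt)
 have Hs: "open (mobius \<sigma> ` {z. 2 < Im z})" "mobius \<sigma> ` {z. 2 < Im z} <= uhp" if "\<sigma> : S" for \<sigma>
  using open_mobius_image[OF _ H] mobius_uhp H(2) that by (auto simp: S_def)
 have "EX \<F><=C ` S. finite \<F> & uhp <= \<Union>\<F>"
 proof (rule finite_subcover)
  fix A assume "A : C ` S"
  thus "open A & A <= uhp & invariant A" using translates(1-3)[OF Hs] by (auto simp: C_def)
 next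
  fix z assume z: "z : uhp"
  obtain s where s: "s : cusps \<Gamma>" using assms by blast
  obtain \<sigma> where \<sigma>: "\<sigma> : SL2R" "bdry_mobius \<sigma> None = s" using exists_scaling by blast
  \<comment> \<open>after rescaling, the horoball at this one cusp reaches down to the given point\<close>
  define w where "w = mobius (matrix_inv \<sigma>) z"
  have w: "w : uhp" "mobius \<sigma> w = z"
   using mobius_uhp[OF SL2R_inv(3)[OF \<sigma>(1)] z] mobius_mult[OF \<sigma>(1) SL2R_inv(3)[OF \<sigma>(1)] z] SL2R_inv[OF \<sigma>(1)]
   by (simp_all add: w_def)
  define d where "d = 2 / sqrt (Im w)"
  have d: "d > 0" "d\<^sup>2 * Im w = 4" using w(1) by (simp_all add: d_def uhp_def power_divide)
  define t :: "real^2^2" where "t = vector [vector [1 / d, 0], vector [0, d]]"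
  have t: "t : SL2R" "t$2$1 = 0" using d by (simp_all add: t_def SL2R_def det_2)
  define x where "x = of_real (d\<^sup>2) * w"
  have x: "2 < Im x" "x : uhp" using d by (simp_all add: x_def uhp_def)
  have "mobius t x = w" using d(1) by (simp add: mobius_def jfac_def t_def x_def power2_eq_square)
  hence "z = mobius (\<sigma> ** t) x" using mobius_mult[OF \<sigma>(1) t(1) x(2)] w(2) by simp
  moreover have "\<sigma> ** t : S"
   using \<sigma> s t by (simp add: S_def SL2R_mult bdry_mobius_mult) (simp add: bdry_mobius_def)
  ultimately show "EX A:C ` S. z : A" using translates(4)[OF Hs] x(1) by (auto simp: C_def)
 next
  fix s assume s: "s : cusps \<Gamma>"
  obtain \<sigma> where \<sigma>: "\<sigma> : SL2R" "bdry_mobius \<sigma> None = s" using exists_scaling by blast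
  have \<sigma>S: "\<sigma> : S" using \<sigma> s by (simp add: S_def)
  have "near_cusp (C \<sigma>) s" unfolding near_cusp_def
  proof (intro ballI impI)
   fix \<sigma>' assume \<sigma>': "\<sigma>' : SL2R" "bdry_mobius \<sigma>' None = s"
   define t where "t = matrix_inv \<sigma> ** \<sigma>'"
   have tS: "t : SL2R" by (simp add: t_def SL2R_mult SL2R_inv \<sigma> \<sigma>')
   have t21: "t$2$1 = 0" unfolding t_def by (rule stabilizer_triangular[OF \<sigma>(1) \<sigma>'(1)]) (simp add: \<sigma> \<sigma>')
   have \<sigma>t: "\<sigma> ** t = \<sigma>'" by (simp add: t_def matrix_mul_assoc SL2R_inv[OF \<sigma>(1)])
   note tri = mobius_triangular[OF tS t21]
   have "mobius \<sigma>' z : C \<sigma>" if z: "2 * (t$2$2)\<^sup>2 < Im z" for z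
   proof -
    have "0 < (t$2$2)\<^sup>2" using tri(1) by simp
    hence zu: "z : uhp" "2 < Im (mobius t z)" using z unfolding tri(2) uhp_def mem_Collect_eq
     by (linarith, simp add: less_divide_eq)
    have "mobius \<sigma>' z = mobius \<sigma> (mobius t z)" using mobius_mult[OF \<sigma>(1) tS zu(1)] \<sigma>t by simp
    also have "\<dots> : mobius \<sigma> ` {z. 2 < Im z}" using zu(2) by simp
    finally show ?thesis using translates(4)[OF Hs[OF \<sigma>S]] by (auto simp: C_def)
   qed
   moreover have "0 < 2 * (t$2$2)\<^sup>2" using tri(1) by simp
   ultimately show "EX Y>0. ALL z. Y < Im z --> mobius \<sigma>' z : C \<sigma>" by blast
  qed
  with \<sigma>S show "EX A:C ` S. near_cusp A s" by blast
 qed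
 then obtain \<F> where F: "\<F> <= C ` S" "finite \<F>" "uhp <= \<Union>\<F>" by blast
 obtain \<Sigma> where "\<Sigma> <= S" "finite \<Sigma>" "\<F> = C ` \<Sigma>" using finite_subset_image[OF F(2,1)] by blast
 with F(3) show ?thesis unfolding C_def S_def by (intro exI[of _ \<Sigma>]) auto
qed

text \<open>A Schwarz lemma in the variable \<open>q\<close>: a zero of order \<open>N\<close> at the cusp
gains \<open>|q|\<^sup>N\<close> between the heights 1 and 2, which beats the growth of
\<open>y\<^sup>k\<close>.\<close>

lemma cusp_estimate:
 assumes s: "s : SL2R" and g: "g holomorphic_on ball 0 1" "!!z. z : uhp ==> slash (int k) f s z = g (qparam w z)"
  and w: "w > 0" and N: "w * (real k + 1) <= 4 * pi * real N" and van: "!!n. n < N ==> taylor_coeff 0 n g = 0"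
  and C: "!!z. Im z = 1 ==> petersson (int k) f (mobius s z) <= C" and z: "2 < Im z"
 shows "petersson (int k) f (mobius s z) <= exp (-1) * C"
proof -
 have pet: "petersson (int k) f (mobius s z) = (cmod (g (qparam w z)))\<^sup>2 * Im z ^ k" if "z : uhp" for z
  using petersson_mobius[OF s that, of "int k" f] g(2)[OF that] by (simp add: petersson_def)
 define r where "r = exp (- (2 * pi / w))"
 have r: "0 < r" "r < 1" using w by (simp_all add: r_def)
 have C0: "0 <= C" using C[of \<i>] petersson_nonneg[OF mobius_uhp[OF s, of \<i>], of "int k" f] by (simp add: uhp_def)
 have zu: "z : uhp" using z by (simp add: uhp_def)
 have "cmod (g (qparam w z)) <= sqrt C * (cmod (qparam w z - 0) / r) ^ N"
 proof (rule schwarz_vanishing[OF g(1) open_ball])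
  show "cball 0 r <= ball (0::complex) 1" using r by auto
  fix q :: complex assume q: "cmod (q - 0) = r"
  hence "q ~= 0" "cmod q < 1" using r by auto
  then obtain x where x: "x : uhp" "q = qparam w x" using qparam_surj[OF w] by blast
  hence "exp (- (2 * pi * Im x / w)) = exp (- (2 * pi / w))" using q norm_qparam by (simp add: r_def)
  hence "Im x = 1" using w by (simp add: field_simps)
  hence "(cmod (g q))\<^sup>2 <= C" using C[of x] pet[OF x(1)] x(2) by simp
  thus "cmod (g q) <= sqrt C" by (rule real_le_rsqrt)
 next
  show "cmod (qparam w z - 0) <= r" unfolding r_def using z w by (simp add: norm_qparam divide_right_mono)
 qed (use r van in auto)
 also have "cmod (qparam w z - 0) / r = exp (- (2 * pi * (Im z - 1) / w))"
  by (simp add: norm_qparam r_def exp_diff[symmetric] diff_divide_distrib right_diff_distrib)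
 finally have "(cmod (g (qparam w z)))\<^sup>2 <= (sqrt C * exp (- (2 * pi * (Im z - 1) / w)) ^ N)\<^sup>2" by (rule power_mono) simp
 also have "\<dots> = C * exp (- (4 * pi * real N / w * (Im z - 1)))"
  using C0 by (simp add: power_mult_distrib exp_of_nat_mult[symmetric] flip: exp_double)
 finally have 1: "(cmod (g (qparam w z)))\<^sup>2 <= C * exp (- (4 * pi * real N / w * (Im z - 1)))" .
 have "Im z <= exp (Im z - 1)" using exp_ge_add_one_self[of "Im z - 1"] by simp
 hence "Im z ^ k <= exp (Im z - 1) ^ k" using z by (intro power_mono) auto
 also have "\<dots> = exp (real k * (Im z - 1))" by (simp add: exp_of_nat_mult)
 finally have 2: "Im z ^ k <= exp (real k * (Im z - 1))" .
 have "petersson (int k) f (mobius s z) <= C * exp (- (4 * pi * real N / w * (Im z - 1))) * exp (real k * (Im z - 1))"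
  unfolding pet[OF zu] using 1 2 C0 z by (intro mult_mono) auto
 also have "\<dots> = C * exp (real k * (Im z - 1) - 4 * pi * real N / w * (Im z - 1))"
 by (smt (verit, ccfv_threshold) divide_divide_eq_right exp_diff times_divide_eq_left times_divide_eq_right)
 also have "\<dots> <= C * exp (-1)"
 proof -
  have "real k + 1 <= 4 * pi * real N / w" using N w by (simp add: pos_le_divide_eq mult.commute)
  hence "(real k + 1) * (Im z - 1) <= 4 * pi * real N / w * (Im z - 1)" using z by (intro mult_right_mono) auto
  hence "real k * (Im z - 1) - 4 * pi * real N / w * (Im z - 1) <= - 1" using z by (simp add: algebra_simps)
  thus ?thesis using C0 by (intro mult_left_mono) auto
 qed
 finally show ?thesis by (simp add: mult.commute)
qed

text \<open>The half plane is covered by the translates of finitely many horoballs. If enough Taylor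
coefficients vanish at each of the corresponding cusps, the supremum \<open>S\<close> of \<open>|f|\<^sup>2
y\<^sup>k\<close> satisfies \<open>S \<le> S/e\<close>; so finitely many functionals separate the
forms.\<close>

lemma modform_fin_dim:
 assumes cusp: "cusps \<Gamma> ~= {}" shows "fin_dim (fscale (*)) {f. modform \<Gamma> (int k) f}"
proof -
 obtain \<Sigma> where \<Sigma>: "finite \<Sigma>" "\<Sigma> <= {\<sigma>\<in>SL2R. bdry_mobius \<sigma> None : cusps \<Gamma>}"
  and cover: "!!z. z : uhp ==> EX \<sigma>:\<Sigma>. z : translates (mobius \<sigma> ` {z. 2 < Im z})"
  using horoball_cover[OF cusp] by blast
 have "ALL \<sigma>:\<Sigma>. EX w>0. ALL k f. modform \<Gamma> k f --> (ALL z:uhp. slash k f \<sigma> (z + of_real w) = slash k f \<sigma> z)"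
  using slash_cusp_periodic \<Sigma>(2) by blast
 then obtain w where w: "!!\<sigma>. \<sigma> : \<Sigma> ==> w \<sigma> > 0"
  "!!\<sigma> k f z. \<sigma> : \<Sigma> ==> modform \<Gamma> k f ==> z : uhp ==> slash k f \<sigma> (z + of_real (w \<sigma>)) = slash k f \<sigma> z" by metis
 define isq where "isq \<sigma> f g \<longleftrightarrow> g holomorphic_on ball 0 1 & (ALL z:uhp. slash (int k) f \<sigma> z = g (qparam (w \<sigma>) z))" for \<sigma> f g
 define qe where "qe \<sigma> f = (SOME g. isq \<sigma> f g)" for \<sigma> f
 have qe: "isq \<sigma> f (qe \<sigma> f)" if \<sigma>: "\<sigma> : \<Sigma>" and f: "modform \<Gamma> (int k) f" for \<sigma> f
 proof -
  have \<sigma>': "\<sigma> : SL2R" "bdry_mobius \<sigma> None : cusps \<Gamma>" using \<sigma> \<Sigma>(2) by auto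
  obtain Y M where YM: "!!z. Y < Im z ==> cmod (slash (int k) f \<sigma> z) <= M" using cusp_bound[OF f \<sigma>'] by blast
  have "(f \<circ> mobius \<sigma>) holomorphic_on uhp"
   using f holo_mobius[OF \<sigma>'(1)] mobius_uhp[OF \<sigma>'(1)]
   by (intro holomorphic_on_compose_gen[of _ _ _ uhp]) (auto simp: modform_def holo_uhp_def)
  hence hol: "slash (int k) f \<sigma> holomorphic_on uhp" unfolding slash_def o_def
   using jfac_nonzero[OF \<sigma>'(1)] by (intro holomorphic_intros holo_jfac) auto
  have "EX g. isq \<sigma> f g" unfolding isq_def by (rule qparam_expansion[OF hol w(1)[OF \<sigma>] w(2)[OF \<sigma> f] YM])
  thus ?thesis unfolding qe_def by (rule someI_ex)
 qed
 have uniq: "taylor_coeff 0 n (qe \<sigma> f) = taylor_coeff 0 n g" if "\<sigma> : \<Sigma>" "modform \<Gamma> (int k) f" "isq \<sigma> f g" for \<sigma> f g n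
 proof (rule taylor_coeff_cong[OF open_ball[of 0 1]])
  fix q :: complex assume q: "q : ball 0 1"
  show "qe \<sigma> f q = g q"
   by (rule qparam_unique[OF _ _ w(1)[OF that(1)] _ q])
    (use qe[OF that(1,2)] that(3) in \<open>simp_all add: isq_def\<close>)
 qed simp
 \<comment> \<open>vanishing to this order makes the factor \<open>exp (-1)\<close> available on each horoball\<close>
 define N where "N \<sigma> = nat \<lceil>w \<sigma> * (real k + 1) / (4 * pi)\<rceil>" for \<sigma>
 have N: "w \<sigma> * (real k + 1) <= 4 * pi * real (N \<sigma>)" for \<sigma>
 proof -
  have "w \<sigma> * (real k + 1) / (4 * pi) <= real (N \<sigma>)" unfolding N_def by linarith
  thus ?thesis by (simp add: field_simps)
 qed
 define l where "l i f = taylor_coeff 0 (snd i) (qe (fst i) f)" for i :: "(real^2^2) \<times> nat" and f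
 define I where "I = (SIGMA \<sigma>:\<Sigma>. {..<N \<sigma>})"
 let ?M = "{f. modform \<Gamma> (int k) f}"
 have ladd: "l i (f + h) = l i f + l i h" if i: "i : I" and f: "f : ?M" and h: "h : ?M" for i f h
 proof -
  obtain \<sigma> n where \<sigma>: "i = (\<sigma>, n)" "\<sigma> : \<Sigma>" using i by (auto simp: I_def)
  note q = qe[OF \<sigma>(2) f[simplified]] qe[OF \<sigma>(2) h[simplified]]
  have fh: "f + h = (%z. f z + h z)" by (simp add: fun_eq_iff)
  have mfh: "modform \<Gamma> (int k) (f + h)" using cfun.subspace_add[OF modform_subspace] f h by blast
  have "isq \<sigma> (f + h) (%q. qe \<sigma> f q + qe \<sigma> h q)"
   using q unfolding fh isq_def by (auto simp: slash_add intro!: holomorphic_intros)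
  from uniq[OF \<sigma>(2) mfh this, of n]
  show ?thesis using \<sigma> q by (simp add: l_def isq_def taylor_coeff_add[of _ "ball 0 1"])
 qed
 have lscale: "l i (fscale (*) c f) = c * l i f" if i: "i : I" and f: "f : ?M" for i f c
 proof -
  obtain \<sigma> n where \<sigma>: "i = (\<sigma>, n)" "\<sigma> : \<Sigma>" using i by (auto simp: I_def)
  have fc: "fscale (*) c f = (%z. c * f z)" by (simp add: fscale_def)
  have mfc: "modform \<Gamma> (int k) (fscale (*) c f)" using cfun.subspace_scale[OF modform_subspace] f by blast
  have "isq \<sigma> (fscale (*) c f) (%q. c * qe \<sigma> f q)"
   using qe[OF \<sigma>(2) f[simplified]] unfolding fc isq_def by (auto simp: slash_cmult intro!: holomorphic_intros)
  from uniq[OF \<sigma>(2) mfc this, of n]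
  show ?thesis using \<sigma> qe[OF \<sigma>(2) f[simplified]] by (simp add: l_def isq_def taylor_coeff_cmult[of _ "ball 0 1"])
 qed
 have "f = 0" if f: "modform \<Gamma> (int k) f" and zero: "ALL i:I. l i f = 0" for f
 proof (rule ccontr)
  assume "f ~= 0"
  have hf: "holo_uhp f" using f by (simp add: modform_def)
  define \<phi> where "\<phi> = petersson (int k) f"
  have inv: "\<phi> (mobius g z) = \<phi> z" if "g : \<Gamma>" "z : uhp" for g z
   unfolding \<phi>_def by (rule petersson_invariant[OF f that])
  have van: "taylor_coeff 0 n (qe \<sigma> f) = 0" if "\<sigma> : \<Sigma>" "n < N \<sigma>" for \<sigma> n
   using zero that by (force simp: l_def I_def)
  have cusp: "\<phi> z <= exp (-1) * C" if \<sigma>: "\<sigma> : \<Sigma>" and C: "!!z. Im z = 1 ==> \<phi> (mobius \<sigma> z) <= C"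
    and z: "z : translates (mobius \<sigma> ` {z. 2 < Im z})" for \<sigma> C z
  proof -
   obtain g x where g: "g : \<Gamma>" "2 < Im x" "z = mobius g (mobius \<sigma> x)" using z by (auto simp: translates_def)
   have \<sigma>S: "\<sigma> : SL2R" using \<sigma> \<Sigma>(2) by blast
   have "\<phi> (mobius \<sigma> x) <= exp (-1) * C" unfolding \<phi>_def
    using qe[OF \<sigma> f] by (intro cusp_estimate[OF \<sigma>S _ _ w(1)[OF \<sigma>] N van[OF \<sigma>] C[unfolded \<phi>_def] g(2)])
     (auto simp: isq_def)
   moreover have "x : uhp" using g(2) by (simp add: uhp_def)
   ultimately show ?thesis using inv g mobius_uhp[OF \<sigma>S] by simp
  qed
  have bound: "EX C. ALL z. Im z = 1 --> \<phi> (mobius \<sigma> z) <= C" if \<sigma>: "\<sigma> : \<Sigma>" for \<sigma>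
  proof -
   have \<sigma>S: "\<sigma> : SL2R" using \<sigma> \<Sigma>(2) by blast
   define r where "r = exp (- (2 * pi / w \<sigma>))"
   have "r < 1" using w(1)[OF \<sigma>] by (simp add: r_def)
   hence "continuous_on (cball 0 r) (qe \<sigma> f)"
    using qe[OF \<sigma> f] by (intro holomorphic_on_imp_continuous_on) (auto simp: isq_def elim!: holomorphic_on_subset)
   hence "bounded (qe \<sigma> f ` cball 0 r)" by (intro compact_imp_bounded compact_continuous_image) auto
   then obtain b where b: "!!q. q : cball 0 r ==> cmod (qe \<sigma> f q) <= b" unfolding bounded_iff by blast
   have "\<phi> (mobius \<sigma> z) <= b\<^sup>2" if z: "Im z = 1" for z
   proof -
    have zu: "z : uhp" using z by (simp add: uhp_def)
    have "\<phi> (mobius \<sigma> z) = (cmod (qe \<sigma> f (qparam (w \<sigma>) z)))\<^sup>2"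
     using petersson_mobius[OF \<sigma>S zu, of "int k" f] qe[OF \<sigma> f] zu z by (simp add: \<phi>_def petersson_def isq_def)
    moreover have "qparam (w \<sigma>) z : cball 0 r" using z by (simp add: norm_qparam r_def)
    ultimately show ?thesis using b by (simp add: power_mono)
   qed
   thus ?thesis by blast
  qed
  obtain C where C: "!!\<sigma> z. \<sigma> : \<Sigma> ==> Im z = 1 ==> \<phi> (mobius \<sigma> z) <= C \<sigma>" using bound by metis
  have "exp (-1) * C \<sigma> <= (\<Sum>\<sigma>\<in>\<Sigma>. \<bar>exp (-1) * C \<sigma>\<bar>)" if "\<sigma> : \<Sigma>" for \<sigma>
   using member_le_sum[of \<sigma> \<Sigma> "%\<sigma>. \<bar>exp (-1) * C \<sigma>\<bar>"] that \<Sigma>(1) abs_ge_self[of "exp (-1) * C \<sigma>"] by fastforce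
  hence bdd: "\<phi> z <= (\<Sum>\<sigma>\<in>\<Sigma>. \<bar>exp (-1) * C \<sigma>\<bar>)" if "z : uhp" for z
   using cover[OF that] cusp[OF _ C] by (meson order_trans)
  define S where "S = Sup (\<phi> ` uhp)"
  have le: "\<phi> z <= S" if "z : uhp" for z
   unfolding S_def using bdd that by (intro cSUP_upper) (auto simp: bdd_above_def)
  obtain z1 where z1: "z1 : uhp" "f z1 ~= 0"
   using \<open>f ~= 0\<close> hf by (fastforce simp: holo_uhp_def fun_eq_iff)
  have "0 < \<phi> z1" using z1 by (simp add: \<phi>_def petersson_def uhp_def)
  hence S: "S > 0" using le[OF z1(1)] by simp
  have cS: "\<phi> z <= exp (-1) * S" if "\<sigma> : \<Sigma>" "z : translates (mobius \<sigma> ` {z. 2 < Im z})" for \<sigma> z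
  proof (rule cusp[OF that(1) _ that(2)])
   fix z :: complex assume "Im z = 1"
   hence "mobius \<sigma> z : uhp" using mobius_uhp[of \<sigma> z] that(1) \<Sigma>(2) by (auto simp: uhp_def)
   thus "\<phi> (mobius \<sigma> z) <= S" by (rule le)
  qed
  have "S <= exp (-1) * S" unfolding S_def
   using cover cS[unfolded S_def] z1(1) by (intro cSUP_least) auto
  moreover have "exp (-1) * S < 1 * S" using S by (intro mult_strict_right_mono) auto
  ultimately show False by linarith
 qed
 moreover have "0 : ?M" by (rule cfun.subspace_0[OF modform_subspace])
 moreover have "l i 0 = 0" if "i : I" for i
  using lscale[OF that \<open>0 : ?M\<close>, of 0] cfun.scale_zero_right[of 0] by simp
 ultimately have "{f : ?M. ALL i:I. l i f = 0} = {0}" by blast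
 hence ker: "fin_dim (fscale (*)) {f : ?M. ALL i:I. l i f = 0}" using cfun.fin_dim_zero by simp
 have "finite I" unfolding I_def using \<Sigma> by auto
 from cfun.fin_dim_functionals[OF this modform_subspace ladd lscale ker] show ?thesis .
qed

end

section \<open>Graded vector spaces\<close>

lemma Sum_any_finite_sum: "finite I ==> (!!i. i ~: I ==> f i = 0) ==> Sum_any f = sum f I"
 by (rule Sum_any.expand_superset) auto

lemma Sum_any_nat_less: "(!!i. i >= M ==> f i = 0) ==> Sum_any f = (\<Sum>i<(M::nat). f i)"
 by (rule Sum_any_finite_sum) auto

lemma sum_fun_at: "(sum x A) t = (\<Sum>k\<in>A. x k t)"
 for x :: "'k => 'a => 'b::comm_monoid_add"
 by (induction A rule: infinite_finite_induct) simp_all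

context graded_vector_space
begin

abbreviation "\<V> \<equiv> total_space V"

lemma zero_piece: "0 : V n"
 using subspace_0[OF subspace_piece] .

lemma finsupp_add:
 assumes "finsupp_family V x" "finsupp_family V y" shows "finsupp_family V (%k. x k + y k)"
  "Sum_any (%k. x k + y k) = Sum_any x + Sum_any y"
proof -
 have fin: "finite {k. x k ~= 0}" "finite {k. y k ~= 0}" using assms by (simp_all add: finsupp_family_def)
 have "{k. x k + y k ~= 0} <= {k. x k ~= 0} \<union> {k. y k ~= 0}" by auto
 hence "finite {k. x k + y k ~= 0}" using fin by (meson finite_Un finite_subset)
 thus "finsupp_family V (%k. x k + y k)"
  using assms subspace_piece subspace_add by (auto simp: finsupp_family_def)
 show "Sum_any (%k. x k + y k) = Sum_any x + Sum_any y" by (rule Sum_any.distrib[OF fin])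
qed

lemma finsupp_scale:
 assumes "finsupp_family V x" shows "finsupp_family V (%k. smul (c k) (x k))"
proof -
 have "{k. smul (c k) (x k) ~= 0} <= {k. x k ~= 0}" by auto
 thus ?thesis using assms subspace_piece subspace_scale finite_subset
  by (auto simp: finsupp_family_def)
qed

lemma smul_Sum_any:
 assumes "finite {k. x k ~= 0}" shows "smul c (Sum_any x) = Sum_any (%k. smul c (x k))"
proof -
 have "Sum_any (%k. smul c (x k)) = (\<Sum>k\<in>{k. x k ~= 0}. smul c (x k))"
  using assms by (intro Sum_any_finite_sum) auto
 thus ?thesis by (simp add: Sum_any.expand_set scale_sum_right)
qed

lemma total_space_subspace: "subspace (\<V>)"
 unfolding subspace_def
proof (intro conjI ballI allI)
 have "finsupp_family V (%_. 0)" by (simp add: finsupp_family_def zero_piece)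
 thus "0 : \<V>" unfolding total_space_def by (force intro!: exI[of _ "%_. 0"])
 fix u assume "u : \<V>"
 then obtain x where x: "finsupp_family V x" "u = Sum_any x" by (auto simp: total_space_def)
 show "smul c u : \<V>" for c
  using x finsupp_scale[OF x(1), of "%_. c"] smul_Sum_any[of x c] by (auto simp: total_space_def finsupp_family_def)
 fix v assume "v : \<V>"
 then obtain y where y: "finsupp_family V y" "v = Sum_any y" by (auto simp: total_space_def)
 show "u + v : \<V>"
  unfolding total_space_def x(2) y(2) using finsupp_add[OF x(1) y(1)]
  by (intro CollectI exI[of _ "%k. x k + y k"]) simp
qed

lemmas total_0 = subspace_0[OF total_space_subspace]
 and total_add = subspace_add[OF total_space_subspace]
 and total_scale = subspace_scale[OF total_space_subspace]
 and total_sum = subspace_sum[OF total_space_subspace]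
 and total_diff = subspace_diff[OF total_space_subspace]

lemma finsupp_single:
 assumes "v : V n"
 shows "finsupp_family V (%k. if k = n then v else 0)" "Sum_any (%k. if k = n then v else 0) = v"
proof -
 have "finite {k. (if k = n then v else 0) ~= 0}" by (rule finite_subset[of _ "{n}"]) auto
 thus "finsupp_family V (%k. if k = n then v else 0)"
  using assms by (simp add: finsupp_family_def zero_piece)
qed simp

lemma piece_total: "v : V n ==> v : \<V>"
 unfolding total_space_def using finsupp_single[of v n]
 by (intro CollectI exI[of _ "%k. if k = n then v else 0"]) simp

lemma total_induct [consumes 1, case_names piece add]:
 assumes "v : \<V>"
  and piece: "!!n v. v : V n ==> P v"
  and add: "!!u v. u : \<V> ==> v : \<V> ==> P u ==> P v ==> P (u + v)"
 shows "P v"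
proof -
 obtain x where x: "finsupp_family V x" "v = Sum_any x" using assms(1) by (auto simp: total_space_def)
 have "(\<Sum>k\<in>S. x k) : \<V> & P (\<Sum>k\<in>S. x k)" if "finite S" for S
  using that
 proof (induction S rule: finite_induct)
  case empty
  thus ?case using total_0 piece[OF zero_piece] by simp
 next
  case (insert k S)
  have "x k : V k" using x by (simp add: finsupp_family_def)
  thus ?case using insert add piece piece_total total_add by simp
 qed
 from this[of "{k. x k ~= 0}"] x show ?thesis by (simp add: finsupp_family_def Sum_any.expand_set)
qed

lemma family_unique:
 assumes "finsupp_family V x" "finsupp_family V y" "Sum_any x = Sum_any y" shows "x = y"
proof -
 have m: "finsupp_family V (%k. smul (-1) (y k))" by (rule finsupp_scale[OF assms(2)])
 have "Sum_any (%k. smul (-1) (y k)) = smul (-1) (Sum_any y)"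
  using assms(2) by (intro smul_Sum_any[symmetric]) (simp add: finsupp_family_def)
 hence "Sum_any (%k. x k + smul (-1) (y k)) = 0"
  unfolding finsupp_add(2)[OF assms(1) m] using assms(3) by simp
 from direct[OF finsupp_add(1)[OF assms(1) m] this] show ?thesis by (simp add: fun_eq_iff)
qed

lemma component_Sum_any: "finsupp_family V x ==> component V (Sum_any x) = x"
 unfolding component_def using family_unique by (intro the_equality) auto

lemma component_family:
 assumes "v : \<V>" shows "finsupp_family V (component V v)" "Sum_any (component V v) = v"
 using assms component_Sum_any by (auto simp: total_space_def)

lemma component_piece: "v : V n ==> component V v = (%k. if k = n then v else 0)"
 using component_Sum_any[OF finsupp_single(1)] finsupp_single(2) by metis

lemma component_in: "v : \<V> ==> component V v k : V k"
 using component_family(1) by (simp add: finsupp_family_def)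

lemma component_add:
 assumes "u : \<V>" "v : \<V>"
 shows "component V (u + v) = (%k. component V u k + component V v k)"
 using component_Sum_any[OF finsupp_add(1)[OF component_family(1)[OF assms(1)] component_family(1)[OF assms(2)]]]
  finsupp_add(2)[OF component_family(1)[OF assms(1)] component_family(1)[OF assms(2)]]
 by (simp add: component_family(2) assms)

lemma component_scale:
 assumes "v : \<V>"
 shows "component V (smul c v) = (%k. smul c (component V v k))"
proof -
 have "Sum_any (%k. smul c (component V v k)) = smul c v"
  using smul_Sum_any[of "component V v" c] component_family[OF assms] by (simp add: finsupp_family_def)
 thus ?thesis using component_Sum_any[OF finsupp_scale[OF component_family(1)[OF assms], of "%_. c"]] by simp
qed

lemma piece_disjoint: "v : V n ==> v : V m ==> n ~= m ==> v = 0"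
 using component_piece[of v n] component_piece[of v m] by (metis (full_types))

lemma component_eq_self: "v : \<V> ==> (!!k. k ~= n ==> component V v k = 0) ==> v : V n"
by (smt (verit) Sum_any.cong component_family(1,2) finsupp_family_def finsupp_single(2))

text \<open>A family of linear maps on the pieces determines a linear map on the total space.\<close>

definition gext :: "(int => 'v => 'w::comm_monoid_add) => 'v => 'w" where
 "gext \<phi> v = Sum_any (%k. \<phi> k (component V v k))"

lemma gext_finite:
 assumes "!!k. \<phi> k 0 = (0 :: 'w::comm_monoid_add)" "v : \<V>"
 shows "finite {k. \<phi> k (component V v k) ~= 0}"
by (smt (verit) assms(1,2) finite_subset finsupp_family_def graded_vector_space.component_family(1) graded_vector_space_axioms mem_Collect_eq subsetI)

lemma gext_piece: "(!!k. \<phi> k 0 = (0 :: 'w::comm_monoid_add)) ==> v : V n ==> gext \<phi> v = \<phi> n v"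
 using Sum_any_finite_sum[of "{n}" "%k. \<phi> k (component V v k)"] by (simp add: gext_def component_piece)

lemma gext_add:
 assumes "!!k. \<phi> k 0 = (0 :: 'w::comm_monoid_add)"
  "!!k u v. u : V k ==> v : V k ==> \<phi> k (u + v) = \<phi> k u + \<phi> k v"
  "u : \<V>" "v : \<V>"
 shows "gext \<phi> (u + v) = gext \<phi> u + gext \<phi> v"
 unfolding gext_def component_add[OF assms(3,4)]
 using assms(2)[OF component_in[OF assms(3)] component_in[OF assms(4)]]
 by (simp add: Sum_any.distrib[OF gext_finite[where \<phi> = \<phi>, OF assms(1,3)] gext_finite[where \<phi> = \<phi>, OF assms(1,4)]])

lemma filtration_family:
 "finsupp_family (%n. if n <= N then V n else {0}) x ==> finsupp_family V x"
 unfolding finsupp_family_def using zero_piece by (metis singletonD)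

lemma filtration_graded: "graded_vector_space smul (%n. if n <= N then V n else {0})"
proof unfold_locales
 show "subspace (if n <= N then V n else {0})" for n using subspace_piece by simp
 show "x = (%_. 0)" if "finsupp_family (%n. if n <= N then V n else {0}) x" "Sum_any x = 0" for x
  using direct filtration_family that by blast
qed

lemma filtration_total: "v : filtration V N ==> v : \<V>"
 using filtration_family by (auto simp: filtration_def total_space_def)

lemma filtration_subspace: "subspace (filtration V N)"
 unfolding filtration_def by (rule graded_vector_space.total_space_subspace[OF filtration_graded])

lemma piece_filtration: "v : V n ==> n <= N ==> v : filtration V N"
 unfolding filtration_def by (rule graded_vector_space.piece_total[OF filtration_graded, of _ n]) simp

lemma filtration_induct [consumes 1, case_names piece add]:
 assumes "v : filtration V N"
  and "!!n v. n <= N ==> v : V n ==> P v"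
  and "!!u v. u : filtration V N ==> v : filtration V N ==> P u ==> P v ==> P (u + v)"
  and "P 0"
 shows "P v"
 using assms(1) unfolding filtration_def
 by (rule graded_vector_space.total_induct[OF filtration_graded])
  (use assms in \<open>auto simp: filtration_def split: if_splits\<close>)

lemma filtration_mono: "N <= M ==> filtration V N <= filtration V M"
proof
 fix v assume NM: "N <= M" and "v : filtration V N"
 from this(2) show "v : filtration V M"
  by (induction rule: filtration_induct)
   (use NM piece_filtration subspace_add[OF filtration_subspace] subspace_0[OF filtration_subspace] in auto)
qed

lemma doubled_family: "finsupp_family (doubled V) x ==> finsupp_family V (%n. x (2 * n)) & Sum_any (%n. x (2 * n)) = Sum_any x"
proof -
 assume x: "finsupp_family (doubled V) x"
 have odd: "x k = 0" if "odd k" for k using x that unfolding finsupp_family_def doubled_def by (metis singletonD)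
 have fin: "finite {k. x k ~= 0}" using x by (simp add: finsupp_family_def)
 have img: "{k. x k ~= 0} = (%n. 2 * n) ` {n. x (2 * n) ~= 0}"
  using odd by (auto simp: image_def elim!: evenE) (metis evenE)
 have inj: "inj_on (%n::int. 2 * n) A" for A by (auto simp: inj_on_def)
 have fin2: "finite {n. x (2 * n) ~= 0}" using fin unfolding img by (rule finite_imageD[OF _ inj])
 have "x (2 * n) : V n" for n using x by (auto simp: finsupp_family_def doubled_def dest: spec[of _ "2 * n"])
 moreover have "Sum_any (%n. x (2 * n)) = Sum_any x"
  unfolding Sum_any.expand_set img by (simp add: sum.reindex[OF inj] o_def)
 ultimately show ?thesis using fin2 by (simp add: finsupp_family_def)
qed

lemma doubled_graded: "graded_vector_space smul (doubled V)"
proof unfold_locales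
 show "subspace (doubled V n)" for n using subspace_piece by (simp add: doubled_def)
 fix x assume x: "finsupp_family (doubled V) x" "Sum_any x = 0"
 hence "(%n. x (2 * n)) = (%_. 0)" using direct doubled_family by metis
 hence even: "x (2 * n) = 0" for n by meson
 have "x k = 0" for k
 proof (cases "even k")
  case True thus ?thesis using even by (auto elim!: evenE)
 next
  case False thus ?thesis using x(1) unfolding finsupp_family_def doubled_def by (metis singletonD)
 qed
 thus "x = (%_. 0)" by blast
qed

lemma total_doubled: "total_space (doubled V) = \<V>"
proof
 show "total_space (doubled V) <= \<V>"
 by (smt (verit, best) doubled_family mem_Collect_eq subsetI total_space_def)
 show "\<V> <= total_space (doubled V)"
 proof
  fix v assume "v : \<V>"
  thus "v : total_space (doubled V)"
  proof (induction rule: total_induct)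
   case (piece n v)
   hence "v : doubled V (2 * n)" by (simp add: doubled_def)
   thus ?case by (rule graded_vector_space.piece_total[OF doubled_graded])
  next
   case (add u v)
   thus ?case using graded_vector_space.total_add[OF doubled_graded] by blast
  qed
 qed
qed

text \<open>Coordinates with respect to a basis that is compatible with the grading detect the degree, see
\<open>crd_other_degree\<close>.\<close>

definition hbasis :: "'v set" where
 "hbasis = (SOME B. B <= (\<Union>n. V n) & independent B & (\<Union>n. V n) <= span B)"

lemma hbasis: "hbasis <= (\<Union>n. V n)" "independent hbasis" "span hbasis = \<V>"
proof -
 have "EX B. B <= (\<Union>n. V n) & independent B & (\<Union>n. V n) <= span B"
  by (rule maximal_independent_subset[of "\<Union>n. V n"]) (intro exI conjI)
 hence *: "hbasis <= (\<Union>n. V n) & independent hbasis & (\<Union>n. V n) <= span hbasis"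
  unfolding hbasis_def by (rule someI_ex)
 thus "hbasis <= (\<Union>n. V n)" "independent hbasis" by simp_all
 show "span hbasis = \<V>"
 proof
  have "hbasis <= \<V>" using * piece_total by blast
  thus "span hbasis <= \<V>" using total_space_subspace span_minimal by blast
  show "\<V> <= span hbasis"
  proof
   fix v assume "v : \<V>"
   thus "v : span hbasis"
   proof (induction rule: total_induct)
    case (piece n v)
    thus ?case using * by blast
   qed (rule span_add)
  qed
 qed
qed

definition crd :: "'v => 'v => complex" where
 "crd b v = representation hbasis v b"

lemma crd_add: "u : \<V> ==> v : \<V> ==> crd b (u + v) = crd b u + crd b v"
 unfolding crd_def using representation_add[OF hbasis(2)] hbasis(3) by simp

lemma crd_scale: "v : \<V> ==> crd b (smul c v) = c * crd b v"
 unfolding crd_def using representation_scale[OF hbasis(2)] hbasis(3) by simp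

lemma crd_zero [simp]: "crd b 0 = 0"
 by (simp add: crd_def representation_zero)

lemma crd_finite: "finite {b. crd b v ~= 0}"
 unfolding crd_def by (rule finite_representation)

lemma crd_hbasis: "crd b v ~= 0 ==> b : hbasis"
 unfolding crd_def by (rule representation_ne_zero)

lemma crd_expand:
 assumes "v : \<V>" "finite S" "!!b. b ~: S ==> crd b v = 0"
 shows "v = (\<Sum>b\<in>S. smul (crd b v) b)"
proof -
 have "v = (\<Sum>b\<in>{b. crd b v ~= 0}. smul (crd b v) b)"
  using sum_nonzero_representation_eq[OF hbasis(2)] assms(1) hbasis(3) by (simp add: crd_def)
 also have "\<dots> = (\<Sum>b\<in>S. smul (crd b v) b)"
  using assms by (intro sum.mono_neutral_left) auto
 finally show ?thesis .
qed

lemma crd_lincomb: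
 assumes "!!i. i : I ==> x i : \<V>"
 shows "crd b (\<Sum>i\<in>I. smul (c i) (x i)) = (\<Sum>i\<in>I. c i * crd b (x i))"
 using assms
proof (induction I rule: infinite_finite_induct)
 case (insert i I)
 hence "(\<Sum>i\<in>I. smul (c i) (x i)) : \<V>" by (intro total_sum total_scale) auto
 with insert show ?case by (simp add: crd_add total_scale crd_scale)
qed simp_all

lemma crd_eqI:
 assumes "u : \<V>" "v : \<V>" "!!b. crd b u = crd b v" shows "u = v"
proof -
 have "u = (\<Sum>b\<in>{b. crd b u ~= 0}. smul (crd b u) b)" by (rule crd_expand[OF assms(1) crd_finite]) simp
 also have "\<dots> = v" unfolding assms(3) by (rule crd_expand[OF assms(2) crd_finite, symmetric]) simp
 finally show ?thesis .
qed

lemma crd_off_degree: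
 assumes v: "v : V n" and b: "b ~: V n" shows "crd b v = 0"
proof (rule ccontr)
 assume nz: "crd b v ~= 0"
 define S where "S = {b. crd b v ~= 0}"
 define S' where "S' = {b\<in>S. b ~: V n}"
 have fin: "finite S" "finite S'" unfolding S_def S'_def using crd_finite by auto
 have hb: "c : hbasis" if "c : S" for c using that crd_hbasis by (simp add: S_def)
 have vt: "v : \<V>" using piece_total v .
 have "v = (\<Sum>b\<in>S. smul (crd b v) b)" by (rule crd_expand[OF vt fin(1)]) (simp add: S_def)
 also have "\<dots> = (\<Sum>b\<in>S'. smul (crd b v) b) + (\<Sum>b\<in>S - S'. smul (crd b v) b)"
  using sum.subset_diff[of S' S] fin(1) by (simp add: S'_def add.commute)
 finally have "(\<Sum>b\<in>S'. smul (crd b v) b) + (\<Sum>b\<in>S - S'. smul (crd b v) b) = v" by (rule sym)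
 hence eq: "(\<Sum>b\<in>S'. smul (crd b v) b) = v - (\<Sum>b\<in>S - S'. smul (crd b v) b)" by (rule eq_diff_eq[THEN iffD2])
 have Z: "(\<Sum>b\<in>S - S'. smul (crd b v) b) : V n"
  by (intro subspace_sum[OF subspace_piece] subspace_scale[OF subspace_piece]) (auto simp: S'_def)
 have in_n: "(\<Sum>b\<in>S'. smul (crd b v) b) : V n"
  unfolding eq by (rule subspace_diff[OF subspace_piece v Z])
 have St: "b : \<V>" if "b : S'" for b
 using S'_def hb hbasis(3) local.span_base that by blast
 have comp0: "component V b n = 0" if bS: "b : S'" for b
 proof -
  have "b : hbasis" using bS hb by (simp add: S'_def)
  then obtain m where m: "b : V m" using hbasis(1) by blast
  hence "m ~= n" using bS by (auto simp: S'_def)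
  with component_piece[OF m] show ?thesis by simp
 qed
 have "component V (\<Sum>b\<in>T. smul (crd b v) b) n = 0" if "T <= S'" for T
  using finite_subset[OF that fin(2)] that
 proof (induction T rule: finite_induct)
  case empty
  thus ?case using component_piece[OF zero_piece, of n] by simp
 next
  case (insert b T)
  have "(\<Sum>b\<in>T. smul (crd b v) b) : \<V>"
   using insert St by (intro total_sum total_scale) auto
  thus ?case using insert St[of b] comp0[of b]
   by (simp add: component_add[OF total_scale] component_scale)
 qed
 hence "component V (\<Sum>b\<in>S'. smul (crd b v) b) n = 0" by simp
 hence "(\<Sum>b\<in>S'. smul (crd b v) b) = 0" using component_piece[OF in_n] by simp
 moreover have "b : S'" using nz b by (simp add: S'_def S_def)
 moreover have "S' <= hbasis" using hb by (auto simp: S'_def)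
 ultimately have "crd b v = 0"
  using independentD[OF independent_mono[OF hbasis(2)] fin(2) order_refl, of "%b. crd b v"] by blast
 with nz show False by simp
qed

lemma crd_other_degree:
 assumes "b : V n" "b : hbasis" "v : V m" "m ~= n" shows "crd b v = 0"
proof (rule crd_off_degree[OF assms(3)])
 show "b ~: V m"
 by (metis assms(1,2,4) hbasis(2) local.dependent_zero piece_disjoint)
qed

lemma hbasis_total: "b : hbasis ==> b : \<V>"
 using hbasis(1) piece_total by blast

definition functional :: "('v => complex) => bool" where
 "functional \<psi> \<longleftrightarrow> (ALL u:\<V>. ALL v:\<V>. \<psi> (u + v) = \<psi> u + \<psi> v) &
  (ALL c. ALL v:\<V>. \<psi> (smul c v) = c * \<psi> v)"

lemma functional_zero: "functional \<psi> ==> \<psi> 0 = 0"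
 unfolding functional_def using total_0 by (metis mult_zero_left scale_zero_left)

lemma functional_sum:
 assumes "functional \<psi>" "finite B" "B <= \<V>"
 shows "\<psi> (\<Sum>b\<in>B. smul (c b) b) = (\<Sum>b\<in>B. c b * \<psi> b)"
 using assms(2,3)
proof (induction B rule: finite_induct)
 case empty
 thus ?case using functional_zero[OF assms(1)] by simp
next
 case (insert b B)
 have "(\<Sum>b\<in>B. smul (c b) b) : \<V>" using insert by (intro total_sum total_scale) auto
 moreover have "smul (c b) b : \<V>" using insert total_scale by simp
 ultimately show ?case using insert assms(1) by (simp add: functional_def)
qed

lemma vholo_functional:
 assumes "functional \<psi>" "W <= \<V>" "vholo_uhp smul W F"
 shows "holo_uhp (%z. \<psi> (F z))"
proof -
 obtain B c where B: "finite B" "B <= W" "ALL b:B. holo_uhp (c b)" "F = (%z. \<Sum>b\<in>B. smul (c b z) b)"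
  using assms(3) by (auto simp: vholo_uhp_def)
 have "B <= \<V>" using B(2) assms(2) by blast
 have "(%z. \<psi> (F z)) = (%z. \<Sum>b\<in>B. c b z * \<psi> b)"
  unfolding B(4) by (rule ext) (rule functional_sum[OF assms(1) B(1) \<open>B <= \<V>\<close>])
 moreover have "holo_uhp (%z. \<Sum>b\<in>B. \<psi> b * c b z)" using B(3) by (intro holo_uhp_sum holo_uhp_cmult) auto
 ultimately show ?thesis by (simp add: mult.commute)
qed

lemma vbounded_functional:
 assumes "functional \<psi>" "W <= \<V>" "vbounded_at_i_inf smul W F"
 shows "bounded_at_i_inf (%z. \<psi> (F z))"
 unfolding bounded_at_i_inf_def
proof (intro allI impI)
 fix C :: "real set" assume "compact C"
 then obtain Y M B where B: "Y > 0" "finite B" "B <= W"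
   "ALL z. Re z : C --> Y < Im z --> (EX c. (ALL b:B. cmod (c b) <= M) & F z = (\<Sum>b\<in>B. smul (c b) b))"
  using assms(3) unfolding vbounded_at_i_inf_def by meson
 have Bt: "B <= \<V>" using B(3) assms(2) by blast
 have "cmod (\<psi> (F z)) <= (\<Sum>b\<in>B. M * cmod (\<psi> b))" if z: "Re z : C" "Y < Im z" for z
 proof -
  obtain c where c: "ALL b:B. cmod (c b) <= M" "F z = (\<Sum>b\<in>B. smul (c b) b)" using B(4) z by blast
  show ?thesis unfolding c(2) functional_sum[OF assms(1) B(2) Bt]
   using c(1) by (intro sum_norm_le) (auto simp: norm_mult intro!: mult_right_mono)
 qed
 with B(1) show "EX Y>0. EX M. ALL z. Re z : C --> Y < Im z --> cmod (\<psi> (F z)) <= M" by blast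
qed

lemma vholo_in:
 assumes "vholo_uhp smul W F" "subspace W" shows "F z : W"
 using assms unfolding vholo_uhp_def by (auto intro!: subspace_sum subspace_scale)

lemma vholo_off: "vholo_uhp smul W F ==> z ~: uhp ==> F z = 0"
 by (auto simp: vholo_uhp_def holo_uhp_def)

lemma vholo_mono: "vholo_uhp smul W F ==> W <= W' ==> vholo_uhp smul W' F"
 unfolding vholo_uhp_def by blast

lemma vholo_sum_basis:
 "finite B ==> B <= W ==> (!!b. b : B ==> holo_uhp (c b)) ==> vholo_uhp smul W (%z. \<Sum>b\<in>B. smul (c b z) b)"
 unfolding vholo_uhp_def by blast

lemma vholo_add:
 assumes "vholo_uhp smul W F" "vholo_uhp smul W G" shows "vholo_uhp smul W (%z. F z + G z)"
proof -
 obtain B c where B: "finite B" "B <= W" "ALL b:B. holo_uhp (c b)" "F = (%z. \<Sum>b\<in>B. smul (c b z) b)"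
  using assms(1) by (auto simp: vholo_uhp_def)
 obtain B' c' where B': "finite B'" "B' <= W" "ALL b:B'. holo_uhp (c' b)" "G = (%z. \<Sum>b\<in>B'. smul (c' b z) b)"
  using assms(2) by (auto simp: vholo_uhp_def)
 define d where "d b = (%z. (if b : B then c b z else 0) + (if b : B' then c' b z else 0))" for b
 have "F z + G z = (\<Sum>b\<in>B \<union> B'. smul (d b z) b)" for z
 proof -
  have "F z = (\<Sum>b\<in>B \<union> B'. smul (if b : B then c b z else 0) b)"
   unfolding B(4) using B(1) B'(1) by (intro sum.mono_neutral_cong_left) auto
  moreover have "G z = (\<Sum>b\<in>B \<union> B'. smul (if b : B' then c' b z else 0) b)"
   unfolding B'(4) using B(1) B'(1) by (intro sum.mono_neutral_cong_left) auto
  ultimately show ?thesis by (simp add: d_def scale_left_distrib sum.distrib)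
 qed
 hence "(%z. F z + G z) = (%z. \<Sum>b\<in>B \<union> B'. smul (d b z) b)" by (rule ext)
 moreover have "holo_uhp (d b)" for b
  unfolding d_def using B(3) B'(3)
  by (intro holo_uhp_add) (cases "b : B"; cases "b : B'"; simp add: holo_uhp_zero)+
 ultimately show ?thesis using B B' by (simp add: vholo_sum_basis)
qed

lemma vbounded_mono: "vbounded_at_i_inf smul W F ==> W <= W' ==> vbounded_at_i_inf smul W' F"
 unfolding vbounded_at_i_inf_def by (meson order_trans)

lemma vbounded_add:
 assumes "vbounded_at_i_inf smul W F" "vbounded_at_i_inf smul W G"
 shows "vbounded_at_i_inf smul W (%z. F z + G z)"
 unfolding vbounded_at_i_inf_def
proof (intro allI impI)
 fix C :: "real set" assume C: "compact C"
 obtain Y M B where B: "Y > 0" "finite B" "B <= W"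
   "ALL z. Re z : C --> Y < Im z --> (EX c. (ALL b:B. cmod (c b) <= M) & F z = (\<Sum>b\<in>B. smul (c b) b))"
  using assms(1) C unfolding vbounded_at_i_inf_def by meson
 obtain Y' M' B' where B': "Y' > 0" "finite B'" "B' <= W"
   "ALL z. Re z : C --> Y' < Im z --> (EX c. (ALL b:B'. cmod (c b) <= M') & G z = (\<Sum>b\<in>B'. smul (c b) b))"
  using assms(2) C unfolding vbounded_at_i_inf_def by meson
 have "EX e. (ALL b:B \<union> B'. cmod (e b) <= \<bar>M\<bar> + \<bar>M'\<bar>) & F z + G z = (\<Sum>b\<in>B \<union> B'. smul (e b) b)"
  if z: "Re z : C" "max Y Y' < Im z" for z
 proof -
  obtain c where c: "ALL b:B. cmod (c b) <= M" "F z = (\<Sum>b\<in>B. smul (c b) b)" using B(4) z by auto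
  obtain c' where c': "ALL b:B'. cmod (c' b) <= M'" "G z = (\<Sum>b\<in>B'. smul (c' b) b)" using B'(4) z by auto
  define e where "e b = (if b : B then c b else 0) + (if b : B' then c' b else 0)" for b
  have "F z = (\<Sum>b\<in>B \<union> B'. smul (if b : B then c b else 0) b)"
   unfolding c(2) using B(2) B'(2) by (intro sum.mono_neutral_cong_left) auto
  moreover have "G z = (\<Sum>b\<in>B \<union> B'. smul (if b : B' then c' b else 0) b)"
   unfolding c'(2) using B(2) B'(2) by (intro sum.mono_neutral_cong_left) auto
  ultimately have "F z + G z = (\<Sum>b\<in>B \<union> B'. smul (e b) b)" by (simp add: e_def scale_left_distrib sum.distrib)
  moreover have "cmod (e b) <= \<bar>M\<bar> + \<bar>M'\<bar>" for b
  proof -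
   have "cmod (if b : B then c b else 0) <= \<bar>M\<bar>" using c(1) by (cases "b : B") force+
   moreover have "cmod (if b : B' then c' b else 0) <= \<bar>M'\<bar>" using c'(1) by (cases "b : B'") force+
   ultimately show ?thesis unfolding e_def by (rule norm_triangle_mono)
  qed
  ultimately show ?thesis by blast
 qed
 thus "EX Y>0. EX M. EX B. finite B & B <= W & (ALL z. Re z : C --> Y < Im z -->
   (EX c. (ALL b:B. cmod (c b) <= M) & F z + G z = (\<Sum>b\<in>B. smul (c b) b)))"
  using B(1-3) B'(1-3) by (intro exI[of _ "max Y Y'"] conjI exI[of _ "\<bar>M\<bar> + \<bar>M'\<bar>"] exI[of _ "B \<union> B'"]) auto
qed

lemma vbounded_single:
 assumes "v : W" "bounded_at_i_inf f" shows "vbounded_at_i_inf smul W (%z. smul (f z) v)"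
 unfolding vbounded_at_i_inf_def
proof (intro allI impI)
 fix C :: "real set" assume "compact C"
 then obtain Y M where YM: "Y > 0" "ALL z. Re z : C --> Y < Im z --> cmod (f z) <= M"
  using assms(2) unfolding bounded_at_i_inf_def by blast
 have "EX c. (ALL b:{v}. cmod (c b) <= M) & smul (f z) v = (\<Sum>b\<in>{v}. smul (c b) b)" if "Re z : C" "Y < Im z" for z
  using YM(2) that by (intro exI[of _ "%_. f z"]) simp
 with YM(1) assms(1) show "EX Y>0. EX M. EX B. finite B & B <= W & (ALL z. Re z : C --> Y < Im z -->
   (EX c. (ALL b:B. cmod (c b) <= M) & smul (f z) v = (\<Sum>b\<in>B. smul (c b) b)))"
  by (intro exI[of _ Y] conjI exI[of _ M] exI[of _ "{v}"]) auto
qed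

lemma vbounded_zero: "vbounded_at_i_inf smul W (%z. 0)"
 unfolding vbounded_at_i_inf_def
 by (intro allI impI exI[of _ 1] conjI exI[of _ "{}"]) auto

lemma vbounded_cong:
 assumes "vbounded_at_i_inf smul W F" "!!z. z : uhp ==> F z = G z" shows "vbounded_at_i_inf smul W G"
 unfolding vbounded_at_i_inf_def
proof (intro allI impI)
 fix C :: "real set" assume C: "compact C"
 obtain Y M B where B: "Y > 0" "finite B" "B <= W"
   "ALL z. Re z : C --> Y < Im z --> (EX c. (ALL b:B. cmod (c b) <= M) & F z = (\<Sum>b\<in>B. smul (c b) b))"
  using assms(1) C unfolding vbounded_at_i_inf_def by meson
 have "F z = G z" if "Y < Im z" for z using assms(2) that B(1) by (simp add: uhp_def)
 with B(4) have "ALL z. Re z : C --> Y < Im z --> (EX c. (ALL b:B. cmod (c b) <= M) & G z = (\<Sum>b\<in>B. smul (c b) b))" by metis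
 with B(1-3) show "EX Y>0. EX M. EX B. finite B & B <= W & (ALL z. Re z : C --> Y < Im z -->
   (EX c. (ALL b:B. cmod (c b) <= M) & G z = (\<Sum>b\<in>B. smul (c b) b)))" by blast
qed

lemma vbounded_sum:
 "finite I ==> (!!i. i : I ==> vbounded_at_i_inf smul W (F i)) ==> vbounded_at_i_inf smul W (%z. \<Sum>i\<in>I. F i z)"
 by (induction I rule: finite_induct) (auto intro: vbounded_zero vbounded_add)

lemma vholo_zero: "vholo_uhp smul W (%z. 0)"
 using vholo_sum_basis[of "{}" W] by simp

lemma vholo_sum:
 "finite I ==> (!!i. i : I ==> vholo_uhp smul W (F i)) ==> vholo_uhp smul W (%z. \<Sum>i\<in>I. F i z)"
 by (induction I rule: finite_induct) (auto intro: vholo_zero vholo_add)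

lemma vholo_single: "v : W ==> holo_uhp f ==> vholo_uhp smul W (%z. smul (f z) v)"
 using vholo_sum_basis[of "{v}" W "%_. f"] by simp

end

section \<open>Exponentials and the operators K\<close>

context quasi_voa
begin

lemma L_zero: "m : {-1, 0, 1} ==> L m 0 = 0"
 using L_scale[of m 0 0] total_0 by simp

lemma component_L0:
 assumes "v : \<V>" shows "component V (L 0 v) k = smul (of_int k) (component V v k)"
 using assms
proof (induction rule: total_induct)
 case (piece n v)
 hence "component V (L 0 v) k = smul (of_int n) (component V v k)"
  by (simp only: L0_degree component_scale[OF piece_total])
 thus ?case by (cases "k = n") (simp_all add: component_piece[OF piece])
next
 case (add u v)
 thus ?case by (simp add: L_add component_add L_closed scale_right_distrib)
qed

lemma L0_eigen:
 assumes "v : \<V>" "L 0 v = smul (of_int n) v" shows "v : V n"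
proof (rule component_eq_self[OF assms(1)])
 fix k assume "k ~= n"
 have "smul (of_int k) (component V v k) = smul (of_int n) (component V v k)"
  unfolding component_L0[OF assms(1), symmetric] assms(2) component_scale[OF assms(1)] ..
 hence "smul (of_int k - of_int n) (component V v k) = 0" by (simp add: scale_left_diff_distrib)
 with \<open>k ~= n\<close> show "component V v k = 0" by simp
qed

lemma L_degree:
 assumes m: "m : {-1, 0, 1}" and v: "v : V n" shows "L m v : V (n - m)"
proof (rule L0_eigen[OF L_closed[OF m piece_total[OF v]]])
 have vt: "v : \<V>" by (rule piece_total[OF v])
 have "L 0 (L m v) - L m (L 0 v) = smul (of_int (0 - m)) (L (0 + m) v)"
  using sl2[of 0 m v] m vt by simp
 moreover have "L m (L 0 v) = smul (of_int n) (L m v)" using L_scale[OF m vt] L0_degree[OF v] by simp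
 ultimately have "L 0 (L m v) = smul (of_int n) (L m v) + smul (of_int (- m)) (L m v)"
  by (simp add: diff_eq_eq add.commute)
 thus "L 0 (L m v) = smul (of_int (n - m)) (L m v)"
  by (simp only: scale_left_distrib[symmetric] of_int_add[symmetric]) simp
qed

abbreviation "L1p i \<equiv> (L 1 ^^ i)"

lemma L1p_total: "v : \<V> ==> L1p i v : \<V>"
 by (induction i) (simp_all add: L_closed)

lemma L1p_add: "u : \<V> ==> v : \<V> ==> L1p i (u + v) = L1p i u + L1p i v"
 by (induction i) (simp_all add: L_add L1p_total)

lemma L1p_scale: "v : \<V> ==> L1p i (smul c v) = smul c (L1p i v)"
 by (induction i) (simp_all add: L_scale L1p_total)

lemma L1p_zero: "L1p i 0 = 0"
 by (induction i) (simp_all add: L_zero)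

lemma L1p_degree: "v : V n ==> L1p i v : V (n - int i)"
proof (induction i)
 case (Suc i)
 thus ?case using L_degree[of 1 "L1p i v" "n - int i"] by (simp add: algebra_simps)
qed simp

lemma L1p_L1p: "L1p i (L1p j v) = L1p (i + j) v"
 by (simp add: funpow_add)

lemma L1p_vanish:
 assumes low: "!!n. n < N0 ==> V n = {0}" and v: "v : filtration V N" and i: "N - int i < N0"
 shows "L1p i v = 0"
 using v
proof (induction rule: filtration_induct)
 case (piece n v)
 hence "n - int i < N0" using i by linarith
 thus ?case using L1p_degree[OF piece(2), of i] low by simp
next
 case (add u v)
 thus ?case using L1p_add filtration_total by simp
qed (simp add: L1p_zero)

lemma total_filtration: "v : \<V> ==> EX N. v : filtration V N"
proof (induction rule: total_induct)
 case (piece n v)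
 thus ?case using piece_filtration by blast
next
 case (add u v)
 then obtain N M where "u : filtration V N" "v : filtration V M" by blast
 hence "u : filtration V (max N M)" "v : filtration V (max N M)"
  using filtration_mono[of N "max N M"] filtration_mono[of M "max N M"] by auto
 thus ?case using subspace_add[OF filtration_subspace] by blast
qed

lemma L1p_nilpotent_filtration: "EX I. ALL i>=I. ALL v:filtration V N. L1p i v = 0"
proof -
 obtain N0 where N0: "ALL n<N0. V n = {0}" using bounded_below by blast
 have "L1p i v = 0" if "i >= nat (N - N0 + 1)" "v : filtration V N" for i v
  by (rule L1p_vanish[OF _ that(2), of N0]) (use N0 that(1) in auto)
 thus ?thesis by blast
qed

lemma L1p_nilpotent: "v : \<V> ==> EX I. ALL i>=I. L1p i v = 0"
 using total_filtration L1p_nilpotent_filtration by meson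

abbreviation "E a v \<equiv> exp_op smul (L 1) a v"

lemma E_sum: "(!!i. i >= I ==> L1p i v = 0) ==> E a v = (\<Sum>i<I. smul (a ^ i / fact i) (L1p i v))"
 unfolding exp_op_def by (rule Sum_any_nat_less) simp

lemma E_total: "v : \<V> ==> E a v : \<V>"
proof -
 assume v: "v : \<V>"
 then obtain I where "!!i. i >= I ==> L1p i v = 0" using L1p_nilpotent by blast
 thus ?thesis using v by (simp add: E_sum[of I] total_sum total_scale L1p_total)
qed

lemma E_add:
 assumes "u : \<V>" "v : \<V>" shows "E a (u + v) = E a u + E a v"
proof -
 obtain I J where I: "!!i. i >= I ==> L1p i u = 0" and J: "!!i. i >= J ==> L1p i v = 0"
  using L1p_nilpotent assms by meson
 have "E a u = (\<Sum>i<max I J. smul (a ^ i / fact i) (L1p i u))" "E a v = (\<Sum>i<max I J. smul (a ^ i / fact i) (L1p i v))"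
  using I J by (intro E_sum; simp)+
 moreover have "E a (u + v) = (\<Sum>i<max I J. smul (a ^ i / fact i) (L1p i (u + v)))"
  using I J by (intro E_sum) (simp add: L1p_add assms)
 ultimately show ?thesis by (simp add: L1p_add assms scale_right_distrib sum.distrib)
qed

lemma E_scale:
 assumes "v : \<V>" shows "E a (smul c v) = smul c (E a v)"
proof -
 obtain I where I: "!!i. i >= I ==> L1p i v = 0" using L1p_nilpotent assms by blast
 have "E a (smul c v) = (\<Sum>i<I. smul (a ^ i / fact i) (L1p i (smul c v)))"
  using I by (intro E_sum) (simp add: L1p_scale assms)
 thus ?thesis using I by (simp add: E_sum[of I] L1p_scale assms scale_sum_right mult.commute)
qed

lemma E_zero_vec: "E a 0 = 0"
 by (subst E_sum[of 0]) (simp_all add: L1p_zero)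

lemma E_0: "v : \<V> ==> E 0 v = v"
proof -
 assume v: "v : \<V>"
 then obtain I where I: "!!i. i >= I ==> L1p i v = 0" using L1p_nilpotent by blast
 have "E 0 v = (\<Sum>i<Suc I. smul (0 ^ i / fact i) (L1p i v))" using I by (intro E_sum) simp
 also have "\<dots> = (\<Sum>i\<in>{0}. smul (0 ^ i / fact i) (L1p i v))" by (rule sum.mono_neutral_right) auto
 finally show ?thesis by simp
qed

lemma E_finite_sum:
 assumes "!!i. i : I ==> x i : \<V>"
 shows "E a (\<Sum>i\<in>I. smul (c i) (x i)) = (\<Sum>i\<in>I. smul (c i) (E a (x i)))"
 using assms
proof (induction I rule: infinite_finite_induct)
 case (insert i I)
 hence "(\<Sum>i\<in>I. smul (c i) (x i)) : \<V>" by (intro total_sum total_scale) auto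
 with insert show ?case by (simp add: E_add total_scale E_scale)
qed (simp_all add: E_zero_vec)

lemma E_E:
 assumes v: "v : \<V>" shows "E a (E b v) = E (a + b) v"
proof -
 obtain I where I: "!!i. i >= I ==> L1p i v = 0" using L1p_nilpotent v by blast
 have I': "L1p i (L1p j v) = 0" if "i >= I" for i j using I that by (simp add: L1p_L1p)
 define g where "g i j = smul (a ^ i / fact i * (b ^ j / fact j)) (L1p (i + j) v)" for i j
 have "E a (E b v) = E a (\<Sum>j<I. smul (b ^ j / fact j) (L1p j v))" using E_sum[of I v b] I by simp
 also have "\<dots> = (\<Sum>j<I. smul (b ^ j / fact j) (E a (L1p j v)))" by (rule E_finite_sum) (simp add: L1p_total v)
 also have "\<dots> = (\<Sum>j<I. \<Sum>i<I. g i j)"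
 proof (rule sum.cong[OF refl])
  fix j
  have "E a (L1p j v) = (\<Sum>i<I. smul (a ^ i / fact i) (L1p i (L1p j v)))" by (rule E_sum) (rule I')
  thus "smul (b ^ j / fact j) (E a (L1p j v)) = (\<Sum>i<I. g i j)"
   by (simp add: g_def scale_sum_right L1p_L1p mult.commute)
 qed
 also have "\<dots> = (\<Sum>i<I. \<Sum>j<I. g i j)" by (rule sum.swap)
 also have "\<dots> = (\<Sum>(i, j)\<in>{..<I} \<times> {..<I}. g i j)" by (simp add: sum.cartesian_product)
 also have "\<dots> = (\<Sum>(i, j)\<in>{(i, j). i + j < I}. g i j)"
 proof (rule sum.mono_neutral_right)
  show "ALL p:{..<I} \<times> {..<I} - {(i, j). i + j < I}. (case p of (i, j) => g i j) = 0"
  proof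
   fix p assume "p : {..<I} \<times> {..<I} - {(i, j). i + j < I}"
   hence "I <= fst p + snd p" by auto
   hence "L1p (fst p + snd p) v = 0" by (rule I)
   thus "(case p of (i, j) => g i j) = 0" by (simp add: g_def split_beta)
  qed
 qed auto
 also have "\<dots> = (\<Sum>k<I. \<Sum>i\<le>k. g i (k - i))" by (rule sum.triangle_reindex)
 also have "\<dots> = (\<Sum>k<I. smul ((a + b) ^ k / fact k) (L1p k v))"
 proof (rule sum.cong[OF refl])
  fix k
  have "(a + b) ^ k / fact k = (\<Sum>i\<le>k. a ^ i / fact i * (b ^ (k - i) / fact (k - i)))"
   unfolding binomial_ring sum_divide_distrib
   by (rule sum.cong[OF refl]) (simp add: binomial_fact field_simps)
  thus "(\<Sum>i\<le>k. g i (k - i)) = smul ((a + b) ^ k / fact k) (L1p k v)"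
   by (simp add: g_def scale_sum_left)
 qed
 also have "\<dots> = E (a + b) v" by (rule E_sum[OF I, symmetric])
 finally show ?thesis .
qed

abbreviation "D x v \<equiv> deg_op smul V x v"

lemma D_gext: "D x v = gext (%n. smul (x powi (- 2 * n))) v"
 by (simp add: deg_op_def gext_def)

lemma D_piece: "v : V n ==> D x v = smul (x powi (- 2 * n)) v"
 unfolding D_gext by (rule gext_piece) simp_all

lemma D_add: "u : \<V> ==> v : \<V> ==> D x (u + v) = D x u + D x v"
 unfolding D_gext by (rule gext_add) (simp_all add: scale_right_distrib)

lemma D_total: "v : \<V> ==> D x v : \<V>"
proof (induction rule: total_induct)
 case (piece n v)
 thus ?case by (simp add: D_piece total_scale piece_total)
qed (simp add: D_add total_add)

lemma D_scale: "v : \<V> ==> D x (smul c v) = smul c (D x v)"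
proof (induction rule: total_induct)
 case (piece n v)
 thus ?case using D_piece[OF subspace_scale[OF subspace_piece piece], of x c] by (simp add: D_piece mult.commute)
qed (simp add: D_add scale_right_distrib total_scale)

lemma D_inverse: "v : \<V> ==> x ~= 0 ==> D x (D (1 / x) v) = v"
proof (induction rule: total_induct)
 case (piece n v)
 have "x powi (- 2 * n) * (1 / x) powi (- 2 * n) = 1"
  using piece(2) by (simp flip: power_int_mult_distrib)
 thus ?case using piece by (simp add: D_piece D_scale piece_total mult.commute)
qed (simp add: D_add D_total)

text \<open>\<open>L(1)\<close> lowers the degree by one, so conjugation by
\<open>x\<^sup>-\<^sup>2\<^sup>L\<^sup>(\<^sup>0\<^sup>)\<close> multiplies it by
\<open>x\<^sup>2\<close>.\<close>

lemma D_E: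
 assumes "v : \<V>" "x ~= 0" shows "D x (E a v) = E (x\<^sup>2 * a) (D x v)"
 using assms(1)
proof (induction rule: total_induct)
 case (piece n v)
 have vt: "v : \<V>" by (rule piece_total[OF piece])
 obtain I where I: "!!i. i >= I ==> L1p i v = 0" using L1p_nilpotent vt by blast
 have "D x (\<Sum>i\<in>S. smul (a ^ i / fact i) (L1p i v)) = (\<Sum>i\<in>S. smul (a ^ i / fact i) (D x (L1p i v)))" if "finite S" for S
  using that
 proof (induction S rule: finite_induct)
  case empty
  thus ?case using D_piece[OF zero_piece, of x 0] by simp
 next
  case (insert i S)
  have "(\<Sum>i\<in>S. smul (a ^ i / fact i) (L1p i v)) : \<V>" by (intro total_sum total_scale L1p_total vt)
  with insert show ?case by (simp add: D_add D_scale total_scale L1p_total vt)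
 qed
 hence "D x (E a v) = (\<Sum>i<I. smul (a ^ i / fact i) (D x (L1p i v)))" by (simp add: E_sum[OF I])
 also have "\<dots> = (\<Sum>i<I. smul (x powi (- 2 * n)) (smul ((x\<^sup>2 * a) ^ i / fact i) (L1p i v)))"
 proof (rule sum.cong[OF refl])
  fix i
  have "x powi (- 2 * (n - int i)) = x powi (- 2 * n) * (x\<^sup>2) ^ i"
  proof -
   have "x powi (- 2 * (n - int i)) = x powi (- 2 * n + 2 * int i)" by (simp add: algebra_simps)
   also have "\<dots> = x powi (- 2 * n) * x powi (2 * int i)" by (rule power_int_add) (use assms(2) in simp)
   also have "x powi (2 * int i) = (x\<^sup>2) ^ i" by (simp add: power_int_mult)
   finally show ?thesis .
  qed
  thus "smul (a ^ i / fact i) (D x (L1p i v)) = smul (x powi (- 2 * n)) (smul ((x\<^sup>2 * a) ^ i / fact i) (L1p i v))"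
   using D_piece[OF L1p_degree[OF piece], of x i] by (simp add: power_mult_distrib mult_ac)
 qed
 also have "\<dots> = E (x\<^sup>2 * a) (D x v)"
  by (simp add: D_piece[OF piece] E_scale vt E_sum[OF I] scale_sum_right)
 finally show ?case .
qed (simp add: E_add D_add E_total D_total)

text \<open>Moving \<open>j\<^sup>-\<^sup>2\<^sup>L\<^sup>(\<^sup>0\<^sup>)\<close> to the left of the
exponential rescales its argument \<open>-cj\<close> to \<open>-X\<close>.\<close>

lemma K_inverse:
 assumes g: "g : SL2R" "z : uhp" and w: "w : \<V>"
 shows "the_inv_into (\<V>) (K_op smul V L g z) w = E (Xfac g z) (D (1 / jfac g z) w)"
proof -
 define j X c where j_X_c_def: "j = jfac g z" "X = Xfac g z" "c = complex_of_real (g$2$1)"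
 have j: "j ~= 0" using jfac_nonzero[OF g] by (simp add: j_X_c_def)
 have jX: "j\<^sup>2 * X = c * j" using j by (simp add: j_X_c_def Xfac_def power2_eq_square)
 have K: "K_op smul V L g z v = D j (E (- X) v)" if "v : \<V>" for v
  using D_E[OF that j, of "- X"] jX by (simp add: K_op_def j_X_c_def)
 have "inj_on (K_op smul V L g z) (\<V>)"
 proof (rule inj_onI)
  fix u v assume uv: "u : \<V>" "v : \<V>" "K_op smul V L g z u = K_op smul V L g z v"
  have recover: "E X (D (1 / j) (K_op smul V L g z v)) = v" if v: "v : \<V>" for v
  proof -
   have "D (1 / j) (D j (E (- X) v)) = E (- X) v"
    using D_inverse[OF E_total[OF v], of "1 / j" "- X"] j by simp
   thus ?thesis unfolding K[OF v] using E_E[OF v, of X "- X"] E_0[OF v] by simp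
  qed
  show "u = v" using recover[OF uv(1)] recover[OF uv(2)] unfolding uv(3) by (rule trans[OF sym])
 qed
 thus ?thesis
 proof (rule the_inv_into_f_eq)
  show "E (Xfac g z) (D (1 / jfac g z) w) : \<V>" by (intro E_total D_total w)
  show "K_op smul V L g z (E (Xfac g z) (D (1 / jfac g z) w)) = w"
  proof -
   have "K_op smul V L g z (E X (D (1 / j) w)) = D j (E (- X + X) (D (1 / j) w))"
    unfolding K[OF E_total[OF D_total[OF w]]] E_E[OF D_total[OF w]] ..
   also have "\<dots> = w" using E_0[OF D_total[OF w]] D_inverse[OF w j] by simp
   finally show ?thesis unfolding j_X_c_def .
  qed
 qed
qed

lemma vslash_eq:
 assumes "g : SL2R" "z : uhp" "F (mobius g z) : \<V>"
 shows "vslash smul V L k F g z = smul (jfac g z powi (- k)) (E (Xfac g z) (D (1 / jfac g z) (F (mobius g z))))"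
 unfolding vslash_def K_inverse[OF assms] ..

lemma vslash_add:
 assumes "g : SL2R" "z : uhp" "F (mobius g z) : \<V>" "G (mobius g z) : \<V>"
 shows "vslash smul V L k (%z. F z + G z) g z = vslash smul V L k F g z + vslash smul V L k G g z"
 using assms by (simp add: vslash_eq total_add D_add E_add D_total scale_right_distrib)

text \<open>For a homogeneous vector the vector-valued slash operator separates into the scalar one in
weight \<open>k - 2n\<close> and \<open>exp(X L(1))\<close>.\<close>

lemma vslash_fun_vec:
 assumes "g : SL2R" "z : uhp" and v: "v : V n"
 shows "vslash smul V L k (fun_vec smul f v) g z = smul (slash (k - 2 * n) f g z) (E (Xfac g z) v)"
proof -
 have vt: "v : \<V>" by (rule piece_total[OF v])
 have j: "jfac g z ~= 0" using jfac_nonzero assms by blast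
 have "(1 / jfac g z) powi (- 2 * n) = jfac g z powi (2 * n)"
  by (simp add: power_int_divide_distrib power_int_minus field_simps)
 moreover have "jfac g z powi (- k) * jfac g z powi (2 * n) = jfac g z powi (- (k - 2 * n))"
  using j by (simp flip: power_int_add)
 ultimately show ?thesis
  using assms by (simp add: vslash_eq fun_vec_def total_scale vt D_scale D_piece[OF v] E_scale slash_def mult_ac)
qed

end

section \<open>The graded algebra of quasimodular forms\<close>

lemma uderiv_cmult': "holo_uhp f ==> uderiv (%z. c * f z) = (%z. c * uderiv f z)"
proof
 fix z assume "holo_uhp f"
 thus "uderiv (%z. c * f z) z = c * uderiv f z"
  using DERIV_cmult[OF uderiv_DERIV, of f z c] DERIV_imp_deriv
  by (cases "z : uhp") (auto simp: uderiv_def)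
qed

lemma uderiv_add': "holo_uhp f ==> holo_uhp g ==> uderiv (%z. f z + g z) = (%z. uderiv f z + uderiv g z)"
proof
 fix z assume "holo_uhp f" "holo_uhp g"
 thus "uderiv (%z. f z + g z) z = uderiv f z + uderiv g z"
  using DERIV_add[OF uderiv_DERIV uderiv_DERIV, of f z g] DERIV_imp_deriv
  by (cases "z : uhp") (auto simp: uderiv_def)
qed

context first_kind
begin

abbreviation "\<A> \<equiv> total_space (QM \<Gamma>)"

definition qcoeff :: "int => (complex => complex) => nat => complex => complex" where
 "qcoeff k f = (SOME Q. qm_coeffs \<Gamma> k f Q)"

lemma qcoeff: "f : QM \<Gamma> k ==> qm_coeffs \<Gamma> k f (qcoeff k f)"
by (metis (mono_tags, lifting) QM_def mem_Collect_eq qcoeff_def)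

lemma qcoeff_eq: "qm_coeffs \<Gamma> k f Q ==> qcoeff k f = Q"
 using qm_coeffs_unique unfolding qcoeff_def by (metis someI)

lemma QM_holo: "f : QM \<Gamma> k ==> holo_uhp f"
 by (simp add: QM_def)

lemma plus_fun_lambda: "(f :: 'a => 'b::plus) + g = (%z. f z + g z)"
 by (simp add: fun_eq_iff)

lemma fscale_mult: "fscale (*) c f = (%z. c * f z)"
 by (simp add: fscale_def)

lemma qm_add:
 assumes "f : QM \<Gamma> k" "g : QM \<Gamma> k"
 shows "f + g : QM \<Gamma> k" "qcoeff k (f + g) m = qcoeff k f m + qcoeff k g m"
proof -
 have *: "qm_coeffs \<Gamma> k (f + g) (%m z. qcoeff k f m z + qcoeff k g m z)"
  unfolding plus_fun_lambda by (rule qm_coeffs_add[OF qcoeff[OF assms(1)] qcoeff[OF assms(2)]])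
 thus "f + g : QM \<Gamma> k" using assms unfolding QM_def by (auto simp: plus_fun_lambda holo_uhp_add)
 show "qcoeff k (f + g) m = qcoeff k f m + qcoeff k g m" unfolding qcoeff_eq[OF *] by (simp add: plus_fun_lambda)
qed

lemma qm_scale:
 assumes "f : QM \<Gamma> k"
 shows "fscale (*) c f : QM \<Gamma> k" "qcoeff k (fscale (*) c f) m = fscale (*) c (qcoeff k f m)"
proof -
 have *: "qm_coeffs \<Gamma> k (fscale (*) c f) (%m z. c * qcoeff k f m z)"
  unfolding fscale_mult by (rule qm_coeffs_cmult[OF qcoeff[OF assms(1)]])
 thus "fscale (*) c f : QM \<Gamma> k" using assms unfolding QM_def by (auto simp: fscale_mult holo_uhp_cmult)
 show "qcoeff k (fscale (*) c f) m = fscale (*) c (qcoeff k f m)" unfolding qcoeff_eq[OF *] by (simp add: fscale_mult)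
qed

lemma qm_zero: "0 : QM \<Gamma> k"
 unfolding QM_def zero_fun_def using qm_coeffs_zero holo_uhp_zero by blast

lemma qm_mult: "f : QM \<Gamma> k ==> g : QM \<Gamma> l ==> (%z. f z * g z) : QM \<Gamma> (k + l)"
 using qm_coeffs_mult[OF \<Gamma>_SL2R] holo_uhp_mult unfolding QM_def by blast

lemma qcoeff_mult:
 assumes "f : QM \<Gamma> k" "g : QM \<Gamma> l"
 shows "qcoeff (k + l) (%z. f z * g z) = (%m z. \<Sum>i\<le>m. qcoeff k f i z * qcoeff l g (m - i) z)"
 by (rule qcoeff_eq[OF qm_coeffs_mult[OF \<Gamma>_SL2R qcoeff[OF assms(1)] qcoeff[OF assms(2)]]])

lemma qcoeff_0: "f : QM \<Gamma> k ==> qcoeff k f 0 = f"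
 using qm_coeffs_Q0[OF QM_holo qcoeff] by blast

lemma qcoeff_in: "f : QM \<Gamma> k ==> qcoeff k f m : QM \<Gamma> (k - 2 * int m)"
 using qm_coeffs_Q[OF qcoeff] qm_coeffs_holo[OF qcoeff] unfolding QM_def by blast

lemma qm_uderiv: "f : QM \<Gamma> k ==> uderiv f : QM \<Gamma> (k + 2)"
 using qm_coeffs_uderiv[OF \<Gamma>_SL2R QM_holo qcoeff] holo_uderiv[OF QM_holo] unfolding QM_def by blast

lemma qcoeff_uderiv:
 assumes "f : QM \<Gamma> k"
 shows "qcoeff (k + 2) (uderiv f) 1 = uderiv (qcoeff k f 1) + fscale (*) (of_int k) f"
 unfolding qcoeff_eq[OF qm_coeffs_uderiv[OF \<Gamma>_SL2R QM_holo[OF assms] qcoeff[OF assms]]]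
 by (simp add: fun_eq_iff fscale_mult qcoeff_0[OF assms])

lemma QM_subspace: "cfun.subspace (QM \<Gamma> k)"
 unfolding cfun.subspace_def using qm_zero qm_add(1) qm_scale(1) by blast

lemma QM_graded_eq: "QM_graded \<Gamma> = QM \<Gamma>"
proof
 fix k show "QM_graded \<Gamma> k = QM \<Gamma> k"
  using QM_negative qm_zero by (auto simp: QM_graded_def)
qed

sublocale QMg: graded_vector_space "fscale ((*) :: complex => complex => complex)" "QM \<Gamma>"
proof unfold_locales
 show "cfun.subspace (QM \<Gamma> n)" for n by (rule QM_subspace)
 fix x assume x: "finsupp_family (QM \<Gamma>) x" "Sum_any x = 0"
 define K where "K = {k. x k ~= 0}"
 have K: "finite K" "!!k. x k : QM \<Gamma> k" using x(1) by (simp_all add: finsupp_family_def K_def)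
 have "(\<Sum>k\<in>K. x k z) = 0" for z
 proof -
  have "(\<Sum>k\<in>K. x k) = 0" using x(2) by (simp add: Sum_any.expand_set K_def)
  thus ?thesis by (metis sum_fun_at zero_fun_apply)
 qed
 hence "x k = 0" if "k : K" for k using QM_sum_zero[OF K(1) K(2)] that by blast
 thus "x = (%_. 0)" by (auto simp: K_def fun_eq_iff)
qed

lemma total_holo: "f : \<A> ==> holo_uhp f"
 by (induction rule: QMg.total_induct) (auto simp: QM_holo plus_fun_lambda holo_uhp_add)

lemma qcoeff_zero: "qcoeff k 0 m = 0"
by (metis QMg.zero_piece add_cancel_left_left qm_add(2))

text \<open>Induction on the depth: the top coefficient of a form with at most \<open>s + 1\<close>
coefficients is modular, and forms for which it vanishes have at most \<open>s\<close>.\<close>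

lemma QM_fin_dim:
 assumes cusp: "cusps \<Gamma> ~= {}" shows "fin_dim (fscale (*)) (QM \<Gamma> k)"
proof -
 define D where "D s = {f\<in>QM \<Gamma> k. ALL m>=s. qcoeff k f m = 0}" for s :: nat
 have sub: "cfun.subspace (D s)" for s
  unfolding cfun.subspace_def
 proof (intro conjI ballI allI)
  show "0 : D s" unfolding D_def using qm_zero qcoeff_zero by blast
 next
  fix f g assume "f : D s" "g : D s"
  thus "f + g : D s" by (simp add: D_def qm_add)
 next
  fix c f assume "f : D s"
  hence f: "f : QM \<Gamma> k" "!!m. m >= s ==> qcoeff k f m = 0" by (simp_all add: D_def)
  have "fscale (*) c (0 :: complex => complex) = 0" by (simp add: fscale_mult fun_eq_iff)
  thus "fscale (*) c f : D s" unfolding D_def using qm_scale[OF f(1)] f(2) by auto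
 qed
 have fin: "fin_dim (fscale (*)) (D s)" for s
 proof (induction s)
  case 0
  have "D 0 <= {0}"
  proof
   fix f assume "f : D 0"
   hence "f : QM \<Gamma> k" "qcoeff k f 0 = 0" by (simp_all add: D_def)
   thus "f : {0}" using qcoeff_0 by (metis singletonI)
  qed
  thus ?case by (rule cfun.fin_dim_subspace_of[OF sub _ cfun.fin_dim_zero])
 next
  case (Suc s)
  have fm: "fin_dim (fscale (*)) {f. modform \<Gamma> (k - 2 * int s) f}"
  proof (cases "k - 2 * int s >= 0")
   case True
   hence "k - 2 * int s = int (nat (k - 2 * int s))" by simp
   thus ?thesis using modform_fin_dim[OF cusp, of "nat (k - 2 * int s)"] by metis
  next
   case False
   hence "{f. modform \<Gamma> (k - 2 * int s) f} <= {0}" using modform_negative by auto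
   thus ?thesis by (rule cfun.fin_dim_subspace_of[OF modform_subspace _ cfun.fin_dim_zero])
  qed
  show ?case
  proof (rule cfun.fin_dim_rank[OF sub fm])
   show "(%f. qcoeff k f s) ` D (Suc s) <= {f. modform \<Gamma> (k - 2 * int s) f}"
    using modform_top[OF qcoeff] by (auto simp: D_def)
   have "{f : D (Suc s). qcoeff k f s = 0} = D s"
    by (auto simp: D_def) (metis Suc_leI le_neq_implies_less)
   with Suc show "fin_dim (fscale (*)) {f : D (Suc s). qcoeff k f s = 0}" by simp
  qed (simp_all add: D_def qm_add qm_scale)
 qed
 have "QM \<Gamma> k = D (nat k + 1)"
  using qm_coeffs_top[OF qcoeff] by (force simp: D_def)
 with fin show ?thesis by metis
qed

text \<open>The operators \<open>L(m)\<close> on scalar forms: \<open>Q\<^sub>1\<close>, half the weight,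
and the derivative.\<close>

definition qop :: "int => (complex => complex) => complex => complex" where
 "qop m f = (if m = 1 then QMg.gext (%k f. qcoeff k f 1) f
  else if m = 0 then QMg.gext (%k. fscale (*) (of_int k / 2)) f else uderiv f)"

lemma qop_simps:
 assumes "f : QM \<Gamma> k"
 shows "qop 1 f = qcoeff k f 1" "qop 0 f = fscale (*) (of_int k / 2) f" "qop (-1) f = uderiv f"
proof -
 show "qop 1 f = qcoeff k f 1"
  unfolding qop_def if_P[OF refl] by (rule QMg.gext_piece[where \<phi> = "%k f. qcoeff k f 1", OF qcoeff_zero assms])
 have "fscale (*) c (0 :: complex => complex) = 0" for c :: complex by (simp add: fscale_mult fun_eq_iff)
 thus "qop 0 f = fscale (*) (of_int k / 2) f"
  unfolding qop_def by (simp add: QMg.gext_piece[where \<phi> = "%k. fscale (*) (of_int k / 2)", OF _ assms])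
qed (simp add: qop_def)

lemma uderiv_add: "holo_uhp f ==> holo_uhp g ==> uderiv (f + g) = uderiv f + uderiv g"
 unfolding plus_fun_lambda by (rule uderiv_add')

lemma fscale_add_right: "fscale (*) c (f + g) = fscale (*) c f + fscale (*) (c::complex) g"
 by (simp add: fscale_mult fun_eq_iff algebra_simps)

lemma qop_add:
 assumes f: "f : \<A>" and g: "g : \<A>"
 shows "qop m (f + g) = qop m f + qop m g"
proof -
 have 1: "QMg.gext (%k f. qcoeff k f 1) (f + g) = QMg.gext (%k f. qcoeff k f 1) f + QMg.gext (%k f. qcoeff k f 1) g"
  by (rule QMg.gext_add[where \<phi> = "%k f. qcoeff k f 1", OF qcoeff_zero qm_add(2) f g])
 have 0: "QMg.gext (%k. fscale (*) (of_int k / 2)) (f + g) =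
   QMg.gext (%k. fscale (*) (of_int k / 2)) f + QMg.gext (%k. fscale (*) (of_int k / 2)) g"
  by (rule QMg.gext_add[where \<phi> = "%k. fscale (*) (of_int k / 2)", OF _ fscale_add_right f g])
   (simp add: fscale_mult fun_eq_iff)
 show ?thesis unfolding qop_def using 1 0 uderiv_add[OF total_holo[OF f] total_holo[OF g]] by simp
qed

lemma qop_degree: "m : {-1, 0, 1} ==> f : QM \<Gamma> k ==> qop m f : QM \<Gamma> (k - 2 * m)"
 using qcoeff_in[of f k 1] qm_uderiv[of f k] qm_scale(1)[of f k] by (auto simp: qop_simps)

lemma qop_closed:
 assumes m: "m : {-1, 0, 1}" and "f : \<A>"
 shows "qop m f : \<A>"
 using assms(2)
proof (induction rule: QMg.total_induct)
 case (piece k f)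
 show ?case by (rule QMg.piece_total[OF qop_degree[OF m piece]])
next
 case (add f g)
 show ?case unfolding qop_add[OF add.hyps] by (rule QMg.total_add[OF add.IH])
qed

lemma qop_scale:
 assumes m: "m : {-1, 0, 1}" and f: "f : \<A>"
 shows "qop m (fscale (*) c f) = fscale (*) c (qop m f)"
 using f
proof (induction rule: QMg.total_induct)
 case (piece k f)
 note fc = qm_scale(1)[OF piece, of c]
 have "qop 1 (fscale (*) c f) = fscale (*) c (qop 1 f)" unfolding qop_simps[OF piece] qop_simps[OF fc] by (rule qm_scale(2)[OF piece])
 moreover have "qop 0 (fscale (*) c f) = fscale (*) c (qop 0 f)"
  unfolding qop_simps[OF piece] qop_simps[OF fc] by (simp add: fscale_mult mult.left_commute)
 moreover have "qop (-1) (fscale (*) c f) = fscale (*) c (qop (-1) f)"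
  unfolding qop_simps(3)[OF piece] qop_simps(3)[OF fc] unfolding fscale_mult by (rule uderiv_cmult'[OF QM_holo[OF piece]])
 ultimately show ?case using m by blast
next
 case (add u v)
 thus ?case by (simp only: fscale_add_right qop_add QMg.total_scale)
qed

lemma qop_sl2:
 assumes m: "m : {-1, 0, 1}" and n: "n : {-1, 0, 1}" and f: "f : \<A>"
 shows "qop m (qop n f) - qop n (qop m f) = fscale (*) (of_int (m - n)) (qop (m + n) f)"
 using f
proof (induction rule: QMg.total_induct)
 case (piece k f)
 have w: "qop 0 (qop j f) - qop j (qop 0 f) = fscale (*) (of_int (- j)) (qop j f)" if j: "j : {-1, 0, 1}" for j
  unfolding qop_simps(2)[OF qop_degree[OF j piece]] qop_simps(2)[OF piece] qop_scale[OF j QMg.piece_total[OF piece]]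
  by (simp add: fscale_mult fun_eq_iff algebra_simps diff_divide_distrib)
 have w': "qop j (qop 0 f) - qop 0 (qop j f) = fscale (*) (of_int j) (qop j f)" if j: "j : {-1, 0, 1}" for j
  using w[OF j] by (simp add: fscale_mult fun_eq_iff algebra_simps)
 have p1: "qop 1 (qop (-1) f) - qop (-1) (qop 1 f) = fscale (*) 2 (qop 0 f)"
  unfolding qop_simps[OF piece] qop_simps(1)[OF qm_uderiv[OF piece]] qop_simps(3)[OF qcoeff_in[OF piece, of 1]] qcoeff_uderiv[OF piece]
  by (simp add: fscale_mult fun_eq_iff)
 hence p2: "qop (-1) (qop 1 f) - qop 1 (qop (-1) f) = fscale (*) (-2) (qop 0 f)"
  by (simp add: fscale_mult fun_eq_iff algebra_simps)
 have z: "fscale (*) (0::complex) h = 0" for h by (simp add: fscale_mult fun_eq_iff)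
 consider "m = n" | "m = 0" | "n = 0" | "m = 1" "n = -1" | "m = -1" "n = 1" using m n by auto
 thus ?case
 proof cases
  case 1 thus ?thesis by (simp add: z)
 next
  case 2 thus ?thesis using w[OF n] by simp
 next
  case 3 thus ?thesis using w'[OF m] by simp
 next
  case 4 thus ?thesis using p1 by simp
 next
  case 5 thus ?thesis using p2 by simp
 qed
next
 case (add u v)
 note uv = add.hyps(1,2)
 have "qop m (qop n (u + v)) - qop n (qop m (u + v)) =
   (qop m (qop n u) + qop m (qop n v)) - (qop n (qop m u) + qop n (qop m v))"
  by (simp only: qop_add[OF uv] qop_add[OF qop_closed[OF n uv(1)] qop_closed[OF n uv(2)]]
    qop_add[OF qop_closed[OF m uv(1)] qop_closed[OF m uv(2)]])
 also have "\<dots> = (qop m (qop n u) - qop n (qop m u)) + (qop m (qop n v) - qop n (qop m v))"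
  by (rule add_diff_add)
 finally show ?case unfolding add.IH qop_add[OF uv] fscale_add_right .
qed

end

section \<open>Coordinates of vector-valued quasimodular forms\<close>

lemma triangle_sum:
 fixes g :: "nat => nat => 'a::comm_monoid_add"
 assumes "!!i j. i >= I \<or> j > s ==> g i j = 0"
 shows "(\<Sum>i<I. \<Sum>j\<le>s. g i j) = (\<Sum>l\<le>s + I. \<Sum>i\<le>l. g i (l - i))"
proof -
 have "(\<Sum>i<I. \<Sum>j\<le>s. g i j) = (\<Sum>(i, j)\<in>{..<I} \<times> {..s}. g i j)" by (simp add: sum.cartesian_product)
 also have "\<dots> = (\<Sum>(i, j)\<in>{(i, j). i + j < Suc (s + I)}. g i j)"
 proof (rule sum.mono_neutral_left)
  have "{(i, j). i + j < Suc (s + I)} <= {..s + I} \<times> {..s + I}" by auto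
  thus "finite {(i, j). i + j < Suc (s + I)}" by (rule finite_subset) simp
  show "ALL p:{(i, j). i + j < Suc (s + I)} - {..<I} \<times> {..s}. (case p of (i, j) => g i j) = 0"
  proof
   fix p assume "p : {(i, j). i + j < Suc (s + I)} - {..<I} \<times> {..s}"
   hence "fst p >= I \<or> snd p > s" by (auto simp: not_less not_le)
   from assms[OF this] show "(case p of (i, j) => g i j) = 0" by (simp add: split_beta)
  qed
  have "i + j < Suc (s + I)" if "i < I" "j <= s" for i j using that by linarith
  thus "{..<I} \<times> {..s} <= {(i, j). i + j < Suc (s + I)}" by auto
 qed
 also have "\<dots> = (\<Sum>l<Suc (s + I). \<Sum>i\<le>l. g i (l - i))" by (rule sum.triangle_reindex)
 finally show ?thesis by (simp add: lessThan_Suc_atMost)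
qed

lemma powi_reciprocal: "(1 / x) powi (- 2 * m) = (x::complex) powi (2 * m)"
by (simp add: power_int_minus_divide power_int_one_over)

locale qvoa_forms = quasi_voa smul V Y vac L + first_kind \<Gamma>
 for smul :: "complex => 'v::ab_group_add => 'v" and V :: "int => 'v set"
  and Y :: "'v => int => 'v => 'v" and vac :: 'v and L :: "int => 'v => 'v" and \<Gamma> :: "(real^2^2) set"
begin

abbreviation "\<Q> \<equiv> QMV smul V L \<Gamma>"
abbreviation "\<F> \<equiv> total_space \<Q>"
abbreviation "fvec \<equiv> fun_vec smul"
abbreviation "scl \<equiv> fscale smul"
abbreviation "vqm \<equiv> vqm_coeffs smul V L \<Gamma>"
abbreviation "vsl \<equiv> vslash smul V L"

lemma vslash_sum:
 assumes g: "g : SL2R" "w : uhp" and F: "!!i. i : I ==> F i (mobius g w) : \<V>"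
 shows "vsl k (%w. \<Sum>i\<in>I. F i w) g w = (\<Sum>i\<in>I. vsl k (F i) g w)"
proof -
 have z: "vsl k (%w. 0) g w = 0"
  using vslash_eq[OF g, of "%w. 0"] D_piece[OF zero_piece, of _ 0] total_0 by (simp add: E_zero_vec)
 show ?thesis using F
 proof (induction I rule: infinite_finite_induct)
  case (insert i I)
  hence "(\<Sum>i\<in>I. F i (mobius g w)) : \<V>" by (intro total_sum) auto
  with insert show ?case using vslash_add[OF g, of "F i" "%w. \<Sum>i\<in>I. F i w"] by simp
 qed (simp_all add: z)
qed

lemma L1p_filtration: "v : filtration V N ==> L1p i v : filtration V N"
proof (induction rule: filtration_induct)
 case (piece n v)
 show ?case by (rule piece_filtration[OF L1p_degree[OF piece(2)]]) (use piece in simp)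
next
 case (add u v)
 thus ?case using L1p_add filtration_total subspace_add[OF filtration_subspace] by simp
qed (simp add: L1p_zero subspace_0[OF filtration_subspace])

lemma D_filtration: "v : filtration V N ==> D x v : filtration V N"
proof (induction rule: filtration_induct)
 case (piece n v)
 thus ?case using D_piece piece_filtration subspace_scale[OF filtration_subspace] by simp
next
 case (add u v)
 thus ?case using D_add filtration_total subspace_add[OF filtration_subspace] by simp
qed (use D_piece[OF zero_piece, of x 0] subspace_0[OF filtration_subspace] in simp)

lemma E_filtration: assumes "v : filtration V N" shows "E a v : filtration V N"
proof -
 obtain I where I: "!!i. i >= I ==> L1p i v = 0" using L1p_nilpotent filtration_total[OF assms] by blast
 have "E a v = (\<Sum>i<I. smul (a ^ i / fact i) (L1p i v))" by (rule E_sum) (rule I)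
 thus ?thesis
  using subspace_sum[OF filtration_subspace subspace_scale[OF filtration_subspace L1p_filtration[OF assms]]] by simp
qed

text \<open>The product of the expansions of \<open>f|\<gamma>\<close> and of \<open>exp(X L(1)) v\<close>
in powers of \<open>X\<close>.\<close>

lemma fun_vec_coeffs:
 assumes f: "f : QM \<Gamma> j" and v: "v : V n"
 shows "vqm n (j + 2 * n) (fvec f v)
  (%m z. \<Sum>i\<le>m. smul (qcoeff j f (m - i) z / fact i) (L1p i v))"
 unfolding vqm_coeffs_def
proof (intro conjI allI ballI impI)
 have vf: "L1p i v : filtration V n" for i by (rule piece_filtration[OF L1p_degree[OF v]]) simp
 have hq: "holo_uhp (%z. qcoeff j f m z / c)" for m c
  using holo_uhp_cmult[OF qm_coeffs_holo[OF qcoeff[OF f]], of "1 / c"] by simp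
 show "vholo_uhp smul (filtration V n) (%z. \<Sum>i\<le>m. smul (qcoeff j f (m - i) z / fact i) (L1p i v))" for m
  by (rule vholo_sum) (auto intro!: vholo_single vf hq)
 obtain s where s: "ALL m>s. qcoeff j f m = 0"
  "ALL s'>=s. ALL g:\<Gamma>. ALL z:uhp. slash j f g z = (\<Sum>m\<le>s'. Xfac g z ^ m * qcoeff j f m z)"
  using qm_coeffs_expansion[OF qcoeff[OF f]] by blast
 obtain I where I: "!!i. i >= I ==> L1p i v = 0" using L1p_nilpotent piece_total[OF v] by blast
 show "EX s. (ALL m>s. (%z. \<Sum>i\<le>m. smul (qcoeff j f (m - i) z / fact i) (L1p i v)) = 0) &
   (ALL g:\<Gamma>. ALL z:uhp. vsl (j + 2 * n) (fvec f v) g z =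
    (\<Sum>m\<le>s. smul (Xfac g z ^ m) (\<Sum>i\<le>m. smul (qcoeff j f (m - i) z / fact i) (L1p i v))))"
 proof (intro exI[of _ "s + I"] conjI allI impI ballI)
  fix m assume m: "m > s + I"
  have "smul (qcoeff j f (m - i) z / fact i) (L1p i v) = 0" for i z
  proof (cases "i >= I")
   case False
   hence "qcoeff j f (m - i) = 0" using s(1) m by simp
   thus ?thesis by simp
  qed (simp add: I)
  hence "(\<Sum>i\<le>m. smul (qcoeff j f (m - i) z / fact i) (L1p i v)) = 0" for z
   by (intro sum.neutral ballI)
  thus "(%z. \<Sum>i\<le>m. smul (qcoeff j f (m - i) z / fact i) (L1p i v)) = 0"
   unfolding fun_eq_iff zero_fun_apply by blast
 next
  fix g z assume g: "g : \<Gamma>" "z : uhp"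
  define X where "X = Xfac g z"
  define h where "h i m = smul (X ^ (i + m) * qcoeff j f m z / fact i) (L1p i v)" for i m
  have "vsl (j + 2 * n) (fvec f v) g z = smul (slash j f g z) (E X v)"
   using vslash_fun_vec[OF in_SL2R[OF g(1)] g(2) v, of "j + 2 * n" f] by (simp add: X_def)
  also have "slash j f g z = (\<Sum>m\<le>s. X ^ m * qcoeff j f m z)"
   using s(2)[rule_format, of s g z] g by (simp add: X_def)
  also have "E X v = (\<Sum>i<I. smul (X ^ i / fact i) (L1p i v))" by (rule E_sum[OF I])
  also have "smul (\<Sum>m\<le>s. X ^ m * qcoeff j f m z) (\<Sum>i<I. smul (X ^ i / fact i) (L1p i v)) = (\<Sum>i<I. \<Sum>m\<le>s. h i m)"
   unfolding scale_sum_right by (rule sum.cong[OF refl])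
    (simp add: h_def sum_distrib_right sum_distrib_left sum_divide_distrib scale_sum_left power_add mult_ac)
  also have "\<dots> = (\<Sum>l\<le>s + I. \<Sum>i\<le>l. h i (l - i))"
  proof (rule triangle_sum)
   fix i m assume "i >= I \<or> m > s"
   hence "L1p i v = 0 \<or> qcoeff j f m = 0" using I s(1) by blast
   thus "h i m = 0" by (auto simp: h_def)
  qed
  also have "\<dots> = (\<Sum>m\<le>s + I. smul (X ^ m) (\<Sum>i\<le>m. smul (qcoeff j f (m - i) z / fact i) (L1p i v)))"
   by (intro sum.cong refl) (simp add: h_def scale_sum_right)
  finally show "vsl (j + 2 * n) (fvec f v) g z =
    (\<Sum>m\<le>s + I. smul (Xfac g z ^ m) (\<Sum>i\<le>m. smul (qcoeff j f (m - i) z / fact i) (L1p i v)))"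
   by (simp add: X_def)
 qed
 fix t m assume t: "t : SL2R" "bdry_mobius t None : cusps \<Gamma>"
 have "vbounded_at_i_inf smul (filtration V n) (%z. \<Sum>i\<le>m. \<Sum>l<I.
   smul ((1 / (fact i * fact l)) * (slash (j - 2 * int (m - i)) (qcoeff j f (m - i)) t z * Xfac t z ^ l)) (L1p (l + i) v))"
  by (intro vbounded_sum finite_atMost finite_lessThan vbounded_single[OF vf] bounded_at_i_inf_cmult bounded_at_i_inf_mult
    qm_coeffs_bounded[OF qcoeff[OF f] t] bounded_at_i_inf_power bounded_Xfac t)
 thus "vbounded_at_i_inf smul (filtration V n)
   (vsl (j + 2 * n - 2 * int m) (%z. \<Sum>i\<le>m. smul (qcoeff j f (m - i) z / fact i) (L1p i v)) t)"
 proof (rule vbounded_cong)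
  fix z assume z: "z : uhp"
  have "vsl (j + 2 * n - 2 * int m) (%z. \<Sum>i\<le>m. smul (qcoeff j f (m - i) z / fact i) (L1p i v)) t z =
    (\<Sum>i\<le>m. vsl (j + 2 * n - 2 * int m) (%z. smul (qcoeff j f (m - i) z / fact i) (L1p i v)) t z)"
   by (rule vslash_sum[OF t(1) z]) (intro total_scale L1p_total piece_total[OF v])
  also have "\<dots> = (\<Sum>i\<le>m. \<Sum>l<I. smul ((1 / (fact i * fact l)) *
    (slash (j - 2 * int (m - i)) (qcoeff j f (m - i)) t z * Xfac t z ^ l)) (L1p (l + i) v))"
  proof (rule sum.cong[OF refl])
   fix i assume i: "i : {..m}"
   have w: "j + 2 * n - 2 * int m - 2 * (n - int i) = j - 2 * int (m - i)" using i by auto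
   have "vsl (j + 2 * n - 2 * int m) (fvec (%z. (1 / fact i) * qcoeff j f (m - i) z) (L1p i v)) t z =
     smul (slash (j - 2 * int (m - i)) (%z. (1 / fact i) * qcoeff j f (m - i) z) t z) (E (Xfac t z) (L1p i v))"
    unfolding vslash_fun_vec[OF t(1) z L1p_degree[OF v]] w ..
   also have "E (Xfac t z) (L1p i v) = (\<Sum>l<I. smul (Xfac t z ^ l / fact l) (L1p l (L1p i v)))"
    by (rule E_sum) (simp add: L1p_L1p I)
   finally show "vsl (j + 2 * n - 2 * int m) (%z. smul (qcoeff j f (m - i) z / fact i) (L1p i v)) t z =
     (\<Sum>l<I. smul ((1 / (fact i * fact l)) *
      (slash (j - 2 * int (m - i)) (qcoeff j f (m - i)) t z * Xfac t z ^ l)) (L1p (l + i) v))"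
    unfolding slash_cmult by (simp add: fun_vec_def L1p_L1p scale_sum_right mult_ac)
  qed
  finally show "(\<Sum>i\<le>m. \<Sum>l<I. smul ((1 / (fact i * fact l)) *
    (slash (j - 2 * int (m - i)) (qcoeff j f (m - i)) t z * Xfac t z ^ l)) (L1p (l + i) v)) =
    vsl (j + 2 * n - 2 * int m) (%z. \<Sum>i\<le>m. smul (qcoeff j f (m - i) z / fact i) (L1p i v)) t z" ..
 qed
qed

lemma vholo_filtration_in: "vholo_uhp smul (filtration V N) F ==> F z : filtration V N"
 by (rule vholo_in[OF _ filtration_subspace])

lemma vqm_coeffs_holo: "vqm N k F Q ==> vholo_uhp smul (filtration V N) (Q m)"
 by (simp add: vqm_coeffs_def)

lemma vqm_coeffs_expansion:
 assumes "vqm N k F Q"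
 shows "EX s. (ALL m>s. Q m = 0) & (ALL s'>=s. ALL g:\<Gamma>. ALL z:uhp. vsl k F g z = (\<Sum>m\<le>s'. smul (Xfac g z ^ m) (Q m z)))"
proof -
 obtain s where s: "ALL m>s. Q m = 0"
   "ALL g:\<Gamma>. ALL z:uhp. vsl k F g z = (\<Sum>m\<le>s. smul (Xfac g z ^ m) (Q m z))"
  using assms unfolding vqm_coeffs_def by blast
 have eq: "(\<Sum>m\<le>s'. smul (Xfac g z ^ m) (Q m z)) = (\<Sum>m\<le>s. smul (Xfac g z ^ m) (Q m z))" if "s' >= s" for s' g z
 proof (rule sum.mono_neutral_right)
  show "ALL m:{..s'} - {..s}. smul (Xfac g z ^ m) (Q m z) = 0"
  by (simp add: s(1))
 qed (use that in simp_all)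
 have "vsl k F g z = (\<Sum>m\<le>s'. smul (Xfac g z ^ m) (Q m z))" if "s' >= s" "g : \<Gamma>" "z : uhp" for s' g z
  unfolding eq[OF that(1)] using s(2) that(2,3) by blast
 with s(1) show ?thesis by blast
qed

lemma vqm_coeffs_add:
 assumes F: "vqm N k F Q" "!!w. F w : \<V>"
  and G: "vqm M k G R" "!!w. G w : \<V>"
 shows "vqm (max N M) k (%w. F w + G w) (%m w. Q m w + R m w)"
 unfolding vqm_coeffs_def
proof (intro conjI allI ballI impI)
 have mono: "filtration V N <= filtration V (max N M)" "filtration V M <= filtration V (max N M)"
  by (intro filtration_mono; simp)+
 show "vholo_uhp smul (filtration V (max N M)) (%w. Q m w + R m w)" for m
  using vholo_add[OF vholo_mono[OF vqm_coeffs_holo[OF F(1)] mono(1)] vholo_mono[OF vqm_coeffs_holo[OF G(1)] mono(2)]] .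
 obtain s where s: "ALL m>s. Q m = 0" "ALL s'>=s. ALL g:\<Gamma>. ALL w:uhp. vsl k F g w = (\<Sum>m\<le>s'. smul (Xfac g w ^ m) (Q m w))"
  using vqm_coeffs_expansion[OF F(1)] by blast
 obtain t where t: "ALL m>t. R m = 0" "ALL s'>=t. ALL g:\<Gamma>. ALL w:uhp. vsl k G g w = (\<Sum>m\<le>s'. smul (Xfac g w ^ m) (R m w))"
  using vqm_coeffs_expansion[OF G(1)] by blast
 show "EX s. (ALL m>s. (%w. Q m w + R m w) = 0) & (ALL g:\<Gamma>. ALL w:uhp. vsl k (%w. F w + G w) g w =
   (\<Sum>m\<le>s. smul (Xfac g w ^ m) (Q m w + R m w)))"
 proof (intro exI[of _ "max s t"] conjI allI impI ballI)
  fix m assume "m > max s t"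
  hence "Q m = 0" "R m = 0" using s(1) t(1) by auto
  thus "(%w. Q m w + R m w) = 0" by (intro ext) simp
 next
  fix g w assume g: "g : \<Gamma>" "w : uhp"
  show "vsl k (%w. F w + G w) g w = (\<Sum>m\<le>max s t. smul (Xfac g w ^ m) (Q m w + R m w))"
   using vslash_add[OF in_SL2R[OF g(1)] g(2) F(2) G(2)] s(2)[rule_format, of "max s t" g w] t(2)[rule_format, of "max s t" g w] g
   by (simp add: scale_right_distrib sum.distrib)
 qed
 fix h m assume h: "h : SL2R" "bdry_mobius h None : cusps \<Gamma>"
 have b: "vbounded_at_i_inf smul (filtration V N) (vsl (k - 2 * int m) (Q m) h)"
  "vbounded_at_i_inf smul (filtration V M) (vsl (k - 2 * int m) (R m) h)"
  using F(1) G(1) h unfolding vqm_coeffs_def by blast+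
 have "vbounded_at_i_inf smul (filtration V (max N M))
   (%w. vsl (k - 2 * int m) (Q m) h w + vsl (k - 2 * int m) (R m) h w)"
  by (rule vbounded_add[OF vbounded_mono[OF b(1) mono(1)] vbounded_mono[OF b(2) mono(2)]])
 thus "vbounded_at_i_inf smul (filtration V (max N M)) (vsl (k - 2 * int m) (%w. Q m w + R m w) h)"
 proof (rule vbounded_cong)
  fix w assume w: "w : uhp"
  have "Q m z : \<V>" "R m z : \<V>" for z
   using vholo_filtration_in[OF vqm_coeffs_holo] F(1) G(1) filtration_total by blast+
  thus "vsl (k - 2 * int m) (Q m) h w + vsl (k - 2 * int m) (R m) h w =
    vsl (k - 2 * int m) (%w. Q m w + R m w) h w"
   using vslash_add[OF h(1) w] by simp
 qed
qed

lemma QMV_E: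
 assumes "F : \<Q> k"
 obtains N Q where "vholo_uhp smul (filtration V N) F" "vqm N k F Q"
 using assms by (auto simp: QMV_def)

lemma QMV_values: "F : \<Q> k ==> F z : \<V>"
 by (auto simp: QMV_def intro: filtration_total vholo_filtration_in)

lemma QMV_off: "F : \<Q> k ==> z ~: uhp ==> F z = 0"
 by (auto simp: QMV_def dest: vholo_off)

lemma QMV_fun_vec:
 assumes "f : QM \<Gamma> j" "v : V n" shows "fvec f v : \<Q> (j + 2 * n)"
proof -
 have "vholo_uhp smul (filtration V n) (fvec f v)"
  unfolding fun_vec_def by (rule vholo_single[OF piece_filtration[OF assms(2)] QM_holo[OF assms(1)]]) simp
 with fun_vec_coeffs[OF assms] show ?thesis unfolding QMV_def by blast
qed

lemma QMV_add:
 assumes "F : \<Q> k" "G : \<Q> k" shows "F + G : \<Q> k"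
proof -
 obtain N Q where F: "vholo_uhp smul (filtration V N) F" "vqm N k F Q" using QMV_E[OF assms(1)] .
 obtain M R where G: "vholo_uhp smul (filtration V M) G" "vqm M k G R" using QMV_E[OF assms(2)] .
 have "vqm (max N M) k (%z. F z + G z) (%m z. Q m z + R m z)"
  by (rule vqm_coeffs_add[OF F(2) QMV_values[OF assms(1)] G(2) QMV_values[OF assms(2)]])
 moreover have "vholo_uhp smul (filtration V (max N M)) (%z. F z + G z)"
  by (intro vholo_add vholo_mono[OF F(1)] vholo_mono[OF G(1)] filtration_mono) auto
 ultimately show ?thesis unfolding QMV_def plus_fun_lambda by blast
qed

lemma QMV_zero: "0 : \<Q> k"
proof -
 have "fvec 0 0 : \<Q> (k + 2 * 0)" by (rule QMV_fun_vec[OF qm_zero zero_piece])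
 moreover have "fvec 0 0 = 0" by (simp add: fun_vec_def fun_eq_iff)
 ultimately show ?thesis by simp
qed

text \<open>The coordinate functional of a vector of degree \<open>n\<close> composed with
\<open>L(1)\<^sup>i\<close> sees only degree \<open>n + i\<close>, on which
\<open>j\<^sup>2\<^sup>L\<^sup>(\<^sup>0\<^sup>)\<close> is a scalar. Applying \<open>exp(-X L(1))\<close>
to the expansion of \<open>F\<close> therefore yields a polynomial in \<open>X\<close> for the scalar slash
of the coordinate, and the same computation at a cusp gives boundedness.\<close>

lemma crd_quasimodular:
 assumes F: "F : \<Q> k" and b: "b : hbasis" "b : V n"
 shows "(%w. crd b (F w)) : QM \<Gamma> (k - 2 * n)"
proof -
 obtain N Q where F1: "vholo_uhp smul (filtration V N) F" and F2: "vqm N k F Q" using QMV_E[OF F] .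
 obtain I where I: "ALL i>=I. ALL v:filtration V N. L1p i v = 0" using L1p_nilpotent_filtration by blast
 define \<psi> where "\<psi> i v = crd b (L1p i v)" for i v
 have fun\<psi>: "functional (\<psi> i)" for i
  unfolding functional_def \<psi>_def by (auto simp: L1p_add L1p_scale crd_add crd_scale L1p_total)
 have ftot: "filtration V N <= \<V>" using filtration_total by blast
 have \<psi>add: "\<psi> i (u + v) = \<psi> i u + \<psi> i v" "\<psi> i (smul c u) = c * \<psi> i u"
  if "u : \<V>" "v : \<V>" for i u v c
  using fun\<psi>[of i] that unfolding functional_def by blast+
 have \<psi>0: "\<psi> i 0 = 0" for i using functional_zero[OF fun\<psi>] .
 have \<psi>sum: "\<psi> i (\<Sum>l\<in>S. smul (c l) (x l)) = (\<Sum>l\<in>S. c l * \<psi> i (x l))"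
  if "!!l. l : S ==> x l : \<V>" for i S and c :: "nat => complex" and x
  using that
 proof (induction S rule: infinite_finite_induct)
  case (insert l S)
  have "(\<Sum>l\<in>S. smul (c l) (x l)) : \<V>" using insert by (intro total_sum total_scale) auto
  thus ?case using insert \<psi>add(1)[OF total_scale, of "x l" _ i "c l"] \<psi>add(2)[of "x l" "x l" i "c l"] by simp
 qed (simp_all add: \<psi>0)
 have \<psi>D: "\<psi> i (D x v) = x powi (- 2 * (n + int i)) * \<psi> i v" if "v : \<V>" for i x v
  using that
 proof (induction rule: total_induct)
  case (piece m v)
  have "\<psi> i (D x v) = x powi (- 2 * m) * \<psi> i v"
   using \<psi>add(2)[OF piece_total[OF piece] piece_total[OF piece]] by (simp add: D_piece[OF piece])
  moreover have "\<psi> i v = 0" if "m ~= n + int i"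
   unfolding \<psi>_def by (rule crd_other_degree[OF b(2,1) L1p_degree[OF piece]]) (use that in auto)
  ultimately show ?case by (cases "m = n + int i") auto
 next
  case (add u v)
  thus ?case by (simp add: D_add \<psi>add D_total distrib_left)
 qed
 have \<psi>E: "\<psi> i (E a v) = (\<Sum>r<I. a ^ r / fact r * \<psi> (i + r) v)" if v: "v : filtration V N" for i a v
 proof -
  have "\<psi> i (E a v) = \<psi> i (\<Sum>r<I. smul (a ^ r / fact r) (L1p r v))"
   using I v by (simp add: E_sum[of I])
  also have "\<dots> = (\<Sum>r<I. a ^ r / fact r * \<psi> i (L1p r v))"
   by (rule \<psi>sum) (simp add: L1p_total filtration_total[OF v])
  finally show ?thesis by (simp add: \<psi>_def L1p_L1p)
 qed
 have \<psi>van: "\<psi> i v = 0" if "i >= I" "v : filtration V N" for i v using I that by (simp add: \<psi>_def)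
 have Qin: "Q m w : filtration V N" for m w by (rule vholo_filtration_in[OF vqm_coeffs_holo[OF F2]])
 have Fin: "F w : filtration V N" for w by (rule vholo_filtration_in[OF F1])
 \<comment> \<open>undoing the slash operator on a coordinate\<close>
 have unslash: "\<psi> i (E (- Xfac g w) (vsl l G g w)) =
   slash (l - 2 * (n + int i)) (%w. \<psi> i (G w)) g w"
  if g: "g : SL2R" "w : uhp" and G: "!!z. G z : \<V>" for g w G l i
 proof -
  define j X where "j = jfac g w" "X = Xfac g w"
  have j: "j ~= 0" using jfac_nonzero[OF g] by (simp add: j_X_def)
  have Dt: "D (1 / j) (G (mobius g w)) : \<V>" by (rule D_total[OF G])
  have "E (- X) (vsl l G g w) = smul (j powi (- l)) (D (1 / j) (G (mobius g w)))"
   using vslash_eq[OF g G, of l] by (simp add: j_X_def[symmetric] E_scale E_total Dt E_E E_0)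
  hence "\<psi> i (E (- X) (vsl l G g w)) = j powi (- l) * ((1 / j) powi (- 2 * (n + int i)) * \<psi> i (G (mobius g w)))"
   using \<psi>add(2)[OF Dt Dt] \<psi>D[OF G] by simp
  also have "j powi (- l) * ((1 / j) powi (- 2 * (n + int i)) * \<psi> i (G (mobius g w))) =
    j powi (- (l - 2 * (n + int i))) * \<psi> i (G (mobius g w))"
  proof -
   have "(1 / j) powi (- 2 * (n + int i)) = j powi (2 * (n + int i))" by (rule powi_reciprocal)
   thus ?thesis using power_int_add[of j "- l" "2 * (n + int i)"] j by (simp add: algebra_simps)
  qed
  finally show ?thesis by (simp add: slash_def j_X_def)
 qed
 define P where "P m w = (\<Sum>i\<le>m. (- 1) ^ i / fact i * \<psi> i (Q (m - i) w))" for m w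
 have "qm_coeffs \<Gamma> (k - 2 * n) (%w. crd b (F w)) P"
 proof -
  obtain s where s: "ALL m>s. Q m = 0" "ALL s'>=s. ALL g:\<Gamma>. ALL w:uhp. vsl k F g w = (\<Sum>m\<le>s'. smul (Xfac g w ^ m) (Q m w))"
   using vqm_coeffs_expansion[OF F2] by blast
  show ?thesis
  proof (rule qm_coeffsI[where s = "s + I"])
   show "holo_uhp (P m)" for m unfolding P_def
    by (intro holo_uhp_sum holo_uhp_cmult vholo_functional[OF fun\<psi> ftot vqm_coeffs_holo[OF F2]])
  next
   fix m assume m: "m > s + I"
   have "(- 1) ^ i / fact i * \<psi> i (Q (m - i) w) = 0" for i w
   proof (cases "i >= I")
    case False
    hence "Q (m - i) = 0" using s(1) m by simp
    thus ?thesis by (simp add: \<psi>0)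
   qed (simp add: \<psi>van Qin)
   thus "P m = 0" by (intro ext) (simp add: P_def)
  next
   fix g w assume g: "g : \<Gamma>" "w : uhp"
   define X where "X = Xfac g w"
   define R where "R = vsl k F g w"
   have R: "R = (\<Sum>m\<le>s. smul (X ^ m) (Q m w))" using s(2)[rule_format, of s g w] g by (simp add: R_def X_def)
   have Rin: "R : filtration V N"
    unfolding R by (intro subspace_sum[OF filtration_subspace] subspace_scale[OF filtration_subspace] Qin)
   have "slash (k - 2 * n) (%w. crd b (F w)) g w = \<psi> 0 (E (- X) R)"
    using unslash[OF in_SL2R[OF g(1)] g(2), of F 0 k] filtration_total[OF Fin] by (simp add: \<psi>_def X_def R_def)
   also have "\<dots> = (\<Sum>i<I. (- X) ^ i / fact i * \<psi> i R)" using \<psi>E[OF Rin, of 0] by simp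
   also have "\<dots> = (\<Sum>i<I. \<Sum>m\<le>s. X ^ (i + m) * ((- 1) ^ i / fact i * \<psi> i (Q m w)))"
   proof (rule sum.cong[OF refl])
    fix i
    have "\<psi> i R = (\<Sum>m\<le>s. X ^ m * \<psi> i (Q m w))"
     unfolding R by (rule \<psi>sum) (rule filtration_total[OF Qin])
    moreover have "(- X) ^ i = (- 1) ^ i * X ^ i" by (rule power_minus)
    ultimately show "(- X) ^ i / fact i * \<psi> i R = (\<Sum>m\<le>s. X ^ (i + m) * ((- 1) ^ i / fact i * \<psi> i (Q m w)))"
     by (simp add: sum_distrib_left sum_divide_distrib power_add mult_ac)
   qed
   also have "\<dots> = (\<Sum>l\<le>s + I. \<Sum>i\<le>l. X ^ (i + (l - i)) * ((- 1) ^ i / fact i * \<psi> i (Q (l - i) w)))"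
   proof (rule triangle_sum)
    fix i m assume "i >= I \<or> m > s"
    hence "\<psi> i (Q m w) = 0"
    proof
     assume "m > s"
     hence "Q m = 0" using s(1) by simp
     thus ?thesis by (simp add: \<psi>0)
    qed (simp add: \<psi>van Qin)
    thus "X ^ (i + m) * ((- 1) ^ i / fact i * \<psi> i (Q m w)) = 0" by simp
   qed
   also have "\<dots> = (\<Sum>m\<le>s + I. X ^ m * P m w)"
    by (intro sum.cong refl) (simp add: P_def sum_distrib_left)
   finally show "slash (k - 2 * n) (%w. crd b (F w)) g w = (\<Sum>m\<le>s + I. Xfac g w ^ m * P m w)"
    by (simp add: X_def)
  next
   fix h m assume h: "h : SL2R" "bdry_mobius h None : cusps \<Gamma>"
   define G where "G i = vsl (k - 2 * int (m - i)) (Q (m - i)) h" for i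
   have Gb: "vbounded_at_i_inf smul (filtration V N) (G i)" for i
    using F2 h unfolding vqm_coeffs_def G_def by blast
   have "bounded_at_i_inf (%w. - Xfac h w)"
    using bounded_at_i_inf_cmult[OF bounded_Xfac[OF h(1)], of "-1"] by simp
   hence mX: "bounded_at_i_inf (%w. (1 / fact r) * (- Xfac h w) ^ r)" for r
    by (intro bounded_at_i_inf_cmult bounded_at_i_inf_power)
   have "bounded_at_i_inf (%w. \<Sum>i\<le>m. (- 1) ^ i / fact i * (\<Sum>r<I. (1 / fact r) * (- Xfac h w) ^ r * \<psi> (i + r) (G i w)))"
    by (intro bounded_at_i_inf_sum bounded_at_i_inf_cmult finite_atMost finite_lessThan
      bounded_at_i_inf_mult[OF mX] vbounded_functional[OF fun\<psi> ftot Gb])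
   thus "bounded_at_i_inf (slash (k - 2 * n - 2 * int m) (P m) h)"
   proof (rule bounded_at_i_inf_cong)
    fix w assume w: "w : uhp"
    have Qt: "Q l z : \<V>" for l z by (rule filtration_total[OF Qin])
    have summand: "(\<Sum>r<I. (1 / fact r) * (- Xfac h w) ^ r * \<psi> (i + r) (G i w)) =
      slash (k - 2 * n - 2 * int m) (%w. \<psi> i (Q (m - i) w)) h w" if i: "i <= m" for i
    proof -
     have Gin: "G i w : filtration V N"
      unfolding G_def vslash_eq[OF h(1) w Qt]
      by (intro subspace_scale[OF filtration_subspace] E_filtration D_filtration Qin)
     have "(\<Sum>r<I. (1 / fact r) * (- Xfac h w) ^ r * \<psi> (i + r) (G i w)) = \<psi> i (E (- Xfac h w) (G i w))"
      using \<psi>E[OF Gin, of i "- Xfac h w"] by simp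
     also have "\<dots> = slash (k - 2 * int (m - i) - 2 * (n + int i)) (%w. \<psi> i (Q (m - i) w)) h w"
      unfolding G_def by (rule unslash[OF h(1) w Qt])
     also have "k - 2 * int (m - i) - 2 * (n + int i) = k - 2 * n - 2 * int m" using i by simp
     finally show ?thesis .
    qed
    have "(\<Sum>i\<le>m. (- 1) ^ i / fact i * (\<Sum>r<I. (1 / fact r) * (- Xfac h w) ^ r * \<psi> (i + r) (G i w))) =
      (\<Sum>i\<le>m. (- 1) ^ i / fact i * slash (k - 2 * n - 2 * int m) (%w. \<psi> i (Q (m - i) w)) h w)"
     by (rule sum.cong[OF refl]) (simp only: summand atMost_iff)
    also have "\<dots> = slash (k - 2 * n - 2 * int m) (P m) h w"
     by (simp add: slash_def P_def sum_distrib_left mult_ac)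
    finally show "(\<Sum>i\<le>m. (- 1) ^ i / fact i * (\<Sum>r<I. (1 / fact r) * (- Xfac h w) ^ r * \<psi> (i + r) (G i w))) =
      slash (k - 2 * n - 2 * int m) (P m) h w" .
   qed
  qed
 qed
 moreover have "holo_uhp (%w. crd b (F w))"
  using vholo_functional[OF fun\<psi>[of 0] ftot F1] by (simp add: \<psi>_def)
 ultimately show ?thesis unfolding QM_def by blast
qed

lemma finite_basis_piece: "finite (hbasis \<inter> V n)"
proof -
 obtain B where B: "finite B" "V n = span B" using finite_dimensional by blast
 have "independent (hbasis \<inter> V n)" by (rule independent_mono[OF hbasis(2)]) simp
 thus ?thesis using independent_span_bound[OF B(1)] B(2) by blast
qed

lemma filtration_crd_support: "EX S. finite S & S <= hbasis & (ALL v:filtration V N. ALL b. b ~: S --> crd b v = 0)"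
proof -
 obtain N0 where N0: "ALL n<N0. V n = {0}" using bounded_below by blast
 define S where "S = (\<Union>n\<in>{N0..N}. hbasis \<inter> V n)"
 have "crd b v = 0" if "v : filtration V N" and b: "b ~: S" for v b
  using that(1)
 proof (induction rule: filtration_induct)
  case (piece n v)
  show ?case
  proof (cases "n < N0")
   case True
   hence "v = 0" using piece N0 by simp
   thus ?thesis by simp
  next
   case False
   show ?thesis
   proof (rule ccontr)
    assume "crd b v ~= 0"
    hence "b : hbasis" "b : V n" using crd_hbasis crd_off_degree[OF piece(2)] by blast+
    with False piece(1) have "b : S" by (auto simp: S_def)
    with b show False by simp
   qed
  qed
 next
  case (add u v)
  thus ?case using crd_add filtration_total by simp
 qed simp
 moreover have "finite S" unfolding S_def using finite_basis_piece by blast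
 moreover have "S <= hbasis" by (auto simp: S_def)
 ultimately show ?thesis by blast
qed

lemma QMV_expand:
 assumes "F : \<Q> k"
 shows "EX S. finite S & S <= hbasis & (ALL w b. b ~: S --> crd b (F w) = 0) &
  F = (\<Sum>b\<in>S. fvec (%w. crd b (F w)) b)"
proof -
 obtain N Q where F: "vholo_uhp smul (filtration V N) F" "vqm N k F Q" using QMV_E[OF assms] .
 obtain S where S: "finite S" "S <= hbasis" "!!v b. v : filtration V N ==> b ~: S ==> crd b v = 0"
  using filtration_crd_support by metis
 have z: "crd b (F w) = 0" if "b ~: S" for b w using S(3) vholo_filtration_in[OF F(1)] that by blast
 have "F w = (\<Sum>b\<in>S. fvec (%w. crd b (F w)) b) w" for w
  unfolding sum_fun_at fun_vec_def using crd_expand[OF QMV_values[OF assms] S(1), of w] z by blast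
 hence "F = (\<Sum>b\<in>S. fvec (%w. crd b (F w)) b)" by (rule ext)
 with S(1,2) z show ?thesis by blast
qed

text \<open>Properties of vector-valued forms are proved on products \<open>f v\<close> and extended
additively.\<close>

lemma QMV_induct [consumes 1, case_names zero fun_vec add]:
 assumes F: "F : \<Q> k" and "P 0"
  and gen: "!!n f v. f : QM \<Gamma> (k - 2 * n) ==> v : V n ==> P (fvec f v)"
  and add: "!!F G. F : \<Q> k ==> G : \<Q> k ==> P F ==> P G ==> P (F + G)"
 shows "P F"
proof -
 obtain S where S: "finite S" "S <= hbasis" "F = (\<Sum>b\<in>S. fvec (%z. crd b (F z)) b)"
  using QMV_expand[OF F] by blast
 have "(\<Sum>b\<in>T. fvec (%z. crd b (F z)) b) : \<Q> k & P (\<Sum>b\<in>T. fvec (%z. crd b (F z)) b)"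
  if "finite T" "T <= hbasis" for T
  using that
 proof (induction T rule: finite_induct)
  case empty
  show ?case unfolding sum.empty using assms(2) QMV_zero by blast
 next
  case (insert b T)
  obtain n where n: "b : V n" using insert(4) hbasis(1) by blast
  have q: "(%z. crd b (F z)) : QM \<Gamma> (k - 2 * n)" using crd_quasimodular[OF F _ n] insert by simp
  have "fvec (%z. crd b (F z)) b : \<Q> k" using QMV_fun_vec[OF q n] by simp
  moreover have "(\<Sum>b\<in>T. fvec (%z. crd b (F z)) b) : \<Q> k & P (\<Sum>b\<in>T. fvec (%z. crd b (F z)) b)"
   using insert by blast
  ultimately show ?case unfolding sum.insert[OF insert(1,2)] using gen[OF q n] add QMV_add by blast
 qed
 from this[OF S(1,2)] S(3) show ?thesis by metis
qed

lemma fscale_fun_vec: "scl c (fvec f v) = fvec (fscale (*) c f) v"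
 by (simp add: fscale_def fun_vec_def)

lemma QMV_scale: "F : \<Q> k ==> scl c F : \<Q> k"
proof (induction rule: QMV_induct)
 case zero
 have z: "scl c 0 = 0" by (simp add: fscale_def fun_eq_iff)
 show ?case unfolding z by (rule QMV_zero)
next
 case (fun_vec n f v)
 thus ?case using QMV_fun_vec[OF qm_scale(1)[OF fun_vec(1), of c] fun_vec(2)] by (simp add: fscale_fun_vec)
next
 case (add F G)
 have z: "scl c (F + G) = scl c F + scl c G" by (simp add: fscale_def fun_eq_iff scale_right_distrib)
 show ?case unfolding z by (rule QMV_add[OF add(3,4)])
qed

lemma vqm_coeffs_unique:
 assumes F: "vqm N k F Q" and G: "vqm M k F R" shows "Q = R"
proof (intro ext)
 fix m z
 obtain s where s: "ALL m>s. Q m = 0" "ALL s'>=s. ALL g:\<Gamma>. ALL z:uhp. vsl k F g z = (\<Sum>m\<le>s'. smul (Xfac g z ^ m) (Q m z))"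
  using vqm_coeffs_expansion[OF F(1)] by blast
 obtain t where t: "ALL m>t. R m = 0" "ALL s'>=t. ALL g:\<Gamma>. ALL z:uhp. vsl k F g z = (\<Sum>m\<le>s'. smul (Xfac g z ^ m) (R m z))"
  using vqm_coeffs_expansion[OF G(1)] by blast
 have Qt: "Q m z : \<V>" "R m z : \<V>" for m z
  using vholo_filtration_in[OF vqm_coeffs_holo] F G filtration_total by blast+
 show "Q m z = R m z"
 proof (cases "z : uhp")
  case False
  thus ?thesis using vholo_off[OF vqm_coeffs_holo[OF F]] vholo_off[OF vqm_coeffs_holo[OF G]] by simp
 next
  case z: True
  define u where "u = max m (max s t)"
  show ?thesis
  proof (rule crd_eqI[OF Qt])
   fix b
   have "crd b (Q m z) - crd b (R m z) = 0"
   proof (rule X_independent[OF z, where s = u and a = "%m. crd b (Q m z) - crd b (R m z)"])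
    fix g assume g: "g : \<Gamma>"
    have "(\<Sum>m\<le>u. smul (Xfac g z ^ m) (Q m z)) = (\<Sum>m\<le>u. smul (Xfac g z ^ m) (R m z))"
     using s(2)[rule_format, of u g z] t(2)[rule_format, of u g z] g z by (simp add: u_def)
    hence "crd b (\<Sum>m\<le>u. smul (Xfac g z ^ m) (Q m z)) = crd b (\<Sum>m\<le>u. smul (Xfac g z ^ m) (R m z))" by simp
    thus "(\<Sum>m\<le>u. (crd b (Q m z) - crd b (R m z)) * Xfac g z ^ m) = 0"
     unfolding crd_lincomb[OF Qt(1)] crd_lincomb[OF Qt(2)] by (simp add: right_diff_distrib sum_subtractf mult.commute)
   qed (simp add: u_def)
   thus "crd b (Q m z) = crd b (R m z)" by simp
  qed
 qed
qed

sublocale QVg: graded_vector_space "scl" \<Q>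
proof (intro graded_vector_space.intro graded_vector_space_axioms.intro)
 show vs: "vector_space (scl)" by (rule vector_space_fscale) unfold_locales
 show "Modules.module.subspace (scl) (\<Q> n)" for n
 proof -
  interpret fv: vector_space "scl" by (rule vs)
  show ?thesis unfolding fv.subspace_def using QMV_zero QMV_add QMV_scale by blast
 qed
 fix x assume x: "finsupp_family \<Q> x" "Sum_any x = 0"
 define K where "K = {k. x k ~= 0}"
 have K: "finite K" "!!k. x k : \<Q> k" using x(1) by (simp_all add: finsupp_family_def K_def)
 have sumK: "(\<Sum>k\<in>K. x k z) = 0" for z
 proof -
  have "(\<Sum>k\<in>K. x k) = 0" using x(2) by (simp add: Sum_any.expand_set K_def)
  thus ?thesis by (metis sum_fun_at zero_fun_apply)
 qed
 have "crd b (x k z) = 0" if k: "k : K" for b k z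
 proof (cases "b : hbasis")
  case False thus ?thesis using crd_hbasis by blast
 next
  case True
  then obtain n where n: "b : V n" using hbasis(1) by blast
  define f where "f j = (%z. crd b (x (j + 2 * n) z))" for j
  have "f (k - 2 * n) = 0"
  proof (rule QM_sum_zero[where K = "(%k. k - 2 * n) ` K" and f = f])
   show "finite ((%k. k - 2 * n) ` K)" using K(1) by simp
   show "f j : QM \<Gamma> j" for j unfolding f_def using crd_quasimodular[OF K(2) True n, of "j + 2 * n"] by simp
   fix z
   have "(\<Sum>j\<in>(%k. k - 2 * n) ` K. f j z) = (\<Sum>k\<in>K. crd b (x k z))"
    by (subst sum.reindex) (auto simp: inj_on_def f_def)
   also have "\<dots> = 0" using crd_lincomb[where I = K and c = "%_. 1" and x = "%k. x k z" and b = b] QMV_values[OF K(2)] sumK by simp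
   finally show "(\<Sum>j\<in>(%k. k - 2 * n) ` K. f j z) = 0" .
  qed (use k in simp)
  thus ?thesis by (auto simp: f_def fun_eq_iff)
 qed
 hence "x k z = 0" if "k : K" for k z
  using crd_eqI[OF QMV_values[OF K(2)] total_0, of k z] that by simp
 hence "x k = 0" if "k : K" for k using that by (auto simp: fun_eq_iff)
 thus "x = (%_. 0)" by (auto simp: K_def fun_eq_iff)
qed

lemma forms_induct [consumes 1, case_names fun_vec add]:
 assumes "F : \<F>"
  and gen: "!!j n f v. f : QM \<Gamma> j ==> v : V n ==> P (fvec f v)"
  and add: "!!F G. F : \<F> ==> G : \<F> ==> P F ==> P G ==> P (F + G)"
 shows "P F"
 using assms(1)
proof (induction rule: QVg.total_induct)
 case (piece k F)
 thus ?case
 proof (induction rule: QMV_induct)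
  case zero
  have z: "fvec 0 0 = 0" by (simp add: fun_vec_def fun_eq_iff)
  show ?case using gen[OF qm_zero zero_piece] unfolding z .
 next
  case (fun_vec n f v) thus ?case by (rule gen)
 next
  case (add F G) thus ?case using assms(3) QVg.piece_total by blast
 qed
qed (rule add)

end

section \<open>Internal gradings and transport of graded module structures\<close>

context graded_vector_space
begin

lemma total_abelian_group:
 fixes M :: "('v, 'm) ring_scheme"
 assumes M: "carrier M = \<V>" "\<zero>\<^bsub>M\<^esub> = 0" "!!x y. x \<oplus>\<^bsub>M\<^esub> y = x + y"
 shows "abelian_group M"
proof (rule abelian_groupI)
 fix x assume "x : carrier M"
 hence "- x : carrier M" unfolding M by (rule subspace_neg[OF total_space_subspace])
 moreover have "- x \<oplus>\<^bsub>M\<^esub> x = \<zero>\<^bsub>M\<^esub>" by (simp add: M)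
 ultimately show "EX y:carrier M. y \<oplus>\<^bsub>M\<^esub> x = \<zero>\<^bsub>M\<^esub>" by blast
qed (simp_all add: M total_add total_0 add.assoc add.commute)

lemma finsum_total:
 fixes M :: "('v, 'm) ring_scheme"
 assumes M: "carrier M = \<V>" "\<zero>\<^bsub>M\<^esub> = 0" "!!x y. x \<oplus>\<^bsub>M\<^esub> y = x + y"
  and "finite S" "!!i. i : S ==> c i : \<V>"
 shows "finsum M c S = sum c S"
proof -
 interpret M: abelian_group M by (rule total_abelian_group[OF M])
 show ?thesis using assms(4,5)
 proof (induction S rule: finite_induct)
  case empty
  show ?case unfolding M.finsum_empty M(2) sum.empty ..
 next
  case (insert i S)
  have c: "c : S \<rightarrow> carrier M" "c i : carrier M" using insert(4) M(1) by auto
  show ?case unfolding M.finsum_insert[OF insert(1,2) c] M(3) sum.insert[OF insert(1,2)]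
   using insert by simp
 qed
qed

lemma grading_total:
 fixes M :: "('v, 'm) ring_scheme"
 assumes M: "carrier M = \<V>" "\<zero>\<^bsub>M\<^esub> = 0" "!!x y. x \<oplus>\<^bsub>M\<^esub> y = x + y"
 shows "grading M V"
 unfolding grading_def
proof (intro conjI allI ballI)
 interpret M: abelian_group M by (rule total_abelian_group[OF M])
 show "additive_subgroup (V k) M" for k
 proof (rule additive_subgroupI, rule M.a_group[THEN group.subgroupI])
  show "V k <= carrier (add_monoid M)" using piece_total M(1) by auto
  show "V k ~= {}" using zero_piece by blast
  show "a \<otimes>\<^bsub>add_monoid M\<^esub> b : V k" if "a : V k" "b : V k" for a b
   using subspace_add[OF subspace_piece that] M(3)[of a b] by simp
  show "inv\<^bsub>add_monoid M\<^esub> a : V k" if a: "a : V k" for a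
  proof -
   have n: "- a : V k" by (rule subspace_neg[OF subspace_piece a])
   have "\<ominus>\<^bsub>M\<^esub> a = - a"
    by (rule M.minus_equality) (use M piece_total a n in auto)
   thus ?thesis using n by (simp add: a_inv_def)
  qed
 qed
 fix x assume x: "x : carrier M"
 have fs: "finsum M c {k. c k ~= \<zero>\<^bsub>M\<^esub>} = Sum_any c" if "finsupp_family V c" for c
 proof -
  have "finsum M c {k. c k ~= 0} = sum c {k. c k ~= 0}"
   by (rule finsum_total[OF M]) (use that piece_total in \<open>auto simp: finsupp_family_def\<close>)
  thus ?thesis unfolding M(2) Sum_any.expand_set .
 qed
 have eq: "((ALL k. c k : V k) & finite {k. c k ~= \<zero>\<^bsub>M\<^esub>} & x = finsum M c {k. c k ~= \<zero>\<^bsub>M\<^esub>}) \<longleftrightarrow>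
   finsupp_family V c & x = Sum_any c" for c
  using fs[of c] unfolding finsupp_family_def M(2) by (metis (mono_tags, lifting))
 have xt: "x : \<V>" using x M(1) by simp
 show "EX! c. (ALL k. c k : V k) & finite {k. c k ~= \<zero>\<^bsub>M\<^esub>} & x = finsum M c {k. c k ~= \<zero>\<^bsub>M\<^esub>}"
  unfolding eq
 proof (rule ex1I[of _ "component V x"])
  show "finsupp_family V (component V x) & x = Sum_any (component V x)"
   using component_family[OF xt] by simp
  show "c = component V x" if "finsupp_family V c & x = Sum_any c" for c
   using component_Sum_any[of c] that by simp
 qed
qed

end

text \<open>The module axioms and the grading of the tensor product are pulled back along the bijection, so
that only the target has to be known to be a graded module.\<close>

lemma graded_module_transport:
 fixes R :: "('a, 'm) ring_scheme" and M :: "('a, 'b, 'n) module_scheme" and N :: "('a, 'c, 'l) module_scheme"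
 assumes N: "graded_module R A N C"
  and bij: "bij_betw \<phi> (carrier M) (carrier N)"
  and zero: "\<zero>\<^bsub>M\<^esub> : carrier M" "\<phi> \<zero>\<^bsub>M\<^esub> = \<zero>\<^bsub>N\<^esub>"
  and add: "!!x y. x : carrier M ==> y : carrier M ==> x \<oplus>\<^bsub>M\<^esub> y : carrier M & \<phi> (x \<oplus>\<^bsub>M\<^esub> y) = \<phi> x \<oplus>\<^bsub>N\<^esub> \<phi> y"
  and smult: "!!r x. r : carrier R ==> x : carrier M ==> r \<odot>\<^bsub>M\<^esub> x : carrier M & \<phi> (r \<odot>\<^bsub>M\<^esub> x) = r \<odot>\<^bsub>N\<^esub> \<phi> x"
  and pieces: "!!k. B k <= carrier M" "!!k. \<phi> ` B k = C k"
  and R: "!!i. A i <= carrier R"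
 shows "graded_module_iso R A M B N C \<phi>"
proof -
 have NR: "graded_cring R A" and Nm: "Module.module R N" and Ng: "grading N C"
  and Ns: "!!i j r x. r : A i ==> x : C j ==> r \<odot>\<^bsub>N\<^esub> x : C (i + j)"
  using N unfolding graded_module_def by blast+
 interpret N: Module.module R N by (rule Nm)
 have inj: "!!x y. x : carrier M ==> y : carrier M ==> \<phi> x = \<phi> y ==> x = y"
  using bij unfolding bij_betw_def inj_on_def by blast
 have im: "\<phi> x : carrier N" if "x : carrier M" for x using bij that unfolding bij_betw_def by blast
 have surj: "EX x:carrier M. \<phi> x = y" if "y : carrier N" for y
  using bij_betw_imp_surj_on[OF bij] that by (metis imageE)
 have abM: "abelian_group M"
 proof (rule abelian_groupI)
  fix x y z assume xyz: "x : carrier M" "y : carrier M" "z : carrier M"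
  show "(x \<oplus>\<^bsub>M\<^esub> y) \<oplus>\<^bsub>M\<^esub> z = x \<oplus>\<^bsub>M\<^esub> (y \<oplus>\<^bsub>M\<^esub> z)"
   by (rule inj) (simp_all add: add xyz im N.M.add.m_assoc)
 next
  fix x y assume xy: "x : carrier M" "y : carrier M"
  show "x \<oplus>\<^bsub>M\<^esub> y = y \<oplus>\<^bsub>M\<^esub> x" by (rule inj) (simp_all add: add xy im N.M.add.m_comm)
 next
  fix x assume x: "x : carrier M"
  show "\<zero>\<^bsub>M\<^esub> \<oplus>\<^bsub>M\<^esub> x = x" by (rule inj) (simp_all add: add zero x im)
  obtain y where y: "y : carrier M" "\<phi> y = \<ominus>\<^bsub>N\<^esub> \<phi> x" using surj[OF N.M.a_inv_closed[OF im[OF x]]] by blast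
  have "y \<oplus>\<^bsub>M\<^esub> x = \<zero>\<^bsub>M\<^esub>" by (rule inj) (simp_all add: add zero x y im N.M.l_neg)
  with y show "EX y:carrier M. y \<oplus>\<^bsub>M\<^esub> x = \<zero>\<^bsub>M\<^esub>" by blast
 qed (simp_all add: zero add)
 interpret M: abelian_group M by (rule abM)
 have modM: "Module.module R M"
 proof (rule moduleI[OF N.R.is_cring abM])
  fix a b x assume h: "a : carrier R" "b : carrier R" "x : carrier M"
  show "(a \<oplus>\<^bsub>R\<^esub> b) \<odot>\<^bsub>M\<^esub> x = a \<odot>\<^bsub>M\<^esub> x \<oplus>\<^bsub>M\<^esub> b \<odot>\<^bsub>M\<^esub> x"
   by (rule inj) (simp_all add: add smult h im N.smult_l_distr)
  show "(a \<otimes>\<^bsub>R\<^esub> b) \<odot>\<^bsub>M\<^esub> x = a \<odot>\<^bsub>M\<^esub> (b \<odot>\<^bsub>M\<^esub> x)"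
   by (rule inj) (simp_all add: smult h im N.smult_assoc1)
 next
  fix a x y assume h: "a : carrier R" "x : carrier M" "y : carrier M"
  show "a \<odot>\<^bsub>M\<^esub> (x \<oplus>\<^bsub>M\<^esub> y) = a \<odot>\<^bsub>M\<^esub> x \<oplus>\<^bsub>M\<^esub> a \<odot>\<^bsub>M\<^esub> y"
   by (rule inj) (simp_all add: add smult h im N.smult_r_distr)
 next
  fix x assume x: "x : carrier M"
  show "\<one>\<^bsub>R\<^esub> \<odot>\<^bsub>M\<^esub> x = x" by (rule inj) (simp_all add: smult x im)
 qed (simp add: smult)
 have BinC: "x : B k" if xM: "x : carrier M" and xC: "\<phi> x : C k" for x k
 proof -
  obtain z where "z : B k" "\<phi> z = \<phi> x" using xC pieces(2)[of k] by (metis imageE)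
  thus ?thesis using inj xM pieces(1) by (metis subsetD)
 qed
 have CB: "\<phi> x : C k" if "x : B k" for x k using that pieces(2) by blast
 have subC: "additive_subgroup (C k) N" for k using Ng unfolding grading_def by blast
 have finsum: "\<phi> (finsum M c S) = finsum N (%i. \<phi> (c i)) S & finsum M c S : carrier M"
  if finS: "finite S" and cin: "!!i. c i : carrier M" for c and S :: "int set"
  using finS
 proof (induction S rule: finite_induct)
  case empty
  show ?case unfolding M.finsum_empty N.M.finsum_empty using zero by simp
 next
  case (insert i S)
  have c: "c : S \<rightarrow> carrier M" "(%i. \<phi> (c i)) : S \<rightarrow> carrier N" using cin im by auto
  show ?case
   unfolding M.finsum_insert[OF insert(1,2) c(1) cin] N.M.finsum_insert[OF insert(1,2) c(2) im[OF cin]]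
   using insert.IH add cin by simp
 qed
 have gM: "grading M B"
  unfolding grading_def
 proof (intro conjI allI ballI)
  show "additive_subgroup (B k) M" for k
  proof (rule additive_subgroupI, rule M.a_group[THEN group.subgroupI])
   interpret Ck: additive_subgroup "C k" N by (rule subC)
   show "B k <= carrier (add_monoid M)" using pieces(1) by simp
   have "\<zero>\<^bsub>M\<^esub> : B k" using BinC[OF zero(1)] zero(2) Ck.zero_closed by simp
   thus "B k ~= {}" by blast
   show "a \<otimes>\<^bsub>add_monoid M\<^esub> b : B k" if ab: "a : B k" "b : B k" for a b
   proof -
    have c: "a : carrier M" "b : carrier M" using pieces(1) ab by blast+
    have "a \<oplus>\<^bsub>M\<^esub> b : B k" using BinC[of "a \<oplus>\<^bsub>M\<^esub> b" k] add[OF c] Ck.a_closed[OF CB[OF ab(1)] CB[OF ab(2)]] by simp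
    thus ?thesis by simp
   qed
   show "inv\<^bsub>add_monoid M\<^esub> a : B k" if a: "a : B k" for a
   proof -
    have ac: "a : carrier M" using pieces(1) a by blast
    have "\<phi> (\<ominus>\<^bsub>M\<^esub> a) \<oplus>\<^bsub>N\<^esub> \<phi> a = \<zero>\<^bsub>N\<^esub>" using add[of "\<ominus>\<^bsub>M\<^esub> a" a] ac zero(2) by (simp add: M.l_neg)
    hence "\<phi> (\<ominus>\<^bsub>M\<^esub> a) = \<ominus>\<^bsub>N\<^esub> \<phi> a"
     using N.M.minus_equality im[OF ac] im[OF M.a_inv_closed[OF ac]] by metis
    hence "\<phi> (\<ominus>\<^bsub>M\<^esub> a) : C k" using Ck.a_inv_closed CB[OF a] by simp
    from BinC[OF M.a_inv_closed[OF ac] this] show ?thesis by (simp add: a_inv_def)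
   qed
  qed
  fix x assume x: "x : carrier M"
  let ?P = "%c. (ALL k. c k : B k) & finite {k. c k ~= \<zero>\<^bsub>M\<^esub>} & x = finsum M c {k. c k ~= \<zero>\<^bsub>M\<^esub>}"
  let ?Q = "%c. (ALL k. c k : C k) & finite {k. c k ~= \<zero>\<^bsub>N\<^esub>} & \<phi> x = finsum N c {k. c k ~= \<zero>\<^bsub>N\<^esub>}"
  have exQ: "EX! c. ?Q c" using Ng im[OF x] unfolding grading_def by blast
  have PQ: "?P c \<longleftrightarrow> ?Q (%k. \<phi> (c k))" if c: "!!k. c k : B k" for c
  proof -
   have cM: "c k : carrier M" for k using c pieces(1) by blast
   have nz: "{k. c k ~= \<zero>\<^bsub>M\<^esub>} = {k. \<phi> (c k) ~= \<zero>\<^bsub>N\<^esub>}"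
    using inj[OF cM zero(1)] zero(2) by auto
   have "x = finsum M c {k. c k ~= \<zero>\<^bsub>M\<^esub>} \<longleftrightarrow> \<phi> x = finsum N (%k. \<phi> (c k)) {k. \<phi> (c k) ~= \<zero>\<^bsub>N\<^esub>}"
    if fin: "finite {k. c k ~= \<zero>\<^bsub>M\<^esub>}"
    using finsum[of "{k. c k ~= \<zero>\<^bsub>M\<^esub>}" c, OF fin cM] inj[OF x] unfolding nz by metis
   thus ?thesis using c CB nz by auto
  qed
  obtain d where d: "?Q d" using exQ by blast
  have "ALL k. EX b. b : B k & \<phi> b = d k" using d pieces(2) by (metis imageE)
  then obtain c where c: "!!k. c k : B k" "!!k. \<phi> (c k) = d k" by metis
  have "?P c" using PQ[of c, OF c(1)] d c(2) by simp
  moreover have "c' = c" if P: "?P c'" for c'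
  proof -
   have c': "!!k. c' k : B k" using P by blast
   have Q: "?Q (%k. \<phi> (c' k))" by (rule iffD1[OF PQ P]) (rule c')
   have "(%k. \<phi> (c' k)) = d"
    by (rule trans[OF the1_equality[where P = ?Q, OF exQ Q, symmetric] the1_equality[where P = ?Q, OF exQ d]])
   hence "\<phi> (c' k) = \<phi> (c k)" for k unfolding c(2) by (rule fun_cong)
   hence "c' k = c k" for k using inj[of "c' k" "c k"] c(1)[of k] c'[of k] pieces(1)[of k] by blast
   thus ?thesis by blast
  qed
  ultimately show "EX! c. ?P c" by (rule ex1I)
 qed
 have "r \<odot>\<^bsub>M\<^esub> x : B (i + j)" if r: "r : A i" and x: "x : B j" for i j r x
 proof -
  have "r : carrier R" "x : carrier M" using R pieces(1) r x by blast+
  from smult[OF this] show ?thesis using BinC[of "r \<odot>\<^bsub>M\<^esub> x" "i + j"] Ns[OF r CB[OF x]] by simp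
 qed
 hence "graded_module R A M B" unfolding graded_module_def using NR modM gM by blast
 thus ?thesis unfolding graded_module_iso_def using N bij add smult pieces(2) by blast
qed

section \<open>Tensor products\<close>

abbreviation "supp \<equiv> Poly_Mapping.keys"
abbreviation "coef \<equiv> Poly_Mapping.lookup"

lemma lookup_free_scale: "coef (free_scale c p) x = c * coef p x"
 by (simp add: free_scale_def Poly_Mapping.map.rep_eq when_def)

lemma vector_space_free: "vector_space (free_scale :: complex => ('x \<Rightarrow>\<^sub>0 complex) => _)"
 by unfold_locales (rule poly_mapping_eqI; simp add: lookup_free_scale lookup_add algebra_simps)+

interpretation free: vector_space "free_scale :: complex => ('x \<Rightarrow>\<^sub>0 complex) => ('x \<Rightarrow>\<^sub>0 complex)"
 by (rule vector_space_free)

definition lin :: "(complex => 'w => 'w) => ('x => 'w::ab_group_add) => ('x \<Rightarrow>\<^sub>0 complex) => 'w" where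
 "lin sc h p = (\<Sum>x\<in>supp p. sc (coef p x) (h x))"

lemma free_scale_single: "free_scale c (Poly_Mapping.single x d) = Poly_Mapping.single x (c * d)"
 by (rule poly_mapping_eqI) (simp add: lookup_free_scale lookup_single when_def)

lemma free_expand: "p = (\<Sum>x\<in>supp p. free_scale (coef p x) (Poly_Mapping.single x 1))"
proof (rule poly_mapping_eqI)
 fix y
 have "(\<Sum>x\<in>supp p. coef p x when x = y) = coef p y"
  by (cases "y : supp p") (simp_all add: when_def sum.delta in_keys_iff)
 thus "coef p y = coef (\<Sum>x\<in>supp p. free_scale (coef p x) (Poly_Mapping.single x 1)) y"
  by (simp add: lookup_sum free_scale_single lookup_single)
qed

locale complex_space = vector_space scale for scale :: "complex => 'w::ab_group_add => 'w"
begin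

lemma lin_superset:
 assumes "finite S" "supp p <= S"
 shows "lin scale h p = (\<Sum>x\<in>S. scale (coef p x) (h x))"
 unfolding lin_def using assms by (intro sum.mono_neutral_left) (auto simp: in_keys_iff)

lemma lin_add: "lin scale h (p + q) = lin scale h p + lin scale h q"
proof -
 let ?S = "supp p \<union> supp q"
 have S: "finite ?S" by simp
 have "supp (p + q) <= ?S" "supp p <= ?S" "supp q <= ?S"
  by (rule keys_add) auto
 note sup = this[THEN lin_superset[OF S, where h = h]]
 show ?thesis unfolding sup by (simp add: lookup_add scale_left_distrib sum.distrib)
qed

lemma lin_scale: "lin scale h (free_scale c p) = scale c (lin scale h p)"
proof -
 have "supp (free_scale c p) <= supp p" by (auto simp: in_keys_iff lookup_free_scale)
 from lin_superset[OF finite_keys this, of h] show ?thesis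
  by (simp add: lookup_free_scale lin_def scale_sum_right)
qed

lemma lin_single: "lin scale h (Poly_Mapping.single x c) = scale c (h x)"
 by (simp add: lin_def)

lemma lin_zero: "lin scale h 0 = 0"
 by (simp add: lin_def)

lemma lin_diff: "lin scale h (p - q) = lin scale h p - lin scale h q"
 using lin_add[of h "p - q" q] by (simp add: eq_diff_eq)

end

lemma lin_span:
 assumes "vector_space sc" "p : free.span G" "!!g. g : G ==> lin sc h g : W" "Modules.module.subspace sc W"
 shows "lin sc h p : W"
proof -
 interpret complex_space sc by (simp add: complex_space_def assms(1))
 show ?thesis using assms(2)
 proof (rule free.span_induct)
  show "free.subspace {p. lin sc h p : W}"
   unfolding free.subspace_def using assms(4) by (simp add: lin_zero lin_add lin_scale subspace_0 subspace_add subspace_scale)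
 qed (use assms(3) in simp)
qed

locale two_spaces = a: vector_space sA + b: vector_space sB
 for sA :: "complex => 'a::ab_group_add => 'a" and sB :: "complex => 'b::ab_group_add => 'b" +
 fixes A B
 assumes subA: "a.subspace A" and subB: "b.subspace B"
begin

abbreviation "R \<equiv> tensor_relations sA sB A B"

lemma R_subspace: "free.subspace R"
 unfolding tensor_relations_def by (rule free.subspace_span)

lemma R_add_left: "a : A ==> a' : A ==> b : B ==> free_gen (a + a') b - free_gen a b - free_gen a' b : R"
 unfolding tensor_relations_def by (rule free.span_base) blast

lemma R_add_right: "a : A ==> b : B ==> b' : B ==> free_gen a (b + b') - free_gen a b - free_gen a b' : R"
 unfolding tensor_relations_def by (rule free.span_base) blast

lemma R_scale_left: "a : A ==> b : B ==> free_gen (sA c a) b - free_scale c (free_gen a b) : R"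
 unfolding tensor_relations_def by (rule free.span_base) blast

lemma R_scale_right: "a : A ==> b : B ==> free_gen a (sB c b) - free_scale c (free_gen a b) : R"
 unfolding tensor_relations_def by (rule free.span_base) blast

definition equiv_mod :: "('a \<times> 'b \<Rightarrow>\<^sub>0 complex) => ('a \<times> 'b \<Rightarrow>\<^sub>0 complex) => bool" (infix \<open>\<doteq>\<close> 50) where
 "p \<doteq> q \<longleftrightarrow> p - q : R"

lemma eqv_refl: "p \<doteq> p"
 using free.subspace_0[OF R_subspace] by (simp add: equiv_mod_def)

lemma eqv_sym: "p \<doteq> q ==> q \<doteq> p"
 using free.subspace_neg[OF R_subspace, of "p - q"] by (simp add: equiv_mod_def)

lemma eqv_trans [trans]: "p \<doteq> q ==> q \<doteq> r ==> p \<doteq> r"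
 using free.subspace_add[OF R_subspace, of "p - q" "q - r"] by (simp add: equiv_mod_def)

lemma eqv_add: "p \<doteq> q ==> p' \<doteq> q' ==> p + p' \<doteq> q + q'"
 using free.subspace_add[OF R_subspace, of "p - q" "p' - q'"] by (simp add: equiv_mod_def add_diff_add)

lemma eqv_scale: "p \<doteq> q ==> free_scale c p \<doteq> free_scale c q"
 using free.subspace_scale[OF R_subspace, of "p - q" c] by (simp add: equiv_mod_def free.scale_right_diff_distrib)

lemma eqv_sum: "(!!i. i : I ==> p i \<doteq> q i) ==> sum p I \<doteq> sum q I"
 by (induction I rule: infinite_finite_induct) (simp_all add: eqv_refl eqv_add)

lemma class_eq_iff: "tensor_class sA sB A B p = tensor_class sA sB A B q \<longleftrightarrow> p \<doteq> q"
proof -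
 have c: "tensor_class sA sB A B p = {r. r \<doteq> p}" for p by (simp add: tensor_class_def equiv_mod_def)
 show ?thesis unfolding c using eqv_refl eqv_sym eqv_trans by blast
qed

lemma mem_class: "q : tensor_class sA sB A B p \<longleftrightarrow> q \<doteq> p"
 by (simp add: tensor_class_def equiv_mod_def)

lemma lin_relations:
 assumes sc: "vector_space sc" "Modules.module.subspace sc W" and p: "p : R"
  and "!!a a' b. a : A ==> a' : A ==> b : B ==> lin sc h (free_gen (a + a') b - free_gen a b - free_gen a' b) : W"
  and "!!a b b'. a : A ==> b : B ==> b' : B ==> lin sc h (free_gen a (b + b') - free_gen a b - free_gen a b') : W"
  and "!!c a b. a : A ==> b : B ==> lin sc h (free_gen (sA c a) b - free_scale c (free_gen a b)) : W"
  and "!!c a b. a : A ==> b : B ==> lin sc h (free_gen a (sB c b) - free_scale c (free_gen a b)) : W"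
 shows "lin sc h p : W"
 by (rule lin_span[OF sc(1) p[unfolded tensor_relations_def] _ sc(2)]) (use assms(4-) in blast)

lemma gen_zero_right: "a : A ==> free_gen a 0 \<doteq> 0"
 using R_add_right[of a 0 0] b.subspace_0[OF subB] eqv_sym[of 0 "free_gen a 0"] by (simp add: equiv_mod_def)

lemma gen_zero_left: "b : B ==> free_gen 0 b \<doteq> 0"
 using R_add_left[of 0 0 b] a.subspace_0[OF subA] eqv_sym[of 0 "free_gen 0 b"] by (simp add: equiv_mod_def)

lemma gen_add_right: "a : A ==> b : B ==> b' : B ==> free_gen a (b + b') \<doteq> free_gen a b + free_gen a b'"
 using R_add_right[of a b b'] by (simp add: equiv_mod_def diff_diff_eq)

lemma gen_add_left: "a : A ==> a' : A ==> b : B ==> free_gen (a + a') b \<doteq> free_gen a b + free_gen a' b"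
 using R_add_left[of a a' b] by (simp add: equiv_mod_def diff_diff_eq)

lemma gen_sum_right:
 assumes a: "a : A" and b: "!!i. i : I ==> x i : B"
 shows "free_gen a (\<Sum>i\<in>I. sB (c i) (x i)) \<doteq> (\<Sum>i\<in>I. free_scale (c i) (free_gen a (x i)))"
 using b
proof (induction I rule: infinite_finite_induct)
 case (insert i I)
 have s: "(\<Sum>i\<in>I. sB (c i) (x i)) : B" using insert by (intro b.subspace_sum[OF subB] b.subspace_scale[OF subB]) auto
 have "free_gen a (sB (c i) (x i) + (\<Sum>i\<in>I. sB (c i) (x i))) \<doteq> free_gen a (sB (c i) (x i)) + free_gen a (\<Sum>i\<in>I. sB (c i) (x i))"
  by (rule gen_add_right[OF a _ s]) (use insert in \<open>auto intro: b.subspace_scale[OF subB]\<close>)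
 also have "\<dots> \<doteq> free_scale (c i) (free_gen a (x i)) + (\<Sum>i\<in>I. free_scale (c i) (free_gen a (x i)))"
  by (rule eqv_add) (use R_scale_right[OF a] insert in \<open>auto simp: equiv_mod_def\<close>)
 finally show ?case using insert by simp
qed (use gen_zero_right[OF a] in simp_all)

lemma gen_sum_left:
 assumes b: "b : B" and a: "!!i. i : I ==> x i : A"
 shows "free_gen (\<Sum>i\<in>I. sA (c i) (x i)) b \<doteq> (\<Sum>i\<in>I. free_scale (c i) (free_gen (x i) b))"
 using a
proof (induction I rule: infinite_finite_induct)
 case (insert i I)
 have s: "(\<Sum>i\<in>I. sA (c i) (x i)) : A" using insert by (intro a.subspace_sum[OF subA] a.subspace_scale[OF subA]) auto
 have "free_gen (sA (c i) (x i) + (\<Sum>i\<in>I. sA (c i) (x i))) b \<doteq> free_gen (sA (c i) (x i)) b + free_gen (\<Sum>i\<in>I. sA (c i) (x i)) b"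
  by (rule gen_add_left[OF _ s b]) (use insert in \<open>auto intro: a.subspace_scale[OF subA]\<close>)
 also have "\<dots> \<doteq> free_scale (c i) (free_gen (x i) b) + (\<Sum>i\<in>I. free_scale (c i) (free_gen (x i) b))"
  by (rule eqv_add) (use R_scale_left[OF _ b] insert in \<open>auto simp: equiv_mod_def\<close>)
 finally show ?case using insert by simp
qed (use gen_zero_left[OF b] in simp_all)

text \<open>Modulo the bilinearity relations, the right-hand factors of a tensor can be expanded in a finite
spanning set.\<close>

lemma normal_form:
 assumes S: "finite S" "S <= B"
  and p: "!!x y. (x, y) : supp p ==> x : A & y = (\<Sum>s\<in>S. sB (\<phi> s y) s)"
 shows "p \<doteq> (\<Sum>s\<in>S. free_gen (\<Sum>(x, y)\<in>supp p. sA (coef p (x, y) * \<phi> s y) x) s)"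
proof -
 let ?K = "supp p"
 have "p = (\<Sum>(x, y)\<in>?K. free_scale (coef p (x, y)) (free_gen x y))"
  using free_expand[of p] by (simp add: case_prod_beta)
 also have "\<dots> \<doteq> (\<Sum>(x, y)\<in>?K. free_scale (coef p (x, y)) (\<Sum>s\<in>S. free_scale (\<phi> s y) (free_gen x s)))"
 proof (rule eqv_sum)
  fix i assume i: "i : ?K"
  obtain x y where xy: "i = (x, y)" by (cases i)
  have x: "x : A" and y: "y = (\<Sum>s\<in>S. sB (\<phi> s y) s)" using p i xy by blast+
  have "free_gen x (\<Sum>s\<in>S. sB (\<phi> s y) s) \<doteq> (\<Sum>s\<in>S. free_scale (\<phi> s y) (free_gen x s))"
   by (rule gen_sum_right[OF x]) (use S in auto)
  hence "free_gen x y \<doteq> (\<Sum>s\<in>S. free_scale (\<phi> s y) (free_gen x s))" using y by simp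
  thus "(case i of (x, y) => free_scale (coef p (x, y)) (free_gen x y)) \<doteq>
    (case i of (x, y) => free_scale (coef p (x, y)) (\<Sum>s\<in>S. free_scale (\<phi> s y) (free_gen x s)))"
   unfolding xy prod.case by (rule eqv_scale)
 qed
 also have "(\<Sum>(x, y)\<in>?K. free_scale (coef p (x, y)) (\<Sum>s\<in>S. free_scale (\<phi> s y) (free_gen x s))) =
   (\<Sum>s\<in>S. \<Sum>i\<in>?K. free_scale (coef p i * \<phi> s (snd i)) (free_gen (fst i) s))"
  by (subst sum.swap) (simp add: case_prod_beta free.scale_sum_right)
 also have "\<dots> \<doteq> (\<Sum>s\<in>S. free_gen (\<Sum>i\<in>?K. sA (coef p i * \<phi> s (snd i)) (fst i)) s)"
  by (rule eqv_sum, rule eqv_sym, rule gen_sum_left) (use S p in auto)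
 finally show ?thesis by (simp add: case_prod_beta)
qed

end

lemma (in complex_space) lin_sum:
 "lin scale h (\<Sum>i\<in>I. free_scale (c i) (q i)) = (\<Sum>i\<in>I. scale (c i) (lin scale h (q i)))"
 by (induction I rule: infinite_finite_induct) (simp_all add: lin_zero lin_add lin_scale)

lemma free_action_lin: "free_action g p = lin free_scale (%(f, v). free_gen (%z. g z * f z) v) p"
 unfolding free_action_def lin_def
 by (rule sum.cong[OF refl]) (auto simp: free_scale_single)

context first_kind
begin

lemma total_mult:
 assumes f: "f : \<A>" and g: "g : \<A>"
 shows "(%z. f z * g z) : \<A>"
 using f
proof (induction rule: QMg.total_induct)
 case (piece k f)
 show ?case using g
 proof (induction rule: QMg.total_induct)
  case (piece l g)
  show ?case by (rule QMg.piece_total[OF qm_mult[OF \<open>f : QM \<Gamma> k\<close> piece]])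
 next
  case (add u v)
  have "(%z. f z * (u + v) z) = (%z. f z * u z) + (%z. f z * v z)" by (simp add: fun_eq_iff distrib_left)
  thus ?case using QMg.total_add[OF add(3,4)] by simp
 qed
next
 case (add u v)
 have "(%z. (u + v) z * g z) = (%z. u z * g z) + (%z. v z * g z)" by (simp add: fun_eq_iff distrib_right)
 thus ?case using QMg.total_add[OF add(3,4)] by simp
qed

lemma total_off: "f : \<A> ==> z ~: uhp ==> f z = 0"
 using total_holo unfolding holo_uhp_def by blast

lemma QM_ring_graded: "graded_cring (QM_ring \<Gamma>) (QM \<Gamma>)"
proof -
 have ops: "carrier (QM_ring \<Gamma>) = \<A>" "\<zero>\<^bsub>QM_ring \<Gamma>\<^esub> = 0" "!!x y. x \<oplus>\<^bsub>QM_ring \<Gamma>\<^esub> y = x + y"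
  by (simp_all add: QM_ring_def QM_graded_eq fun_eq_iff)
 have mult: "x \<otimes>\<^bsub>QM_ring \<Gamma>\<^esub> y = (%z. x z * y z)" for x y by (simp add: QM_ring_def)
 have one: "\<one>\<^bsub>QM_ring \<Gamma>\<^esub> = (%z. if z : uhp then 1 else 0)" by (simp add: QM_ring_def)
 have "cring (QM_ring \<Gamma>)"
 proof (rule cringI)
  show "abelian_group (QM_ring \<Gamma>)" by (rule QMg.total_abelian_group[OF ops])
  show "Group.comm_monoid (QM_ring \<Gamma>)"
  proof (rule comm_monoidI)
   show "\<one>\<^bsub>QM_ring \<Gamma>\<^esub> : carrier (QM_ring \<Gamma>)" unfolding one ops by (rule QMg.piece_total[OF one_QM])
   show "\<one>\<^bsub>QM_ring \<Gamma>\<^esub> \<otimes>\<^bsub>QM_ring \<Gamma>\<^esub> x = x" if "x : carrier (QM_ring \<Gamma>)" for x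
    using total_off[of x] that unfolding one mult ops by (auto simp: fun_eq_iff)
  qed (auto simp: mult ops total_mult fun_eq_iff mult_ac)
 qed (auto simp: mult ops fun_eq_iff distrib_right)
 moreover have "grading (QM_ring \<Gamma>) (QM \<Gamma>)" by (rule QMg.grading_total[OF ops])
 ultimately show ?thesis unfolding graded_cring_def mult one using one_QM qm_mult by blast
qed

end

context qvoa_forms
begin

lemma QMV_smult:
 assumes f: "f : QM \<Gamma> i" and F: "F : \<Q> j" shows "(%w. smul (f w) (F w)) : \<Q> (i + j)"
 using F
proof (induction rule: QMV_induct)
 case zero
 have "(%w. smul (f w) (0 w)) = 0" by (simp add: fun_eq_iff)
 thus ?case using QMV_zero[of "i + j"] by metis
next
 case (fun_vec n g v)
 have "(%w. smul (f w) (fvec g v w)) = fvec (%w. f w * g w) v" by (simp add: fun_vec_def)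
 thus ?case using QMV_fun_vec[OF qm_mult[OF f fun_vec(1)] fun_vec(2)] by simp
next
 case (add F G)
 have z: "(%w. smul (f w) ((F + G) w)) = (%w. smul (f w) (F w)) + (%w. smul (f w) (G w))"
  by (simp add: fun_eq_iff scale_right_distrib)
 show ?case unfolding z by (rule QMV_add[OF add(3,4)])
qed

lemma total_smult:
 assumes f: "f : \<A>" and F: "F : \<F>"
 shows "(%w. smul (f w) (F w)) : \<F>"
 using f
proof (induction rule: QMg.total_induct)
 case (piece k f)
 show ?case using F
 proof (induction rule: QVg.total_induct)
  case (piece l F)
  show ?case by (rule QVg.piece_total[OF QMV_smult[OF \<open>f : QM \<Gamma> k\<close> piece]])
 next
  case (add F G)
  have z: "(%w. smul (f w) ((F + G) w)) = (%w. smul (f w) (F w)) + (%w. smul (f w) (G w))"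
   by (simp add: fun_eq_iff scale_right_distrib)
  show ?case unfolding z by (rule QVg.total_add[OF add(3,4)])
 qed
next
 case (add u v)
 have z: "(%w. smul ((u + v) w) (F w)) = (%w. smul (u w) (F w)) + (%w. smul (v w) (F w))"
  by (simp add: fun_eq_iff scale_left_distrib)
 show ?case unfolding z by (rule QVg.total_add[OF add(3,4)])
qed

lemma forms_off: "F : \<F> ==> z ~: uhp ==> F z = 0"
 by (induction rule: QVg.total_induct) (simp_all add: QMV_off)

lemma forms_values: "F : \<F> ==> F z : \<V>"
 by (induction rule: QVg.total_induct) (simp_all add: QMV_values total_add)

lemma fun_vec_add_left: "fvec (f + g) v = fvec f v + fvec g v"
 by (simp add: fun_vec_def fun_eq_iff scale_left_distrib)

lemma fun_vec_add_right: "fvec f (u + v) = fvec f u + fvec f v"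
 by (simp add: fun_vec_def fun_eq_iff scale_right_distrib)

lemma total_fun_vec:
 assumes f: "f : \<A>" and v: "v : \<V>"
 shows "fvec f v : \<F>"
 using f
proof (induction rule: QMg.total_induct)
 case (piece k f)
 show ?case using v
 proof (induction rule: total_induct)
  case (piece n v)
  show ?case by (rule QVg.piece_total[OF QMV_fun_vec[OF \<open>f : QM \<Gamma> k\<close> piece]])
 next
  case (add u v) show ?case unfolding fun_vec_add_right by (rule QVg.total_add[OF add(3,4)])
 qed
next
 case (add f g) show ?case unfolding fun_vec_add_left by (rule QVg.total_add[OF add(3,4)])
qed

lemma QMV_graded_module: "graded_module (QM_ring \<Gamma>) (QM \<Gamma>) (QMV_module smul V L \<Gamma>) \<Q>"
proof -
 let ?M = "QMV_module smul V L \<Gamma>"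
 have ops: "carrier ?M = \<F>" "\<zero>\<^bsub>?M\<^esub> = 0" "!!x y. x \<oplus>\<^bsub>?M\<^esub> y = x + y"
  by (simp_all add: QMV_module_def fun_eq_iff)
 have sm: "f \<odot>\<^bsub>?M\<^esub> F = (%z. smul (f z) (F z))" for f F by (simp add: QMV_module_def)
 have R: "carrier (QM_ring \<Gamma>) = \<A>" "!!x y. x \<oplus>\<^bsub>QM_ring \<Gamma>\<^esub> y = (%z. x z + y z)"
  "!!x y. x \<otimes>\<^bsub>QM_ring \<Gamma>\<^esub> y = (%z. x z * y z)" "\<one>\<^bsub>QM_ring \<Gamma>\<^esub> = (%z. if z : uhp then 1 else 0)"
  by (simp_all add: QM_ring_def QM_graded_eq)
 have "Module.module (QM_ring \<Gamma>) ?M"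
 proof (rule moduleI)
  show "cring (QM_ring \<Gamma>)" using QM_ring_graded unfolding graded_cring_def by blast
  show "abelian_group ?M" by (rule QVg.total_abelian_group[OF ops])
  show "\<one>\<^bsub>QM_ring \<Gamma>\<^esub> \<odot>\<^bsub>?M\<^esub> F = F" if "F : carrier ?M" for F
   using forms_off[of F] that unfolding ops R sm by (auto simp: fun_eq_iff)
  show "a \<odot>\<^bsub>?M\<^esub> F : carrier ?M" if "a : carrier (QM_ring \<Gamma>)" "F : carrier ?M" for a F
   using total_smult that unfolding ops R sm by blast
 qed (simp_all add: ops R sm fun_eq_iff scale_left_distrib scale_right_distrib)
 moreover have "grading ?M \<Q>" by (rule QVg.grading_total[OF ops])
 ultimately show ?thesis unfolding graded_module_def sm using QM_ring_graded QMV_smult by blast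
qed

sublocale forms_space: complex_space "scl"
 by unfold_locales

sublocale tens: two_spaces "fscale (*)" smul "\<A>" "\<V>"
 by (intro two_spaces.intro two_spaces_axioms.intro cfun.vector_space_axioms vector_space_axioms
   QMg.total_space_subspace total_space_subspace)

definition ev :: "((complex => complex) \<times> 'v \<Rightarrow>\<^sub>0 complex) => complex => 'v" where
 "ev = lin (scl) (%(f, v). fvec f v)"

lemma ev_gen: "ev (free_gen f v) = fvec f v"
 unfolding ev_def by (simp add: forms_space.lin_single)

lemma fun_vec_fscale_left: "fvec (fscale (*) c f) v = scl c (fvec f v)"
 by (simp add: fun_vec_def fscale_def)

lemma fun_vec_fscale_right: "fvec f (smul c v) = scl c (fvec f v)"
 by (simp add: fun_vec_def fscale_def mult.commute)

lemma ev_relations: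
 assumes "p : tens.R" shows "ev p = 0"
proof -
 note d = forms_space.lin_diff forms_space.lin_scale forms_space.lin_single
 have "ev p : {0}" unfolding ev_def
  by (rule tens.lin_relations[OF QVg.vector_space_axioms QVg.subspace_single_0 assms])
   (simp_all only: d prod.case fun_vec_add_left fun_vec_add_right fun_vec_fscale_left fun_vec_fscale_right
    QVg.scale_one add_diff_cancel_left' diff_self singleton_iff)
 thus ?thesis by simp
qed
lemma ev_at: "ev p z = (\<Sum>x\<in>supp p. smul (coef p x * fst x z) (snd x))"
 unfolding ev_def lin_def sum_fun_at by (rule sum.cong) (auto simp: fscale_def fun_vec_def)

text \<open>In the normal form with basis vectors on the right, the left-hand factors are the coordinates of
the function that the tensor evaluates to.\<close>

lemma ev_kernel:
 assumes p: "supp p <= \<A> \<times> \<V>" and ev: "ev p = 0"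
 shows "p : tens.R"
proof -
 let ?K = "supp p"
 define S where "S = (\<Union>x\<in>?K. {b. crd b (snd x) ~= 0})"
 have S: "finite S" "S <= \<V>"
  unfolding S_def using crd_finite crd_hbasis hbasis_total by (auto intro: finite_UN_I)
 have exp: "y = (\<Sum>b\<in>S. smul (crd b y) b)" if "(x, y) : ?K" for x y
  by (rule crd_expand[OF _ S(1)]) (use that p in \<open>auto simp: S_def\<close>)
 have "tens.equiv_mod p (\<Sum>b\<in>S. free_gen (\<Sum>(x, y)\<in>?K. fscale (*) (coef p (x, y) * crd b y) x) b)"
 proof (rule tens.normal_form[OF S])
  fix x y assume "(x, y) : ?K"
  thus "x : \<A> & y = (\<Sum>s\<in>S. smul (crd s y) s)" using exp p by blast
 qed
 also have "(\<Sum>b\<in>S. free_gen (\<Sum>(x, y)\<in>?K. fscale (*) (coef p (x, y) * crd b y) x) b) = (\<Sum>b\<in>S. free_gen 0 b)"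
 proof (rule sum.cong[OF refl])
  fix b assume "b : S"
  have "(\<Sum>(x, y)\<in>?K. fscale (*) (coef p (x, y) * crd b y) x) z = 0" for z
  proof -
   have "(\<Sum>(x, y)\<in>?K. fscale (*) (coef p (x, y) * crd b y) x) z =
     (\<Sum>x\<in>?K. coef p x * fst x z * crd b (snd x))"
    unfolding sum_fun_at by (rule sum.cong) (auto simp: fscale_def)
   also have "\<dots> = crd b (ev p z)" unfolding ev_at by (rule crd_lincomb[symmetric]) (use p in auto)
   finally show ?thesis using ev by simp
  qed
  hence "(\<Sum>(x, y)\<in>?K. fscale (*) (coef p (x, y) * crd b y) x) = 0"
   unfolding fun_eq_iff zero_fun_apply by blast
  thus "free_gen (\<Sum>(x, y)\<in>?K. fscale (*) (coef p (x, y) * crd b y) x) b = free_gen 0 b" by simp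
 qed
 also have "tens.equiv_mod (\<Sum>b\<in>S. free_gen 0 b) (\<Sum>b\<in>S. 0)"
  by (rule tens.eqv_sum) (use S tens.gen_zero_left in auto)
 finally show ?thesis by (simp add: tens.equiv_mod_def)
qed

lemma ev_free_action: "ev (free_action g p) = (%z. smul (g z) (ev p z))"
proof
 fix z
 have "free_action g p = (\<Sum>x\<in>supp p. free_scale (coef p x) (free_gen (%z. g z * fst x z) (snd x)))"
  unfolding free_action_lin lin_def by (simp add: case_prod_beta)
 hence "ev (free_action g p) = (\<Sum>x\<in>supp p. scl (coef p x) (ev (free_gen (%z. g z * fst x z) (snd x))))"
  unfolding ev_def by (simp only: forms_space.lin_sum)
 thus "ev (free_action g p) z = smul (g z) (ev p z)"
  by (simp add: sum_fun_at ev_gen ev_at fscale_def fun_vec_def scale_sum_right mult_ac)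
qed

interpretation free_space: complex_space free_scale
 by (simp add: complex_space_def vector_space_free)

lemma free_action_relations:
 assumes g: "g : \<A>" and "p : tens.R" shows "free_action g p : tens.R"
 unfolding free_action_lin
proof (rule tens.lin_relations[OF vector_space_free tens.R_subspace assms(2)],
  unfold free_space.lin_diff free_space.lin_scale free_space.lin_single free.scale_one prod.case)
 have d: "(%z. g z * (a + a') z) = (%z. g z * a z) + (%z. g z * a' z)"
  "(%z. g z * fscale (*) c a z) = fscale (*) c (%z. g z * a z)" for a a' c
  by (simp_all add: fun_eq_iff fscale_def distrib_left)
 show "free_gen (%z. g z * (a + a') z) b - free_gen (%z. g z * a z) b - free_gen (%z. g z * a' z) b : tens.R"
  if "a : \<A>" "a' : \<A>" "b : \<V>" for a a' b
  unfolding d by (intro tens.R_add_left total_mult g that)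
 show "free_gen (%z. g z * fscale (*) c a z) b - free_scale c (free_gen (%z. g z * a z) b) : tens.R"
  if "a : \<A>" "b : \<V>" for a b c
  unfolding d by (intro tens.R_scale_left total_mult g that)
qed (intro tens.R_add_right tens.R_scale_right total_mult g; assumption)+
lemma ev_total:
 assumes "supp p <= \<A> \<times> \<V>" shows "ev p : \<F>"
 unfolding ev_def lin_def using assms total_fun_vec
 by (intro QVg.total_sum QVg.total_scale) auto

lemma ev_surjective:
 assumes "F : \<F>"
 shows "EX p. supp p <= \<A> \<times> \<V> & ev p = F"
 using assms
proof (induction rule: forms_induct)
 case (fun_vec j n f v)
 thus ?case
  by (intro exI[of _ "free_gen f v"]) (simp add: ev_gen QMg.piece_total piece_total)
next
 case (add F G)
 then obtain p q where "supp p <= \<A> \<times> \<V>" "ev p = F"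
  "supp q <= \<A> \<times> \<V>" "ev q = G" by blast
 moreover from this have "supp (p + q) <= \<A> \<times> \<V>"
  using keys_add[of p q] by blast
 ultimately show ?case using forms_space.lin_add[of _ p q] unfolding ev_def by blast
qed

lemma ev_piece:
 assumes "supp p <= (\<Union>i. QM \<Gamma> i \<times> doubled V (k - i))" shows "ev p : \<Q> k"
 unfolding ev_def lin_def
proof (intro QVg.subspace_sum[OF QVg.subspace_piece] QVg.subspace_scale[OF QVg.subspace_piece])
 fix x assume "x : supp p"
 then obtain i where "x : QM \<Gamma> i \<times> doubled V (k - i)" using assms by blast
 then obtain f v where x: "x = (f, v)" "f : QM \<Gamma> i" "v : doubled V (k - i)" by blast
 have "fvec f v : \<Q> k"
 proof (cases "even (k - i)")
  case True
  hence "v : V ((k - i) div 2)" using x(3) by (simp add: doubled_def)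
  from QMV_fun_vec[OF x(2) this] show ?thesis using True by simp
 next
  case False
  hence "fvec f v = 0" using x(3) by (simp add: doubled_def fun_vec_def fun_eq_iff)
  thus ?thesis using QMV_zero by metis
 qed
 thus "(case x of (f, v) => fvec f v) : \<Q> k" using x(1) by simp
qed

lemma ev_piece_surjective:
 assumes "F : \<Q> k"
 shows "EX p. supp p <= (\<Union>i. QM \<Gamma> i \<times> doubled V (k - i)) & ev p = F"
 using assms
proof (induction rule: QMV_induct)
 case zero
 show ?case by (intro exI[of _ 0]) (simp add: ev_def forms_space.lin_zero)
next
 case (fun_vec n f v)
 hence "(f, v) : QM \<Gamma> (k - 2 * n) \<times> doubled V (k - (k - 2 * n))" by (simp add: doubled_def)
 thus ?case by (intro exI[of _ "free_gen f v"]) (auto simp add: ev_gen)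
next
 case (add F G)
 then obtain p q where "supp p <= (\<Union>i. QM \<Gamma> i \<times> doubled V (k - i))" "ev p = F"
  "supp q <= (\<Union>i. QM \<Gamma> i \<times> doubled V (k - i))" "ev q = G" by blast
 moreover from this have "supp (p + q) <= (\<Union>i. QM \<Gamma> i \<times> doubled V (k - i))"
  using keys_add[of p q] by blast
 ultimately show ?case using forms_space.lin_add[of _ p q] unfolding ev_def by blast
qed

theorem tensor_product_iso:
 "EX \<iota>. graded_module_iso (QM_ring \<Gamma>) (QM \<Gamma>) (tensor_module smul (QM \<Gamma>) (doubled V))
   (tensor_piece smul (QM \<Gamma>) (doubled V)) (QMV_module smul V L \<Gamma>) \<Q> \<iota> &
  (ALL f:\<A>. ALL v:\<V>.
   \<iota> (QM_tensor_class smul (QM \<Gamma>) (doubled V) (free_gen f v)) = fvec f v)"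
proof -
 let ?cl = "QM_tensor_class smul (QM \<Gamma>) (doubled V)"
 let ?M = "tensor_module smul (QM \<Gamma>) (doubled V)"
 let ?T = "\<A> \<times> \<V>"
 define \<iota> where "\<iota> S = ev (SOME p. p : S)" for S
 have cleq: "?cl p = ?cl q \<longleftrightarrow> p - q : tens.R" for p q
  unfolding total_doubled tens.class_eq_iff tens.equiv_mod_def ..
 have mem: "q : ?cl p \<longleftrightarrow> q - p : tens.R" for p q
  unfolding total_doubled tens.mem_class tens.equiv_mod_def ..
 have evdiff: "ev (p - q) = ev p - ev q" "ev (p + q) = ev p + ev q" for p q
  unfolding ev_def by (rule forms_space.lin_diff forms_space.lin_add)+
 have \<iota>cl: "\<iota> (?cl p) = ev p" for p
 proof -
  have "p : ?cl p" unfolding mem using tens.eqv_refl[of p] unfolding tens.equiv_mod_def .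
  hence "(SOME q. q : ?cl p) : ?cl p" by (rule someI)
  hence "ev ((SOME q. q : ?cl p) - p) = 0" unfolding mem by (rule ev_relations)
  thus ?thesis unfolding \<iota>_def evdiff by simp
 qed
 have car: "carrier ?M = ?cl ` {p. supp p <= ?T}"
  by (simp add: tensor_module_def total_doubled)
 have add: "?cl p \<oplus>\<^bsub>?M\<^esub> ?cl q = ?cl (p + q)" for p q
 proof -
  have "{p' + q' |p' q'. p' : ?cl p & q' : ?cl q} = ?cl (p + q)"
  proof (rule equalityI; rule subsetI)
   fix r assume "r : {p' + q' |p' q'. p' : ?cl p & q' : ?cl q}"
   then obtain p' q' where r: "r = p' + q'" "p' - p : tens.R" "q' - q : tens.R" unfolding mem by blast
   show "r : ?cl (p + q)" unfolding mem r(1)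
    using free.subspace_add[OF tens.R_subspace r(2,3)] by (simp add: add_diff_add)
  next
   fix r assume "r : ?cl (p + q)"
   hence r: "(r - p) - q : tens.R" unfolding mem by (simp add: diff_diff_eq)
   have "p - p : tens.R" using free.subspace_0[OF tens.R_subspace] by simp
   with r have "r = p + (r - p) & p : ?cl p & r - p : ?cl q" unfolding mem by simp
   thus "r : {p' + q' |p' q'. p' : ?cl p & q' : ?cl q}" by blast
  qed
  thus ?thesis by (simp add: tensor_module_def)
 qed
 have sm: "g \<odot>\<^bsub>?M\<^esub> ?cl p = ?cl (free_action g p)" if g: "g : \<A>" for g p
 proof -
  have "?cl (free_action g q) = ?cl (free_action g p)" if "q : ?cl p" for q
  proof -
   have "free_action g (q - p) : tens.R" using that unfolding mem by (rule free_action_relations[OF g])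
   thus ?thesis unfolding cleq unfolding free_action_lin free_space.lin_diff .
  qed
  moreover have "p : ?cl p" unfolding mem using free.subspace_0[OF tens.R_subspace] by simp
  ultimately have "(\<Union>q\<in>?cl p. ?cl (free_action g q)) = ?cl (free_action g p)" by blast
  thus ?thesis by (simp add: tensor_module_def)
 qed
 have fa_keys: "supp (free_action g p) <= ?T" if g: "g : \<A>" and p: "supp p <= ?T" for g p
 proof -
  have "supp (\<Sum>x\<in>I. Poly_Mapping.single ((%w. g w * fst x w), snd x) (coef p x)) <= ?T"
   if "finite I" "I <= supp p" for I
   using that
  proof (induction I rule: finite_induct)
   case (insert x I)
   have "supp (Poly_Mapping.single ((%w. g w * fst x w), snd x) (coef p x)) <= ?T"
    using p insert(4) total_mult[OF g] by auto
   thus ?case unfolding sum.insert[OF insert(1,2)] using keys_add insert by (meson Un_least insert_subset subset_trans)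
  qed simp
  from this[OF finite_keys order_refl] show ?thesis by (simp add: free_action_def case_prod_beta)
 qed
 have "graded_module_iso (QM_ring \<Gamma>) (QM \<Gamma>) ?M (tensor_piece smul (QM \<Gamma>) (doubled V)) (QMV_module smul V L \<Gamma>) \<Q> \<iota>"
 proof (rule graded_module_transport[OF QMV_graded_module])
  show "bij_betw \<iota> (carrier ?M) (carrier (QMV_module smul V L \<Gamma>))"
   unfolding bij_betw_def
  proof (intro conjI)
   show "inj_on \<iota> (carrier ?M)"
   proof (rule inj_onI)
    fix S T assume S: "S : carrier ?M" and T: "T : carrier ?M" and eq: "\<iota> S = \<iota> T"
    obtain p where p: "S = ?cl p" "supp p <= ?T" using S unfolding car by blast
    obtain q where q: "T = ?cl q" "supp q <= ?T" using T unfolding car by blast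
    have "ev (p - q) = 0" using eq unfolding p(1) q(1) \<iota>cl evdiff by simp
    moreover have "supp (p - q) <= ?T" using keys_diff[of p q] p(2) q(2) by blast
    ultimately have "p - q : tens.R" using ev_kernel by blast
    thus "S = T" unfolding p(1) q(1) cleq .
   qed
   have "\<iota> ` carrier ?M = ev ` {p. supp p <= ?T}" unfolding car image_image \<iota>cl ..
   also have "\<dots> = \<F>" using ev_total ev_surjective by blast
   finally show "\<iota> ` carrier ?M = carrier (QMV_module smul V L \<Gamma>)" by (simp add: QMV_module_def)
  qed
  have z: "\<zero>\<^bsub>?M\<^esub> = ?cl 0" by (simp add: tensor_module_def)
  show "\<zero>\<^bsub>?M\<^esub> : carrier ?M" unfolding z car by (rule imageI) simp
  have "ev 0 = 0" by (simp add: ev_def forms_space.lin_zero)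
  thus "\<iota> \<zero>\<^bsub>?M\<^esub> = \<zero>\<^bsub>QMV_module smul V L \<Gamma>\<^esub>" unfolding z \<iota>cl by (simp add: QMV_module_def fun_eq_iff)
  show "S \<oplus>\<^bsub>?M\<^esub> T : carrier ?M & \<iota> (S \<oplus>\<^bsub>?M\<^esub> T) = \<iota> S \<oplus>\<^bsub>QMV_module smul V L \<Gamma>\<^esub> \<iota> T"
   if S: "S : carrier ?M" and T: "T : carrier ?M" for S T
  proof -
   obtain p where p: "S = ?cl p" "supp p <= ?T" using S unfolding car by blast
   obtain q where q: "T = ?cl q" "supp q <= ?T" using T unfolding car by blast
   have "supp (p + q) <= ?T" using keys_add[of p q] p(2) q(2) by blast
   hence "?cl (p + q) : carrier ?M" unfolding car by blast
   moreover have "ev (p + q) = ev p \<oplus>\<^bsub>QMV_module smul V L \<Gamma>\<^esub> ev q" by (simp add: evdiff QMV_module_def fun_eq_iff)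
   ultimately show ?thesis unfolding p(1) q(1) add \<iota>cl by blast
  qed
  show "g \<odot>\<^bsub>?M\<^esub> S : carrier ?M & \<iota> (g \<odot>\<^bsub>?M\<^esub> S) = g \<odot>\<^bsub>QMV_module smul V L \<Gamma>\<^esub> \<iota> S"
   if g: "g : carrier (QM_ring \<Gamma>)" and S: "S : carrier ?M" for g S
  proof -
   have g: "g : \<A>" using g by (simp add: QM_ring_def QM_graded_eq)
   obtain p where p: "S = ?cl p" "supp p <= ?T" using S unfolding car by blast
   have "?cl (free_action g p) : carrier ?M" using fa_keys[OF g p(2)] unfolding car by blast
   moreover have "ev (free_action g p) = g \<odot>\<^bsub>QMV_module smul V L \<Gamma>\<^esub> ev p"
    by (simp add: ev_free_action QMV_module_def)
   ultimately show ?thesis unfolding p(1) sm[OF g] \<iota>cl by blast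
  qed
  show "tensor_piece smul (QM \<Gamma>) (doubled V) k <= carrier ?M" for k
  proof -
   have "QM \<Gamma> i \<times> doubled V (k - i) <= ?T" for i
    using QMg.piece_total graded_vector_space.piece_total[OF doubled_graded] unfolding total_doubled by blast
   thus ?thesis unfolding car tensor_piece_def by blast
  qed
  show "\<iota> ` tensor_piece smul (QM \<Gamma>) (doubled V) k = \<Q> k" for k
  proof -
   have "\<iota> ` tensor_piece smul (QM \<Gamma>) (doubled V) k = ev ` {p. supp p <= (\<Union>i. QM \<Gamma> i \<times> doubled V (k - i))}"
    unfolding tensor_piece_def image_image \<iota>cl ..
   also have "\<dots> = \<Q> k"
   proof
    show "ev ` {p. supp p <= (\<Union>i. QM \<Gamma> i \<times> doubled V (k - i))} <= \<Q> k"
     by (rule image_subsetI) (use ev_piece in simp)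
    show "\<Q> k <= ev ` {p. supp p <= (\<Union>i. QM \<Gamma> i \<times> doubled V (k - i))}"
    proof
     fix F assume "F : \<Q> k"
     from ev_piece_surjective[OF this] obtain p
      where "supp p <= (\<Union>i. QM \<Gamma> i \<times> doubled V (k - i))" "ev p = F" by (elim exE conjE)
     thus "F : ev ` {p. supp p <= (\<Union>i. QM \<Gamma> i \<times> doubled V (k - i))}"
      by (intro image_eqI[of _ _ p]) simp_all
    qed
   qed
   finally show ?thesis .
  qed
  show "QM \<Gamma> i <= carrier (QM_ring \<Gamma>)" for i
   using QMg.piece_total by (auto simp: QM_ring_def QM_graded_eq)
 qed
 moreover have "\<iota> (?cl (free_gen f v)) = fvec f v" for f v unfolding \<iota>cl ev_gen ..
 ultimately show ?thesis by (intro exI[of _ \<iota>] conjI ballI)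
qed

end

section \<open>Divided derivatives\<close>

text \<open>Divided derivatives. The derivative is the one that vanishes off the half plane, so that the
result is a quasimodular form again.\<close>

definition hasse :: "nat => (complex => complex) => complex => complex" where
 "hasse i f = (%z. (uderiv ^^ i) f z / fact i)"

lemma uderiv_eq_deriv: "z : uhp ==> uderiv f z = deriv f z"
 by (simp add: uderiv_def)

lemma uderiv_pow_holo: "holo_uhp f ==> holo_uhp ((uderiv ^^ i) f)"
 by (induction i) (simp_all add: holo_uderiv)

lemma hasse_holo: "holo_uhp f ==> holo_uhp (hasse i f)"
 unfolding hasse_def using holo_uhp_cmult[OF uderiv_pow_holo, of f "1 / fact i" i] by simp

lemma hasse_0: "hasse 0 f = f"
 by (simp add: hasse_def)

lemma uderiv_mult: "holo_uhp f ==> holo_uhp g ==> uderiv (%z. f z * g z) = (%z. uderiv f z * g z + f z * uderiv g z)"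
proof
 fix z assume fg: "holo_uhp f" "holo_uhp g"
 show "uderiv (%z. f z * g z) z = uderiv f z * g z + f z * uderiv g z"
 proof (cases "z : uhp")
  case True
  have "((%z. f z * g z) has_field_derivative uderiv f z * g z + uderiv g z * f z) (at z)"
   by (rule DERIV_mult[OF uderiv_DERIV[OF fg(1) True] uderiv_DERIV[OF fg(2) True]])
  from DERIV_imp_deriv[OF this] True show ?thesis by (simp add: uderiv_def)
 qed (simp add: uderiv_def)
qed

lemma uderiv_sum: "(!!i. i : I ==> holo_uhp (f i)) ==> uderiv (%z. \<Sum>i\<in>I. f i z) = (%z. \<Sum>i\<in>I. uderiv (f i) z)"
proof (induction I rule: infinite_finite_induct)
 case (insert i I)
 hence "holo_uhp (%z. \<Sum>i\<in>I. f i z)" by (intro holo_uhp_sum) auto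
 with insert show ?case using uderiv_add'[of "f i" "%z. \<Sum>i\<in>I. f i z"] by simp
qed (simp_all add: uderiv_def fun_eq_iff)

lemma uderiv_pow_cmult: "holo_uhp f ==> (uderiv ^^ i) (%z. c * f z) = (%z. c * (uderiv ^^ i) f z)"
 by (induction i) (simp_all add: uderiv_cmult' uderiv_pow_holo)

lemma hasse_cmult: "holo_uhp f ==> hasse i (%z. c * f z) = (%z. c * hasse i f z)"
 unfolding hasse_def by (simp add: uderiv_pow_cmult)

lemma hasse_add: "holo_uhp f ==> holo_uhp g ==> hasse i (%z. f z + g z) = (%z. hasse i f z + hasse i g z)"
proof -
 assume fg: "holo_uhp f" "holo_uhp g"
 have "(uderiv ^^ i) (%z. f z + g z) = (%z. (uderiv ^^ i) f z + (uderiv ^^ i) g z)"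
  by (induction i) (simp_all add: uderiv_add' uderiv_pow_holo fg)
 thus ?thesis by (simp add: hasse_def add_divide_distrib)
qed

lemma uderiv_hasse: "holo_uhp f ==> uderiv (hasse i f) = (%z. of_nat (Suc i) * hasse (Suc i) f z)"
 unfolding hasse_def using uderiv_cmult'[OF uderiv_pow_holo, of f "1 / fact i" i]
 by (simp add: field_simps del: of_nat_Suc)

lemma hasse_uderiv: "hasse i (uderiv f) = (%z. of_nat (Suc i) * hasse (Suc i) f z)"
 unfolding hasse_def by (simp add: funpow_swap1 field_simps del: of_nat_Suc)

lemma hasse_hasse: "holo_uhp f ==> hasse a (hasse p f) = (%z. of_nat ((p + a) choose a) * hasse (p + a) f z)"
proof -
 assume f: "holo_uhp f"
 have "(uderiv ^^ a) (hasse p f) = (%z. 1 / fact p * (uderiv ^^ (p + a)) f z)"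
  using uderiv_pow_cmult[OF uderiv_pow_holo[OF f, of p], of a "1 / fact p"]
  unfolding hasse_def by (simp add: funpow_add add.commute[of p a])
 thus ?thesis unfolding hasse_def
  by (simp add: binomial_fact field_simps)
qed

text \<open>The Leibniz rule has no binomial coefficients for divided derivatives.\<close>

lemma hasse_mult:
 assumes f: "holo_uhp f" and g: "holo_uhp g"
 shows "hasse s (%z. f z * g z) = (%z. \<Sum>a\<le>s. hasse a f z * hasse (s - a) g z)"
proof (induction s)
 case 0
 show ?case by (simp add: hasse_0)
next
 case (Suc s)
 have fg: "holo_uhp (%z. f z * g z)" by (rule holo_uhp_mult[OF f g])
 show ?case
 proof
  fix z
  define X where "X a = hasse a f z * hasse (Suc s - a) g z" for a
  have "of_nat (Suc s) * hasse (Suc s) (%z. f z * g z) z = uderiv (%z. \<Sum>a\<le>s. hasse a f z * hasse (s - a) g z) z"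
   using uderiv_hasse[OF fg, of s] Suc.IH by metis
  also have "\<dots> = (\<Sum>a\<le>s. uderiv (%z. hasse a f z * hasse (s - a) g z) z)"
   using uderiv_sum[of "{..s}" "%a z. hasse a f z * hasse (s - a) g z"] holo_uhp_mult[OF hasse_holo[OF f] hasse_holo[OF g]] by simp
  also have "\<dots> = (\<Sum>a\<le>s. of_nat (Suc a) * X (Suc a) + of_nat (Suc s - a) * X a)"
  proof (rule sum.cong[OF refl])
   fix a assume a: "a : {..s}"
   have "Suc (s - a) = Suc s - a" using a by simp
   thus "uderiv (%z. hasse a f z * hasse (s - a) g z) z = of_nat (Suc a) * X (Suc a) + of_nat (Suc s - a) * X a"
    unfolding uderiv_mult[OF hasse_holo[OF f] hasse_holo[OF g]] uderiv_hasse[OF f] uderiv_hasse[OF g] X_def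
    by (simp add: algebra_simps)
  qed
  also have "\<dots> = (\<Sum>a\<le>s. of_nat (Suc a) * X (Suc a)) + (\<Sum>a\<le>s. of_nat (Suc s - a) * X a)" by (rule sum.distrib)
  also have "(\<Sum>a\<le>s. of_nat (Suc a) * X (Suc a)) = (\<Sum>a\<le>Suc s. of_nat a * X a)"
   unfolding sum.atMost_Suc_shift[of "%a. of_nat a * X a"] by simp
  also have "(\<Sum>a\<le>s. of_nat (Suc s - a) * X a) = (\<Sum>a\<le>Suc s. of_nat (Suc s - a) * X a)" by simp
  also have "(\<Sum>a\<le>Suc s. of_nat a * X a) + (\<Sum>a\<le>Suc s. of_nat (Suc s - a) * X a) = (\<Sum>a\<le>Suc s. of_nat (Suc s) * X a)"
   unfolding sum.distrib[symmetric]
   by (rule sum.cong[OF refl]) (simp add: distrib_right[symmetric] of_nat_add[symmetric] del: of_nat_Suc of_nat_add)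
  finally have "of_nat (Suc s) * hasse (Suc s) (%z. f z * g z) z = of_nat (Suc s) * (\<Sum>a\<le>Suc s. X a)"
   by (simp only: sum_distrib_left)
  moreover have "(of_nat (Suc s) :: complex) ~= 0" by (rule of_nat_neq_0)
  ultimately have "hasse (Suc s) (%z. f z * g z) z = (\<Sum>a\<le>Suc s. X a)" using mult_left_cancel by blast
  thus "hasse (Suc s) (%z. f z * g z) z = (\<Sum>a\<le>Suc s. hasse a f z * hasse (Suc s - a) g z)"
   unfolding X_def .
 qed
qed

lemma hasse_one: "hasse i (%z. if z : uhp then 1 else 0) = (if i = 0 then (%z. if z : uhp then 1 else 0) else 0)"
proof (cases i)
 case (Suc j)
 let ?o = "%z. if z : uhp then 1 else (0::complex)"
 have "uderiv ?o = 0"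
 proof
  fix z
  show "uderiv ?o z = 0 z"
  proof (cases "z : uhp")
   case True
   have "(?o has_field_derivative 0) (at z)"
    by (rule has_field_derivative_transform_within_open[OF DERIV_const[of 1] open_uhp True]) simp
   thus ?thesis using DERIV_imp_deriv True by (simp add: uderiv_def)
  qed (simp add: uderiv_def)
 qed
 moreover have u0: "uderiv 0 = 0" by (simp add: uderiv_def fun_eq_iff zero_fun_def)
 have "(uderiv ^^ j) 0 = 0" by (induction j) (simp_all only: funpow.simps id_apply o_apply u0)
 ultimately have "(uderiv ^^ i) ?o = 0" unfolding Suc funpow_Suc_right o_apply by simp
 thus ?thesis using Suc by (simp add: hasse_def fun_eq_iff)
qed (simp add: hasse_0)

lemma hasse_deriv:
 assumes "w : uhp" shows "(deriv ^^ i) f w / fact i = hasse i f w"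
proof -
 have "(deriv ^^ i) f w = (uderiv ^^ i) f w" using assms
 proof (induction i arbitrary: w)
  case (Suc i)
  have "eventually (%z. (deriv ^^ i) f z = (uderiv ^^ i) f z) (nhds w)"
   unfolding eventually_nhds using Suc open_uhp by blast
  thus ?case using deriv_cong_ev[OF _ refl] uderiv_eq_deriv[OF Suc.prems] by simp
 qed simp
 thus ?thesis by (simp add: hasse_def)
qed

context first_kind
begin

lemma hasse_QM: "f : QM \<Gamma> k ==> hasse i f : QM \<Gamma> (k + 2 * int i)"
proof -
 assume f: "f : QM \<Gamma> k"
 have "(uderiv ^^ i) f : QM \<Gamma> (k + 2 * int i)"
 proof (induction i)
  case (Suc i)
  thus ?case using qm_uderiv[OF Suc] by (simp add: algebra_simps)
 qed (simp add: f)
 from qm_scale(1)[OF this, of "1 / fact i"] show ?thesis by (simp add: hasse_def fscale_mult)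
qed

definition linear_op :: "((complex => complex) => complex => complex) => bool" where
 "linear_op \<theta> \<longleftrightarrow> (ALL f:\<A>. \<theta> f : \<A> & (ALL c. \<theta> (fscale (*) c f) = fscale (*) c (\<theta> f)) &
  (ALL g:\<A>. \<theta> (f + g) = \<theta> f + \<theta> g))"

lemma linear_op_hasse: "linear_op (hasse i)"
 unfolding linear_op_def
proof (intro ballI conjI allI)
 fix f assume f: "f : \<A>"
 show "hasse i (fscale (*) c f) = fscale (*) c (hasse i f)" for c
  unfolding fscale_mult by (rule hasse_cmult[OF total_holo[OF f]])
 have add: "hasse i (f + g) = hasse i f + hasse i g" if "f : \<A>" "g : \<A>" for f g
  unfolding plus_fun_lambda by (rule hasse_add[OF total_holo[OF that(1)] total_holo[OF that(2)]])
 thus "hasse i (f + g) = hasse i f + hasse i g" if "g : \<A>" for g using f that by blast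
 show "hasse i f : \<A>" using f
 proof (induction rule: QMg.total_induct)
  case (piece k f) show ?case by (rule QMg.piece_total[OF hasse_QM[OF piece]])
 next
  case (add u v)
  have "hasse i (u + v) = hasse i u + hasse i v"
   unfolding plus_fun_lambda by (rule hasse_add[OF total_holo[OF add(1)] total_holo[OF add(2)]])
  thus ?case by (simp only: QMg.total_add[OF add(3,4)])
 qed
qed

lemma linear_op_qop: "m : {-1, 0, 1} ==> linear_op (qop m)"
 unfolding linear_op_def
 by (intro ballI conjI allI qop_closed qop_scale qop_add)

lemma linear_op_zero: "linear_op \<theta> ==> \<theta> 0 = 0"
proof -
 assume \<theta>: "linear_op \<theta>"
 have z: "fscale (*) (0::complex) h = 0" for h by (simp add: fscale_mult fun_eq_iff)
 have "\<theta> (fscale (*) 0 0) = fscale (*) 0 (\<theta> 0)" using \<theta> QMg.total_0 unfolding linear_op_def by blast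
 thus ?thesis unfolding z .
qed

end

section \<open>Vertex operators on vector-valued quasimodular forms\<close>

context qvoa_forms
begin

lemma forms_crd: "F : \<F> ==> (%z. crd b (F z)) : \<A>"
proof (induction rule: forms_induct)
 case (fun_vec j n f v)
 have "(%z. crd b (fvec f v z)) = fscale (*) (crd b v) f"
  by (simp add: fun_vec_def fscale_def crd_scale[OF piece_total[OF fun_vec(2)]] mult.commute)
 thus ?case using QMg.total_scale[OF QMg.piece_total[OF fun_vec(1)], of "crd b v"] by simp
next
 case (add F G)
 have "(%z. crd b ((F + G) z)) = (%z. crd b (F z)) + (%z. crd b (G z))"
  by (simp add: fun_eq_iff crd_add forms_values[OF add(1)] forms_values[OF add(2)])
 thus ?case using QMg.total_add[OF add(3,4)] by simp
qed

lemma forms_support: "F : \<F> ==> EX S. finite S & S <= \<V> & (ALL b. b ~: S --> (%z. crd b (F z)) = 0)"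
proof (induction rule: forms_induct)
 case (fun_vec j n f v)
 have "(%z. crd b (fvec f v z)) = 0" if "b ~: {b. crd b v ~= 0}" for b
  using that by (simp add: fun_vec_def fun_eq_iff crd_scale[OF piece_total[OF fun_vec(2)]])
 moreover have "{b. crd b v ~= 0} <= \<V>" using crd_hbasis hbasis_total by blast
 ultimately show ?case using crd_finite[of v] by blast
next
 case (add F G)
 then obtain S T where S: "finite S" "S <= \<V>" "ALL b. b ~: S --> (%z. crd b (F z)) = 0"
  and T: "finite T" "T <= \<V>" "ALL b. b ~: T --> (%z. crd b (G z)) = 0" by blast
 have "(%z. crd b ((F + G) z)) = 0" if "b ~: S \<union> T" for b
  using S(3) T(3) that by (simp add: fun_eq_iff crd_add forms_values[OF add(1)] forms_values[OF add(2)])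
 thus ?case using S(1,2) T(1,2) by (intro exI[of _ "S \<union> T"]) auto
qed

text \<open>An operator on scalar forms acts on vector-valued forms through their coordinates.\<close>

definition lift :: "((complex => complex) => complex => complex) => (complex => 'v) => complex => 'v" where
 "lift \<theta> F = (%z. Sum_any (%b. smul (\<theta> (%t. crd b (F t)) z) b))"

lemma lift_sum:
 assumes "linear_op \<theta>" "finite S" "!!b. b ~: S ==> (%z. crd b (F z)) = 0"
 shows "lift \<theta> F z = (\<Sum>b\<in>S. smul (\<theta> (%t. crd b (F t)) z) b)"
 unfolding lift_def
proof (rule Sum_any_finite_sum[OF assms(2)])
 fix b assume "b ~: S"
 thus "smul (\<theta> (%t. crd b (F t)) z) b = 0" unfolding assms(3)[OF \<open>b ~: S\<close>] linear_op_zero[OF assms(1)] by simp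
qed

lemma lift_values:
 assumes "linear_op \<theta>" "F : \<F>" shows "lift \<theta> F z : \<V>"
proof -
 obtain S where S: "finite S" "S <= \<V>" "!!b. b ~: S ==> (%z. crd b (F z)) = 0"
  using forms_support[OF assms(2)] by blast
 have "lift \<theta> F z = (\<Sum>b\<in>S. smul (\<theta> (%t. crd b (F t)) z) b)"
  by (rule lift_sum[OF assms(1) S(1)]) (rule S(3))
 also have "\<dots> : \<V>" using S(2) by (intro total_sum total_scale) auto
 finally show ?thesis .
qed

lemma lift_add:
 assumes \<theta>: "linear_op \<theta>" and F: "F : \<F>" and G: "G : \<F>"
 shows "lift \<theta> (F + G) = lift \<theta> F + lift \<theta> G"
proof
 fix w
 obtain S where S: "finite S" "!!b. b ~: S ==> (%w. crd b (F w)) = 0" using forms_support[OF F] by blast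
 obtain T where T: "finite T" "!!b. b ~: T ==> (%w. crd b (G w)) = 0" using forms_support[OF G] by blast
 have c: "(%w. crd b ((F + G) w)) = (%w. crd b (F w)) + (%w. crd b (G w))" for b
  by (simp add: fun_eq_iff crd_add forms_values[OF F] forms_values[OF G])
 have fin: "finite (S \<union> T)" using S(1) T(1) by simp
 have z: "(%w. crd b ((F + G) w)) = 0" if "b ~: S \<union> T" for b
  using S(2)[of b] T(2)[of b] that unfolding c by simp
 have "lift \<theta> (F + G) w = (\<Sum>b\<in>S \<union> T. smul (\<theta> (%t. crd b ((F + G) t)) w) b)"
  by (rule lift_sum[OF \<theta> fin z])
 also have "\<dots> = (\<Sum>b\<in>S \<union> T. smul (\<theta> (%t. crd b (F t)) w) b + smul (\<theta> (%t. crd b (G t)) w) b)"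
 proof (rule sum.cong[OF refl])
  fix b
  have "\<theta> (%t. crd b ((F + G) t)) = \<theta> (%t. crd b (F t)) + \<theta> (%t. crd b (G t))"
   unfolding c using \<theta> forms_crd[OF F] forms_crd[OF G] unfolding linear_op_def by blast
  thus "smul (\<theta> (%t. crd b ((F + G) t)) w) b = smul (\<theta> (%t. crd b (F t)) w) b + smul (\<theta> (%t. crd b (G t)) w) b"
   by (simp add: scale_left_distrib)
 qed
 also have "\<dots> = lift \<theta> F w + lift \<theta> G w"
  unfolding sum.distrib by (intro arg_cong2[where f = "(+)"] lift_sum[OF \<theta> fin, symmetric]) (use S T in auto)
 finally show "lift \<theta> (F + G) w = (lift \<theta> F + lift \<theta> G) w" by simp
qed

lemma lift_fun_vec:
 assumes \<theta>: "linear_op \<theta>" and f: "f : \<A>" and v: "v : \<V>"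
 shows "lift \<theta> (fvec f v) = fvec (\<theta> f) v"
proof
 fix w
 let ?S = "{b. crd b v ~= 0}"
 have c: "(%w. crd b (fvec f v w)) = fscale (*) (crd b v) f" for b
  by (simp add: fun_vec_def fscale_def crd_scale[OF v] mult.commute)
 have z: "(%w. crd b (fvec f v w)) = 0" if "b ~: ?S" for b
  unfolding c using that by (simp add: fscale_def fun_eq_iff)
 have "lift \<theta> (fvec f v) w = (\<Sum>b\<in>?S. smul (\<theta> (fscale (*) (crd b v) f) w) b)"
  using lift_sum[OF \<theta> crd_finite, of v "fvec f v" w, OF z] unfolding c .
 also have "\<dots> = (\<Sum>b\<in>?S. smul (\<theta> f w) (smul (crd b v) b))"
 proof (rule sum.cong[OF refl])
  fix b
  have "\<theta> (fscale (*) (crd b v) f) = fscale (*) (crd b v) (\<theta> f)" using \<theta> f unfolding linear_op_def by blast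
  thus "smul (\<theta> (fscale (*) (crd b v) f) w) b = smul (\<theta> f w) (smul (crd b v) b)"
   by (simp add: fscale_def mult.commute)
 qed
 also have "\<dots> = smul (\<theta> f w) v"
  unfolding scale_sum_right[symmetric] using crd_expand[OF v crd_finite, of v] by simp
 finally show "lift \<theta> (fvec f v) w = fvec (\<theta> f) v w" by (simp add: fun_vec_def)
qed

lemma total_linear:
 assumes "linear_op \<theta>" "f : \<A>" shows "\<theta> f : \<A>"
 using assms unfolding linear_op_def by blast

lemma mode_total:
 assumes u: "u : \<V>" and v: "v : \<V>" shows "Y u n v : \<V>"
 using u
proof (induction rule: total_induct)
 case (piece a u)
 show ?case using v
 proof (induction rule: total_induct)
  case (piece b v)
  show ?case by (rule piece_total[OF mode_degree[OF \<open>u : V a\<close> piece]])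
 next
  case (add x y)
  show ?case unfolding mode_add_right[OF piece_total[OF piece] add(1,2)] by (rule total_add[OF add(3,4)])
 qed
next
 case (add x y)
 show ?case unfolding mode_add_left[OF add(1,2) v] by (rule total_add[OF add(3,4)])
qed

lemma mode_zero_left: "v : \<V> ==> Y 0 n v = 0"
 using mode_scale_left[OF total_0, of v 0 n] by simp

lemma mode_zero_right: "u : \<V> ==> Y u n 0 = 0"
 using mode_scale_right[OF _ total_0, of u n 0] by simp

definition Yf :: "(complex => 'v) => int => (complex => 'v) => complex => 'v" where
 "Yf F n G = (%z. Sum_any (%i::nat. Y (lift (hasse i) F z) (n + int i) (G z)))"

text \<open>The bound on \<open>n\<close> has to be uniform in the point and in the order of derivation; it
depends only on the finitely many vectors involved.\<close>

lemma Yf_truncation: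
 assumes F: "F : \<F>" and G: "G : \<F>"
 shows "EX M. ALL n>=M. ALL i z. Y (lift (hasse i) F z) n (G z) = 0"
 using F
proof (induction rule: forms_induct)
 case (fun_vec j a f u)
 note u = piece_total[OF fun_vec(2)] and f = QMg.piece_total[OF fun_vec(1)]
 show ?case using G
 proof (induction rule: forms_induct)
  case (fun_vec k b g v)
  note v = piece_total[OF fun_vec(2)]
  obtain M where M: "ALL n>=M. Y u n v = 0" using truncation[OF u v] by blast
  have "Y (lift (hasse i) (fvec f u) z) n (fvec g v z) = 0" if "n >= M" for n i z
   unfolding lift_fun_vec[OF linear_op_hasse f u] unfolding fun_vec_def
    mode_scale_left[OF u total_scale[OF v]] mode_scale_right[OF u v] using M that by simp
  thus ?case by blast
 next
  case (add G H)
  obtain M where M: "ALL n>=M. ALL i z. Y (lift (hasse i) (fvec f u) z) n (G z) = 0" using add(3) by blast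
  obtain N where N: "ALL n>=N. ALL i z. Y (lift (hasse i) (fvec f u) z) n (H z) = 0" using add(4) by blast
  have "Y (lift (hasse i) (fvec f u) z) n ((G + H) z) = 0" if "n >= max M N" for n i z
   unfolding plus_fun_apply mode_add_right[OF lift_values[OF linear_op_hasse total_fun_vec[OF f u]] forms_values[OF add(1)] forms_values[OF add(2)]]
   using M N that by simp
  thus ?case by blast
 qed
next
 case (add F H)
 obtain M where M: "ALL n>=M. ALL i z. Y (lift (hasse i) F z) n (G z) = 0" using add(3) by blast
 obtain N where N: "ALL n>=N. ALL i z. Y (lift (hasse i) H z) n (G z) = 0" using add(4) by blast
 have "Y (lift (hasse i) (F + H) z) n (G z) = 0" if "n >= max M N" for n i z
  unfolding lift_add[OF linear_op_hasse add(1,2)] plus_fun_apply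
   mode_add_left[OF lift_values[OF linear_op_hasse add(1)] lift_values[OF linear_op_hasse add(2)] forms_values[OF G]]
  using M N that by simp
 thus ?case by blast
qed

lemma Yf_finite:
 assumes F: "F : \<F>" and G: "G : \<F>"
 shows "finite {i. Y (lift (hasse i) F z) (n + int i) (G z) ~= 0}"
proof -
 obtain M where M: "ALL n>=M. ALL i z. Y (lift (hasse i) F z) n (G z) = 0" using Yf_truncation[OF F G] by blast
 have "{i. Y (lift (hasse i) F z) (n + int i) (G z) ~= 0} <= {..<nat (M - n)}"
 proof
  fix i assume "i : {i. Y (lift (hasse i) F z) (n + int i) (G z) ~= 0}"
  hence "~ n + int i >= M" using M by blast
  thus "i : {..<nat (M - n)}" by simp
 qed
 thus ?thesis by (rule finite_subset) simp
qed

lemma Yf_vanish: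
 assumes F: "F : \<F>" and G: "G : \<F>" shows "EX M. ALL n>=M. Yf F n G = 0"
proof -
 obtain M where M: "ALL n>=M. ALL i z. Y (lift (hasse i) F z) n (G z) = 0" using Yf_truncation[OF F G] by blast
 have "Yf F n G = 0" if "n >= M" for n
  unfolding Yf_def using M that by (simp add: fun_eq_iff)
 thus ?thesis by blast
qed

lemma Yf_add_left:
 assumes "F : \<F>" "F' : \<F>" "G : \<F>"
 shows "Yf (F + F') n G = Yf F n G + Yf F' n G"
proof
 fix z
 have "Y (lift (hasse i) (F + F') z) (n + int i) (G z) =
   Y (lift (hasse i) F z) (n + int i) (G z) + Y (lift (hasse i) F' z) (n + int i) (G z)" for i
  unfolding lift_add[OF linear_op_hasse assms(1,2)] plus_fun_apply
  by (rule mode_add_left[OF lift_values[OF linear_op_hasse assms(1)] lift_values[OF linear_op_hasse assms(2)] forms_values[OF assms(3)]])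
 thus "Yf (F + F') n G z = (Yf F n G + Yf F' n G) z"
  unfolding Yf_def plus_fun_apply using Sum_any.distrib[OF Yf_finite[OF assms(1,3)] Yf_finite[OF assms(2,3)]] by simp
qed

lemma Yf_add_right:
 assumes "F : \<F>" "G : \<F>" "G' : \<F>"
 shows "Yf F n (G + G') = Yf F n G + Yf F n G'"
proof
 fix z
 have "Y (lift (hasse i) F z) (n + int i) ((G + G') z) =
   Y (lift (hasse i) F z) (n + int i) (G z) + Y (lift (hasse i) F z) (n + int i) (G' z)" for i
  unfolding plus_fun_apply
  by (rule mode_add_right[OF lift_values[OF linear_op_hasse assms(1)] forms_values[OF assms(2)] forms_values[OF assms(3)]])
 thus "Yf F n (G + G') z = (Yf F n G + Yf F n G') z"
  unfolding Yf_def plus_fun_apply using Sum_any.distrib[OF Yf_finite[OF assms(1,2)] Yf_finite[OF assms(1,3)]] by simp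
qed

lemma Yf_at:
 assumes "f : \<A>" "u : \<V>" "v : \<V>"
 shows "Yf (fvec f u) n (fvec g v) =
  (%z. Sum_any (%i::nat. smul (hasse i f z * g z) (Y u (n + int i) v)))"
 unfolding Yf_def lift_fun_vec[OF linear_op_hasse assms(1,2)] unfolding fun_vec_def
  mode_scale_left[OF assms(2) total_scale[OF assms(3)]] mode_scale_right[OF assms(2,3)] by simp

lemma Yf_fun_vec:
 assumes "f : \<A>" "u : \<V>" "v : \<V>"
  and "!!i. i >= I ==> Y u (n + int i) v = 0"
 shows "Yf (fvec f u) n (fvec g v) =
  (\<Sum>i<I. fvec (%z. hasse i f z * g z) (Y u (n + int i) v))"
proof
 fix z
 show "Yf (fvec f u) n (fvec g v) z =
  (\<Sum>i<I. fvec (%z. hasse i f z * g z) (Y u (n + int i) v)) z"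
  unfolding Yf_at[OF assms(1-3)] sum_fun_at unfolding fun_vec_def
  by (rule Sum_any_nat_less) (simp add: assms(4))
qed

lemma mode_bound: "u : \<V> ==> v : \<V> ==> EX I::nat. ALL i>=I. Y u (n + int i) v = 0"
proof -
 assume "u : \<V>" "v : \<V>"
 then obtain M where M: "ALL n>=M. Y u n v = 0" using truncation by blast
 have "Y u (n + int i) v = 0" if "i >= nat (M - n)" for i using M that by simp
 thus ?thesis by blast
qed

lemma Yf_degree:
 assumes F: "F : \<Q> j" and G: "G : \<Q> k" shows "Yf F n G : \<Q> (j + k - 2 * n - 2)"
 using F
proof (induction rule: QMV_induct)
 case zero
 have "Yf 0 n G = Yf 0 n G + Yf 0 n G" using Yf_add_left[OF QVg.total_0 QVg.total_0 QVg.piece_total[OF G], of n] by simp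
 hence y: "Yf 0 n G = 0" by simp
 show ?case unfolding y by (rule QMV_zero)
next
 case (fun_vec p f u)
 note f = QMg.piece_total[OF fun_vec(1)] and u = piece_total[OF fun_vec(2)]
 show ?case using G
 proof (induction rule: QMV_induct)
  case zero
  have "Yf (fvec f u) n 0 = Yf (fvec f u) n 0 + Yf (fvec f u) n 0"
   using Yf_add_right[OF total_fun_vec[OF f u] QVg.total_0 QVg.total_0, of n] by simp
  hence y: "Yf (fvec f u) n 0 = 0" by simp
  show ?case unfolding y by (rule QMV_zero)
 next
  case (fun_vec q g v)
  note v = piece_total[OF fun_vec(2)]
  obtain I where I: "!!i. i >= I ==> Y u (n + int i) v = 0" using mode_bound[OF u v] by blast
  have eq: "Yf (fvec f u) n (fvec g v) = (\<Sum>i<I. fvec (%z. hasse i f z * g z) (Y u (n + int i) v))"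
   by (rule Yf_fun_vec[OF f u v]) (rule I)
  show ?case unfolding eq
  proof (rule QVg.subspace_sum[OF QVg.subspace_piece])
   fix i
   have w: "j - 2 * p + 2 * int i + (k - 2 * q) + 2 * (p + q - (n + int i) - 1) = j + k - 2 * n - 2" by simp
   show "fvec (%z. hasse i f z * g z) (Y u (n + int i) v) : \<Q> (j + k - 2 * n - 2)"
    using QMV_fun_vec[OF qm_mult[OF hasse_QM[OF \<open>f : QM \<Gamma> (j - 2 * p)\<close>] fun_vec(1)] mode_degree[OF \<open>u : V p\<close> fun_vec(2), of "n + int i"], of i]
    unfolding w .
  qed
 next
  case (add A B)
  show ?case unfolding Yf_add_right[OF total_fun_vec[OF f u] QVg.piece_total[OF add(1)] QVg.piece_total[OF add(2)]]
   by (rule QMV_add[OF add(3,4)])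
 qed
next
 case (add A B)
 show ?case unfolding Yf_add_left[OF QVg.piece_total[OF add(1)] QVg.piece_total[OF add(2)] QVg.piece_total[OF G]]
  by (rule QMV_add[OF add(3,4)])
qed

definition Lf :: "int => (complex => 'v) => complex => 'v" where
 "Lf m F = lift (qop m) F + (%z. L m (F z))"

lemma Lf_fun_vec:
 assumes m: "m : {-1, 0, 1}" and f: "f : \<A>" and v: "v : \<V>"
 shows "Lf m (fvec f v) = fvec (qop m f) v + fvec f (L m v)"
 unfolding Lf_def lift_fun_vec[OF linear_op_qop[OF m] f v]
 by (simp add: fun_vec_def fun_eq_iff L_scale[OF m v])

lemma Lf_add:
 assumes m: "m : {-1, 0, 1}" and F: "F : \<F>" and G: "G : \<F>"
 shows "Lf m (F + G) = Lf m F + Lf m G"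
 unfolding Lf_def lift_add[OF linear_op_qop[OF m] F G]
 by (simp add: fun_eq_iff L_add[OF m forms_values[OF F] forms_values[OF G]])

lemma Lf_closed:
 assumes m: "m : {-1, 0, 1}" and F: "F : \<F>" shows "Lf m F : \<F>"
 using F
proof (induction rule: forms_induct)
 case (fun_vec j n f v)
 note f = QMg.piece_total[OF fun_vec(1)] and v = piece_total[OF fun_vec(2)]
 show ?case unfolding Lf_fun_vec[OF m f v]
  by (rule QVg.total_add[OF total_fun_vec[OF qop_closed[OF m f] v] total_fun_vec[OF f L_closed[OF m v]]])
next
 case (add F G)
 show ?case unfolding Lf_add[OF m add(1,2)] by (rule QVg.total_add[OF add(3,4)])
qed

end

section \<open>The Borcherds identity with function coefficients\<close>

text \<open>Vanishing beyond the antidiagonal lets a triangular double sum be completed to a square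
one.\<close>

lemma triangle_square:
 fixes G :: "nat => nat => 'a::comm_monoid_add"
 assumes "!!a q. a + q >= B ==> G a q = 0"
 shows "(\<Sum>s<B. \<Sum>a\<le>s. G a (s - a)) = (\<Sum>a<B. \<Sum>q<B. G a q)"
proof -
 have "(\<Sum>a<B. \<Sum>q<B. G a q) = (\<Sum>(a, q)\<in>{..<B} \<times> {..<B}. G a q)" by (simp add: sum.cartesian_product)
 also have "\<dots> = (\<Sum>(a, q)\<in>{(a, q). a + q < B}. G a q)"
 proof (rule sum.mono_neutral_right)
  show "ALL p:{..<B} \<times> {..<B} - {(a, q). a + q < B}. (case p of (a, q) => G a q) = 0"
  proof
   fix p assume "p : {..<B} \<times> {..<B} - {(a, q). a + q < B}"
   hence "fst p + snd p >= B" by auto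
   from assms[OF this] show "(case p of (a, q) => G a q) = 0" by (simp add: split_beta)
  qed
 qed auto
 also have "\<dots> = (\<Sum>s<B. \<Sum>a\<le>s. G a (s - a))" by (rule sum.triangle_reindex)
 finally show ?thesis ..
qed

lemma gbinomial_vandermonde_nat:
 fixes x :: complex
 shows "(\<Sum>i\<le>t. (x gchoose i) * of_nat (r choose (t - i))) = (x + of_nat r gchoose t)"
 using gbinomial_Vandermonde[of x "of_nat r" t] by (simp add: binomial_gbinomial atLeast0AtMost)


context complex_space
begin

text \<open>With \<open>r = p + a\<close> and \<open>t = i + p\<close> as new indices, the coefficient of
\<open>\<alpha>\<^sub>r \<beta>\<^sub>q\<close> is a Vandermonde sum. All sums run to a common bound
\<open>B\<close>, chosen so large that the reindexing only moves vanishing terms across it.\<close>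

lemma leibniz_vandermonde:
 fixes T :: "nat => int => 'w" and \<alpha> \<beta> :: "nat => complex" and c :: int
 assumes T1: "!!t e. t >= K0 ==> T t e = 0"
  and T2: "!!t e. t < K0 ==> e >= c - int t + int K1 ==> T t e = 0"
  and B: "K0 + K1 <= B"
 shows "(\<Sum>i<B. \<Sum>p<B. \<Sum>s<B. scale ((x gchoose i) * (\<Sum>a\<le>s. of_nat ((p + a) choose a) * \<alpha> (p + a) * \<beta> (s - a)))
    (T (i + p) (c - int i + int s))) =
  (\<Sum>r<B. \<Sum>q<B. scale (\<alpha> r * \<beta> q) (\<Sum>t<B. scale (x + of_nat r gchoose t) (T t (c + int r + int q - int t))))"
proof -
 define G where "G i p a q = scale ((x gchoose i) * (of_nat ((p + a) choose a) * \<alpha> (p + a) * \<beta> q)) (T (i + p) (c - int i + int (a + q)))" for i p a q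
 have G0: "G i p a q = 0" if "p >= K0 \<or> a >= K1 \<or> a + q >= B" for i p a q
 proof (cases "i + p >= K0")
  case True thus ?thesis by (simp add: G_def T1)
 next
  case False
  hence "a >= K1 \<or> a + q >= B" using that by linarith
  hence "a + q >= K1" using B by linarith
  hence "T (i + p) (c - int i + int (a + q)) = 0" using False by (intro T2) auto
  thus ?thesis by (simp add: G_def)
 qed
 have "(\<Sum>i<B. \<Sum>p<B. \<Sum>s<B. scale ((x gchoose i) * (\<Sum>a\<le>s. of_nat ((p + a) choose a) * \<alpha> (p + a) * \<beta> (s - a)))
    (T (i + p) (c - int i + int s))) = (\<Sum>i<B. \<Sum>p<B. \<Sum>s<B. \<Sum>a\<le>s. G i p a (s - a))"
  by (intro sum.cong refl) (simp add: G_def sum_distrib_left scale_sum_left)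
 also have "\<dots> = (\<Sum>i<B. \<Sum>p<B. \<Sum>a<B. \<Sum>q<B. G i p a q)"
  by (intro sum.cong refl triangle_square) (simp add: G0)
 also have "\<dots> = (\<Sum>i<B. \<Sum>r<B. \<Sum>p\<le>r. \<Sum>q<B. G i p (r - p) q)"
 proof (rule sum.cong[OF refl], rule triangle_square[symmetric], rule sum.neutral, rule ballI)
  fix i p a q assume "p + a >= B"
  hence "p >= K0 \<or> a >= K1 \<or> a + q >= B" using B by linarith
  thus "G i p a q = 0" by (rule G0)
 qed
 also have "\<dots> = (\<Sum>i<B. \<Sum>r<B. \<Sum>q<B. \<Sum>p\<le>r. G i p (r - p) q)"
  by (intro sum.cong refl sum.swap)
 also have "\<dots> = (\<Sum>r<B. \<Sum>i<B. \<Sum>q<B. \<Sum>p\<le>r. G i p (r - p) q)" by (rule sum.swap)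
 also have "\<dots> = (\<Sum>r<B. \<Sum>q<B. \<Sum>i<B. \<Sum>p\<le>r. G i p (r - p) q)" by (intro sum.cong refl sum.swap)
 also have "\<dots> = (\<Sum>r<B. \<Sum>q<B. scale (\<alpha> r * \<beta> q) (\<Sum>t<B. scale (x + of_nat r gchoose t) (T t (c + int r + int q - int t))))"
 proof (intro sum.cong refl)
  fix r q assume r: "r : {..<B}"
  define Z where "Z t = T t (c + int r + int q - int t)" for t
  define H where "H i p = scale ((x gchoose i) * of_nat (r choose p)) (Z (i + p))" for i p
  have Z0: "Z t = 0" if "t >= B" for t using that B by (simp add: Z_def T1)
  have "(\<Sum>p\<le>r. G i p (r - p) q) = scale (\<alpha> r * \<beta> q) (\<Sum>p<B. H i p)" for i
  proof -
   have "(\<Sum>p\<le>r. G i p (r - p) q) = (\<Sum>p\<le>r. scale (\<alpha> r * \<beta> q) (H i p))"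
   proof (rule sum.cong[OF refl])
    fix p assume p: "p : {..r}"
    have e: "c - int i + int (r - p + q) = c + int r + int q - int (i + p)" using p by simp
    have b: "r choose (r - p) = r choose p" using p binomial_symmetric[of p r] by simp
    have rp: "p + (r - p) = r" using p by simp
    show "G i p (r - p) q = scale (\<alpha> r * \<beta> q) (H i p)"
     unfolding G_def H_def Z_def e rp b by (simp add: mult_ac)
   qed
   also have "\<dots> = (\<Sum>p<B. scale (\<alpha> r * \<beta> q) (H i p))"
    by (rule sum.mono_neutral_left) (use r in \<open>auto simp: H_def not_le\<close>)
   finally show ?thesis by (simp add: scale_sum_right)
  qed
  hence "(\<Sum>i<B. \<Sum>p\<le>r. G i p (r - p) q) = scale (\<alpha> r * \<beta> q) (\<Sum>i<B. \<Sum>p<B. H i p)"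
   by (simp add: scale_sum_right)
  also have "(\<Sum>i<B. \<Sum>p<B. H i p) = (\<Sum>t<B. \<Sum>i\<le>t. H i (t - i))"
   by (rule triangle_square[symmetric]) (simp add: H_def Z0)
  also have "\<dots> = (\<Sum>t<B. scale (x + of_nat r gchoose t) (Z t))"
  proof (rule sum.cong[OF refl])
   fix t
   have "(\<Sum>i\<le>t. H i (t - i)) = scale (\<Sum>i\<le>t. (x gchoose i) * of_nat (r choose (t - i))) (Z t)"
    unfolding scale_sum_left by (rule sum.cong[OF refl]) (simp add: H_def)
   thus "(\<Sum>i\<le>t. H i (t - i)) = scale (x + of_nat r gchoose t) (Z t)"
    unfolding gbinomial_vandermonde_nat .
  qed
  finally show "(\<Sum>i<B. \<Sum>p\<le>r. G i p (r - p) q) =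
    scale (\<alpha> r * \<beta> q) (\<Sum>t<B. scale (x + of_nat r gchoose t) (T t (c + int r + int q - int t)))"
   unfolding Z_def .
 qed
 finally show ?thesis .
qed

end

context qvoa_forms
begin

lemma Yf_closed: "F : \<F> ==> G : \<F> ==> Yf F n G : \<F>"
proof (induction rule: QVg.total_induct)
 case (piece j F)
 from piece(2) show ?case
 proof (induction rule: QVg.total_induct)
  case (piece k G)
  show ?case by (rule QVg.piece_total[OF Yf_degree[OF \<open>F : \<Q> j\<close> piece]])
 next
  case (add G H)
  show ?case unfolding Yf_add_right[OF QVg.piece_total[OF piece(1)] add(1,2)] by (rule QVg.total_add[OF add(3,4)])
 qed
next
 case (add F H)
 show ?case unfolding Yf_add_left[OF add(1,2,5)] by (rule QVg.total_add[OF add(3)[OF add(5)] add(4)[OF add(5)]])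
qed

lemma Yf_sum_left:
 assumes "!!i. i : I ==> F i : \<F>" "G : \<F>"
 shows "Yf (\<Sum>i\<in>I. F i) n G = (\<Sum>i\<in>I. Yf (F i) n G)"
 using assms(1)
proof (induction I rule: infinite_finite_induct)
 case (insert i I)
 have "(\<Sum>i\<in>I. F i) : \<F>" using insert by (intro QVg.total_sum) auto
 from Yf_add_left[OF insert(4) this assms(2)] insert.IH insert(4)
 show ?case unfolding sum.insert[OF insert(1,2)] by (metis insertCI)
qed (use Yf_add_left[OF QVg.total_0 QVg.total_0 assms(2), of n] in simp_all)

lemma Yf_sum_right:
 assumes "F : \<F>" "!!i. i : I ==> G i : \<F>"
 shows "Yf F n (\<Sum>i\<in>I. G i) = (\<Sum>i\<in>I. Yf F n (G i))"
 using assms(2)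
proof (induction I rule: infinite_finite_induct)
 case (insert i I)
 have "(\<Sum>i\<in>I. G i) : \<F>" using insert by (intro QVg.total_sum) auto
 from Yf_add_right[OF assms(1) insert(4) this] insert.IH insert(4)
 show ?case unfolding sum.insert[OF insert(1,2)] by (metis insertCI)
qed (use Yf_add_right[OF assms(1) QVg.total_0 QVg.total_0, of n] in simp_all)

text \<open>Nested modes need one bound for the finitely many values of the inner mode.\<close>

lemma mode_bound_uniform:
 assumes u: "u : \<V>" and x: "!!i. i < (K::nat) ==> x i : \<V>"
 shows "EX M. ALL i<K. ALL n>=M. Y u n (x i) = 0" "EX M. ALL i<K. ALL n>=M. Y (x i) n u = 0"
proof -
 have "ALL i. EX M. i < K --> (ALL n>=M. Y u n (x i) = 0)" using truncation[OF u x] by blast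
 then obtain M where M: "!!i n. i < K ==> n >= M i ==> Y u n (x i) = 0" by metis
 have "Y u n (x i) = 0" if i: "i < K" and n: "n >= Max (M ` {..<K})" for i n
 proof (rule M[OF i])
  have "M i <= Max (M ` {..<K})" using i by (intro Max_ge) auto
  thus "n >= M i" using n by linarith
 qed
 thus "EX M. ALL i<K. ALL n>=M. Y u n (x i) = 0" by blast
 have "ALL i. EX M. i < K --> (ALL n>=M. Y (x i) n u = 0)" using truncation[OF x u] by blast
 then obtain M' where M': "!!i n. i < K ==> n >= M' i ==> Y (x i) n u = 0" by metis
 have "Y (x i) n u = 0" if i: "i < K" and n: "n >= Max (M' ` {..<K})" for i n
 proof (rule M'[OF i])
  have "M' i <= Max (M' ` {..<K})" using i by (intro Max_ge) auto
  thus "n >= M' i" using n by linarith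
 qed
 thus "EX M. ALL i<K. ALL n>=M. Y (x i) n u = 0" by blast
qed

lemma Yf_Yf_fun_vec:
 assumes f: "f : \<A>" and g: "g : \<A>" and h: "h : \<A>"
  and u: "u : \<V>" and v: "v : \<V>" and w: "w : \<V>"
  and b1: "!!q. q >= B ==> Y v (k + int q) w = 0"
  and b2: "!!q r. r >= B ==> Y u (n + int r) (Y v (k + int q) w) = 0"
 shows "Yf (fvec f u) n (Yf (fvec g v) k (fvec h w)) z =
  (\<Sum>r<B. \<Sum>q<B. smul (hasse r f z * hasse q g z * h z) (Y u (n + int r) (Y v (k + int q) w)))"
proof -
 have gh: "(%z. hasse q g z * h z) : \<A>" for q
  by (rule total_mult[OF total_linear[OF linear_op_hasse g] h])
 have "Yf (fvec g v) k (fvec h w) =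
   (\<Sum>q<B. fvec (%z. hasse q g z * h z) (Y v (k + int q) w))"
  by (rule Yf_fun_vec[OF g v w b1])
 hence "Yf (fvec f u) n (Yf (fvec g v) k (fvec h w)) =
   (\<Sum>q<B. Yf (fvec f u) n (fvec (%z. hasse q g z * h z) (Y v (k + int q) w)))"
  using Yf_sum_right[OF total_fun_vec[OF f u] total_fun_vec[OF gh mode_total[OF v w]]] by simp
 also have "\<dots> = (\<Sum>q<B. \<Sum>r<B. fvec (%z. hasse r f z * (hasse q g z * h z)) (Y u (n + int r) (Y v (k + int q) w)))"
  by (rule sum.cong[OF refl]) (rule Yf_fun_vec[OF f u mode_total[OF v w] b2])
 also have "\<dots> = (\<Sum>r<B. \<Sum>q<B. fvec (%z. hasse r f z * (hasse q g z * h z)) (Y u (n + int r) (Y v (k + int q) w)))"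
  by (rule sum.swap)
 finally show ?thesis by (simp add: sum_fun_at fun_vec_def mult.assoc)
qed

lemma Yf_left_Yf_fun_vec:
 assumes f: "f : \<A>" and g: "g : \<A>" and h: "h : \<A>"
  and u: "u : \<V>" and v: "v : \<V>" and w: "w : \<V>"
  and b1: "!!p. p >= B ==> Y u (k + int p) v = 0"
  and b2: "!!p s. s >= B ==> Y (Y u (k + int p) v) (n + int s) w = 0"
 shows "Yf (Yf (fvec f u) k (fvec g v)) n (fvec h w) z =
  (\<Sum>p<B. \<Sum>s<B. smul ((\<Sum>a\<le>s. of_nat ((p + a) choose a) * hasse (p + a) f z * hasse (s - a) g z) * h z)
   (Y (Y u (k + int p) v) (n + int s) w))"
proof -
 have fg: "(%z. hasse p f z * g z) : \<A>" for p
  by (rule total_mult[OF total_linear[OF linear_op_hasse f] g])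
 have "Yf (fvec f u) k (fvec g v) =
   (\<Sum>p<B. fvec (%z. hasse p f z * g z) (Y u (k + int p) v))"
  by (rule Yf_fun_vec[OF f u v b1])
 hence "Yf (Yf (fvec f u) k (fvec g v)) n (fvec h w) =
   (\<Sum>p<B. Yf (fvec (%z. hasse p f z * g z) (Y u (k + int p) v)) n (fvec h w))"
  using Yf_sum_left[OF total_fun_vec[OF fg mode_total[OF u v]] total_fun_vec[OF h w]] by simp
 also have "\<dots> = (\<Sum>p<B. \<Sum>s<B. fvec (%z. hasse s (%z. hasse p f z * g z) z * h z) (Y (Y u (k + int p) v) (n + int s) w))"
  by (rule sum.cong[OF refl]) (rule Yf_fun_vec[OF fg mode_total[OF u v] w b2])
 finally show ?thesis
  by (simp add: sum_fun_at fun_vec_def hasse_mult[OF hasse_holo[OF total_holo[OF f]] total_holo[OF g]]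
    hasse_hasse[OF total_holo[OF f]])
qed

lemma Yf_vanish_fun_vec:
 assumes "f : \<A>" "u : \<V>" "v : \<V>"
  and "!!i. Y u (n + int i) v = 0"
 shows "Yf (fvec f u) n (fvec g v) = 0"
 using Yf_fun_vec[OF assms(1-3), of 0 n g] assms(4) by simp

lemma Yf_zero_left: "G : \<F> ==> Yf 0 n G = 0"
 using Yf_add_left[OF QVg.total_0 QVg.total_0, of G n] by simp

lemma Yf_zero_right: "F : \<F> ==> Yf F n 0 = 0"
 using Yf_add_right[OF _ QVg.total_0 QVg.total_0, of F n] by simp

text \<open>At a point both sides are sums over \<open>r\<close> and \<open>q\<close> of
\<open>f\<^sub>[\<^sub>r\<^sub>] g\<^sub>[\<^sub>q\<^sub>] h\<close> times the two sides of the Borcherds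
identity of \<open>V\<close> at the indices \<open>l\<close>, \<open>m + r\<close>, \<open>n + q\<close>,
where brackets denote divided derivatives. The bounds \<open>K\<^sub>i\<close> and \<open>E\<^sub>i\<close>
come from truncation in \<open>V\<close>.\<close>

lemma borcherds_fun_vec:
 assumes f: "f : \<A>" and g: "g : \<A>" and h: "h : \<A>"
  and u: "u : \<V>" and v: "v : \<V>" and w: "w : \<V>"
 defines "F \<equiv> fvec f u" and "G \<equiv> fvec g v" and "H \<equiv> fvec h w"
 shows "Sum_any (%i::nat. scl (of_int m gchoose i) (Yf (Yf F (l + int i) G) (m + n - int i) H)) =
  Sum_any (%i::nat. scl ((-1) ^ i * (of_int l gchoose i))
   (Yf F (m + l - int i) (Yf G (n + int i) H) - scl ((-1) powi l) (Yf G (n + l - int i) (Yf F (m + int i) H))))"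
proof
 fix \<tau>
 have Ft: "F : \<F>" and Gt: "G : \<F>" and Ht: "H : \<F>"
  unfolding F_def G_def H_def using total_fun_vec f g h u v w by blast+
 obtain K0 where K0: "!!t. t >= K0 ==> Y u (l + int t) v = 0" using mode_bound[OF u v] by blast
 obtain K2 where K2: "!!t. t >= K2 ==> Y v (n + int t) w = 0" using mode_bound[OF v w] by blast
 obtain K3 where K3: "!!t. t >= K3 ==> Y u (m + int t) w = 0" using mode_bound[OF u w] by blast
 obtain E1 where E1: "!!t e. t < K0 ==> e >= E1 ==> Y (Y u (l + int t) v) e w = 0"
  using mode_bound_uniform(2)[OF w, of K0 "%t. Y u (l + int t) v"] mode_total[OF u v] by blast
 obtain E2 where E2: "!!t e. t < K2 ==> e >= E2 ==> Y u e (Y v (n + int t) w) = 0"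
  using mode_bound_uniform(1)[OF u, of K2 "%t. Y v (n + int t) w"] mode_total[OF v w] by blast
 obtain E3 where E3: "!!t e. t < K3 ==> e >= E3 ==> Y v e (Y u (m + int t) w) = 0"
  using mode_bound_uniform(1)[OF v, of K3 "%t. Y u (m + int t) w"] mode_total[OF u w] by blast
 define K1 where "K1 = nat (E1 - m - n) + K0"
 define B where "B = K0 + K1 + K2 + K3 + nat (E2 - m - l) + nat (E3 - n - l)"
 let ?\<alpha> = "%r. hasse r f \<tau>" and ?\<beta> = "%q. hasse q g \<tau>"
 let ?S = "%r q i. smul ((- 1) ^ i * (of_int l gchoose i)) (Y u (m + int r + l - int i) (Y v (n + int q + int i) w) - smul ((- 1) powi l) (Y v (n + int q + l - int i) (Y u (m + int r + int i) w)))"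
 let ?R = "%i::nat. scl ((-1) ^ i * (of_int l gchoose i)) (Yf F (m + l - int i) (Yf G (n + int i) H) - scl ((-1) powi l) (Yf G (n + l - int i) (Yf F (m + int i) H)))"
 let ?A = "%i::nat. scl (of_int m gchoose i) (Yf (Yf F (l + int i) G) (m + n - int i) H)"
 let ?c = "%p s. \<Sum>a\<le>s. of_nat ((p + a) choose a) * ?\<alpha> (p + a) * ?\<beta> (s - a)"
 let ?T = "%t e. Y (Y u (l + int t) v) e w"
 have Yu0: "Y u e 0 = 0" "Y v e 0 = 0" "Y 0 e w = 0" for e using mode_zero_left mode_zero_right u v w by blast+
 have L0: "Yf (Yf F (l + int i) G) (m + n - int i) H = 0" if "i >= B" for i
 proof -
  have z: "Y u (l + int i + int p) v = 0" for p
   using K0[of "i + p"] that by (simp add: B_def add.assoc)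
  have "Yf F (l + int i) G = 0" unfolding F_def G_def by (rule Yf_vanish_fun_vec[OF f u v z])
  thus ?thesis using Yf_zero_left[OF Ht] by simp
 qed
 have L1: "Yf (Yf F (l + int i) G) (m + n - int i) H \<tau> =
   (\<Sum>p<B. \<Sum>s<B. smul (?c p s * h \<tau>)
    (?T (i + p) (m + n - int i + int s)))" for i
 proof -
  have e: "l + int i + int p = l + int (i + p)" for p by simp
  have "Yf (Yf F (l + int i) G) (m + n - int i) H \<tau> =
   (\<Sum>p<B. \<Sum>s<B. smul (?c p s * h \<tau>)
    (Y (Y u (l + int i + int p) v) (m + n - int i + int s) w))"
   unfolding F_def G_def H_def
  proof (rule Yf_left_Yf_fun_vec[OF f g h u v w])
   show "Y u (l + int i + int p) v = 0" if "p >= B" for p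
    unfolding e by (rule K0) (use that in \<open>simp add: B_def\<close>)
   show "Y (Y u (l + int i + int p) v) (m + n - int i + int s) w = 0" if s: "s >= B" for p s
   proof (cases "i + p < K0")
    case True
    show ?thesis unfolding e by (rule E1[OF True]) (use s True in \<open>simp add: B_def K1_def\<close>)
   next
    case False
    thus ?thesis unfolding e using K0[of "i + p"] Yu0 by simp
   qed
  qed
  thus ?thesis unfolding e .
 qed
 have "Sum_any ?A \<tau> =
   (\<Sum>i<B. ?A i) \<tau>"
  by (rule arg_cong[where f = "%F. F \<tau>"], rule Sum_any_nat_less) (simp add: L0 fscale_def fun_eq_iff)
 also have "\<dots> = (\<Sum>i<B. \<Sum>p<B. \<Sum>s<B. smul (h \<tau>) (smul ((of_int m gchoose i) * ?c p s)
    (?T (i + p) (m + n - int i + int s))))"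
  unfolding sum_fun_at fscale_def L1 scale_sum_right by (intro sum.cong refl) (simp add: mult_ac)
 also have "\<dots> = smul (h \<tau>) (\<Sum>i<B. \<Sum>p<B. \<Sum>s<B. smul ((of_int m gchoose i) * ?c p s)
    (?T (i + p) (m + n - int i + int s)))"
  by (simp only: scale_sum_right)
 also have "(\<Sum>i<B. \<Sum>p<B. \<Sum>s<B. smul ((of_int m gchoose i) * ?c p s)
    (?T (i + p) (m + n - int i + int s))) =
   (\<Sum>r<B. \<Sum>q<B. smul (?\<alpha> r * ?\<beta> q) (\<Sum>t<B. smul (of_int m + of_nat r gchoose t) (?T t (m + n + int r + int q - int t))))"
 proof (rule complex_space.leibniz_vandermonde[where T = "%t e. ?T t e" and ?K0.0 = K0 and ?K1.0 = K1])
  show "complex_space smul" by (simp add: complex_space_def vector_space_axioms)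
  show "?T t e = 0" if "t >= K0" for t e using K0[OF that] Yu0 by simp
  show "?T t e = 0" if "t < K0" "m + n - int t + int K1 <= e" for t e
  proof (rule E1[OF that(1)])
   have "int K1 >= E1 - m - n + int K0" by (simp add: K1_def)
   thus "E1 <= e" using that by linarith
  qed
  show "K0 + K1 <= B" by (simp add: B_def)
 qed
 also have "\<dots> = (\<Sum>r<B. \<Sum>q<B. smul (?\<alpha> r * ?\<beta> q) (\<Sum>i<B. ?S r q i))"
 proof (intro sum.cong refl)
  fix r q
  have "(\<Sum>t<B. smul (of_int (m + int r) gchoose t) (?T t ((m + int r) + (n + int q) - int t))) =
   Sum_any (%t. smul (of_int (m + int r) gchoose t) (?T t ((m + int r) + (n + int q) - int t)))"
   by (rule Sum_any_nat_less[symmetric]) (use K0 Yu0 in \<open>simp add: B_def\<close>)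
  also have "\<dots> = Sum_any (?S r q)"
   by (rule borcherds[OF u v w])
  also have "\<dots> = (\<Sum>i<B. ?S r q i)"
  proof (rule Sum_any_nat_less)
   fix i assume i: "i >= B"
   have "Y v (n + int q + int i) w = 0" using K2[of "q + i"] i by (simp add: B_def add.assoc)
   moreover have "Y u (m + int r + int i) w = 0" using K3[of "r + i"] i by (simp add: B_def add.assoc)
   ultimately show "?S r q i = 0"
    using Yu0 by simp
  qed
  finally have main: "(\<Sum>t<B. smul (of_int (m + int r) gchoose t) (?T t ((m + int r) + (n + int q) - int t))) = (\<Sum>i<B. ?S r q i)" .
  have e1: "(of_int m + of_nat r :: complex) = of_int (m + int r)" by simp
  have e2: "m + n + int r + int q - int t = (m + int r) + (n + int q) - int t" for t by simp
  show "smul (?\<alpha> r * ?\<beta> q) (\<Sum>t<B. smul (of_int m + of_nat r gchoose t) (?T t (m + n + int r + int q - int t))) =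
   smul (?\<alpha> r * ?\<beta> q) (\<Sum>i<B. ?S r q i)"
   unfolding e1 e2 main ..
 qed
 finally have lhs: "Sum_any ?A \<tau> =
  smul (h \<tau>) (\<Sum>r<B. \<Sum>q<B. smul (?\<alpha> r * ?\<beta> q) (\<Sum>i<B. ?S r q i))" .
 have R0: "Yf G (n + int i) H = 0" "Yf F (m + int i) H = 0" if "i >= B" for i
 proof -
  have "Y v (n + int i + int p) w = 0" "Y u (m + int i + int p) w = 0" for p
   using K2[of "i + p"] K3[of "i + p"] that by (simp_all add: B_def add.assoc)
  thus "Yf G (n + int i) H = 0" "Yf F (m + int i) H = 0" unfolding F_def G_def H_def
   using Yf_vanish_fun_vec[OF g v w] Yf_vanish_fun_vec[OF f u w] by blast+
 qed
 have R1: "Yf F (m + l - int i) (Yf G (n + int i) H) \<tau> =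
   (\<Sum>r<B. \<Sum>q<B. smul (?\<alpha> r * ?\<beta> q * h \<tau>) (Y u (m + int r + l - int i) (Y v (n + int q + int i) w)))" for i
 proof -
  have e: "n + int i + int q = n + int q + int i" "m + l - int i + int r = m + int r + l - int i" for q r by simp_all
  have "Yf F (m + l - int i) (Yf G (n + int i) H) \<tau> =
   (\<Sum>r<B. \<Sum>q<B. smul (?\<alpha> r * ?\<beta> q * h \<tau>) (Y u (m + l - int i + int r) (Y v (n + int i + int q) w)))"
   unfolding F_def G_def H_def
  proof (rule Yf_Yf_fun_vec[OF f g h u v w])
   show "Y v (n + int i + int q) w = 0" if "q >= B" for q
    using K2[of "i + q"] that by (simp add: B_def add.assoc)
   show "Y u (m + l - int i + int r) (Y v (n + int i + int q) w) = 0" if r: "r >= B" for q r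
   proof (cases "i + q < K2")
    case True
    have "Y u (m + l - int i + int r) (Y v (n + int (i + q)) w) = 0"
     by (rule E2[OF True]) (use r True in \<open>simp add: B_def\<close>)
    thus ?thesis by (simp add: add.assoc)
   next
    case False
    thus ?thesis using K2[of "i + q"] Yu0 by (simp add: add.assoc)
   qed
  qed
  thus ?thesis unfolding e .
 qed
 have R2: "Yf G (n + l - int i) (Yf F (m + int i) H) \<tau> =
   (\<Sum>r<B. \<Sum>q<B. smul (?\<alpha> r * ?\<beta> q * h \<tau>) (Y v (n + int q + l - int i) (Y u (m + int r + int i) w)))" for i
 proof -
  have e: "m + int i + int r = m + int r + int i" "n + l - int i + int q = n + int q + l - int i" for q r by simp_all
  have "Yf G (n + l - int i) (Yf F (m + int i) H) \<tau> =
   (\<Sum>q<B. \<Sum>r<B. smul (?\<beta> q * ?\<alpha> r * h \<tau>) (Y v (n + l - int i + int q) (Y u (m + int i + int r) w)))"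
   unfolding F_def G_def H_def
  proof (rule Yf_Yf_fun_vec[OF g f h v u w])
   show "Y u (m + int i + int q) w = 0" if "q >= B" for q
    using K3[of "i + q"] that by (simp add: B_def add.assoc)
   show "Y v (n + l - int i + int r) (Y u (m + int i + int q) w) = 0" if r: "r >= B" for q r
   proof (cases "i + q < K3")
    case True
    have "Y v (n + l - int i + int r) (Y u (m + int (i + q)) w) = 0"
     by (rule E3[OF True]) (use r True in \<open>simp add: B_def\<close>)
    thus ?thesis by (simp add: add.assoc)
   next
    case False
    thus ?thesis using K3[of "i + q"] Yu0 by (simp add: add.assoc)
   qed
  qed
  also have "\<dots> = (\<Sum>r<B. \<Sum>q<B. smul (?\<beta> q * ?\<alpha> r * h \<tau>) (Y v (n + l - int i + int q) (Y u (m + int i + int r) w)))"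
   by (rule sum.swap)
  finally show ?thesis unfolding e by (simp add: mult.commute[of "?\<beta> _" "?\<alpha> _"])
 qed
 have "Sum_any ?R \<tau> =
   (\<Sum>i<B. ?R i) \<tau>"
 proof (rule arg_cong[where f = "%F. F \<tau>"], rule Sum_any_nat_less)
  fix i assume i: "B <= i"
  show "?R i = 0"
   unfolding R0[OF i] Yf_zero_right[OF Ft] Yf_zero_right[OF Gt] QVg.scale_zero_right diff_zero ..
 qed
 also have "\<dots> = (\<Sum>i<B. \<Sum>r<B. \<Sum>q<B. smul (h \<tau>) (smul (?\<alpha> r * ?\<beta> q) (?S r q i)))"
  unfolding sum_fun_at fscale_def minus_apply R1 R2
  by (simp add: scale_sum_right sum_subtractf[symmetric] scale_right_diff_distrib mult_ac)
 also have "\<dots> = (\<Sum>r<B. \<Sum>i<B. \<Sum>q<B. smul (h \<tau>) (smul (?\<alpha> r * ?\<beta> q) (?S r q i)))"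
  by (rule sum.swap)
 also have "\<dots> = (\<Sum>r<B. \<Sum>q<B. \<Sum>i<B. smul (h \<tau>) (smul (?\<alpha> r * ?\<beta> q) (?S r q i)))"
  by (intro sum.cong refl sum.swap)
 also have "\<dots> = smul (h \<tau>) (\<Sum>r<B. \<Sum>q<B. smul (?\<alpha> r * ?\<beta> q) (\<Sum>i<B. ?S r q i))"
  by (simp only: scale_sum_right)
 finally show "Sum_any ?A \<tau> =
  Sum_any ?R \<tau>"
  unfolding lhs by (rule sym)
qed

end

section \<open>The quasi-vertex operator algebra of quasimodular forms\<close>

lemma additive_diff_eq:
 fixes a :: "'a::ab_group_add"
 assumes "a - b = c + d + e" "a' - b' = c' + d' + e'"
 shows "(a + a') - (b + b') = (c + c') + (d + d') + (e + e')"
proof -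
 have "(a + a') - (b + b') = (a - b) + (a' - b')" by simp
 thus ?thesis unfolding assms by (simp add: ac_simps)
qed

context first_kind
begin

lemma qop_mult:
 assumes f: "f : QM \<Gamma> k" and g: "g : QM \<Gamma> l"
 shows "qop 1 (%z. f z * g z) = (%z. qop 1 f z * g z + f z * qop 1 g z)"
 unfolding qop_simps(1)[OF qm_mult[OF f g]] qop_simps(1)[OF f] qop_simps(1)[OF g] qcoeff_mult[OF f g]
 by (simp add: qcoeff_0[OF f] qcoeff_0[OF g] atMost_Suc add.commute)

lemma qop_uderiv:
 assumes f: "f : QM \<Gamma> k"
 shows "qop 1 (uderiv f) = (%z. uderiv (qop 1 f) z + of_int k * f z)"
 unfolding qop_simps(1)[OF qm_uderiv[OF f]] qop_simps(1)[OF f] qcoeff_uderiv[OF f]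
 by (simp add: fun_eq_iff fscale_mult)

text \<open>The \<open>sl\<^sub>2\<close> relation \<open>[L(1), L(-1)] = 2 L(0)\<close> on scalars,
iterated.\<close>

lemma qop_hasse:
 assumes f: "f : QM \<Gamma> k"
 shows "qop 1 (hasse (Suc i) f) z = hasse (Suc i) (qop 1 f) z + (of_int k + of_nat i) * hasse i f z"
proof (induction i arbitrary: z)
 case 0
 have "hasse (Suc 0) h = uderiv h" for h by (simp add: hasse_def)
 thus ?case using qop_uderiv[OF f] by (simp add: hasse_0)
next
 case (Suc i)
 have q: "qop 1 f : QM \<Gamma> (k - 2)" using qop_degree[of 1 f k] f by simp
 have fh: "holo_uhp f" and qh: "holo_uhp (qop 1 f)" using QM_holo f q by blast+
 have H: "hasse (Suc i) f : QM \<Gamma> (k + 2 * int (Suc i))" by (rule hasse_QM[OF f])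
 have "of_nat (Suc (Suc i)) * qop 1 (hasse (Suc (Suc i)) f) z = qop 1 (uderiv (hasse (Suc i) f)) z"
 proof -
  have "uderiv (hasse (Suc i) f) = fscale (*) (of_nat (Suc (Suc i))) (hasse (Suc (Suc i)) f)"
   unfolding uderiv_hasse[OF fh] fscale_mult ..
  hence "qop 1 (uderiv (hasse (Suc i) f)) = fscale (*) (of_nat (Suc (Suc i))) (qop 1 (hasse (Suc (Suc i)) f))"
   using qop_scale[of 1, OF _ QMg.piece_total[OF hasse_QM[OF f]]] by simp
  thus ?thesis by (simp add: fscale_mult)
 qed
 also have "\<dots> = uderiv (qop 1 (hasse (Suc i) f)) z + of_int (k + 2 * int (Suc i)) * hasse (Suc i) f z"
  unfolding qop_uderiv[OF H] ..
 also have "qop 1 (hasse (Suc i) f) = (%z. hasse (Suc i) (qop 1 f) z + (of_int k + of_nat i) * hasse i f z)"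
  by (rule ext) (rule Suc.IH)
 also have "uderiv (%z. hasse (Suc i) (qop 1 f) z + (of_int k + of_nat i) * hasse i f z) =
   (%z. of_nat (Suc (Suc i)) * hasse (Suc (Suc i)) (qop 1 f) z + (of_int k + of_nat i) * (of_nat (Suc i) * hasse (Suc i) f z))"
  unfolding uderiv_add'[OF hasse_holo[OF qh] holo_uhp_cmult[OF hasse_holo[OF fh]]] uderiv_cmult'[OF hasse_holo[OF fh]]
   uderiv_hasse[OF fh] uderiv_hasse[OF qh] ..
 finally have "of_nat (Suc (Suc i)) * qop 1 (hasse (Suc (Suc i)) f) z =
   of_nat (Suc (Suc i)) * (hasse (Suc (Suc i)) (qop 1 f) z + (of_int k + of_nat (Suc i)) * hasse (Suc i) f z)"
  by (simp add: algebra_simps)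
 moreover have "(of_nat (Suc (Suc i)) :: complex) ~= 0" by (rule of_nat_neq_0)
 ultimately show ?case using mult_left_cancel by blast
qed

end

context qvoa_forms
begin

text \<open>All degrees of \<open>V\<close> are doubled, and scalar forms of odd weight vanish.\<close>

lemma QMV_odd:
 assumes "F : \<Q> k" "odd k" shows "F = 0"
 using assms(1)
proof (induction rule: QMV_induct)
 case (fun_vec n f v)
 have "f = 0" using QM_odd[OF fun_vec(1)] assms(2) by simp
 thus ?case by (simp add: fun_vec_def fun_eq_iff)
qed simp_all

abbreviation "\<E> \<equiv> (%n. \<Q> (2 * n))"

lemma even_graded: "graded_vector_space (scl) \<E>"
proof unfold_locales
 show "QVg.subspace (\<Q> (2 * n))" for n by (rule QVg.subspace_piece)
 fix x assume x: "finsupp_family \<E> x" "Sum_any x = 0"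
 define y where "y k = (if even k then x (k div 2) else 0)" for k
 have inj: "inj_on (%n::int. 2 * n) A" for A by (auto simp: inj_on_def)
 have img: "{k. y k ~= 0} = (%n. 2 * n) ` {n. x n ~= 0}"
 proof
  show "{k. y k ~= 0} <= (%n. 2 * n) ` {n. x n ~= 0}"
  proof
   fix k assume "k : {k. y k ~= 0}"
   hence "even k" "x (k div 2) ~= 0" by (auto simp: y_def split: if_splits)
   thus "k : (%n. 2 * n) ` {n. x n ~= 0}" by (intro image_eqI[of _ _ "k div 2"]) auto
  qed
 qed (auto simp: y_def)
 have "finsupp_family \<Q> y"
  unfolding finsupp_family_def img
 proof
  show "ALL k. y k : \<Q> k"
  proof
   fix k show "y k : \<Q> k"
   proof (cases "even k")
    case True
    have "x (k div 2) : \<Q> (2 * (k div 2))" using x(1) by (simp add: finsupp_family_def)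
    thus ?thesis using True by (simp add: y_def)
   next
    case False
    hence y: "y k = 0" by (simp add: y_def)
    show ?thesis unfolding y by (rule QMV_zero)
   qed
  qed
  show "finite ((%n. 2 * n) ` {n. x n ~= 0})" using x(1) by (simp add: finsupp_family_def)
 qed
 moreover have "Sum_any y = 0"
  unfolding Sum_any.expand_set img sum.reindex[OF inj]
  using x(2) by (simp add: y_def Sum_any.expand_set o_def)
 ultimately have "y = (%_. 0)" by (rule QVg.direct)
 hence "y (2 * n) = 0" for n by (rule fun_cong)
 thus "x = (%_. 0)" by (simp add: y_def fun_eq_iff)
qed

lemma QMV_doubled: "\<Q> = doubled \<E>"
proof
 fix k
 show "\<Q> k = doubled \<E> k"
  using QMV_odd[of _ k] QMV_zero[of k] by (cases "even k") (auto simp: doubled_def)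
qed

lemma total_even: "total_space \<E> = \<F>"
 using graded_vector_space.total_doubled[OF even_graded] unfolding QMV_doubled[symmetric] ..

lemma lift_scale:
 assumes \<theta>: "linear_op \<theta>" and F: "F : \<F>"
 shows "lift \<theta> (scl c F) = scl c (lift \<theta> F)"
 using F
proof (induction rule: forms_induct)
 case (fun_vec j n f v)
 note f = QMg.piece_total[OF fun_vec(1)] and v = piece_total[OF fun_vec(2)]
 show ?case unfolding fun_vec_fscale_right[symmetric] lift_fun_vec[OF \<theta> f v] lift_fun_vec[OF \<theta> f total_scale[OF v]] ..
next
 case (add F G)
 show ?case
  unfolding QVg.scale_right_distrib lift_add[OF \<theta> add(1,2)]
   lift_add[OF \<theta> QVg.total_scale[OF add(1)] QVg.total_scale[OF add(2)]] add(3,4) ..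
qed

lemma Yf_scale_left:
 assumes "F : \<F>" "G : \<F>" shows "Yf (scl c F) n G = scl c (Yf F n G)"
proof
 fix z
 have "Y (lift (hasse i) (scl c F) z) (n + int i) (G z) = smul c (Y (lift (hasse i) F z) (n + int i) (G z))" for i
  unfolding lift_scale[OF linear_op_hasse assms(1)] unfolding fscale_def
  by (rule mode_scale_left[OF lift_values[OF linear_op_hasse assms(1)] forms_values[OF assms(2)]])
 thus "Yf (scl c F) n G z = scl c (Yf F n G) z"
  using smul_Sum_any[OF Yf_finite[OF assms], of c z n] by (simp add: Yf_def fscale_def)
qed

lemma Yf_scale_right:
 assumes "F : \<F>" "G : \<F>" shows "Yf F n (scl c G) = scl c (Yf F n G)"
proof
 fix z
 have "Y (lift (hasse i) F z) (n + int i) (scl c G z) = smul c (Y (lift (hasse i) F z) (n + int i) (G z))" for i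
  unfolding fscale_def
  by (rule mode_scale_right[OF lift_values[OF linear_op_hasse assms(1)] forms_values[OF assms(2)]])
 thus "Yf F n (scl c G) z = scl c (Yf F n G) z"
  using smul_Sum_any[OF Yf_finite[OF assms], of c z n] by (simp add: Yf_def fscale_def)
qed

lemma Lf_scale:
 assumes m: "m : {-1, 0, 1}" and F: "F : \<F>"
 shows "Lf m (scl c F) = scl c (Lf m F)"
 unfolding Lf_def lift_scale[OF linear_op_qop[OF m] F]
 by (simp add: fscale_def fun_eq_iff L_scale[OF m forms_values[OF F]] scale_right_distrib)

abbreviation "onef \<equiv> (%z. if z : uhp then 1 else (0::complex))"
abbreviation "vacf \<equiv> (%z. if z : uhp then vac else 0)"

lemma vacf: "vacf = fvec onef vac"
 by (simp add: fun_vec_def fun_eq_iff)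

lemma one_total: "onef : \<A>"
 by (rule QMg.piece_total[OF one_QM])

lemma vac_total: "vac : \<V>"
 by (rule piece_total[OF vac_degree])

lemma vacf_total: "vacf : \<F>"
 unfolding vacf by (rule total_fun_vec[OF one_total vac_total])

lemma mult_one: "f : \<A> ==> (%z. f z * onef z) = f" "f : \<A> ==> (%z. onef z * f z) = f"
 using total_off[of f] by (auto simp: fun_eq_iff)

lemma Yf_vacuum:
 assumes "F : \<F>" shows "Yf vacf n F = (if n = -1 then F else 0)"
 using assms
proof (induction rule: forms_induct)
 case (fun_vec j a f v)
 note f = QMg.piece_total[OF fun_vec(1)] and v = piece_total[OF fun_vec(2)]
 show ?case
 proof
  fix z
  have "Yf vacf n (fvec f v) z = Sum_any (%i::nat. smul (hasse i onef z * f z) (Y vac (n + int i) v))"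
   unfolding vacf Yf_at[OF one_total vac_total v] ..
  also have "\<dots> = (\<Sum>i<Suc 0. smul (hasse i onef z * f z) (Y vac (n + int i) v))"
   by (rule Sum_any_nat_less) (simp add: hasse_one)
  also have "\<dots> = smul (onef z * f z) (Y vac n v)" by (simp add: hasse_0)
  also have "onef z * f z = f z" using fun_cong[OF mult_one(2)[OF f]] .
  finally show "Yf vacf n (fvec f v) z = (if n = - 1 then fvec f v else 0) z"
   using vacuum[OF v, of n] by (simp add: fun_vec_def)
 qed
next
 case (add F G)
 show ?case unfolding Yf_add_right[OF vacf_total add(1,2)] add(3,4) by (cases "n = -1") simp_all
qed

lemma Yf_creation:
 assumes "F : \<F>"
 shows "Yf F (-1) vacf = F" "n >= 0 ==> Yf F n vacf = 0" "Lf (-1) F = Yf F (-2) vacf"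
proof -
 have at: "Yf (fvec f u) n vacf = (\<Sum>i<B. fvec (hasse i f) (Y u (n + int i) vac))"
  if f: "f : \<A>" and u: "u : \<V>" and B: "n + int B >= 0" for f u n B
 proof -
  have "Yf (fvec f u) n vacf = (\<Sum>i<B. fvec (%z. hasse i f z * onef z) (Y u (n + int i) vac))"
   unfolding vacf by (rule Yf_fun_vec[OF f u vac_total], rule creation(2)[OF u]) (use B in simp)
  thus ?thesis unfolding mult_one(1)[OF total_linear[OF linear_op_hasse f]] .
 qed
 show "Yf F (-1) vacf = F" using assms
 proof (induction rule: forms_induct)
  case (fun_vec j a f u)
  note f = QMg.piece_total[OF fun_vec(1)] and u = piece_total[OF fun_vec(2)]
  show ?case using at[OF f u, of "-1" 1] creation(1)[OF u] by (simp add: hasse_0)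
 next
  case (add F G)
  show ?case unfolding Yf_add_left[OF add(1,2) vacf_total] add(3,4) ..
 qed
 show "Yf F n vacf = 0" if n: "n >= 0" using assms
 proof (induction rule: forms_induct)
  case (fun_vec j a f u)
  note f = QMg.piece_total[OF fun_vec(1)] and u = piece_total[OF fun_vec(2)]
  show ?case using at[OF f u, of n 0] n by simp
 next
  case (add F G)
  show ?case unfolding Yf_add_left[OF add(1,2) vacf_total] add(3,4) by (rule add_0_left)
 qed
 show "Lf (-1) F = Yf F (-2) vacf" using assms
 proof (induction rule: forms_induct)
  case (fun_vec j a f u)
  note f = QMg.piece_total[OF fun_vec(1)] and u = piece_total[OF fun_vec(2)]
  have "Yf (fvec f u) (-2) vacf = fvec f (Y u (-2) vac) + fvec (hasse 1 f) (Y u (-1) vac)"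
   using at[OF f u, of "-2" 2] by (simp add: numeral_2_eq_2 hasse_0)
  moreover have "hasse 1 f = uderiv f" by (simp add: hasse_def)
  ultimately show ?case unfolding Lf_fun_vec[of "-1", simplified, OF f u]
   using derivation[OF u] creation(1)[OF u] qop_simps(3)[OF fun_vec(1)] by (simp add: add.commute)
 next
  case (add F G)
  show ?case unfolding Yf_add_left[OF add(1,2) vacf_total] Lf_add[of "-1", simplified, OF add(1,2)] add(3,4) ..
 qed
qed

lemma Lf_sl2:
 assumes m: "m : {-1, 0, 1}" and n: "n : {-1, 0, 1}" and F: "F : \<F>"
 shows "Lf m (Lf n F) - Lf n (Lf m F) = scl (of_int (m - n)) (Lf (m + n) F)"
proof (cases "m = n")
 case True
 thus ?thesis by simp
next
 case False
 hence mn: "m + n : {-1, 0, 1}" using m n by auto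
 show ?thesis using F
 proof (induction rule: forms_induct)
  case (fun_vec j a f v)
  note f = QMg.piece_total[OF fun_vec(1)] and v = piece_total[OF fun_vec(2)]
  have LL: "Lf i (Lf k (fvec f v)) = (fvec (qop i (qop k f)) v + fvec (qop k f) (L i v)) +
    (fvec (qop i f) (L k v) + fvec f (L i (L k v)))"
   if i: "i : {-1, 0, 1}" and k: "k : {-1, 0, 1}" for i k
   unfolding Lf_fun_vec[OF k f v]
    Lf_add[OF i total_fun_vec[OF qop_closed[OF k f] v] total_fun_vec[OF f L_closed[OF k v]]]
    Lf_fun_vec[OF i qop_closed[OF k f] v] Lf_fun_vec[OF i f L_closed[OF k v]] ..
  show ?case
  proof
   fix z
   have q: "qop m (qop n f) z - qop n (qop m f) z = of_int (m - n) * qop (m + n) f z"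
    using fun_cong[OF qop_sl2[OF m n f], of z] by (simp add: fscale_def)
   have cancel: "(a + b + (c + d)) - (a' + c + (b + d')) = (a - a') + (d - d')" for a b c d a' d' :: 'v
    by (simp add: algebra_simps)
   have "(Lf m (Lf n (fvec f v)) - Lf n (Lf m (fvec f v))) z =
    (smul (qop m (qop n f) z) v - smul (qop n (qop m f) z) v) + (smul (f z) (L m (L n v)) - smul (f z) (L n (L m v)))"
    unfolding LL[OF m n] LL[OF n m] minus_apply plus_fun_apply unfolding fun_vec_def by (rule cancel)
   also have "\<dots> = smul (of_int (m - n) * qop (m + n) f z) v + smul (f z) (smul (of_int (m - n)) (L (m + n) v))"
    unfolding scale_left_diff_distrib[symmetric] scale_right_diff_distrib[symmetric] q sl2[OF m n v] ..
   also have "\<dots> = scl (of_int (m - n)) (Lf (m + n) (fvec f v)) z"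
    unfolding Lf_fun_vec[OF mn f v] by (simp add: fscale_def fun_vec_def scale_right_distrib mult.commute)
   finally show "(Lf m (Lf n (fvec f v)) - Lf n (Lf m (fvec f v))) z =
    scl (of_int (m - n)) (Lf (m + n) (fvec f v)) z" .
  qed
 next
  case (add F G)
  have d: "(a + b) - (c + d) = (a - c) + (b - d)" for a b c d :: "complex => 'v" by (rule add_diff_add)
  show ?case
   unfolding Lf_add[OF m add(1,2)] Lf_add[OF n add(1,2)] Lf_add[OF mn add(1,2)]
    Lf_add[OF m Lf_closed[OF n add(1)] Lf_closed[OF n add(2)]]
    Lf_add[OF n Lf_closed[OF m add(1)] Lf_closed[OF m add(2)]] d add(3,4) QVg.scale_right_distrib ..
 qed
qed

lemma Lf_zero: "m : {-1, 0, 1} ==> Lf m 0 = 0"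
 using Lf_add[OF _ QVg.total_0 QVg.total_0, of m] by simp

lemma Lf_sum:
 assumes m: "m : {-1, 0, 1}" and "!!i. i : I ==> F i : \<F>"
 shows "Lf m (\<Sum>i\<in>I. F i) = (\<Sum>i\<in>I. Lf m (F i))"
 using assms(2)
proof (induction I rule: infinite_finite_induct)
 case (insert i I)
 have "(\<Sum>i\<in>I. F i) : \<F>" using insert by (intro QVg.total_sum) auto
 from Lf_add[OF m insert(4) this] insert.IH insert(4)
 show ?case unfolding sum.insert[OF insert(1,2)] by (metis insertCI)
qed (use Lf_zero[OF m] in simp_all)

lemma Lf_0_degree: "F : \<Q> (2 * n) ==> Lf 0 F = scl (of_int n) F"
proof (induction rule: QMV_induct)
 case zero
 have "Lf 0 0 = 0" by (rule Lf_zero) simp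
 thus ?case unfolding QVg.scale_zero_right .
next
 case (fun_vec p f v)
 note f = QMg.piece_total[OF fun_vec(1)] and v = piece_total[OF fun_vec(2)]
 have "Lf 0 (fvec f v) = fvec (qop 0 f) v + fvec f (L 0 v)"
  by (rule Lf_fun_vec[OF _ f v]) simp
 also have "\<dots> = scl (of_int n) (fvec f v)"
 proof
  fix z
  have "of_int (2 * n - 2 * p) / 2 = (of_int n - of_int p :: complex)" by simp
  hence c: "of_int (2 * n - 2 * p) / 2 * f z + f z * of_int p = of_int n * f z"
   by (simp only: left_diff_distrib mult.commute[of "f z"]) simp
  show "(fvec (qop 0 f) v + fvec f (L 0 v)) z = scl (of_int n) (fvec f v) z"
   unfolding qop_simps(2)[OF fun_vec(1)] L0_degree[OF fun_vec(2)] plus_fun_apply fun_vec_def fscale_def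
    scale_scale scale_left_distrib[symmetric] c ..
 qed
 finally show ?case .
next
 case (add F G)
 have "Lf 0 (F + G) = Lf 0 F + Lf 0 G" by (rule Lf_add[OF _ QVg.piece_total[OF add(1)] QVg.piece_total[OF add(2)]]) simp
 thus ?case unfolding add(3,4) QVg.scale_right_distrib .
qed

text \<open>The terms in which \<open>L(1)\<close>, \<open>L(0)\<close>, \<open>L(-1)\<close> act on the
vectors agree by covariance in \<open>V\<close>. The remaining ones, in which \<open>sl\<^sub>2\<close> acts
on \<open>f\<close>, agree by \<open>qop_hasse\<close> after two shifts of the summation index.\<close>

lemma covariance_fun_vec:
 assumes f: "f : QM \<Gamma> k" and g: "g : QM \<Gamma> j" and u: "u : \<V>" and v: "v : \<V>"
 defines "F \<equiv> fvec f u" and "G \<equiv> fvec g v"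
 shows "Lf 1 (Yf F n G) - Yf F n (Lf 1 G) =
  Yf (Lf 1 F) n G + scl 2 (Yf (Lf 0 F) (n + 1) G) + Yf (Lf (-1) F) (n + 2) G"
proof
 fix w
 note ft = QMg.piece_total[OF f] and gt = QMg.piece_total[OF g]
 have m: "(1::int) : {-1, 0, 1}" "(0::int) : {-1, 0, 1}" "(-1::int) : {-1, 0, 1}" by simp_all
 note L1u = L_closed[OF m(1) u] and L0u = L_closed[OF m(2) u] and Lmu = L_closed[OF m(3) u] and L1v = L_closed[OF m(1) v]
 obtain I1 where I1: "!!i. i >= I1 ==> Y u (n + int i) v = 0" using mode_bound[OF u v] by blast
 obtain I2 where I2: "!!i. i >= I2 ==> Y u (n + int i) (L 1 v) = 0" using mode_bound[OF u L1v] by blast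
 obtain I3 where I3: "!!i. i >= I3 ==> Y (L 1 u) (n + int i) v = 0" using mode_bound[OF L1u v] by blast
 obtain I4 where I4: "!!i. i >= I4 ==> Y (L 0 u) (n + 1 + int i) v = 0" using mode_bound[OF L0u v] by blast
 obtain I5 where I5: "!!i. i >= I5 ==> Y (L (-1) u) (n + 2 + int i) v = 0" using mode_bound[OF Lmu v] by blast
 define B where "B = Suc (I1 + I2 + I3 + I4 + I5)"
 define y where "y i = Y u (n + int i) v" for i
 have y0: "y i = 0" if "i >= B - 1" for i unfolding y_def by (rule I1) (use that in \<open>simp add: B_def\<close>)
 define h where "h i = hasse i f w" for i
 have at: "Yf (fvec a x) p (fvec b z) w = (\<Sum>i<B. smul (hasse i a w * b w) (Y x (p + int i) z))"
  if "a : \<A>" "x : \<V>" "z : \<V>" "!!i. i >= B ==> Y x (p + int i) z = 0" for a x z p b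
  unfolding Yf_at[OF that(1-3)] by (rule Sum_any_nat_less) (simp add: that(4))
 have Hg: "(%w. hasse i f w * g w) : \<A>" for i by (rule total_mult[OF total_linear[OF linear_op_hasse ft] gt])
 have yt: "y i : \<V>" for i unfolding y_def by (rule mode_total[OF u v])
 have "Yf F n G = (\<Sum>i<B. fvec (%w. hasse i f w * g w) (y i))"
  unfolding F_def G_def y_def by (rule Yf_fun_vec[OF ft u v], rule I1) (simp add: B_def)
 hence "Lf 1 (Yf F n G) = (\<Sum>i<B. Lf 1 (fvec (%w. hasse i f w * g w) (y i)))"
  using Lf_sum[OF m(1) total_fun_vec[OF Hg yt]] by simp
 also have "\<dots> = (\<Sum>i<B. fvec (%w. qop 1 (hasse i f) w * g w + hasse i f w * qop 1 g w) (y i) +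
   fvec (%w. hasse i f w * g w) (L 1 (y i)))"
  unfolding Lf_fun_vec[OF m(1) Hg yt] qop_mult[OF hasse_QM[OF f] g] ..
 finally have l1: "Lf 1 (Yf F n G) w = (\<Sum>i<B. smul (qop 1 (hasse i f) w * g w) (y i) + smul (h i * qop 1 g w) (y i) + smul (h i * g w) (L 1 (y i)))"
  by (simp add: sum_fun_at fun_vec_def h_def scale_left_distrib)
 have l2: "Yf F n (Lf 1 G) w = (\<Sum>i<B. smul (h i * qop 1 g w) (y i) + smul (h i * g w) (Y u (n + int i) (L 1 v)))"
 proof -
  have "Yf F n (Lf 1 G) w = Yf F n (fvec (qop 1 g) v) w + Yf F n (fvec g (L 1 v)) w"
   unfolding G_def Lf_fun_vec[OF m(1) gt v] F_def
    Yf_add_right[OF total_fun_vec[OF ft u] total_fun_vec[OF qop_closed[OF m(1) gt] v] total_fun_vec[OF gt L1v]]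
   by (rule plus_fun_apply)
  also have "\<dots> = (\<Sum>i<B. smul (hasse i f w * qop 1 g w) (Y u (n + int i) v)) + (\<Sum>i<B. smul (hasse i f w * g w) (Y u (n + int i) (L 1 v)))"
   unfolding F_def
   by (intro arg_cong2[where f = "(+)"] at ft u v L1v I1 I2) (simp_all add: B_def)
  finally show ?thesis by (simp add: sum.distrib h_def y_def)
 qed
 have "Lf 1 (Yf F n G) w - Yf F n (Lf 1 G) w =
   (\<Sum>i<B. smul (qop 1 (hasse i f) w * g w) (y i) + smul (h i * g w) (L 1 (y i) - Y u (n + int i) (L 1 v)))"
  unfolding l1 l2 sum_subtractf[symmetric] by (rule sum.cong[OF refl]) (simp add: scale_right_diff_distrib)
 also have "\<dots> = (\<Sum>i<B. smul (qop 1 (hasse i f) w * g w) (y i)) + (\<Sum>i<B. smul (h i * g w)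
   (Y (L 1 u) (n + int i) v + smul 2 (Y (L 0 u) (n + int i + 1) v) + Y (L (-1) u) (n + int i + 2) v))"
  unfolding sum.distrib y_def covariance[OF u v] ..
 finally have lhs: "Lf 1 (Yf F n G) w - Yf F n (Lf 1 G) w = (\<Sum>i<B. smul (qop 1 (hasse i f) w * g w) (y i)) + (\<Sum>i<B. smul (h i * g w)
   (Y (L 1 u) (n + int i) v + smul 2 (Y (L 0 u) (n + int i + 1) v) + Y (L (-1) u) (n + int i + 2) v))" .
 have Gt: "G : \<F>" unfolding G_def by (rule total_fun_vec[OF gt v])
 have split: "Yf (Lf i F) p G w = Yf (fvec (qop i f) u) p G w + Yf (fvec f (L i u)) p G w" if i: "i : {-1, 0, 1}" for i p
  unfolding F_def Lf_fun_vec[OF i ft u]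
   Yf_add_left[OF total_fun_vec[OF qop_closed[OF i ft] u] total_fun_vec[OF ft L_closed[OF i u]] Gt]
  by (rule plus_fun_apply)
 have e1: "n + 1 + int i = n + int (Suc i)" and e2: "n + 2 + int i = n + int (Suc (Suc i))" for i by simp_all
 have r1: "Yf (Lf 1 F) n G w = (\<Sum>i<B. smul (hasse i (qop 1 f) w * g w) (y i)) + (\<Sum>i<B. smul (h i * g w) (Y (L 1 u) (n + int i) v))"
  unfolding split[OF m(1)] unfolding G_def y_def h_def
  by (intro arg_cong2[where f = "(+)"] at qop_closed[OF m(1) ft] ft u v L1u I1 I3) (simp_all add: B_def)
 have r2: "Yf (Lf 0 F) (n + 1) G w = (\<Sum>i<B. smul (hasse i (qop 0 f) w * g w) (Y u (n + 1 + int i) v)) + (\<Sum>i<B. smul (h i * g w) (Y (L 0 u) (n + 1 + int i) v))"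
  unfolding split[OF m(2)] unfolding G_def h_def
 proof (intro arg_cong2[where f = "(+)"] at qop_closed[OF m(2) ft] ft u v L0u I4)
  show "Y u (n + 1 + int i) v = 0" if "i >= B" for i unfolding e1 by (rule I1) (use that in \<open>simp add: B_def\<close>)
 qed (simp add: B_def)
 have r3: "Yf (Lf (-1) F) (n + 2) G w = (\<Sum>i<B. smul (hasse i (qop (-1) f) w * g w) (Y u (n + 2 + int i) v)) + (\<Sum>i<B. smul (h i * g w) (Y (L (-1) u) (n + 2 + int i) v))"
  unfolding split[OF m(3)] unfolding G_def h_def
 proof (intro arg_cong2[where f = "(+)"] at qop_closed[OF m(3) ft] ft u v Lmu I5)
  show "Y u (n + 2 + int i) v = 0" if "i >= B" for i unfolding e2 by (rule I1) (use that in \<open>simp add: B_def\<close>)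
 qed (simp add: B_def)
 \<comment> \<open>comparison of the terms with \<open>u\<close>\<close>
 have h0: "hasse i (qop 0 f) w = of_int k / 2 * h i" for i
  unfolding qop_simps(2)[OF f] fscale_mult hasse_cmult[OF QM_holo[OF f]] h_def ..
 have hm: "hasse i (qop (-1) f) w = of_nat (Suc i) * h (Suc i)" for i
  unfolding qop_simps(3)[OF f] hasse_uderiv h_def ..
 define C where "C = B - 1"
 have BC: "B = Suc C" by (simp add: C_def B_def)
 have yC: "y i = 0" if "i >= C" for i using y0 that by (simp add: C_def)
 have "(\<Sum>i<B. smul (qop 1 (hasse i f) w * g w) (y i)) =
   smul (qop 1 f w * g w) (y 0) + (\<Sum>i<C. smul (qop 1 (hasse (Suc i) f) w * g w) (y (Suc i)))"
  unfolding BC sum.lessThan_Suc_shift by (simp add: hasse_0)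
 also have "\<dots> = smul (qop 1 f w * g w) (y 0) + (\<Sum>i<C. smul (hasse (Suc i) (qop 1 f) w * g w) (y (Suc i))) +
   (\<Sum>i<C. smul ((of_int k + of_nat i) * h i * g w) (y (Suc i)))"
  unfolding qop_hasse[OF f] by (simp add: distrib_right scale_left_distrib sum.distrib h_def add.assoc)
 also have "smul (qop 1 f w * g w) (y 0) + (\<Sum>i<C. smul (hasse (Suc i) (qop 1 f) w * g w) (y (Suc i))) = (\<Sum>i<B. smul (hasse i (qop 1 f) w * g w) (y i))"
  unfolding BC sum.lessThan_Suc_shift by (simp add: hasse_0)
 also have "(\<Sum>i<C. smul ((of_int k + of_nat i) * h i * g w) (y (Suc i))) =
   (\<Sum>i<B. smul (of_int k * h i * g w) (y (Suc i))) + (\<Sum>i<B. smul (of_nat (Suc i) * h (Suc i) * g w) (y (Suc (Suc i))))"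
 proof -
  have "(\<Sum>i<B. smul (of_nat i * h i * g w) (y (Suc i))) = (\<Sum>i<C. smul (of_nat (Suc i) * h (Suc i) * g w) (y (Suc (Suc i))))"
   unfolding BC sum.lessThan_Suc_shift by simp
  also have "\<dots> = (\<Sum>i<B. smul (of_nat (Suc i) * h (Suc i) * g w) (y (Suc (Suc i))))"
   unfolding BC by (simp add: yC)
  finally have s: "(\<Sum>i<B. smul (of_nat i * h i * g w) (y (Suc i))) = (\<Sum>i<B. smul (of_nat (Suc i) * h (Suc i) * g w) (y (Suc (Suc i))))" .
  have "(\<Sum>i<C. smul ((of_int k + of_nat i) * h i * g w) (y (Suc i))) = (\<Sum>i<B. smul ((of_int k + of_nat i) * h i * g w) (y (Suc i)))"
   unfolding BC by (simp add: yC)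
  also have "\<dots> = (\<Sum>i<B. smul (of_int k * h i * g w) (y (Suc i))) + (\<Sum>i<B. smul (of_nat i * h i * g w) (y (Suc i)))"
   unfolding sum.distrib[symmetric] by (intro sum.cong refl) (simp add: distrib_right scale_left_distrib)
  finally show ?thesis unfolding s .
 qed
 finally have key: "(\<Sum>i<B. smul (qop 1 (hasse i f) w * g w) (y i)) = (\<Sum>i<B. smul (hasse i (qop 1 f) w * g w) (y i)) +
   ((\<Sum>i<B. smul (of_int k * h i * g w) (y (Suc i))) + (\<Sum>i<B. smul (of_nat (Suc i) * h (Suc i) * g w) (y (Suc (Suc i)))))" .
 have t2: "smul 2 (\<Sum>i<B. smul (hasse i (qop 0 f) w * g w) (Y u (n + 1 + int i) v)) = (\<Sum>i<B. smul (of_int k * h i * g w) (y (Suc i)))"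
  unfolding h0 e1 y_def[symmetric] scale_sum_right by simp
 have t3: "(\<Sum>i<B. smul (hasse i (qop (-1) f) w * g w) (Y u (n + 2 + int i) v)) = (\<Sum>i<B. smul (of_nat (Suc i) * h (Suc i) * g w) (y (Suc (Suc i))))"
  unfolding hm e2 y_def[symmetric] ..
 have e3: "n + int i + 1 = n + 1 + int i" "n + int i + 2 = n + 2 + int i" for i by simp_all
 have t4: "(\<Sum>i<B. smul (h i * g w) (Y (L 1 u) (n + int i) v + smul 2 (Y (L 0 u) (n + int i + 1) v) + Y (L (-1) u) (n + int i + 2) v)) =
   (\<Sum>i<B. smul (h i * g w) (Y (L 1 u) (n + int i) v)) + smul 2 (\<Sum>i<B. smul (h i * g w) (Y (L 0 u) (n + 1 + int i) v)) +
   (\<Sum>i<B. smul (h i * g w) (Y (L (-1) u) (n + 2 + int i) v))"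
  unfolding e3 scale_right_distrib sum.distrib scale_sum_right by (simp add: mult.commute)
 have re: "(a + (b + c)) + (d + e + z) = (a + d) + (b + e) + (c + z)" for a b c d e z :: 'v by (simp add: ac_simps)
 have "Yf (Lf 1 F) n G w + smul 2 (Yf (Lf 0 F) (n + 1) G w) + Yf (Lf (-1) F) (n + 2) G w = Lf 1 (Yf F n G) w - Yf F n (Lf 1 G) w"
  unfolding lhs r1 r2 r3 key t4 unfolding scale_right_distrib t2 t3 by (rule re[symmetric])
 thus "(Lf 1 (Yf F n G) - Yf F n (Lf 1 G)) w =
  (Yf (Lf 1 F) n G + scl 2 (Yf (Lf 0 F) (n + 1) G) + Yf (Lf (-1) F) (n + 2) G) w"
  by (simp add: fscale_def)
qed

lemma Yf_covariance:
 assumes F: "F : \<F>" and G: "G : \<F>"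
 shows "Lf 1 (Yf F n G) - Yf F n (Lf 1 G) =
  Yf (Lf 1 F) n G + scl 2 (Yf (Lf 0 F) (n + 1) G) + Yf (Lf (-1) F) (n + 2) G"
proof -
 have m: "(1::int) : {-1, 0, 1}" "(0::int) : {-1, 0, 1}" "(-1::int) : {-1, 0, 1}" by simp_all
 show ?thesis using F
 proof (induction rule: forms_induct)
  case (fun_vec k a f u)
  note f = fun_vec(1) and u = piece_total[OF fun_vec(2)]
  note Ft = total_fun_vec[OF QMg.piece_total[OF f] u]
  show ?case using G
  proof (induction rule: forms_induct)
   case (fun_vec j b g v)
   show ?case by (rule covariance_fun_vec[OF f fun_vec(1) u piece_total[OF fun_vec(2)]])
  next
   case (add G H)
   note gh = add(1,2)
   show ?case
    unfolding Yf_add_right[OF Ft gh] Lf_add[OF m(1) Yf_closed[OF Ft gh(1)] Yf_closed[OF Ft gh(2)]] Lf_add[OF m(1) gh]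
     Yf_add_right[OF Ft Lf_closed[OF m(1) gh(1)] Lf_closed[OF m(1) gh(2)]]
     Yf_add_right[OF Lf_closed[OF m(1) Ft] gh] Yf_add_right[OF Lf_closed[OF m(2) Ft] gh] Yf_add_right[OF Lf_closed[OF m(3) Ft] gh]
     QVg.scale_right_distrib
    by (rule additive_diff_eq[OF add(3,4)])
  qed
 next
  case (add F H)
  note fh = add(1,2)
  show ?case
   unfolding Yf_add_left[OF fh G] Lf_add[OF m(1) Yf_closed[OF fh(1) G] Yf_closed[OF fh(2) G]]
    Yf_add_left[OF fh Lf_closed[OF m(1) G]]
    Lf_add[OF m(1) fh] Lf_add[OF m(2) fh] Lf_add[OF m(3) fh]
    Yf_add_left[OF Lf_closed[OF m(1) fh(1)] Lf_closed[OF m(1) fh(2)] G]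
    Yf_add_left[OF Lf_closed[OF m(2) fh(1)] Lf_closed[OF m(2) fh(2)] G]
    Yf_add_left[OF Lf_closed[OF m(3) fh(1)] Lf_closed[OF m(3) fh(2)] G]
    QVg.scale_right_distrib
   by (rule additive_diff_eq[OF add(3,4)])
 qed
qed

end

context qvoa_forms
begin

definition triadditive :: "((complex => 'v) => (complex => 'v) => (complex => 'v) => complex => 'v) => bool" where
 "triadditive \<Phi> \<longleftrightarrow> (ALL F:\<F>. ALL G:\<F>. ALL H:\<F>. ALL A:\<F>.
  \<Phi> (F + A) G H = \<Phi> F G H + \<Phi> A G H & \<Phi> F (G + A) H = \<Phi> F G H + \<Phi> F A H & \<Phi> F G (H + A) = \<Phi> F G H + \<Phi> F G A)"

lemma triadditiveD:
 assumes "triadditive \<Phi>" "F : \<F>" "G : \<F>" "H : \<F>" "A : \<F>"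
 shows "\<Phi> (F + A) G H = \<Phi> F G H + \<Phi> A G H" "\<Phi> F (G + A) H = \<Phi> F G H + \<Phi> F A H"
  "\<Phi> F G (H + A) = \<Phi> F G H + \<Phi> F G A"
 using assms unfolding triadditive_def by blast+

lemma triadditive_eqI:
 assumes \<Phi>: "triadditive \<Phi>" and \<Psi>: "triadditive \<Psi>"
  and eq: "!!f g h u v w. f : \<A> ==> g : \<A> ==> h : \<A> ==>
   u : \<V> ==> v : \<V> ==> w : \<V> ==>
   \<Phi> (fvec f u) (fvec g v) (fvec h w) = \<Psi> (fvec f u) (fvec g v) (fvec h w)"
  and F: "F : \<F>" and G: "G : \<F>" and H: "H : \<F>"
 shows "\<Phi> F G H = \<Psi> F G H"
 using F
proof (induction rule: forms_induct)
 case (fun_vec j a f u)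
 note f = QMg.piece_total[OF fun_vec(1)] and u = piece_total[OF fun_vec(2)]
 note Ft = total_fun_vec[OF f u]
 show ?case using G
 proof (induction rule: forms_induct)
  case (fun_vec k b g v)
  note g = QMg.piece_total[OF fun_vec(1)] and v = piece_total[OF fun_vec(2)]
  note Gt = total_fun_vec[OF g v]
  show ?case using H
  proof (induction rule: forms_induct)
   case (fun_vec l c h w)
   show ?case by (rule eq[OF f g QMg.piece_total[OF fun_vec(1)] u v piece_total[OF fun_vec(2)]])
  next
   case (add H A)
   show ?case unfolding triadditiveD(3)[OF \<Phi> Ft Gt add(1,2)] triadditiveD(3)[OF \<Psi> Ft Gt add(1,2)] add(3,4) ..
  qed
 next
  case (add G A)
  show ?case unfolding triadditiveD(2)[OF \<Phi> Ft add(1) H add(2)] triadditiveD(2)[OF \<Psi> Ft add(1) H add(2)] add(3,4) ..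
 qed
next
 case (add F A)
 show ?case unfolding triadditiveD(1)[OF \<Phi> add(1) G H add(2)] triadditiveD(1)[OF \<Psi> add(1) G H add(2)] add(3,4) ..
qed

lemma triadditive_Sum_any:
 fixes \<Phi> :: "nat => _"
 assumes t: "!!i. triadditive (\<Phi> i)"
  and fin: "!!F G H. F : \<F> ==> G : \<F> ==> H : \<F> ==> finite {i. \<Phi> i F G H ~= 0}"
 shows "triadditive (%F G H. Sum_any (%i. \<Phi> i F G H))"
 unfolding triadditive_def
proof (intro ballI conjI)
 fix F G H A assume h: "F : \<F>" "G : \<F>" "H : \<F>" "A : \<F>"
 show "Sum_any (%i. \<Phi> i (F + A) G H) = Sum_any (%i. \<Phi> i F G H) + Sum_any (%i. \<Phi> i A G H)"
  unfolding triadditiveD(1)[OF t h] by (rule Sum_any.distrib[OF fin[OF h(1-3)] fin[OF h(4,2,3)]])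
 show "Sum_any (%i. \<Phi> i F (G + A) H) = Sum_any (%i. \<Phi> i F G H) + Sum_any (%i. \<Phi> i F A H)"
  unfolding triadditiveD(2)[OF t h] by (rule Sum_any.distrib[OF fin[OF h(1-3)] fin[OF h(1,4,3)]])
 show "Sum_any (%i. \<Phi> i F G (H + A)) = Sum_any (%i. \<Phi> i F G H) + Sum_any (%i. \<Phi> i F G A)"
  unfolding triadditiveD(3)[OF t h] by (rule Sum_any.distrib[OF fin[OF h(1-3)] fin[OF h(1,2,4)]])
qed

lemma triadditive_scale:
 assumes \<Phi>: "triadditive \<Phi>" shows "triadditive (%F G H. scl c (\<Phi> F G H))"
 unfolding triadditive_def
using QVg.scale_right_distrib assms triadditive_def by auto

lemma triadditive_diff:
 assumes \<Phi>: "triadditive \<Phi>" and \<Psi>: "triadditive \<Psi>" shows "triadditive (%F G H. \<Phi> F G H - \<Psi> F G H)"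
 unfolding triadditive_def
using \<Phi> \<Psi> triadditive_def by auto

lemma triadditive_Yf:
 "triadditive (%F G H. Yf (Yf F a G) b H)" "triadditive (%F G H. Yf F a (Yf G b H))" "triadditive (%F G H. Yf G a (Yf F b H))"
 unfolding triadditive_def
 by (intro ballI conjI; simp only: Yf_add_left Yf_add_right Yf_closed QVg.total_add)+

lemma Yf_borcherds:
 assumes F: "F : \<F>" and G: "G : \<F>" and H: "H : \<F>"
 shows "Sum_any (%i::nat. scl (of_int m gchoose i) (Yf (Yf F (l + int i) G) (m + n - int i) H)) =
  Sum_any (%i::nat. scl ((-1) ^ i * (of_int l gchoose i))
   (Yf F (m + l - int i) (Yf G (n + int i) H) - scl ((-1) powi l) (Yf G (n + l - int i) (Yf F (m + int i) H))))"
proof -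
 let ?A = "%F G H (i::nat). scl (of_int m gchoose i) (Yf (Yf F (l + int i) G) (m + n - int i) H)"
 let ?R = "%F G H (i::nat). scl ((-1) ^ i * (of_int l gchoose i)) (Yf F (m + l - int i) (Yf G (n + int i) H) - scl ((-1) powi l) (Yf G (n + l - int i) (Yf F (m + int i) H)))"
 show ?thesis
 proof (rule triadditive_eqI[where \<Phi> = "%F G H. Sum_any (?A F G H)" and \<Psi> = "%F G H. Sum_any (?R F G H)", OF _ _ _ F G H])
 have vanish: "EX I::nat. ALL i>=I. Yf A (p + int i) B = 0" if A: "A : \<F>" and B: "B : \<F>" for A B p
 proof -
  obtain M where M: "ALL n>=M. Yf A n B = 0" using Yf_vanish[OF A B] by blast
  have "Yf A (p + int i) B = 0" if "i >= nat (M - p)" for i using M that by simp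
  thus ?thesis by blast
 qed
 have fin: "finite {i. \<phi> i ~= 0}" if "ALL i>=I. \<phi> i = 0" for \<phi> :: "nat => complex => 'v" and I
  by (rule finite_subset[of _ "{..<I}"]) (use that in \<open>auto simp: not_le[symmetric]\<close>)
 show "triadditive (%F G H. Sum_any (?A F G H))"
 proof (rule triadditive_Sum_any[OF triadditive_scale[OF triadditive_Yf(1)]])
  fix F G H assume h: "F : \<F>" "G : \<F>" "H : \<F>"
  obtain I where I: "ALL i>=I. Yf F (l + int i) G = 0" using vanish[OF h(1,2)] by blast
  show "finite {i. ?A F G H i ~= 0}"
  proof (rule fin[of I], intro allI impI)
   fix i assume "i >= I"
   hence z: "Yf F (l + int i) G = 0" using I by blast
   show "?A F G H i = 0"
    unfolding z Yf_zero_left[OF h(3)] QVg.scale_zero_right ..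
  qed
 qed
 show "triadditive (%F G H. Sum_any (?R F G H))"
 proof (rule triadditive_Sum_any[OF triadditive_scale[OF triadditive_diff[OF triadditive_Yf(2) triadditive_scale[OF triadditive_Yf(3)]]]])
  fix F G H assume h: "F : \<F>" "G : \<F>" "H : \<F>"
  obtain I where I: "ALL i>=I. Yf G (n + int i) H = 0" using vanish[OF h(2,3)] by blast
  obtain J where J: "ALL i>=J. Yf F (m + int i) H = 0" using vanish[OF h(1,3)] by blast
  show "finite {i. ?R F G H i ~= 0}"
  proof (rule fin[of "max I J"], intro allI impI)
   fix i assume "i >= max I J"
   hence z: "Yf G (n + int i) H = 0" "Yf F (m + int i) H = 0" using I J by auto
   show "?R F G H i = 0"
    unfolding z Yf_zero_right[OF h(1)] Yf_zero_right[OF h(2)] QVg.scale_zero_right diff_zero ..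
  qed
 qed
qed (rule borcherds_fun_vec)
qed

text \<open>Weights and degrees are bounded below, so only finitely many pairs contribute to a given
weight.\<close>

lemma QMV_fin_dim:
 assumes cusp: "cusps \<Gamma> ~= {}" shows "EX B. finite B & \<Q> k = QVg.span B"
proof -
 obtain N0 where N0: "ALL n<N0. V n = {0}" using bounded_below by blast
 have "ALL j. EX B. finite B & QM \<Gamma> j = cfun.span B" using QM_fin_dim[OF cusp] unfolding fin_dim_def by blast
 then obtain C where C: "!!j. finite (C j)" "!!j. QM \<Gamma> j = cfun.span (C j)" by metis
 define P where "P = {N0..k div 2}"
 define B where "B = (\<Union>p\<in>P. \<Union>b\<in>hbasis \<inter> V p. (%f. fvec f b) ` C (k - 2 * p))"
 have finB: "finite B" unfolding B_def P_def using finite_basis_piece C(1) by (intro finite_UN_I) auto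
 have "B <= \<Q> k"
 proof
  fix F assume "F : B"
  then obtain p b f where p: "b : V p" "f : C (k - 2 * p)" "F = fvec f b" unfolding B_def by blast
  have "f : QM \<Gamma> (k - 2 * p)" unfolding C(2) by (rule cfun.span_base[OF p(2)])
  from QMV_fun_vec[OF this p(1)] p(3) show "F : \<Q> k" by simp
 qed
 hence "QVg.span B <= \<Q> k" by (rule QVg.span_minimal[OF _ QVg.subspace_piece])
 moreover have "\<Q> k <= QVg.span B"
 proof
  fix F assume F: "F : \<Q> k"
  obtain S where S: "finite S" "S <= hbasis" "F = (\<Sum>b\<in>S. fvec (%z. crd b (F z)) b)" using QMV_expand[OF F] by blast
  have "(\<Sum>b\<in>S. fvec (%z. crd b (F z)) b) : QVg.span B"
  proof (rule QVg.span_sum)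
   fix b assume "b : S"
   hence b: "b : hbasis" using S by blast
   then obtain p where p: "b : V p" using hbasis(1) by blast
   have q: "(%z. crd b (F z)) : QM \<Gamma> (k - 2 * p)" by (rule crd_quasimodular[OF F b p])
   have lin: "fvec f b : QVg.span B" if "f : cfun.span (C (k - 2 * p))" "p : P" for f
    using that(1)
   proof (rule cfun.span_induct)
    show "cfun.subspace {f. fvec f b : QVg.span B}"
     unfolding cfun.subspace_def
    by (metis (no_types, lifting) QVg.span_add_eq2 QVg.span_scale QVg.span_zero add_cancel_left_left fun_vec_add_left fun_vec_fscale_left mem_Collect_eq)
    show "fvec f b : QVg.span B" if "f : C (k - 2 * p)" for f
    proof -
     have "fvec f b : B" unfolding B_def using that \<open>p : P\<close> b p by blast
     thus ?thesis by (rule QVg.span_base)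
    qed
   qed
   show "fvec (%z. crd b (F z)) b : QVg.span B"
   proof (cases "p : P")
    case True
    show ?thesis by (rule lin[OF _ True]) (use q C(2) in simp)
   next
    case False
    hence "p < N0 \<or> k - 2 * p < 0" unfolding P_def by auto
    hence "fvec (%z. crd b (F z)) b = 0"
    proof
     assume "p < N0"
     hence "b = 0" using N0 p by blast
     thus ?thesis by (simp add: fun_vec_def fun_eq_iff)
    next
     assume "k - 2 * p < 0"
     hence "(%z. crd b (F z)) = 0" using QM_negative[OF q] by blast
     thus ?thesis by (simp add: fun_vec_def fun_eq_iff)
    qed
    thus ?thesis using QVg.span_zero by metis
   qed
  qed
  thus "F : QVg.span B" unfolding S(3)[symmetric] .
 qed
 ultimately show ?thesis using finB by blast
qed

lemma QMV_bounded_below: "EX N. ALL n<N. \<Q> (2 * n) = {0}"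
proof -
 obtain N0 where N0: "ALL n<N0. V n = {0}" using bounded_below by blast
 have "F = 0" if n: "n < N0" and F: "F : \<Q> (2 * n)" for n F
  using F
 proof (induction rule: QMV_induct)
  case (fun_vec p f v)
  show ?case
  proof (cases "p < N0")
   case True
   hence "v = 0" using N0 fun_vec(2) by blast
   thus ?thesis by (simp add: fun_vec_def fun_eq_iff)
  next
   case False
   hence "f = 0" using QM_negative[OF fun_vec(1)] n by simp
   thus ?thesis by (simp add: fun_vec_def fun_eq_iff)
  qed
 qed simp_all
 thus ?thesis using QMV_zero by (intro exI[of _ N0]) blast
qed

theorem forms_quasi_voa:
 assumes cusp: "cusps \<Gamma> ~= {}" shows "quasi_voa (scl) \<E> Yf vacf Lf"
proof (intro quasi_voa.intro graded_vertex_algebra.intro even_graded graded_vertex_algebra_axioms.intro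
  quasi_voa_axioms.intro; (unfold total_even)?)
 show "vacf : \<Q> (2 * 0)" unfolding vacf using QMV_fun_vec[OF one_QM vac_degree] by simp
 show "Yf F n G : \<Q> (2 * (a + b - n - 1))" if "F : \<Q> (2 * a)" "G : \<Q> (2 * b)" for F G a b n
 by (simp add: Yf_degree that(1,2))
 show "EX B. finite B & \<Q> (2 * n) = QVg.span B" for n by (rule QMV_fin_dim[OF cusp])
qed (fact Yf_add_left Yf_scale_left Yf_add_right Yf_scale_right Yf_vanish Yf_vacuum Yf_creation Yf_borcherds
  QMV_bounded_below Lf_closed Lf_add Lf_scale Lf_sl2 Lf_0_degree Yf_covariance)+

text \<open>On \<open>f v\<close> the coefficient of \<open>X\<close> is \<open>Q\<^sub>1(f) v + f L(1)
v\<close>, which is the diagonal action of \<open>L(1)\<close>; uniqueness of the coefficients makes this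
meaningful for every choice of \<open>Q\<close>.\<close>

lemma Lf_1_coefficient:
 assumes Q: "vqm N k F Q" and F: "F : \<Q> k" shows "Lf 1 F = Q 1"
proof -
 have "EX N Q. vqm N k F Q & Lf 1 F = Q 1" using F
 proof (induction rule: QMV_induct)
  case zero
  have z: "fvec 0 0 = 0" by (simp add: fun_vec_def fun_eq_iff)
  have "vqm 0 (k + 2 * 0) (fvec 0 0) (%m t. \<Sum>i\<le>m. smul (qcoeff k 0 (m - i) t / fact i) (L1p i 0))"
   by (rule fun_vec_coeffs[OF qm_zero zero_piece])
  hence q: "vqm 0 k 0 (%m t. \<Sum>i\<le>m. smul (qcoeff k 0 (m - i) t / fact i) (L1p i 0))"
   unfolding z mult_zero_right add_0_right .
  have "(\<Sum>i\<le>1. smul (qcoeff k 0 (1 - i) t / fact i) (L1p i 0)) = 0" for t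
   unfolding L1p_zero scale_zero_right by (rule sum.neutral_const)
  hence "0 = (%t. \<Sum>i\<le>1. smul (qcoeff k 0 (1 - i) t / fact i) (L1p i 0))"
   unfolding fun_eq_iff zero_fun_apply by (intro allI) (rule sym)
  moreover have "Lf 1 0 = 0" by (rule Lf_zero) simp
  ultimately have "Lf 1 0 = (%t. \<Sum>i\<le>1. smul (qcoeff k 0 (1 - i) t / fact i) (L1p i 0))" by (rule trans[rotated])
  with q show ?case by blast
 next
  case (fun_vec n f v)
  have w: "k - 2 * n + 2 * n = k" by simp
  have "Lf 1 (fvec f v) = (%t. \<Sum>i\<le>1. smul (qcoeff (k - 2 * n) f (1 - i) t / fact i) (L1p i v))"
  proof -
   have "Lf 1 (fvec f v) = fvec (qop 1 f) v + fvec f (L 1 v)"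
    by (rule Lf_fun_vec[OF _ QMg.piece_total[OF fun_vec(1)] piece_total[OF fun_vec(2)]]) simp
   thus ?thesis unfolding qop_simps(1)[OF fun_vec(1)]
    by (simp add: fun_vec_def fun_eq_iff atMost_Suc qcoeff_0[OF fun_vec(1)] add.commute)
  qed
  thus ?case using fun_vec_coeffs[OF fun_vec] unfolding w by blast
 next
  case (add F G)
  then obtain N Q M R where "vqm N k F Q" "Lf 1 F = Q 1" "vqm M k G R" "Lf 1 G = R 1" by blast
  note fg = this
  have "vqm (max N M) k (F + G) (%m t. Q m t + R m t)"
   unfolding plus_fun_lambda by (rule vqm_coeffs_add[OF fg(1) QMV_values[OF add(1)] fg(3) QMV_values[OF add(2)]])
  moreover have "Lf 1 (F + G) = Lf 1 F + Lf 1 G"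
   by (rule Lf_add[OF _ QVg.piece_total[OF add(1)] QVg.piece_total[OF add(2)]]) simp
  hence "Lf 1 (F + G) = (%t. Q 1 t + R 1 t)" unfolding fg(2,4) plus_fun_lambda .
  ultimately show ?case by blast
 qed
 then obtain M R where "vqm M k F R" "Lf 1 F = R 1" by blast
 thus ?thesis using vqm_coeffs_unique[OF Q] by simp
qed

lemma Yf_formula:
 assumes f: "f : \<A>" and g: "g : \<A>" and u: "u : \<V>" and v: "v : \<V>"
 shows "Yf (fvec f u) n (fvec g v) =
  (%z. Sum_any (%i::nat. smul ((deriv ^^ i) f z / fact i * g z) (Y u (n + int i) v)))"
proof -
 have "hasse i f z * g z = (deriv ^^ i) f z / fact i * g z" for i z
  using hasse_deriv[of z i f] total_off[OF g, of z] by (cases "z : uhp") simp_all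
 thus ?thesis unfolding Yf_at[OF f u v] by simp
qed

end


theorem theoremC:
  fixes smul :: "complex \<Rightarrow> 'v::ab_group_add \<Rightarrow> 'v"
    and V :: "int \<Rightarrow> 'v set"
    and Y :: "'v \<Rightarrow> int \<Rightarrow> 'v \<Rightarrow> 'v"
    and vac :: 'v
    and L :: "int \<Rightarrow> 'v \<Rightarrow> 'v"
    and \<Gamma> :: "(real^2^2) set"
  assumes "quasi_voa smul V Y vac L"
    and "fuchsian_first_kind \<Gamma>"
  shows
    "(\<exists>\<iota>. graded_module_iso (QM_ring \<Gamma>) (QM_graded \<Gamma>)
            (tensor_module smul (QM_graded \<Gamma>) (doubled V))
            (tensor_piece smul (QM_graded \<Gamma>) (doubled V))
            (QMV_module smul V L \<Gamma>) (QMV smul V L \<Gamma>) \<iota> \<and>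
          (\<forall>f\<in>total_space (QM_graded \<Gamma>). \<forall>v\<in>total_space V.
            \<iota> (QM_tensor_class smul (QM_graded \<Gamma>) (doubled V) (free_gen f v)) = fun_vec smul f v)) \<and>
     (cusps \<Gamma> \<noteq> {} \<longrightarrow>
       (\<exists>Y' L'. doubled_quasi_voa (fscale smul) (QMV smul V L \<Gamma>) Y'
                  (\<lambda>\<tau>. if \<tau> \<in> uhp then vac else 0) L' \<and>
          (\<forall>f\<in>total_space (QM_graded \<Gamma>). \<forall>g\<in>total_space (QM_graded \<Gamma>).
           \<forall>u\<in>total_space V. \<forall>v\<in>total_space V. \<forall>n.
             Y' (fun_vec smul f u) n (fun_vec smul g v) =
               (\<lambda>\<tau>. Sum_any (\<lambda>i::nat. smul ((deriv ^^ i) f \<tau> / fact i * g \<tau>) (Y u (n + int i) v)))) \<and>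
          (\<forall>N k F Q. vqm_coeffs smul V L \<Gamma> N k F Q \<longrightarrow> F \<in> QMV smul V L \<Gamma> k \<longrightarrow>
             L' 1 F = Q 1)))"
proof -
  interpret qvoa_forms smul V Y vac L \<Gamma>
    by (intro qvoa_forms.intro assms(1) first_kind.intro assms(2))
  have dq: "doubled_quasi_voa (fscale smul) \<Q> Yf vacf Lf" if "cusps \<Gamma> \<noteq> {}"
    unfolding doubled_quasi_voa_def
    by (rule exI[of _ \<E>], rule conjI, rule forms_quasi_voa[OF that], rule QMV_doubled)
  show ?thesis
    unfolding QM_graded_eq
    by (rule conjI, rule tensor_product_iso, rule impI, rule exI[of _ Yf], rule exI[of _ Lf])
      (intro conjI dq ballI allI impI Yf_formula Lf_1_coefficient; assumption)
qed

end
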